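(* Let $(A_n)_{n\ge0}$ be a sequence in $\mathcal{S}_\eta(\mathcal{O}_N)$ and set $a:=(A_n)+\mathcal{G}_\eta\in\mathcal{S}_N$. Then the following set-sequences converge with respect to the Hausdorff distance as $n\to\infty$: (a) $\sigma(A_n)\to\sigma(\widetilde{W}(a))$ if $a$ is self-adjoint; (b) $\sigma_2(A_n)\to\sigma_2(\widetilde{W}(a))$; (c) $\sigma^{(\varepsilon)}(A_n)\to\sigma^{(\varepsilon)}(\widetilde{W}(a))$ for every $\varepsilon>0$.
   Context: Let $N\ge 2$ be an integer, $\mathbb{Z}^+=\{0,1,2,\dots\}$. For $n\ge 1$, $P_n$ is the orthogonal projection of $l^2(\mathbb{Z}^+)$ onto the span of the first $n$ standard basis vectors, and $R_n : (x_k)_{k\ge0}\mapsto (x_{n-1},x_{n-2},\dots,x_0,0,0,\dots)$. For $i\in\{0,\dots,N-1\}$, $S_i\in L(l^2(\mathbb{Z}^+))$ is the isometry $(S_i x)_{rN+i}=x_r$ for $r\ge 0$, with all other components of $S_ix$ equal to $0$. The concrete Cuntz algebra $\mathcal{O}_N$ is the smallest $C^*$-subalgebra of $L(l^2(\mathbb{Z}^+))$ containing $S_0,\dots,S_{N-1}$. Let $\mathcal{F}_\eta$ (with $\eta(n)=N^n$) be the $C^*$-algebra of all bounded sequences $(A_n)_{n\ge 0}$ with $A_n\in\mathbb{C}^{N^n\times N^n}$ (identified with operators on $\mathrm{im}\,P_{N^n}$), with entrywise operations and supremum norm, and $\mathcal{G}_\eta$ its closed ideal of sequences with $\|A_n\|\to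 0$. $\mathcal{S}_\eta(\mathcal{O}_N)$ is the smallest $C^*$-subalgebra of $\mathcal{F}_\eta$ containing all sequences $(P_{N^n}AP_{N^n})_{n\ge0}$ with $A\in\mathcal{O}_N$; it contains $\mathcal{G}_\eta$, and $\mathcal{S}_N:=\mathcal{S}_\eta(\mathcal{O}_N)/\mathcal{G}_\eta$. Let $e$ be the identity of $\mathcal{S}_N$, $s_0:=(P_{N^n}S_0P_{N^n})_{n\ge0}+\mathcal{G}_\eta$, and $p_1:=s_0^*s_0$. Definition of $\widetilde W$: for $a\in\mathcal{S}_N$ write $(e-p_1)a(e-p_1)=(A_n)_{n\ge0}+\mathcal{G}_\eta$ and let $W_{00}(a):=\mathrm{s\text{-}lim}_{n\to\infty} R_{N^n}A_nR_{N^n}$ (this strong limit exists and is independent of the representative). For $i,j\in\mathbb{Z}^+$ let $$W_{ij}(a):=(S_{N-1}^* )^i\, W_{00}\big((e-p_1)s_0^i\,a\,(s_0^* )^j(e-p_1)\big)\,S_{N-1}^j,$$ and $\widetilde W(a):=(W_{ij}(a))_{i,j\ge0}$. This infinite matrix defines a bounded operator on $l^2(\mathbb{Z}^+,l^2(\mathbb{Z}^+))$ by $(\widetilde W(a)x)_i=\sum_j W_{ij}(a)x_j$. For an element $b$ of a $C^*$-algebra with identity $e$: $\sigma(b)$ is its spectrum; $\sigma_2(b)$ is the set of all non-negative square roots of elements of $\sigma(b^*b)$; for $\varepsilon>0$, $\sigma^{(\varepsilon)}(b)$ is the set of all $\lambda\in\mathbb{C}$ for which $b-\lambda e$ is not invertible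 or $\|(b-\lambda e)^{-1}\|\ge 1/\varepsilon$. The Hausdorff distance of non-empty compact $M,K\subset\mathbb{C}$ is $d_H(M,K)=\max\{\max_{m\in M}\min_{k\in K}|m-k|,\ \max_{k\in K}\min_{m\in M}|m-k|\}$. *)

theory Defs
  imports "HOL-Analysis.Analysis" "HOL-Algebra.QuotRing" "HOL-Algebra.Module"
begin

class complex_inner = real_normed_vector +
  fixes scaleC :: "complex \<Rightarrow> 'a \<Rightarrow> 'a"  (infixr \<open>*\<^sub>C\<close> 75)
    and cinner :: "'a \<Rightarrow> 'a \<Rightarrow> complex"
  assumes scaleC_add_right: "c *\<^sub>C (x + y) = c *\<^sub>C x + c *\<^sub>C y"
    and scaleC_add_left: "(c + d) *\<^sub>C x = c *\<^sub>C x + d *\<^sub>C x"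
    and scaleC_scaleC: "c *\<^sub>C (d *\<^sub>C x) = (c * d) *\<^sub>C x"
    and scaleR_scaleC: "r *\<^sub>R x = complex_of_real r *\<^sub>C x"
    and cinner_commute: "cinner x y = cnj (cinner y x)"
    and cinner_add_left: "cinner (x + y) z = cinner x z + cinner y z"
    and cinner_scaleC_left: "cinner (c *\<^sub>C x) y = c * cinner x y"
    and cinner_norm: "cinner x x = complex_of_real ((norm x)\<^sup>2)"

instantiation complex :: complex_inner
begin
definition "scaleC_complex (c::complex) (x::complex) = c * x"
definition "cinner_complex (x::complex) (y::complex) = x * cnj y"
instance
  by standard
    (auto simp: scaleC_complex_def cinner_complex_def algebra_simps scaleR_conv_of_real
      complex_mult_cnj cmod_def)
end

lemma cinner_add_right:
  fixes x y z :: "'a::complex_inner"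
  shows "cinner x (y + z) = cinner x y + cinner x z"
  by (metis cinner_commute cinner_add_left complex_cnj_add)

lemma cinner_scaleC_right:
  fixes x y :: "'a::complex_inner"
  shows "cinner x (c *\<^sub>C y) = cnj c * cinner x y"
  by (metis cinner_commute cinner_scaleC_left complex_cnj_mult)

lemma norm_scaleC:
  fixes x :: "'a::complex_inner"
  shows "norm (c *\<^sub>C x) = cmod c * norm x"
proof -
  have "complex_of_real ((norm (c *\<^sub>C x))\<^sup>2) = cnj c * (c * complex_of_real ((norm x)\<^sup>2))"
    by (metis cinner_norm cinner_scaleC_left cinner_scaleC_right mult.left_commute)
  also have "\<dots> = complex_of_real ((cmod c * norm x)\<^sup>2)"
    using complex_norm_square[of c]
    by (simp add: power_mult_distrib mult.commute mult.left_commute)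
  finally have "(norm (c *\<^sub>C x))\<^sup>2 = (cmod c * norm x)\<^sup>2"
    using of_real_eq_iff by blast
  then show ?thesis by (simp add: power2_eq_iff_nonneg)
qed

lemma cinner_bound:
  fixes x y :: "'a::complex_inner"
  shows "cmod (cinner x y) \<le> norm x * norm y"
proof (cases "norm y = 0")
  case True
  then have "y = 0" by simp
  then have "y = 0 *\<^sub>C y" using scaleR_scaleC[of 0 y] by simp
  then have "cinner x y = 0" by (metis cinner_scaleC_right complex_cnj_zero mult_zero_left)
  then show ?thesis by simp
next
  case False
  define t where "t = complex_of_real (1 / (norm y)\<^sup>2) * cinner x y"
  define z where "z = x + (- t) *\<^sub>C y"
  have "cinner z z = cinner x x + (- cnj t) * cinner x y + (- t) * cinner y x
          + (- t) * (- cnj t) * cinner y y"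
    unfolding z_def
    by (simp add: cinner_add_left cinner_add_right cinner_scaleC_left cinner_scaleC_right
        algebra_simps)
  also have "cinner y x = cnj (cinner x y)" by (rule cinner_commute)
  also have "cinner y y = complex_of_real ((norm y)\<^sup>2)" by (rule cinner_norm)
  also have "cinner x x = complex_of_real ((norm x)\<^sup>2)" by (rule cinner_norm)
  finally have "cinner z z = complex_of_real ((norm x)\<^sup>2)
      - complex_of_real (1 / (norm y)\<^sup>2) * (cinner x y * cnj (cinner x y))"
    using False by (simp add: t_def field_simps power2_eq_square)
  also have "\<dots> = complex_of_real ((norm x)\<^sup>2 - (cmod (cinner x y))\<^sup>2 / (norm y)\<^sup>2)"
    using complex_norm_square[of "cinner x y"] by simp
  finally have "(norm z)\<^sup>2 = (norm x)\<^sup>2 - (cmod (cinner x y))\<^sup>2 / (norm y)\<^sup>2"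
    by (metis cinner_norm of_real_eq_iff)
  then have "(cmod (cinner x y))\<^sup>2 / (norm y)\<^sup>2 \<le> (norm x)\<^sup>2"
    by (metis diff_ge_0_iff_ge zero_le_power2)
  then have "(cmod (cinner x y))\<^sup>2 \<le> (norm x * norm y)\<^sup>2"
    using False by (simp add: divide_le_eq power_mult_distrib)
  then show ?thesis by (rule power2_le_imp_le) simp
qed

typedef (overloaded) 'a ell2 = "{x :: nat \<Rightarrow> 'a::real_normed_vector. summable (\<lambda>k. (norm (x k))\<^sup>2)}"
  morphisms coord Abs_ell2
  by (rule exI[of _ "\<lambda>_. 0"]) simp

setup_lifting type_definition_ell2

lemma summable_coord: "summable (\<lambda>k. (norm (coord x k))\<^sup>2)"
  using coord[of x] by simp

lemma ell2_eqI: "(\<And>k. coord x k = coord y k) \<Longrightarrow> x = y"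
  by (metis coord_inverse ext)

lemma sq_summable_add_aux:
  fixes x y :: "nat \<Rightarrow> 'a::real_normed_vector"
  assumes x: "summable (\<lambda>k. (norm (x k))\<^sup>2)" and y: "summable (\<lambda>k. (norm (y k))\<^sup>2)"
  shows "summable (\<lambda>k. (norm (x k + y k))\<^sup>2)"
    and "(\<Sum>k. (norm (x k + y k))\<^sup>2)
           \<le> (sqrt (\<Sum>k. (norm (x k))\<^sup>2) + sqrt (\<Sum>k. (norm (y k))\<^sup>2))\<^sup>2"
proof -
  let ?B = "sqrt (\<Sum>k. (norm (x k))\<^sup>2) + sqrt (\<Sum>k. (norm (y k))\<^sup>2)"
  have B: "(\<Sum>k<n. (norm (x k + y k))\<^sup>2) \<le> ?B\<^sup>2" for n
  proof -
    have "L2_set (\<lambda>k. norm (x k + y k)) {..<n} \<le> L2_set (\<lambda>k. norm (x k) + norm (y k)) {..<n}"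
      by (rule L2_set_mono) (auto simp: norm_triangle_ineq)
    also have "\<dots> \<le> L2_set (\<lambda>k. norm (x k)) {..<n} + L2_set (\<lambda>k. norm (y k)) {..<n}"
      by (rule L2_set_triangle_ineq)
    also have "\<dots> \<le> ?B"
      unfolding L2_set_def
      by (intro add_mono real_sqrt_le_mono sum_le_suminf x y) auto
    finally have "L2_set (\<lambda>k. norm (x k + y k)) {..<n} \<le> ?B" .
    then have "(L2_set (\<lambda>k. norm (x k + y k)) {..<n})\<^sup>2 \<le> ?B\<^sup>2"
      by (rule power_mono) simp
    then show ?thesis by (simp add: L2_set_def sum_nonneg)
  qed
  show s: "summable (\<lambda>k. (norm (x k + y k))\<^sup>2)"
    by (rule summableI_nonneg_bounded[OF _ B]) simp
  show "(\<Sum>k. (norm (x k + y k))\<^sup>2) \<le> ?B\<^sup>2"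
    by (rule suminf_le_const[OF s B])
qed

lemma sq_summable_cinner_aux:
  fixes x y :: "nat \<Rightarrow> 'a::complex_inner"
  assumes x: "summable (\<lambda>k. (norm (x k))\<^sup>2)" and y: "summable (\<lambda>k. (norm (y k))\<^sup>2)"
  shows "summable (\<lambda>k. cinner (x k) (y k))"
proof (rule summable_comparison_test)
  show "summable (\<lambda>k. (norm (x k))\<^sup>2 + (norm (y k))\<^sup>2)"
    using x y by (rule summable_add)
  have "norm (cinner (x k) (y k)) \<le> (norm (x k))\<^sup>2 + (norm (y k))\<^sup>2" for k
  proof -
    have "norm (cinner (x k) (y k)) \<le> norm (x k) * norm (y k)" by (rule cinner_bound)
    also have "\<dots> \<le> 2 * norm (x k) * norm (y k)"
      by simp
    also have "\<dots> \<le> (norm (x k))\<^sup>2 + (norm (y k))\<^sup>2"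
      by (rule sum_squares_bound)
    finally show ?thesis .
  qed
  then show "\<exists>N. \<forall>n\<ge>N. norm (cinner (x n) (y n)) \<le> (norm (x n))\<^sup>2 + (norm (y n))\<^sup>2" by blast
qed

instantiation ell2 :: (real_normed_vector) real_normed_vector
begin

lift_definition zero_ell2 :: "'a ell2" is "\<lambda>_. 0" by simp

lift_definition plus_ell2 :: "'a ell2 \<Rightarrow> 'a ell2 \<Rightarrow> 'a ell2" is "\<lambda>x y k. x k + y k"
  by (rule sq_summable_add_aux)

lift_definition uminus_ell2 :: "'a ell2 \<Rightarrow> 'a ell2" is "\<lambda>x k. - x k" by simp

lift_definition minus_ell2 :: "'a ell2 \<Rightarrow> 'a ell2 \<Rightarrow> 'a ell2" is "\<lambda>x y k. x k - y k"
  subgoal for x y using sq_summable_add_aux(1)[of x "\<lambda>k. - y k"] by simp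
  done

lift_definition scaleR_ell2 :: "real \<Rightarrow> 'a ell2 \<Rightarrow> 'a ell2" is "\<lambda>r x k. r *\<^sub>R x k"
  by (simp add: power_mult_distrib summable_mult)

lift_definition norm_ell2 :: "'a ell2 \<Rightarrow> real" is "\<lambda>x. sqrt (\<Sum>k. (norm (x k))\<^sup>2)" .

definition sgn_ell2 :: "'a ell2 \<Rightarrow> 'a ell2" where "sgn_ell2 x = scaleR (inverse (norm x)) x"

definition dist_ell2 :: "'a ell2 \<Rightarrow> 'a ell2 \<Rightarrow> real" where "dist_ell2 x y = norm (x - y)"

definition [code del]:
  "(uniformity :: ('a ell2 \<times> 'a ell2) filter) = (INF e\<in>{0 <..}. principal {(x, y). dist x y < e})"

definition open_ell2 :: "'a ell2 set \<Rightarrow> bool"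
  where [code del]: "open_ell2 S = (\<forall>x\<in>S. \<forall>\<^sub>F (x', y) in uniformity. x' = x \<longrightarrow> y \<in> S)"

instance
proof
  fix x y z :: "'a ell2" and a b :: real and S :: "'a ell2 set"
  show "x + y + z = x + (y + z)" by transfer (auto simp: algebra_simps)
  show "x + y = y + x" by transfer (auto simp: algebra_simps)
  show "0 + x = x" by transfer auto
  show "- x + x = 0" by transfer auto
  show "x - y = x + - y" by transfer auto
  show "a *\<^sub>R (x + y) = a *\<^sub>R x + a *\<^sub>R y" by transfer (auto simp: algebra_simps)
  show "(a + b) *\<^sub>R x = a *\<^sub>R x + b *\<^sub>R x" by transfer (auto simp: algebra_simps)
  show "a *\<^sub>R b *\<^sub>R x = (a * b) *\<^sub>R x" by transfer auto
  show "1 *\<^sub>R x = x" by transfer auto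
  show "sgn x = scaleR (inverse (norm x)) x" by (rule sgn_ell2_def)
  show "dist x y = norm (x - y)" by (rule dist_ell2_def)
  show "(uniformity :: ('a ell2 \<times> 'a ell2) filter) = (INF e\<in>{0 <..}. principal {(x, y). dist x y < e})"
    by (rule uniformity_ell2_def)
  show "open S = (\<forall>x\<in>S. \<forall>\<^sub>F (x', y) in uniformity. x' = x \<longrightarrow> y \<in> S)"
    by (rule open_ell2_def)
  show "(norm x = 0) = (x = 0)"
    by transfer (auto simp: suminf_eq_zero_iff)
  show "norm (x + y) \<le> norm x + norm y"
  proof transfer
    fix x y :: "nat \<Rightarrow> 'a"
    assume s: "summable (\<lambda>k. (norm (x k))\<^sup>2)" "summable (\<lambda>k. (norm (y k))\<^sup>2)"
    show "sqrt (\<Sum>k. (norm (x k + y k))\<^sup>2)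
        \<le> sqrt (\<Sum>k. (norm (x k))\<^sup>2) + sqrt (\<Sum>k. (norm (y k))\<^sup>2)"
      using sq_summable_add_aux(2)[OF s] s by (intro real_le_lsqrt) (auto intro!: add_nonneg_nonneg suminf_nonneg)
  qed
  show "norm (a *\<^sub>R x) = \<bar>a\<bar> * norm x"
    by transfer (auto simp: power_mult_distrib suminf_mult real_sqrt_mult)
qed

end

instantiation ell2 :: (complex_inner) complex_inner
begin

lift_definition scaleC_ell2 :: "complex \<Rightarrow> 'a ell2 \<Rightarrow> 'a ell2" is "\<lambda>c x k. c *\<^sub>C x k"
  by (simp add: norm_scaleC power_mult_distrib summable_mult)

lift_definition cinner_ell2 :: "'a ell2 \<Rightarrow> 'a ell2 \<Rightarrow> complex" is
  "\<lambda>x y. \<Sum>k. cinner (x k) (y k)" .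

instance
proof
  fix x y z :: "'a ell2" and c d :: complex and r :: real
  show "c *\<^sub>C (x + y) = c *\<^sub>C x + c *\<^sub>C y" by transfer (simp add: scaleC_add_right)
  show "(c + d) *\<^sub>C x = c *\<^sub>C x + d *\<^sub>C x" by transfer (simp add: scaleC_add_left)
  show "c *\<^sub>C (d *\<^sub>C x) = (c * d) *\<^sub>C x" by transfer (simp add: scaleC_scaleC)
  show "r *\<^sub>R x = complex_of_real r *\<^sub>C x" by transfer (simp add: scaleR_scaleC)
  show "cinner x y = cnj (cinner y x)"
  proof transfer
    fix x y :: "nat \<Rightarrow> 'a"
    assume "summable (\<lambda>k. (norm (x k))\<^sup>2)" "summable (\<lambda>k. (norm (y k))\<^sup>2)"
    then have "(\<lambda>k. cinner (y k) (x k)) sums (\<Sum>k. cinner (y k) (x k))"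
      by (intro summable_sums sq_summable_cinner_aux) auto
    then have "(\<lambda>k. cnj (cinner (y k) (x k))) sums cnj (\<Sum>k. cinner (y k) (x k))"
      by (simp add: sums_cnj)
    then have "(\<lambda>k. cinner (x k) (y k)) sums cnj (\<Sum>k. cinner (y k) (x k))"
      by (simp add: cinner_commute[symmetric])
    then show "(\<Sum>k. cinner (x k) (y k)) = cnj (\<Sum>k. cinner (y k) (x k))"
      by (rule sums_unique[symmetric])
  qed
  show "cinner (x + y) z = cinner x z + cinner y z"
    by transfer (auto simp: cinner_add_left suminf_add sq_summable_cinner_aux)
  show "cinner (c *\<^sub>C x) y = c * cinner x y"
    by transfer (auto simp: cinner_scaleC_left suminf_mult sq_summable_cinner_aux)
  show "cinner x x = complex_of_real ((norm x)\<^sup>2)"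
    by transfer (auto simp: cinner_norm suminf_of_real suminf_nonneg simp flip: of_real_power)
qed

end

record 'a cstar = "(complex, 'a) module" +
  star :: "'a \<Rightarrow> 'a"
  nrm :: "'a \<Rightarrow> real"

definition cstar_subalgebra :: "'a cstar \<Rightarrow> 'a set \<Rightarrow> bool" where
  "cstar_subalgebra A B \<longleftrightarrow>
     B \<subseteq> carrier A \<and> \<zero>\<^bsub>A\<^esub> \<in> B \<and>
     (\<forall>x\<in>B. \<forall>y\<in>B. x \<oplus>\<^bsub>A\<^esub> y \<in> B \<and> x \<otimes>\<^bsub>A\<^esub> y \<in> B) \<and>
     (\<forall>c. \<forall>x\<in>B. c \<odot>\<^bsub>A\<^esub> x \<in> B) \<and> (\<forall>x\<in>B. star A x \<in> B) \<and>
     (\<forall>f. \<forall>x\<in>carrier A. (\<forall>n::nat. f n \<in> B) \<and> (\<lambda>n. nrm A (f n \<ominus>\<^bsub>A\<^esub> x)) \<longlonglongrightarrow> 0 \<longrightarrow> x \<in> B)"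

definition cstar_generated :: "'a cstar \<Rightarrow> 'a set \<Rightarrow> 'a set" where
  "cstar_generated A X = \<Inter> {B. cstar_subalgebra A B \<and> X \<subseteq> B}"

definition cspectrum :: "'a cstar \<Rightarrow> 'a \<Rightarrow> complex set" where
  "cspectrum A b = {z. b \<ominus>\<^bsub>A\<^esub> z \<odot>\<^bsub>A\<^esub> \<one>\<^bsub>A\<^esub> \<notin> Units A}"

definition sigma2 :: "'a cstar \<Rightarrow> 'a \<Rightarrow> complex set" where
  "sigma2 A b = {complex_of_real r | r. 0 \<le> r \<and> complex_of_real (r\<^sup>2) \<in> cspectrum A (star A b \<otimes>\<^bsub>A\<^esub> b)}"

definition pseudospectrum :: "'a cstar \<Rightarrow> real \<Rightarrow> 'a \<Rightarrow> complex set" where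
  "pseudospectrum A \<epsilon> b =
     {z. b \<ominus>\<^bsub>A\<^esub> z \<odot>\<^bsub>A\<^esub> \<one>\<^bsub>A\<^esub> \<notin> Units A \<or>
         nrm A (inv\<^bsub>A\<^esub> (b \<ominus>\<^bsub>A\<^esub> z \<odot>\<^bsub>A\<^esub> \<one>\<^bsub>A\<^esub>)) \<ge> 1 / \<epsilon>}"

text \<open>The quotient by a closed ideal: the ring structure is that of \<^const>\<open>FactRing\<close>.\<close>

definition cstar_quot :: "'a cstar \<Rightarrow> 'a set \<Rightarrow> 'a set cstar" where
  "cstar_quot A J =
     \<lparr>carrier = carrier (A Quot J), monoid.mult = monoid.mult (A Quot J), one = one (A Quot J),
      ring.zero = ring.zero (A Quot J), ring.add = ring.add (A Quot J),
      smult = (\<lambda>c X. \<Union>x\<in>X. J +>\<^bsub>A\<^esub> (c \<odot>\<^bsub>A\<^esub> x)),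
      star = (\<lambda>X. star A ` X),
      nrm = (\<lambda>X. INF x\<in>X. nrm A x)\<rparr>"

text \<open>Elements of \<open>'h \<Rightarrow>\<^sub>L 'h\<close> are only real-linear; \<open>cops\<close> singles out the complex-linear ones.\<close>

definition cops :: "('h::complex_inner \<Rightarrow>\<^sub>L 'h) set" where
  "cops = {T. \<forall>c x. blinfun_apply T (c *\<^sub>C x) = c *\<^sub>C blinfun_apply T x}"

definition cscale :: "complex \<Rightarrow> ('h::complex_inner \<Rightarrow>\<^sub>L 'h) \<Rightarrow> ('h \<Rightarrow>\<^sub>L 'h)" where
  "cscale c T = Blinfun (\<lambda>x. c *\<^sub>C blinfun_apply T x)"

definition cadjoint :: "('h::complex_inner \<Rightarrow>\<^sub>L 'h) \<Rightarrow> ('h \<Rightarrow>\<^sub>L 'h)" where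
  "cadjoint T = (THE T'. \<forall>x y. cinner (blinfun_apply T x) y = cinner x (blinfun_apply T' y))"

definition bop :: "('h::complex_inner \<Rightarrow>\<^sub>L 'h) cstar" where
  "bop = \<lparr>carrier = cops, monoid.mult = (\<lambda>A B. A o\<^sub>L B), one = id_blinfun,
          ring.zero = 0, ring.add = (\<lambda>A B. A + B),
          smult = cscale, star = cadjoint, nrm = norm\<rparr>"

definition slim :: "(nat \<Rightarrow> ('h::real_normed_vector \<Rightarrow>\<^sub>L 'h)) \<Rightarrow> ('h \<Rightarrow>\<^sub>L 'h)" where
  "slim T = (THE L. \<forall>x. (\<lambda>n. blinfun_apply (T n) x) \<longlonglongrightarrow> blinfun_apply L x)"

type_synonym l2 = "complex ell2"
type_synonym l2_op = "l2 \<Rightarrow>\<^sub>L l2"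

definition P :: "nat \<Rightarrow> l2_op" where
  "P n = Blinfun (\<lambda>x. Abs_ell2 (\<lambda>k. if k < n then coord x k else 0))"

definition R :: "nat \<Rightarrow> l2_op" where
  "R n = Blinfun (\<lambda>x. Abs_ell2 (\<lambda>k. if k < n then coord x (n - 1 - k) else 0))"

definition S :: "nat \<Rightarrow> nat \<Rightarrow> l2_op" where
  "S N i = Blinfun (\<lambda>x. Abs_ell2 (\<lambda>k. if k mod N = i then coord x (k div N) else 0))"

text \<open>The arguments of \<^const>\<open>Blinfun\<close> and \<^const>\<open>Abs_ell2\<close> above are legitimate.\<close>

lemma blinfun_apply_cscale: "blinfun_apply (cscale c T) x = c *\<^sub>C blinfun_apply T x"
proof -
  have "bounded_linear (\<lambda>x. c *\<^sub>C blinfun_apply T x)"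
  proof (rule bounded_linear_intro)
    show "norm (c *\<^sub>C blinfun_apply T x) \<le> norm x * (cmod c * norm T)" for x
      using mult_left_mono[OF norm_blinfun[of T x], of "cmod c"]
      by (simp add: norm_scaleC mult_ac)
    show "c *\<^sub>C blinfun_apply T (r *\<^sub>R x) = r *\<^sub>R c *\<^sub>C blinfun_apply T x" for r x
      unfolding blinfun.scaleR_right by (simp add: scaleR_scaleC scaleC_scaleC mult.commute)
  qed (simp add: blinfun.add_right scaleC_add_right)
  then show ?thesis unfolding cscale_def by (simp add: bounded_linear_Blinfun_apply)
qed

lemma coord_partial_injection:
  fixes D :: "nat set" and g :: "nat \<Rightarrow> nat"
  assumes "inj_on g D"
  shows "coord (blinfun_apply (Blinfun (\<lambda>x :: l2. Abs_ell2 (\<lambda>k. if k \<in> D then coord x (g k) else 0))) x) k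
           = (if k \<in> D then coord x (g k) else 0)"
proof -
  define F :: "l2 \<Rightarrow> l2" where "F x = Abs_ell2 (\<lambda>k. if k \<in> D then coord x (g k) else 0)" for x
  have B: "(\<Sum>k<n. (norm (if k \<in> D then coord x (g k) else 0))\<^sup>2) \<le> (\<Sum>k. (norm (coord x k))\<^sup>2)"
    for n and x :: l2
  proof -
    have "(\<Sum>k<n. (norm (if k \<in> D then coord x (g k) else 0))\<^sup>2)
        = (\<Sum>k\<in>{..<n} \<inter> D. (norm (coord x (g k)))\<^sup>2)"
      by (rule sum.mono_neutral_cong_right) auto
    also have "\<dots> = (\<Sum>m\<in>g ` ({..<n} \<inter> D). (norm (coord x m))\<^sup>2)"
      using inj_on_subset[OF assms, of "{..<n} \<inter> D"] by (simp add: sum.reindex)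
    also have "\<dots> \<le> (\<Sum>k. (norm (coord x k))\<^sup>2)"
      by (rule sum_le_suminf) (auto simp: summable_coord)
    finally show ?thesis .
  qed
  have s: "summable (\<lambda>k. (norm (if k \<in> D then coord x (g k) else 0))\<^sup>2)" for x :: l2
    by (rule summableI_nonneg_bounded[OF _ B]) simp
  have F: "coord (F x) = (\<lambda>k. if k \<in> D then coord x (g k) else 0)" for x
    unfolding F_def using s[of x] by (simp add: Abs_ell2_inverse)
  have "bounded_linear F"
  proof (rule bounded_linear_intro)
    show "F (x + y) = F x + F y" for x y
      by (rule ell2_eqI) (simp add: F plus_ell2.rep_eq)
    show "F (r *\<^sub>R x) = r *\<^sub>R F x" for r x
      by (rule ell2_eqI) (simp add: F scaleR_ell2.rep_eq)
    show "norm (F x) \<le> norm x * 1" for x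
      unfolding norm_ell2.rep_eq F using suminf_le_const[OF s B] by simp
  qed
  then show ?thesis
    using F[of x] by (simp add: F_def[abs_def] bounded_linear_Blinfun_apply)
qed

lemma coord_P: "coord (blinfun_apply (P n) x) k = (if k < n then coord x k else 0)"
  using coord_partial_injection[of "\<lambda>k. k" "{..<n}"] by (simp add: P_def)

lemma coord_R: "coord (blinfun_apply (R n) x) k = (if k < n then coord x (n - 1 - k) else 0)"
proof -
  have "inj_on (\<lambda>k. n - 1 - k) {..<n}"
    by (rule inj_onI) auto
  from coord_partial_injection[OF this] show ?thesis by (simp add: R_def)
qed

lemma coord_S: "coord (blinfun_apply (S N i) x) k = (if k mod N = i then coord x (k div N) else 0)"
proof -
  have "inj_on (\<lambda>k. k div N) {k. k mod N = i}"
    by (rule inj_onI) (metis div_mult_mod_eq mem_Collect_eq)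
  from coord_partial_injection[OF this] show ?thesis by (simp add: S_def)
qed

definition cuntz :: "nat \<Rightarrow> l2_op set" where
  "cuntz N = cstar_generated bop {S N i | i. i < N}"

text \<open>The \<open>k \<times> k\<close> matrices, as operators on the range of \<^term>\<open>P k\<close> extended by zero; the
  identity is \<^term>\<open>P k\<close>, so spectra are those of \<open>k \<times> k\<close> matrices.\<close>

definition mat_alg :: "nat \<Rightarrow> l2_op cstar" where
  "mat_alg k = bop \<lparr>carrier := {T \<in> cops. P k o\<^sub>L T o\<^sub>L P k = T}, one := P k\<rparr>"

definition F_eta :: "nat \<Rightarrow> (nat \<Rightarrow> l2_op) cstar" where
  "F_eta N = \<lparr>carrier = {A. (\<forall>n. A n \<in> carrier (mat_alg (N ^ n))) \<and> bounded (range A)},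
     monoid.mult = (\<lambda>A B n. A n o\<^sub>L B n), one = (\<lambda>n. P (N ^ n)),
     ring.zero = (\<lambda>n. 0), ring.add = (\<lambda>A B n. A n + B n),
     smult = (\<lambda>c A n. cscale c (A n)), star = (\<lambda>A n. cadjoint (A n)),
     nrm = (\<lambda>A. SUP n. norm (A n))\<rparr>"

definition G_eta :: "nat \<Rightarrow> (nat \<Rightarrow> l2_op) set" where
  "G_eta N = {A \<in> carrier (F_eta N). (\<lambda>n. norm (A n)) \<longlonglongrightarrow> 0}"

definition S_eta :: "nat \<Rightarrow> (nat \<Rightarrow> l2_op) cstar" where
  "S_eta N = F_eta N \<lparr>carrier :=
     cstar_generated (F_eta N) {\<lambda>n. P (N ^ n) o\<^sub>L A o\<^sub>L P (N ^ n) | A. A \<in> cuntz N}\<rparr>"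

definition S_quot :: "nat \<Rightarrow> (nat \<Rightarrow> l2_op) set cstar" where
  "S_quot N = cstar_quot (S_eta N) (G_eta N)"

definition s0 :: "nat \<Rightarrow> (nat \<Rightarrow> l2_op) set" where
  "s0 N = G_eta N +>\<^bsub>S_eta N\<^esub> (\<lambda>n. P (N ^ n) o\<^sub>L S N 0 o\<^sub>L P (N ^ n))"

definition e_minus_p1 :: "nat \<Rightarrow> (nat \<Rightarrow> l2_op) set" where
  "e_minus_p1 N = \<one>\<^bsub>S_quot N\<^esub> \<ominus>\<^bsub>S_quot N\<^esub> (star (S_quot N) (s0 N) \<otimes>\<^bsub>S_quot N\<^esub> s0 N)"

text \<open>The strong limit does not depend on the representative chosen by \<open>SOME\<close>.\<close>

definition W00 :: "nat \<Rightarrow> (nat \<Rightarrow> l2_op) set \<Rightarrow> l2_op" where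
  "W00 N a =
     (let A = (SOME A. A \<in> e_minus_p1 N \<otimes>\<^bsub>S_quot N\<^esub> a \<otimes>\<^bsub>S_quot N\<^esub> e_minus_p1 N)
      in slim (\<lambda>n. R (N ^ n) o\<^sub>L A n o\<^sub>L R (N ^ n)))"

definition W :: "nat \<Rightarrow> (nat \<Rightarrow> l2_op) set \<Rightarrow> nat \<Rightarrow> nat \<Rightarrow> l2_op" where
  "W N a i j =
     (star bop (S N (N - 1)) [^]\<^bsub>bop\<^esub> i) \<otimes>\<^bsub>bop\<^esub>
     W00 N (e_minus_p1 N \<otimes>\<^bsub>S_quot N\<^esub> (s0 N [^]\<^bsub>S_quot N\<^esub> i) \<otimes>\<^bsub>S_quot N\<^esub> a \<otimes>\<^bsub>S_quot N\<^esub>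
            (star (S_quot N) (s0 N) [^]\<^bsub>S_quot N\<^esub> j) \<otimes>\<^bsub>S_quot N\<^esub> e_minus_p1 N) \<otimes>\<^bsub>bop\<^esub>
     (S N (N - 1) [^]\<^bsub>bop\<^esub> j)"

definition W_tilde :: "nat \<Rightarrow> (nat \<Rightarrow> l2_op) set \<Rightarrow> (l2 ell2 \<Rightarrow>\<^sub>L l2 ell2)" where
  "W_tilde N a =
     (THE T. \<forall>x i. (\<lambda>j. blinfun_apply (W N a i j) (coord x j)) sums coord (blinfun_apply T x) i)"

definition hausdorff_dist :: "complex set \<Rightarrow> complex set \<Rightarrow> real" where
  "hausdorff_dist M K = max (SUP m\<in>M. INF k\<in>K. dist m k) (SUP k\<in>K. INF m\<in>M. dist m k)"

text \<open>The Hausdorff distance is meaningful for non-empty compact sets only, so membership in this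
  class is part of convergence.\<close>

definition hausdorff_tendsto :: "(nat \<Rightarrow> complex set) \<Rightarrow> complex set \<Rightarrow> bool" where
  "hausdorff_tendsto M K \<longleftrightarrow>
     (\<forall>n. M n \<noteq> {} \<and> compact (M n)) \<and> K \<noteq> {} \<and> compact K \<and>
     (\<lambda>n. hausdorff_dist (M n) K) \<longlonglongrightarrow> 0"

end

theory Submission
  imports Defs "HOL-Computational_Algebra.Fundamental_Theorem_Algebra"
begin

text \<open>
  A weighted relabelling of basis vectors, by leading zeros in base \<open>N\<close>, gives isometries \<open>U n\<close>
  from the range of \<open>P (N ^ n)\<close> into
  \<open>l\<^sup>2(l\<^sup>2)\<close> with \<open>U n (U n)\<^sup>* \<rightarrow> 1\<close> strongly that intertwine the finite sections of the generators
  with their images under \<open>W_tilde\<close> up to errors tending to zero \<^emph>\<open>in norm\<close>. The sequences \<open>A\<close> for which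
  there is an \<open>L\<close> with \<open>\<parallel>U n A n - L U n\<parallel> \<rightarrow> 0\<close>, and likewise for the adjoints, form a closed algebra, so this
  holds throughout \<open>S_eta N\<close> with \<open>L = W_tilde N a\<close>. Consequently the lower moduli
  \<open>inf {\<parallel>(A n - z) x\<parallel> | \<parallel>x\<parallel> = 1}\<close>, the reciprocals of the resolvent norms, converge to those of \<open>L\<close>
  for every \<open>z\<close>. Part (c) follows since a resolvent norm has no local maximum. In part (a) the matrices
  \<open>A n\<close> are only asymptotically self-adjoint, so a single approximate eigenvector does not locate an
  eigenvalue; but every approximate eigenvector of \<open>L\<close> yields a positive proportion of orthonormal ones of
  \<open>A n\<close>, and a Hilbert--Schmidt estimate then applies. Part (b) is part (a) for \<open>A\<^sup>* A\<close>.
\<close>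

section \<open>Adjoints and direct sums\<close>

text \<open>The weights in the relabelling answer one obstruction. Appending a base-N digit to an
  index removes one leading zero, so recording the number of leading zeros together with the
  reflected remainder turns the sections of the generators into shifts of levels. The exception is
  the index 0, which \<open>s 0 n\<close> fixes although a shift must lower its level: a defect of
  rank one but of norm one, which does not fade as n grows. Spreading high levels over n div 2
  neighbours with slowly varying probabilities reduces the defect to order 1 / sqrt n, while every
  fixed level is eventually left alone. Norm convergence matters because it bounds the lower modulus
  of L - z by that of A n - z uniformly in z; for the reverse estimate, at one z, strong convergence
  is enough. The reflection r -> N^k - 1 - r complements digits. It is the effect of
  \<open>R\<close> in \<open>W00\<close>, and it explains why the digit 0 of \<open>s0\<close> is
  paired with \<open>S N (N - 1)\<close>. Invertibility in the limit is inherited from finite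
  dimension: a matrix bounded below is onto, so its adjoint has the same lower bound, and this bound
  passes to the adjoint of the limit operator.\<close>

lemma scaleC_zero_left [simp]: "0 *\<^sub>C x = (0::'a::complex_inner)"
  using scaleR_scaleC[of 0 x] by simp

lemma scaleC_one [simp]: "1 *\<^sub>C x = (x::'a::complex_inner)"
  using scaleR_scaleC[of 1 x] by simp

interpretation scaleC: bounded_bilinear "scaleC :: complex \<Rightarrow> 'a::complex_inner \<Rightarrow> 'a"
proof
  fix c d :: complex and x y :: 'a and r :: real
  show "(c + d) *\<^sub>C x = c *\<^sub>C x + d *\<^sub>C x" by (rule scaleC_add_left)
  show "c *\<^sub>C (x + y) = c *\<^sub>C x + c *\<^sub>C y" by (rule scaleC_add_right)
  show "(r *\<^sub>R c) *\<^sub>C x = r *\<^sub>R (c *\<^sub>C x)"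
    by (simp add: scaleR_scaleC scaleC_scaleC scaleC_complex_def)
  show "c *\<^sub>C (r *\<^sub>R x) = r *\<^sub>R (c *\<^sub>C x)"
    by (simp add: scaleR_scaleC scaleC_scaleC mult.commute)
  show "\<exists>K. \<forall>c x. norm (c *\<^sub>C (x::'a)) \<le> norm c * norm x * K"
    by (rule exI[of _ 1]) (simp add: norm_scaleC)
qed

interpretation cinner: bounded_bilinear "cinner :: 'a::complex_inner \<Rightarrow> 'a \<Rightarrow> complex"
proof
  fix x y z :: 'a and r :: real
  show "cinner (x + y) z = cinner x z + cinner y z" by (rule cinner_add_left)
  show "cinner x (y + z) = cinner x y + cinner x z" by (rule cinner_add_right)
  show "cinner (r *\<^sub>R x) y = r *\<^sub>R cinner x y"
    by (simp add: scaleR_scaleC cinner_scaleC_left scaleC_complex_def)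
  show "cinner x (r *\<^sub>R y) = r *\<^sub>R cinner x y"
    by (simp add: scaleR_scaleC cinner_scaleC_right scaleC_complex_def)
  show "\<exists>K. \<forall>x y. norm (cinner (x::'a) y) \<le> norm x * norm y * K"
    by (rule exI[of _ 1]) (simp add: cinner_bound)
qed

declare scaleC.zero_right [simp] cinner.zero_left [simp] cinner.zero_right [simp]

lemma cinner_self_eq_0: "cinner x x = 0 \<longleftrightarrow> x = (0::'a::complex_inner)"
  by (simp add: cinner_norm)

lemma cinner_eqI:
  fixes a b :: "'a::complex_inner"
  assumes "\<And>x. cinner x a = cinner x b"
  shows "a = b"
proof -
  have "cinner (a - b) (a - b) = 0" using assms[of "a - b"] by (simp add: cinner.diff_right)
  then show ?thesis by (simp add: cinner_self_eq_0)
qed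

lemma Re_cinner_self: "Re (cinner x x) = (norm (x::'a::complex_inner))\<^sup>2"
  by (simp add: cinner_norm)

lemma norm_diff_sq:
  fixes x y :: "'a::complex_inner"
  shows "(norm (x - y))\<^sup>2 = (norm x)\<^sup>2 - 2 * Re (cinner x y) + (norm y)\<^sup>2"
proof -
  have "Re (cinner y x) = Re (cinner x y)" by (subst cinner_commute) simp
  then show ?thesis
    by (simp flip: Re_cinner_self add: cinner.diff_left cinner.diff_right)
qed

text \<open>A relation rather than an operation, because \<open>cadjoint\<close> is a definite
  description and says nothing before existence is known. Existence is proved for \<open>l2\<close>
  only; on \<open>l2 ell2\<close>, and between the two spaces, adjoint pairs are built explicitly
  and carried along.\<close>

definition adj :: "('a::complex_inner \<Rightarrow>\<^sub>L 'b::complex_inner) \<Rightarrow> ('b \<Rightarrow>\<^sub>L 'a) \<Rightarrow> bool" where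
  "adj F G \<longleftrightarrow> (\<forall>x y. cinner (F x) y = cinner x (G y))"

lemma adjD: "adj F G \<Longrightarrow> cinner (F x) y = cinner x (G y)"
  by (simp add: adj_def)

lemma adj_sym:
  assumes "adj F G"
  shows "adj G F"
  unfolding adj_def
proof (intro allI)
  fix x y
  have "cinner (G x) y = cnj (cinner y (G x))" by (rule cinner_commute)
  also have "\<dots> = cnj (cinner (F y) x)" by (simp add: adjD[OF assms])
  also have "\<dots> = cinner x (F y)" by (rule cinner_commute[symmetric])
  finally show "cinner (G x) y = cinner x (F y)" .
qed

lemma adj_unique: "adj F G \<Longrightarrow> adj F G' \<Longrightarrow> G = G'"
  by (rule blinfun_eqI, rule cinner_eqI) (simp add: adj_def)

lemma cadjoint_eq: "adj T T' \<Longrightarrow> cadjoint T = T'"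
  unfolding cadjoint_def
  by (rule the_equality) (metis adj_def adj_unique)+

text \<open>Elements of the operator type are only real-linear; possessing an adjoint for the
  complex inner product forces complex linearity.\<close>

lemma adj_scaleC:
  assumes "adj F G"
  shows "F (c *\<^sub>C x) = c *\<^sub>C F x"
proof (rule cinner_eqI)
  fix y
  have "cinner y (F (c *\<^sub>C x)) = cinner (G y) (c *\<^sub>C x)"
    by (rule adjD[OF adj_sym[OF assms], symmetric])
  also have "\<dots> = cinner y (c *\<^sub>C F x)"
    by (simp add: cinner_scaleC_right adjD[OF adj_sym[OF assms]])
  finally show "cinner y (F (c *\<^sub>C x)) = cinner y (c *\<^sub>C F x)" .
qed

lemma adj_in_cops: "adj T T' \<Longrightarrow> T \<in> cops"
  by (simp add: cops_def adj_scaleC)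

lemma adj_zero: "adj 0 0"
  by (simp add: adj_def)

lemma adj_id: "adj id_blinfun id_blinfun"
  by (simp add: adj_def)

lemma adj_add: "adj F G \<Longrightarrow> adj F' G' \<Longrightarrow> adj (F + F') (G + G')"
  by (simp add: adj_def blinfun.add_left cinner.add_left cinner.add_right)

lemma adj_diff: "adj F G \<Longrightarrow> adj F' G' \<Longrightarrow> adj (F - F') (G - G')"
  by (simp add: adj_def blinfun.diff_left cinner.diff_left cinner.diff_right)

lemma adj_compose: "adj F G \<Longrightarrow> adj F' G' \<Longrightarrow> adj (F o\<^sub>L F') (G' o\<^sub>L G)"
  by (simp add: adj_def)

lemma adj_cscale: "adj F G \<Longrightarrow> adj (cscale c F) (cscale (cnj c) G)"
  by (simp add: adj_def blinfun_apply_cscale cinner_scaleC_left cinner_scaleC_right)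

lemma adj_norm_le:
  assumes "adj F G"
  shows "norm G \<le> norm F"
proof (rule norm_blinfun_bound)
  fix y
  have "(norm (G y))\<^sup>2 = Re (cinner (G y) (G y))" by (simp add: Re_cinner_self)
  also have "\<dots> = Re (cinner (F (G y)) y)" by (simp add: adjD[OF assms])
  also have "\<dots> \<le> norm (F (G y)) * norm y"
    by (meson complex_Re_le_cmod cinner_bound order_trans)
  also have "\<dots> \<le> norm F * norm (G y) * norm y"
    by (intro mult_right_mono norm_blinfun) simp
  finally have "norm (G y) * norm (G y) \<le> (norm F * norm y) * norm (G y)"
    by (simp add: power2_eq_square mult_ac)
  then show "norm (G y) \<le> norm F * norm y"
    by (cases "norm (G y) = 0") (auto simp: mult_le_cancel_right)
qed simp

lemma adj_norm: "adj F G \<Longrightarrow> norm G = norm F"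
  by (meson adj_norm_le adj_sym antisym)

lemma adj_limit:
  assumes "\<And>n::nat. adj (F n) (G n)" "F \<longlonglongrightarrow> f" "G \<longlonglongrightarrow> g"
  shows "adj f g"
  unfolding adj_def
proof (intro allI)
  fix x y
  have "(\<lambda>n. cinner (F n x) y) \<longlonglongrightarrow> cinner (f x) y"
    by (intro cinner.tendsto blinfun.tendsto assms tendsto_const)
  moreover have "(\<lambda>n. cinner (F n x) y) \<longlonglongrightarrow> cinner x (g y)"
    unfolding adjD[OF assms(1)]
    by (intro cinner.tendsto blinfun.tendsto assms tendsto_const)
  ultimately show "cinner (f x) y = cinner x (g y)" by (rule LIMSEQ_unique)
qed

lemma copsI: "(\<And>c x. blinfun_apply T (c *\<^sub>C x) = c *\<^sub>C blinfun_apply T x) \<Longrightarrow> T \<in> cops"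
  by (simp add: cops_def)

lemma copsD: "T \<in> cops \<Longrightarrow> blinfun_apply T (c *\<^sub>C x) = c *\<^sub>C blinfun_apply T x"
  by (simp add: cops_def)

lemma cops_zero: "0 \<in> cops" and cops_id: "id_blinfun \<in> cops"
  by (auto intro!: copsI)

lemma cops_add: "A \<in> cops \<Longrightarrow> B \<in> cops \<Longrightarrow> A + B \<in> cops"
  and cops_minus: "A \<in> cops \<Longrightarrow> - A \<in> cops"
  and cops_diff: "A \<in> cops \<Longrightarrow> B \<in> cops \<Longrightarrow> A - B \<in> cops"
  and cops_compose: "A \<in> cops \<Longrightarrow> B \<in> cops \<Longrightarrow> A o\<^sub>L B \<in> cops"
  and cops_cscale: "A \<in> cops \<Longrightarrow> cscale c A \<in> cops"
  by (auto intro!: copsI simp: copsD blinfun.add_left blinfun.diff_left blinfun.minus_left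
      scaleC.add_right scaleC.diff_right scaleC.minus_right blinfun_apply_cscale
      scaleC_scaleC mult.commute)

lemma cops_limit:
  assumes "\<And>n::nat. F n \<in> cops" "F \<longlonglongrightarrow> f"
  shows "f \<in> cops"
proof (rule copsI)
  fix c x
  have "(\<lambda>n. F n (c *\<^sub>C x)) \<longlonglongrightarrow> f (c *\<^sub>C x)"
    by (intro blinfun.tendsto assms tendsto_const)
  moreover have "(\<lambda>n. F n (c *\<^sub>C x)) \<longlonglongrightarrow> c *\<^sub>C f x"
    unfolding copsD[OF assms(1)]
    by (intro scaleC.tendsto blinfun.tendsto assms tendsto_const)
  ultimately show "f (c *\<^sub>C x) = c *\<^sub>C f x" by (rule LIMSEQ_unique)
qed

lemma cscale_simps:
  "cscale c (A + B) = cscale c A + cscale c B"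
  "cscale (- 1) A = - A"
  "cscale c A o\<^sub>L B = cscale c (A o\<^sub>L B)"
  "cscale 0 A = 0"
  "cscale 1 A = A"
  by (rule blinfun_eqI; simp add: blinfun_apply_cscale blinfun.add_left blinfun.minus_left
      scaleC.add_right scaleC.minus_left)+

lemma compose_cscale: "A \<in> cops \<Longrightarrow> A o\<^sub>L cscale c B = cscale c (A o\<^sub>L B)"
  by (rule blinfun_eqI) (simp add: blinfun_apply_cscale copsD)

lemma norm_cscale: "norm (cscale c A) = cmod c * norm A"
proof -
  have le: "norm (cscale c A) \<le> cmod c * norm A" for c and A :: "'a::complex_inner \<Rightarrow>\<^sub>L 'a"
    by (rule norm_blinfun_bound)
      (auto simp: blinfun_apply_cscale norm_scaleC mult.assoc intro!: mult_left_mono norm_blinfun)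
  show ?thesis
  proof (cases "c = 0")
    case False
    have "cscale (1 / c) (cscale c A) = A"
      by (rule blinfun_eqI) (simp add: blinfun_apply_cscale scaleC_scaleC False)
    then have "norm A \<le> cmod (1 / c) * norm (cscale c A)" by (metis le)
    then have "cmod c * norm A \<le> norm (cscale c A)"
      using False by (simp add: norm_divide field_simps)
    with le[of c A] show ?thesis by simp
  qed (simp add: cscale_simps)
qed

section \<open>Completeness of ell2, coordinate maps and basis vectors\<close>

lemmas coord_simps [simp] = zero_ell2.rep_eq plus_ell2.rep_eq minus_ell2.rep_eq
  uminus_ell2.rep_eq scaleR_ell2.rep_eq scaleC_ell2.rep_eq

lemma norm_ell2_sq: "(norm x)\<^sup>2 = (\<Sum>k. (norm (coord x k))\<^sup>2)"
  by (simp add: norm_ell2.rep_eq suminf_nonneg summable_coord)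

lemma sum_coord_le: "finite F \<Longrightarrow> (\<Sum>k\<in>F. (norm (coord x k))\<^sup>2) \<le> (norm x)\<^sup>2"
  unfolding norm_ell2_sq by (rule sum_le_suminf) (auto simp: summable_coord)

lemma norm_coord_le: "norm (coord x k) \<le> norm x"
  using sum_coord_le[of "{k}" x] by (simp add: power2_le_iff_abs_le)

lemma norm_ell2_finite:
  assumes "finite F" "\<And>k. k \<notin> F \<Longrightarrow> coord x k = 0"
  shows "(norm x)\<^sup>2 = (\<Sum>k\<in>F. (norm (coord x k))\<^sup>2)"
  unfolding norm_ell2_sq by (rule suminf_finite) (use assms in auto)

lemma norm_ell2_leI:
  assumes "\<And>n. (\<Sum>k<n. (norm (coord x k))\<^sup>2) \<le> c\<^sup>2" "0 \<le> c"
  shows "norm x \<le> c"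
proof -
  have "(norm x)\<^sup>2 \<le> c\<^sup>2"
    unfolding norm_ell2_sq by (rule suminf_le_const[OF summable_coord assms(1)])
  then show ?thesis using assms(2) by (rule power2_le_imp_le)
qed

text \<open>Coordinates are contractions, so coordinatewise limits exist. The Cauchy estimate on
  finite partial sums survives the limit and yields both square summability and norm convergence.
  Completeness serves the fixed point argument and the limits of Cauchy sequences of
  operators.\<close>

instance ell2 :: (banach) banach
proof
  fix X :: "nat \<Rightarrow> 'a ell2"
  assume C: "Cauchy X"
  have "Cauchy (\<lambda>n. coord (X n) k)" for k
  proof (rule CauchyI)
    fix e :: real assume "0 < e"
    from CauchyD[OF C this] obtain M
      where M: "\<And>m n. m \<ge> M \<Longrightarrow> n \<ge> M \<Longrightarrow> norm (X m - X n) < e" by blast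
    have "norm (coord (X m) k - coord (X n) k) < e" if "m \<ge> M" "n \<ge> M" for m n
      using norm_coord_le[of "X m - X n" k] M[OF that] by simp
    then show "\<exists>M. \<forall>m\<ge>M. \<forall>n\<ge>M. norm (coord (X m) k - coord (X n) k) < e" by blast
  qed
  then obtain L where L: "\<And>k. (\<lambda>n. coord (X n) k) \<longlonglongrightarrow> L k"
    unfolding Cauchy_convergent_iff convergent_def by metis
  have tail: "\<exists>M. \<forall>m\<ge>M. \<forall>j. (\<Sum>k<j. (norm (coord (X m) k - L k))\<^sup>2) \<le> e\<^sup>2" if e: "0 < e" for e
  proof -
    from CauchyD[OF C e] obtain M
      where M: "\<And>m n. m \<ge> M \<Longrightarrow> n \<ge> M \<Longrightarrow> norm (X m - X n) < e" by blast
    have "(\<Sum>k<j. (norm (coord (X m) k - L k))\<^sup>2) \<le> e\<^sup>2" if m: "m \<ge> M" for m j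
    proof (rule tendsto_upperbound)
      show "(\<lambda>n. \<Sum>k<j. (norm (coord (X m) k - coord (X n) k))\<^sup>2)
          \<longlonglongrightarrow> (\<Sum>k<j. (norm (coord (X m) k - L k))\<^sup>2)"
        by (intro tendsto_intros L)
      show "\<forall>\<^sub>F n in sequentially. (\<Sum>k<j. (norm (coord (X m) k - coord (X n) k))\<^sup>2) \<le> e\<^sup>2"
      proof (rule eventually_sequentiallyI)
        fix n assume n: "M \<le> n"
        have "(\<Sum>k<j. (norm (coord (X m - X n) k))\<^sup>2) \<le> (norm (X m - X n))\<^sup>2"
          by (rule sum_coord_le) simp
        also have "\<dots> \<le> e\<^sup>2" using M[OF m n] by (intro power_mono) auto
        finally show "(\<Sum>k<j. (norm (coord (X m) k - coord (X n) k))\<^sup>2) \<le> e\<^sup>2" by simp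
      qed
    qed simp
    then show ?thesis by blast
  qed
  have s: "summable (\<lambda>k. (norm (L k))\<^sup>2)"
  proof -
    obtain M where "\<And>j. (\<Sum>k<j. (norm (coord (X M) k - L k))\<^sup>2) \<le> 1\<^sup>2"
      using tail[of 1] by auto
    then have "summable (\<lambda>k. (norm (coord (X M) k - L k))\<^sup>2)"
      by (intro summableI_nonneg_bounded) auto
    then have "summable (\<lambda>k. (norm (- (coord (X M) k - L k)))\<^sup>2)" by (simp only: norm_minus_cancel)
    from sq_summable_add_aux(1)[OF summable_coord[of "X M"] this] show ?thesis by simp
  qed
  define l where "l = Abs_ell2 L"
  have l: "coord l = L" unfolding l_def using s by (simp add: Abs_ell2_inverse)
  have "X \<longlonglongrightarrow> l"
  proof (rule LIMSEQ_I)
    fix e :: real assume e: "0 < e"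
    then obtain M where M: "\<And>m j. m \<ge> M \<Longrightarrow> (\<Sum>k<j. (norm (coord (X m) k - L k))\<^sup>2) \<le> (e / 2)\<^sup>2"
      using tail[of "e / 2"] by auto
    have "norm (X m - l) < e" if "m \<ge> M" for m
    proof -
      have "norm (X m - l) \<le> e / 2"
        by (rule norm_ell2_leI) (use M[OF that] e in \<open>auto simp: l\<close>)
      then show ?thesis using e by simp
    qed
    then show "\<exists>M. \<forall>m\<ge>M. norm (X m - l) < e" by blast
  qed
  then show "convergent X" by (auto simp: convergent_def)
qed

definition ins :: "nat \<Rightarrow> 'a \<Rightarrow>\<^sub>L 'a::real_normed_vector ell2" where
  "ins k = Blinfun (\<lambda>v. Abs_ell2 (\<lambda>i. if i = k then v else 0))"

definition prj :: "nat \<Rightarrow> 'a::real_normed_vector ell2 \<Rightarrow>\<^sub>L 'a" where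
  "prj k = Blinfun (\<lambda>x. coord x k)"

lemma prj_apply [simp]: "prj k x = coord x k"
proof -
  have "bounded_linear (\<lambda>x :: 'a ell2. coord x k)"
    by (rule bounded_linear_intro[where K = 1]) (auto simp: norm_coord_le)
  then show ?thesis by (simp add: prj_def bounded_linear_Blinfun_apply)
qed

lemma coord_ins [simp]: "coord (ins k v) i = (if i = k then v else 0)"
proof -
  define G :: "'a \<Rightarrow> 'a ell2" where "G v = Abs_ell2 (\<lambda>i. if i = k then v else 0)" for v
  have G: "coord (G v) = (\<lambda>i. if i = k then v else 0)" for v
  proof -
    have "summable (\<lambda>i. (norm (if i = k then v else 0))\<^sup>2)"
      by (rule summable_finite[of "{k}"]) auto
    then show ?thesis unfolding G_def by (simp add: Abs_ell2_inverse)
  qed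
  have "bounded_linear G"
  proof (rule bounded_linear_intro[where K = 1])
    show "norm (G x) \<le> norm x * 1" for x
    proof -
      have "(norm (G x))\<^sup>2 = (\<Sum>i\<in>{k}. (norm (coord (G x) i))\<^sup>2)"
        by (rule norm_ell2_finite) (auto simp: G)
      then have "(norm (G x))\<^sup>2 = (norm x)\<^sup>2" by (simp add: G)
      then show ?thesis by (simp add: power2_eq_iff_nonneg)
    qed
    show "G (x + y) = G x + G y" for x y
      by (rule ell2_eqI) (simp add: G)
    show "G (r *\<^sub>R x) = r *\<^sub>R G x" for r x
      by (rule ell2_eqI) (simp add: G)
  qed
  then show ?thesis using G[of v] by (simp add: ins_def G_def[abs_def] bounded_linear_Blinfun_apply)
qed

lemma norm_ins [simp]: "norm (ins k v) = norm v"
proof -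
  have "(norm (ins k v))\<^sup>2 = (\<Sum>i\<in>{k}. (norm (coord (ins k v) i))\<^sup>2)"
    by (rule norm_ell2_finite) auto
  then show ?thesis by (simp add: power2_eq_iff_nonneg)
qed

lemma cinner_ins_right: "cinner x (ins k v) = cinner (coord x k) v"
proof -
  have "cinner x (ins k v) = (\<Sum>i\<in>{k}. cinner (coord x i) (coord (ins k v) i))"
    unfolding cinner_ell2.rep_eq by (rule suminf_finite) (auto simp: cinner.zero_right)
  then show ?thesis by simp
qed

lemma adj_prj_ins: "adj (prj k) (ins k)"
  by (simp add: adj_def cinner_ins_right)

lemma coord_sum: "coord (\<Sum>a\<in>F. f a) k = (\<Sum>a\<in>F. coord (f a) k)"
  by (induction F rule: infinite_finite_induct) auto

lemma ins_partial_sums: "(\<lambda>n. \<Sum>k<n. ins k (coord x k)) \<longlonglongrightarrow> x"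
proof -
  define s where "s n = (\<Sum>k<n. ins k (coord x k))" for n
  have c: "coord (s n) i = (if i < n then coord x i else 0)" for n i
    by (simp add: s_def coord_sum)
  have eq: "(norm (x - s n))\<^sup>2 = (\<Sum>k. (norm (coord x (k + n)))\<^sup>2)" for n
  proof -
    have "(norm (x - s n))\<^sup>2 = (\<Sum>k. (norm (coord (x - s n) (k + n)))\<^sup>2)
        + (\<Sum>k<n. (norm (coord (x - s n) k))\<^sup>2)"
      unfolding norm_ell2_sq[of "x - s n"]
      by (rule suminf_split_initial_segment[OF summable_coord[of "x - s n"]])
    moreover have "(\<Sum>k<n. (norm (coord (x - s n) k))\<^sup>2) = 0"
      by (rule sum.neutral) (simp add: c)
    moreover have "coord (x - s n) (k + n) = coord x (k + n)" for k by (simp add: c)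
    ultimately show ?thesis by (simp only: add_0_right)
  qed
  have "(\<lambda>n. (norm (x - s n))\<^sup>2) \<longlonglongrightarrow> 0"
    unfolding eq by (rule suminf_exist_split2[OF summable_coord])
  then have "(\<lambda>n. sqrt ((norm (x - s n))\<^sup>2)) \<longlonglongrightarrow> sqrt 0" by (rule tendsto_real_sqrt)
  then have "(\<lambda>n. norm (s n - x)) \<longlonglongrightarrow> 0" by (simp add: norm_minus_commute)
  then show ?thesis
    unfolding s_def[symmetric] by (rule LIM_zero_cancel[OF tendsto_norm_zero_cancel])
qed

text \<open>Density of the finitely supported vectors cast as an induction principle, so that
  identities and limits need checking on basis vectors only.\<close>

lemma ell2_dense_induct:
  assumes "closed M" "0 \<in> M" "\<And>x y. x \<in> M \<Longrightarrow> y \<in> M \<Longrightarrow> x + y \<in> M" "\<And>k v. ins k v \<in> M"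
  shows "x \<in> M"
proof -
  have "(\<Sum>k<n. ins k (coord x k)) \<in> M" for n
    by (induction n) (auto intro: assms)
  then show ?thesis by (rule closed_sequentially[OF assms(1) _ ins_partial_sums])
qed

definition ket :: "nat \<Rightarrow> l2" where "ket r = ins r 1"

lemma coord_ket [simp]: "coord (ket r) k = (if k = r then 1 else 0)"
  by (simp add: ket_def)

lemma norm_ket [simp]: "norm (ket r) = 1"
  by (simp add: ket_def)

lemma ins_ket: "ins r c = c *\<^sub>C ket r"
  by (rule ell2_eqI) (simp add: scaleC_complex_def)

lemma cinner_ket: "cinner x (ket r) = coord x r"
  by (simp add: ket_def cinner_ins_right cinner_complex_def)

lemma cinner_ket_left: "cinner (ket r) x = cnj (coord x r)"
  by (subst cinner_commute) (simp add: cinner_ket)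

definition E :: "nat \<Rightarrow> nat \<Rightarrow> l2 ell2" where "E i m = ins i (ket m)"

lemma coord_E [simp]: "coord (coord (E i m) j) k = (if j = i \<and> k = m then 1 else 0)"
  by (simp add: E_def)

lemma norm_E [simp]: "norm (E i m) = 1"
  by (simp add: E_def)

lemma l2_dense_induct:
  assumes "closed M" "0 \<in> M" "\<And>x y. x \<in> M \<Longrightarrow> y \<in> M \<Longrightarrow> x + y \<in> M" "\<And>c k. c *\<^sub>C ket k \<in> M"
  shows "(x :: l2) \<in> M"
  by (rule ell2_dense_induct) (auto simp: assms ins_ket)

lemma K_dense_induct:
  assumes M: "closed M" "0 \<in> M" "\<And>x y. x \<in> M \<Longrightarrow> y \<in> M \<Longrightarrow> x + y \<in> M"
    and E: "\<And>c i m. c *\<^sub>C E i m \<in> M"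
  shows "(x :: l2 ell2) \<in> M"
proof (rule ell2_dense_induct[OF M])
  fix k and v :: l2
  have "v \<in> {v. ins k v \<in> M}"
  proof (rule l2_dense_induct)
    show "closed {v. ins k v \<in> M}"
      using continuous_closed_vimage[OF M(1), of "blinfun_apply (ins k)"]
      by (simp add: vimage_def linear_continuous_at blinfun.bounded_linear_right)
    show "c *\<^sub>C ket m \<in> {v. ins k v \<in> M}" for c m
    proof -
      have "ins k (c *\<^sub>C ket m) = c *\<^sub>C E k m" by (rule ell2_eqI) (simp add: E_def)
      then show ?thesis using E by simp
    qed
  qed (auto simp: M blinfun.add_right)
  then show "ins k v \<in> M" by simp
qed

text \<open>The adjoint vector is written down by coordinates instead of by a representation
  theorem: its k-th entry has to be the conjugate of the inner product of \<open>T (ket k)\<close>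
  with y.\<close>

lemma cops_adj_cadjoint:
  fixes T :: l2_op
  assumes "T \<in> cops"
  shows "adj T (cadjoint T)"
proof -
  have ex: "\<exists>z. (\<forall>x. cinner (T x) y = cinner x z) \<and> norm z \<le> norm T * norm y" for y
  proof -
    define a where "a k = cnj (cinner (T (ket k)) y)" for k
    have S: "T (\<Sum>k<n. c k *\<^sub>C ket k) = (\<Sum>k<n. c k *\<^sub>C T (ket k))" for c and n :: nat
      by (simp add: blinfun.sum_right copsD[OF assms])
    have B: "(\<Sum>k<n. (norm (a k))\<^sup>2) \<le> (norm T * norm y)\<^sup>2" for n
    proof -
      define s where "s = (\<Sum>k<n. (norm (a k))\<^sup>2)"
      \<comment> \<open>Testing \<open>T\<close> on the truncated candidate itself gives (norm v)^2
        <= norm T * norm y * norm v, hence square summability together with the right norm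
        bound.\<close>
      define v where "v = (\<Sum>k<n. a k *\<^sub>C ket k)"
      have s0: "0 \<le> s" by (simp add: s_def sum_nonneg)
      have cv: "coord v k = (if k < n then a k else 0)" for k
        by (simp add: v_def coord_sum scaleC_complex_def if_distrib cong: if_cong)
      have v: "(norm v)\<^sup>2 = s"
        unfolding s_def by (subst norm_ell2_finite[of "{..<n}"]) (auto simp: cv)
      have "cinner (T v) y = (\<Sum>k<n. a k * cnj (a k))"
        by (simp add: v_def S cinner.sum_left cinner_scaleC_left a_def)
      also have "\<dots> = of_real s"
        unfolding s_def of_real_sum by (intro sum.cong refl) (rule complex_norm_square[symmetric])
      finally have "s = cmod (cinner (T v) y)" using s0 by simp
      also have "\<dots> \<le> norm (T v) * norm y" by (rule cinner_bound)
      also have "\<dots> \<le> norm T * norm v * norm y" by (intro mult_right_mono norm_blinfun) simp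
      finally have "s \<le> (norm T * norm y) * norm v" by (simp add: mult_ac)
      then have "norm v * norm v \<le> (norm T * norm y) * norm v"
        using v by (simp add: power2_eq_square)
      then have "norm v \<le> norm T * norm y"
        by (cases "norm v = 0") (auto simp: mult_le_cancel_right)
      then have "(norm v)\<^sup>2 \<le> (norm T * norm y)\<^sup>2" by (rule power_mono) simp
      then show ?thesis using v s_def by simp
    qed
    have s: "summable (\<lambda>k. (norm (a k))\<^sup>2)" by (rule summableI_nonneg_bounded[OF _ B]) simp
    define z where "z = Abs_ell2 a"
    have z: "coord z = a" unfolding z_def using s by (simp add: Abs_ell2_inverse)
    have "norm z \<le> norm T * norm y" by (rule norm_ell2_leI) (auto simp: z B)
    moreover have "x \<in> {x. cinner (T x) y = cinner x z}" for x
    proof (rule l2_dense_induct)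
      show "closed {x. cinner (T x) y = cinner x z}"
        by (intro closed_Collect_eq continuous_intros cinner.continuous_on blinfun.continuous_on)
      show "c *\<^sub>C ket k \<in> {x. cinner (T x) y = cinner x z}" for c k
        by (simp add: copsD[OF assms] cinner_scaleC_left cinner_ket_left z a_def)
    qed (auto simp: blinfun.add_right cinner.add_left)
    ultimately show ?thesis by blast
  qed
  then obtain G where G: "\<And>x y. cinner (T x) y = cinner x (G y)"
      and nG: "\<And>y. norm (G y) \<le> norm T * norm y" by metis
  have "bounded_linear G"
  proof (rule bounded_linear_intro)
    show "G (x + y) = G x + G y" for x y
      by (rule cinner_eqI) (simp add: G[symmetric] cinner.add_right)
    show "G (r *\<^sub>R x) = r *\<^sub>R G x" for r x
      by (rule cinner_eqI) (simp add: G[symmetric] cinner.scaleR_right)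
    show "norm (G x) \<le> norm x * norm T" for x using nG[of x] by (simp add: mult.commute)
  qed
  then have "adj T (Blinfun G)" by (simp add: adj_def G bounded_linear_Blinfun_apply)
  then show ?thesis by (metis cadjoint_eq)
qed


section \<open>Lower moduli and resolvents\<close>

text \<open>The lower modulus of \<open>T\<close> on \<open>H\<close>. For \<open>T\<close>
  invertible on \<open>H\<close> it is the reciprocal of the norm of the inverse; unlike that norm
  it also makes sense at spectral points and varies continuously through them.\<close>

definition nu :: "'a::real_normed_vector set \<Rightarrow> ('a \<Rightarrow>\<^sub>L 'b::real_normed_vector) \<Rightarrow> real" where
  "nu H T = (INF x\<in>{x \<in> H. norm x = 1}. norm (T x))"

lemma nu_le_norm:
  assumes "x \<in> H" "norm x = 1"
  shows "nu H T \<le> norm (T x)"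
  unfolding nu_def by (rule cINF_lower) (use assms in \<open>auto intro!: bdd_belowI2[of _ 0]\<close>)

lemma nu_bound:
  assumes "subspace H" "x \<in> H"
  shows "nu H T * norm x \<le> norm (T x)"
proof (cases "x = 0")
  case False
  have "nu H T \<le> norm (T ((1 / norm x) *\<^sub>R x))"
    by (rule nu_le_norm) (use assms False in \<open>auto simp: subspace_mul\<close>)
  then show ?thesis using False by (simp add: blinfun.scaleR_right field_simps)
qed simp

lemma nu_geI:
  assumes "\<exists>x\<in>H. norm x = 1" "\<And>x. x \<in> H \<Longrightarrow> norm x = 1 \<Longrightarrow> c \<le> norm (blinfun_apply T x)"
  shows "c \<le> nu H T"
  unfolding nu_def by (rule cINF_greatest) (use assms in auto)

lemma nu_approx:
  assumes "\<exists>x\<in>H. norm x = 1" "nu H T < b"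
  shows "\<exists>x\<in>H. norm x = 1 \<and> norm (T x) < b"
  using assms nu_geI[of H b T] by force

lemma nu_nonneg: "\<exists>x\<in>H. norm x = 1 \<Longrightarrow> 0 \<le> nu H T"
  by (rule nu_geI) auto

lemma nu_diff_le:
  assumes H: "\<exists>x\<in>H. norm x = 1"
  shows "nu H T' \<le> nu H T + norm (T' - T)"
proof -
  have "nu H T' - norm (T' - T) \<le> nu H T"
  proof (rule nu_geI[OF H])
    fix x assume x: "x \<in> H" "norm x = 1"
    have "norm (T' x - T x) \<le> norm (T' - T) * norm x"
      by (metis blinfun.diff_left norm_blinfun)
    then show "nu H T' - norm (T' - T) \<le> norm (T x)"
      using nu_le_norm[OF x, of T'] norm_triangle_ineq2[of "T' x" "T x"] x by simp
  qed
  then show ?thesis by simp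
qed

text \<open>The compressed algebra with unit \<open>Q\<close>. Matrix algebras arise from
  \<open>P k\<close> and the full operator algebra from the identity, so spectra and pseudospectra
  are computed once for both.\<close>

definition corner :: "('h::complex_inner \<Rightarrow>\<^sub>L 'h) \<Rightarrow> ('h \<Rightarrow>\<^sub>L 'h) cstar" where
  "corner Q = bop \<lparr>carrier := {T \<in> cops. Q o\<^sub>L T o\<^sub>L Q = T}, one := Q\<rparr>"

lemma mat_alg_corner: "mat_alg k = corner (P k)"
  by (simp add: mat_alg_def corner_def)

lemma bop_corner: "bop = corner id_blinfun"
proof -
  have "id_blinfun o\<^sub>L T o\<^sub>L id_blinfun = T" for T :: "'a \<Rightarrow>\<^sub>L 'a"
    by (rule blinfun_eqI) simp
  then show ?thesis by (simp add: corner_def bop_def)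
qed

lemma corner_simps [simp]:
  "carrier (corner Q) = {T \<in> cops. Q o\<^sub>L T o\<^sub>L Q = T}"
  "A \<otimes>\<^bsub>corner Q\<^esub> B = A o\<^sub>L B" "\<one>\<^bsub>corner Q\<^esub> = Q" "\<zero>\<^bsub>corner Q\<^esub> = 0"
  "A \<oplus>\<^bsub>corner Q\<^esub> B = A + B" "c \<odot>\<^bsub>corner Q\<^esub> A = cscale c A"
  "star (corner Q) = cadjoint" "nrm (corner Q) = norm"
  by (auto simp: corner_def bop_def)

locale hilbert_corner =
  fixes Q :: "'h::complex_inner \<Rightarrow>\<^sub>L 'h"
  assumes Q_cops: "Q \<in> cops" and Q_idem: "Q o\<^sub>L Q = Q" and Q_norm: "norm Q \<le> 1"
    and Q_nontrivial: "\<exists>x\<in>range Q. norm x = 1"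
begin

lemma Q_fix: "x \<in> range Q \<Longrightarrow> Q x = x"
  using Q_idem by (metis blinfun_apply_blinfun_compose imageE)

lemma Q_Q [simp]: "Q (Q x) = Q x"
  by (rule Q_fix) simp

lemma subspace_range_Q: "subspace (range Q)"
  by (rule linear_subspace_image[OF bounded_linear.linear[OF blinfun.bounded_linear_right] subspace_UNIV])

lemma corner_range: "T \<in> carrier (corner Q) \<Longrightarrow> T x \<in> range Q"
  by simp (metis blinfun_apply_blinfun_compose rangeI)

lemma corner_Q_left: "T \<in> carrier (corner Q) \<Longrightarrow> Q (T x) = T x"
  by (rule Q_fix) (rule corner_range)

lemma corner_Q_right:
  assumes "T \<in> carrier (corner Q)"
  shows "T (Q x) = T x"
proof -
  have T: "Q o\<^sub>L T o\<^sub>L Q = T" using assms by simp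
  have "T (Q x) = (Q o\<^sub>L T o\<^sub>L Q) (Q x)" by (simp only: T)
  also have "\<dots> = (Q o\<^sub>L T o\<^sub>L Q) x" by simp
  finally show ?thesis by (simp only: T)
qed

lemma Q_carrier: "Q \<in> carrier (corner Q)"
  by (simp add: Q_cops Q_idem)

lemma carrier_diff:
  assumes "A \<in> carrier (corner Q)" "B \<in> carrier (corner Q)"
  shows "A - B \<in> carrier (corner Q)"
proof -
  have "Q o\<^sub>L (A - B) o\<^sub>L Q = (Q o\<^sub>L A o\<^sub>L Q) - (Q o\<^sub>L B o\<^sub>L Q)"
    by (rule blinfun_eqI) (simp add: blinfun.diff_left blinfun.diff_right)
  then show ?thesis using assms by (simp add: cops_diff)
qed

lemma carrier_cscale:
  assumes "A \<in> carrier (corner Q)"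
  shows "cscale c A \<in> carrier (corner Q)"
proof -
  have "Q o\<^sub>L cscale c A o\<^sub>L Q = cscale c (Q o\<^sub>L A o\<^sub>L Q)"
    by (rule blinfun_eqI) (simp add: blinfun_apply_cscale copsD[OF Q_cops])
  then show ?thesis using assms by (simp add: cops_cscale)
qed

lemma corner_minus:
  assumes "B \<in> carrier (corner Q)"
  shows "A \<ominus>\<^bsub>corner Q\<^esub> B = A - B"
proof -
  have "\<ominus>\<^bsub>corner Q\<^esub> B = - B"
    unfolding a_inv_def m_inv_def
  proof (rule the_equality)
    have "cscale (- 1) B \<in> carrier (corner Q)" by (rule carrier_cscale[OF assms])
    then show "- B \<in> carrier (add_monoid (corner Q)) \<and>
        B \<otimes>\<^bsub>add_monoid (corner Q)\<^esub> - B = \<one>\<^bsub>add_monoid (corner Q)\<^esub> \<and>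
        - B \<otimes>\<^bsub>add_monoid (corner Q)\<^esub> B = \<one>\<^bsub>add_monoid (corner Q)\<^esub>"
      by (simp add: cscale_simps)
  qed (auto simp: eq_neg_iff_add_eq_0)
  then show ?thesis by (simp add: a_minus_def)
qed

lemma corner_shift:
  "B \<in> carrier (corner Q) \<Longrightarrow> B \<ominus>\<^bsub>corner Q\<^esub> z \<odot>\<^bsub>corner Q\<^esub> \<one>\<^bsub>corner Q\<^esub> = B - cscale z Q"
  using corner_minus[OF carrier_cscale[OF Q_carrier, of z]] by simp

text \<open>The inverse is a choice of preimages, inside \<open>range Q\<close>, of the vectors
  \<open>Q y\<close>. Being bounded below makes \<open>M\<close> injective there, so every algebraic
  law for the choice reduces to an equation between images under \<open>M\<close>.\<close>

lemma inverse_of_bounded_below: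
  assumes M: "M \<in> carrier (corner Q)" and pos: "0 < nu (range Q) M"
    and surj: "range Q \<subseteq> M ` range Q"
  shows "\<exists>C\<in>carrier (corner Q). C o\<^sub>L M = Q \<and> M o\<^sub>L C = Q \<and> norm C = 1 / nu (range Q) M"
proof -
  let ?n = "nu (range Q) M"
  have nb: "?n * norm x \<le> norm (M x)" if "x \<in> range Q" for x
    by (rule nu_bound[OF subspace_range_Q that])
  have inj: "x = y" if "x \<in> range Q" "y \<in> range Q" "M x = M y" for x y
  proof -
    have "x - y \<in> range Q" using that subspace_range_Q by (simp add: subspace_diff)
    from nb[OF this] that have "?n * norm (x - y) \<le> 0" by (simp add: blinfun.diff_right)
    then show ?thesis using pos by (simp add: mult_le_0_iff)
  qed
  have "\<exists>x\<in>range Q. M x = Q y" for y using surj by (metis imageE rangeI subsetD)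
  then obtain f where f: "\<And>y. f y \<in> range Q" "\<And>y. M (f y) = Q y" by metis
  have f_le: "?n * norm (f y) \<le> norm y" for y
  proof -
    have "norm (Q y) \<le> norm Q * norm y" by (rule norm_blinfun)
    also have "\<dots> \<le> 1 * norm y" by (rule mult_right_mono[OF Q_norm]) simp
    finally show ?thesis using nb[OF f(1)[of y]] by (simp add: f(2))
  qed
  have bl: "bounded_linear f"
  proof (rule bounded_linear_intro)
    show "f (x + y) = f x + f y" for x y
      by (rule inj) (simp_all add: f subspace_add[OF subspace_range_Q] blinfun.add_right)
    show "f (r *\<^sub>R x) = r *\<^sub>R f x" for r x
      by (rule inj) (simp_all add: f subspace_mul[OF subspace_range_Q] blinfun.scaleR_right)
    show "norm (f x) \<le> norm x * (1 / ?n)" for x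
      using f_le[of x] pos by (simp add: field_simps)
  qed
  define C where "C = Blinfun f"
  have C: "C y = f y" for y unfolding C_def by (simp add: bounded_linear_Blinfun_apply[OF bl])
  have M_cops: "M \<in> cops" using M by simp
  have range_C: "c *\<^sub>C x \<in> range Q" if "x \<in> range Q" for c x
    using Q_fix[OF that] copsD[OF Q_cops, of c x] by (metis rangeI)
  have "C \<in> cops"
  proof (rule copsI)
    fix c x
    show "C (c *\<^sub>C x) = c *\<^sub>C C x"
      unfolding C
      by (rule inj) (simp_all add: f range_C copsD[OF M_cops] copsD[OF Q_cops])
  qed
  moreover have "Q o\<^sub>L C o\<^sub>L Q = C"
  proof (rule blinfun_eqI)
    fix x
    have "f (Q x) = f x" by (rule inj) (simp_all add: f)
    then show "(Q o\<^sub>L C o\<^sub>L Q) x = C x" by (simp add: C Q_fix[OF f(1)])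
  qed
  moreover have MC: "M o\<^sub>L C = Q" by (rule blinfun_eqI) (simp add: C f)
  moreover have CM: "C o\<^sub>L M = Q"
  proof (rule blinfun_eqI)
    fix x
    have "f (M x) = Q x"
      by (rule inj) (simp_all add: f corner_Q_left[OF M] corner_Q_right[OF M])
    then show "(C o\<^sub>L M) x = Q x" by (simp add: C)
  qed
  moreover have "norm C = 1 / ?n"
  proof (rule antisym)
    show "norm C \<le> 1 / ?n"
      by (rule norm_blinfun_bound) (use f_le pos in \<open>auto simp: C field_simps\<close>)
    have Cpos: "0 < norm C"
    proof (rule ccontr)
      assume "\<not> 0 < norm C"
      then have "Q = 0" using MC by simp
      then show False using Q_nontrivial by auto
    qed
    have "1 / norm C \<le> ?n"
    proof (rule nu_geI[OF Q_nontrivial])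
      fix x assume x: "x \<in> range Q" "norm x = 1"
      have "C (M x) = x" using CM Q_fix[OF x(1)] by (metis blinfun_apply_blinfun_compose)
      then have "1 \<le> norm C * norm (M x)" using norm_blinfun[of C "M x"] x by simp
      then show "1 / norm C \<le> norm (M x)" using Cpos by (simp add: field_simps)
    qed
    then show "1 / ?n \<le> norm C" using pos Cpos by (simp add: field_simps)
  qed
  ultimately show ?thesis by auto
qed

text \<open>Surjectivity enters as a conditional premise because its sources differ:
  triangularisation for the matrices, a limiting argument for the operators on
  \<open>l2 ell2\<close>.\<close>

lemma Units_corner:
  assumes M: "M \<in> carrier (corner Q)"
    and surj: "0 < nu (range Q) M \<Longrightarrow> range Q \<subseteq> M ` range Q"
  shows "M \<in> Units (corner Q) \<longleftrightarrow> 0 < nu (range Q) M"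
    and "0 < nu (range Q) M \<Longrightarrow> norm (inv\<^bsub>corner Q\<^esub> M) = 1 / nu (range Q) M"
proof -
  show "M \<in> Units (corner Q) \<longleftrightarrow> 0 < nu (range Q) M"
  proof
    assume "M \<in> Units (corner Q)"
    then obtain C where C: "C o\<^sub>L M = Q" by (auto simp: Units_def)
    have "1 / (norm C + 1) \<le> nu (range Q) M"
    proof (rule nu_geI[OF Q_nontrivial])
      fix x assume x: "x \<in> range Q" "norm x = 1"
      have "C (M x) = x" using C Q_fix[OF x(1)] by (metis blinfun_apply_blinfun_compose)
      then have "1 \<le> norm C * norm (M x)" using norm_blinfun[of C "M x"] x by simp
      also have "\<dots> \<le> (norm C + 1) * norm (M x)" by (rule mult_right_mono) auto
      finally have "1 \<le> (norm C + 1) * norm (M x)" .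
      moreover have "0 < norm C + 1" by (simp add: add_nonneg_pos)
      ultimately show "1 / (norm C + 1) \<le> norm (M x)"
        by (simp add: divide_le_eq mult.commute)
    qed
    moreover have "0 < 1 / (norm C + 1)" by (simp add: add_nonneg_pos)
    ultimately show "0 < nu (range Q) M" by linarith
  next
    assume pos: "0 < nu (range Q) M"
    from inverse_of_bounded_below[OF M pos surj[OF pos]] M
    show "M \<in> Units (corner Q)" unfolding Units_def by auto
  qed
  assume pos: "0 < nu (range Q) M"
  obtain C where C: "C \<in> carrier (corner Q)" "C o\<^sub>L M = Q" "M o\<^sub>L C = Q"
      and nC: "norm C = 1 / nu (range Q) M"
    using inverse_of_bounded_below[OF M pos surj[OF pos]] by blast
  have "inv\<^bsub>corner Q\<^esub> M = C"
    unfolding m_inv_def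
  proof (rule the_equality)
    show "C \<in> carrier (corner Q) \<and> M \<otimes>\<^bsub>corner Q\<^esub> C = \<one>\<^bsub>corner Q\<^esub> \<and>
        C \<otimes>\<^bsub>corner Q\<^esub> M = \<one>\<^bsub>corner Q\<^esub>" using C by simp
    fix D assume D: "D \<in> carrier (corner Q) \<and> M \<otimes>\<^bsub>corner Q\<^esub> D = \<one>\<^bsub>corner Q\<^esub> \<and>
        D \<otimes>\<^bsub>corner Q\<^esub> M = \<one>\<^bsub>corner Q\<^esub>"
    show "D = C"
    proof (rule blinfun_eqI)
      fix x
      have "D x = D (Q x)" using corner_Q_right[of D x] D by simp
      also have "\<dots> = (D o\<^sub>L M) (C x)" using C(3) by (metis blinfun_apply_blinfun_compose)
      also have "\<dots> = C x" using D corner_Q_left[OF C(1)] by simp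
      finally show "D x = C x" .
    qed
  qed
  with nC show "norm (inv\<^bsub>corner Q\<^esub> M) = 1 / nu (range Q) M" by simp
qed

lemma cspectrum_corner:
  assumes B: "B \<in> carrier (corner Q)"
    and surj: "\<And>z. 0 < nu (range Q) (B - cscale z Q) \<Longrightarrow> range Q \<subseteq> (B - cscale z Q) ` range Q"
  shows "cspectrum (corner Q) B = {z. nu (range Q) (B - cscale z Q) = 0}"
proof -
  have M: "B - cscale z Q \<in> carrier (corner Q)" for z
    by (intro carrier_diff B carrier_cscale Q_carrier)
  show ?thesis
    unfolding cspectrum_def corner_shift[OF B]
    using Units_corner(1)[OF M surj] nu_nonneg[OF Q_nontrivial]
    by (auto simp: order_less_le)
qed

lemma pseudospectrum_corner:
  assumes B: "B \<in> carrier (corner Q)"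
    and surj: "\<And>z. 0 < nu (range Q) (B - cscale z Q) \<Longrightarrow> range Q \<subseteq> (B - cscale z Q) ` range Q"
    and \<epsilon>: "0 < \<epsilon>"
  shows "pseudospectrum (corner Q) \<epsilon> B = {z. nu (range Q) (B - cscale z Q) \<le> \<epsilon>}"
proof -
  have M: "B - cscale z Q \<in> carrier (corner Q)" for z
    by (intro carrier_diff B carrier_cscale Q_carrier)
  have "(B - cscale z Q \<notin> Units (corner Q) \<or>
        nrm (corner Q) (inv\<^bsub>corner Q\<^esub> (B - cscale z Q)) \<ge> 1 / \<epsilon>) \<longleftrightarrow>
      nu (range Q) (B - cscale z Q) \<le> \<epsilon>" for z
  proof (cases "0 < nu (range Q) (B - cscale z Q)")
    case True
    have "B - cscale z Q \<in> Units (corner Q)"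
      using Units_corner(1)[OF M surj, of z] True by blast
    moreover have "norm (inv\<^bsub>corner Q\<^esub> (B - cscale z Q)) = 1 / nu (range Q) (B - cscale z Q)"
      by (rule Units_corner(2)[OF M surj True])
    moreover have "1 / \<epsilon> \<le> 1 / n \<longleftrightarrow> n \<le> \<epsilon>" if "0 < n" for n
      using \<epsilon> that by (simp add: field_simps)
    ultimately show ?thesis using True by simp
  next
    case False
    then have "B - cscale z Q \<notin> Units (corner Q)"
      using Units_corner(1)[OF M surj, of z] by blast
    with False \<epsilon> show ?thesis by simp
  qed
  then show ?thesis unfolding pseudospectrum_def corner_shift[OF B] by blast
qed

end

text \<open>Summing over the three cube roots of \<open>r\<^sup>3\<close> makes all cross terms cancel.\<close>

lemma cube_root_average:
  fixes a b c :: "'h::complex_inner" and r :: real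
  defines "w \<equiv> \<lambda>k. complex_of_real r * cis (2 * pi / 3) ^ k"
  shows "(\<Sum>k<3. (norm (a + w k *\<^sub>C b + (w k)\<^sup>2 *\<^sub>C c))\<^sup>2)
      = 3 * ((norm a)\<^sup>2 + r\<^sup>2 * (norm b)\<^sup>2 + r ^ 4 * (norm c)\<^sup>2)"
    and "(w k) ^ 3 = complex_of_real (r ^ 3)"
    and "cmod (w k) = \<bar>r\<bar>"
proof -
  define \<omega> where "\<omega> = cis (2 * pi / 3)"
  have c3: "\<omega> ^ 3 = 1" unfolding \<omega>_def Complex.DeMoivre by simp
  have n1: "\<omega> \<noteq> 1"
  proof -
    have "cos (2 * pi / 3) \<noteq> 1" by (simp add: cos_120)
    then show ?thesis unfolding \<omega>_def by (metis cis.simps(1) one_complex.simps(1))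
  qed
  have "(\<omega> - 1) * (1 + \<omega> + \<omega>\<^sup>2) = 0" using c3 by (simp add: algebra_simps power2_eq_square power3_eq_cube)
  then have z: "1 + \<omega> + \<omega>\<^sup>2 = 0" using n1 by simp
  have "\<omega> * cnj \<omega> = 1" unfolding \<omega>_def by (simp add: cis_cnj cis_mult)
  moreover have "\<omega> * \<omega>\<^sup>2 = 1" using c3 by (simp add: power2_eq_square power3_eq_cube mult.assoc)
  moreover have "\<omega> \<noteq> 0" unfolding \<omega>_def by simp
  ultimately have cj: "cnj \<omega> = \<omega>\<^sup>2" by (metis mult_left_cancel)
  show "(w k) ^ 3 = complex_of_real (r ^ 3)"
    unfolding w_def \<omega>_def[symmetric] power_mult_distrib
    by (simp add: c3 flip: power_mult) (metis c3 mult.commute mult.right_neutral power_mult power_one)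
  show "cmod (w k) = \<bar>r\<bar>" unfolding w_def by (simp add: norm_mult norm_power)
  have ex: "cinner (a + u *\<^sub>C b + v *\<^sub>C c) (a + u *\<^sub>C b + v *\<^sub>C c) =
      cinner a a + u * cnj u * cinner b b + v * cnj v * cinner c c
      + cnj u * cinner a b + u * cinner b a + cnj v * cinner a c + v * cinner c a
      + u * cnj v * cinner b c + v * cnj u * cinner c b" for u v
    by (simp add: cinner_add_left cinner_add_right cinner_scaleC_left cinner_scaleC_right algebra_simps)
  have "(\<Sum>k<3. cinner (a + w k *\<^sub>C b + (w k)\<^sup>2 *\<^sub>C c) (a + w k *\<^sub>C b + (w k)\<^sup>2 *\<^sub>C c))
      = 3 * (cinner a a + of_real (r\<^sup>2) * cinner b b + of_real (r ^ 4) * cinner c c)"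
  proof -
    have s3: "(\<Sum>k<3. f k) = f 0 + f 1 + f 2" for f :: "nat \<Rightarrow> complex"
      by (simp add: numeral_3_eq_3 numeral_2_eq_2)
    have w: "w 0 = of_real r" "w 1 = of_real r * \<omega>" "w 2 = of_real r * \<omega>\<^sup>2"
      by (simp_all add: w_def \<omega>_def)
    define \<rho> where "\<rho> = complex_of_real r"
    have r: "complex_of_real r = \<rho>" "cnj \<rho> = \<rho>" by (simp_all add: \<rho>_def)
    have o2: "\<omega>\<^sup>2 = - 1 - \<omega>" using z by (simp add: add_eq_0_iff algebra_simps) 
    have o2': "\<omega> * \<omega> = - 1 - \<omega>" using o2 by (simp add: power2_eq_square)
    have cj': "cnj \<omega> = - 1 - \<omega>" using cj o2 by simp
    \<comment> \<open>The three expanded squares, with the square of the root already replaced by -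
      1 - \<omega>. For each of \<open>p4\<close> to \<open>p9\<close> the three coefficients are
      proportional to the three cube roots of unity and add up to zero.\<close>
    have poly: "(p1 + \<rho> * \<rho> * p2 + \<rho>\<^sup>2 * \<rho>\<^sup>2 * p3 + \<rho> * p4 + \<rho> * p5 + \<rho>\<^sup>2 * p6 + \<rho>\<^sup>2 * p7
        + \<rho> * \<rho>\<^sup>2 * p8 + \<rho>\<^sup>2 * \<rho> * p9)
      + (p1 + \<rho> * \<omega> * (\<rho> * (- 1 - \<omega>)) * p2 + (\<rho> * \<omega>)\<^sup>2 * (\<rho> * (- 1 - \<omega>))\<^sup>2 * p3
        + \<rho> * (- 1 - \<omega>) * p4 + \<rho> * \<omega> * p5 + (\<rho> * (- 1 - \<omega>))\<^sup>2 * p6 + (\<rho> * \<omega>)\<^sup>2 * p7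
        + \<rho> * \<omega> * (\<rho> * (- 1 - \<omega>))\<^sup>2 * p8 + (\<rho> * \<omega>)\<^sup>2 * (\<rho> * (- 1 - \<omega>)) * p9)
      + (p1 + \<rho> * (- 1 - \<omega>) * (\<rho> * (- 1 - (- 1 - \<omega>))) * p2
        + (\<rho> * (- 1 - \<omega>))\<^sup>2 * (\<rho> * (- 1 - (- 1 - \<omega>)))\<^sup>2 * p3
        + \<rho> * (- 1 - (- 1 - \<omega>)) * p4 + \<rho> * (- 1 - \<omega>) * p5 + (\<rho> * (- 1 - (- 1 - \<omega>)))\<^sup>2 * p6
        + (\<rho> * (- 1 - \<omega>))\<^sup>2 * p7 + \<rho> * (- 1 - \<omega>) * (\<rho> * (- 1 - (- 1 - \<omega>)))\<^sup>2 * p8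
        + (\<rho> * (- 1 - \<omega>))\<^sup>2 * (\<rho> * (- 1 - (- 1 - \<omega>))) * p9)
      = 3 * (p1 + \<rho>\<^sup>2 * p2 + \<rho> ^ 4 * p3)" for p1 p2 p3 p4 p5 p6 p7 p8 p9 :: complex
    proof -
      define k where "k = - 1 - \<omega>"
      have o: "- 1 - \<omega> = k" "- 1 - k = \<omega>" by (simp_all add: k_def)
      have ok: "\<omega> * \<omega> = k" "\<omega> * k = 1" "k * k = \<omega>"
        by (simp_all add: k_def o2' algebra_simps)
      have t: "x * \<omega> * (y * k) = x * y" "x * k * (y * \<omega>) = x * y"
        "x * \<omega> * (y * \<omega>) = x * y * k" "x * k * (y * k) = x * y * \<omega>" for x y :: complex
      proof -
        have "x * \<omega> * (y * k) = x * y * (\<omega> * k)" "x * k * (y * \<omega>) = x * y * (\<omega> * k)"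
          "x * \<omega> * (y * \<omega>) = x * y * (\<omega> * \<omega>)" "x * k * (y * k) = x * y * (k * k)"
          by (simp_all only: mult_ac)
        then show "x * \<omega> * (y * k) = x * y" "x * k * (y * \<omega>) = x * y"
          "x * \<omega> * (y * \<omega>) = x * y * k" "x * k * (y * k) = x * y * \<omega>"
          by (simp_all only: ok mult_1_right)
      qed
      show ?thesis
        unfolding o power2_eq_square t by (simp add: k_def algebra_simps eval_nat_numeral)
    qed
    show ?thesis
      unfolding s3 ex w
      unfolding of_real_power r complex_cnj_mult complex_cnj_power cj' o2
        complex_cnj_diff complex_cnj_minus complex_cnj_one
      by (rule poly)
  qed
  then have "complex_of_real (\<Sum>k<3. (norm (a + w k *\<^sub>C b + (w k)\<^sup>2 *\<^sub>C c))\<^sup>2)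
      = complex_of_real (3 * ((norm a)\<^sup>2 + r\<^sup>2 * (norm b)\<^sup>2 + r ^ 4 * (norm c)\<^sup>2))"
    by (simp add: cinner_norm)
  then show "(\<Sum>k<3. (norm (a + w k *\<^sub>C b + (w k)\<^sup>2 *\<^sub>C c))\<^sup>2)
      = 3 * ((norm a)\<^sup>2 + r\<^sup>2 * (norm b)\<^sup>2 + r ^ 4 * (norm c)\<^sup>2)"
    using of_real_eq_iff by blast
qed

text \<open>The norm of the resolvent of a Hilbert space operator has no local maximum.\<close>

lemma nu_no_local_min:
  fixes T :: "'h::complex_inner \<Rightarrow>\<^sub>L 'h"
  assumes T: "T \<in> cops" and unit: "\<exists>x\<in>UNIV::'h set. norm x = 1"
    and pos: "0 < nu UNIV (T - cscale z id_blinfun)"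
    and surj: "\<And>y. \<exists>x. (T - cscale z id_blinfun) x = y"
    and \<eta>: "0 < \<eta>"
  shows "\<exists>z'. cmod (z' - z) < \<eta> \<and> nu UNIV (T - cscale z' id_blinfun) < nu UNIV (T - cscale z id_blinfun)"
proof (rule ccontr)
  define C where "C = T - cscale z id_blinfun"
  define \<epsilon> where "\<epsilon> = nu UNIV C"
  have \<epsilon>: "0 < \<epsilon>" using pos by (simp add: \<epsilon>_def C_def)
  assume "\<nexists>z'. cmod (z' - z) < \<eta> \<and> nu UNIV (T - cscale z' id_blinfun) < nu UNIV (T - cscale z id_blinfun)"
  then have ge: "\<epsilon> \<le> nu UNIV (T - cscale z' id_blinfun)" if "cmod (z' - z) < \<eta>" for z'
    using that by (force simp: \<epsilon>_def C_def)
  have C_cops: "C \<in> cops" unfolding C_def by (intro cops_diff T cops_cscale cops_id)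
  have lower: "\<epsilon> * norm x \<le> norm (C x)" for x
    unfolding \<epsilon>_def by (rule nu_bound) auto
  have shift: "\<epsilon> * norm x \<le> norm (C x - w *\<^sub>C x)" if "cmod w < \<eta>" for w x
  proof -
    have "\<epsilon> * norm x \<le> nu UNIV (T - cscale (z + w) id_blinfun) * norm x"
      by (rule mult_right_mono[OF ge]) (use that in auto)
    also have "\<dots> \<le> norm ((T - cscale (z + w) id_blinfun) x)" by (rule nu_bound) auto
    also have "(T - cscale (z + w) id_blinfun) x = C x - w *\<^sub>C x"
      by (simp add: C_def blinfun.diff_left blinfun_apply_cscale scaleC_add_left)
    finally show ?thesis .
  qed
  define \<kappa> where "\<kappa> = norm C"
  have \<kappa>: "0 < \<kappa>"
  proof -
    obtain x :: 'h where "norm x = 1" using unit by auto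
    then have "\<epsilon> \<le> norm C" using lower[of x] norm_blinfun[of C x] by simp
    then show ?thesis using \<epsilon> unfolding \<kappa>_def by linarith
  qed
  \<comment> \<open>In \<open>D\<close> the summand 1 pays for the slack in the choice of u, and the
    summand \<open>1 / \<epsilon>\<^sup>2\<close> for the norm of y. Below the radius
    \<open>r0\<close> a gain of order r^2 exceeds a loss of order r^3.\<close>
  define D where "D = 1 + 1 / \<epsilon>\<^sup>2"
  have D: "0 < D" unfolding D_def by (simp add: add_pos_nonneg)
  define r0 where "r0 = \<epsilon>\<^sup>2 / (\<kappa>\<^sup>2 * (2 * \<epsilon> * D + D\<^sup>2))"
  have den: "0 < \<kappa>\<^sup>2 * (2 * \<epsilon> * D + D\<^sup>2)" using \<kappa> D \<epsilon> by (simp add: add_pos_pos)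
  have r0: "0 < r0" unfolding r0_def using den \<epsilon> by simp
  define r where "r = min (min 1 \<eta>) r0 / 2"
  have r: "0 < r" "r < 1" "r < \<eta>" "r < r0" using r0 \<eta> by (auto simp: r_def min_def)
  obtain u where u: "norm u = 1" "norm (C u) < \<epsilon> + r ^ 3"
    using nu_approx[OF unit, of C "\<epsilon> + r ^ 3"] r by (auto simp: \<epsilon>_def)
  \<comment> \<open>The vectors v and y continue the near-minimiser u backwards under
    \<open>C\<close>, so that C - w applied to u + w v + w^2 y telescopes to C u - w^3 y.\<close>
  obtain v where v: "C v = u" using surj unfolding C_def by blast
  obtain y where y: "C y = v" using surj unfolding C_def by blast
  define w where "w k = complex_of_real r * cis (2 * pi / 3) ^ k" for k :: nat
  have key: "\<epsilon>\<^sup>2 * (norm (u + w k *\<^sub>C v + (w k)\<^sup>2 *\<^sub>C y))\<^sup>2 \<le> (norm (C u - r ^ 3 *\<^sub>R y))\<^sup>2" for k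
  proof -
    let ?x = "u + w k *\<^sub>C v + (w k)\<^sup>2 *\<^sub>C y"
    have "C ?x - w k *\<^sub>C ?x = C u - (w k) ^ 3 *\<^sub>C y"
      by (simp add: blinfun.add_right copsD[OF C_cops] v y scaleC_add_right scaleC_scaleC
          power2_eq_square power3_eq_cube mult.assoc)
    also have "\<dots> = C u - r ^ 3 *\<^sub>R y"
      unfolding w_def cube_root_average(2) by (simp add: scaleR_scaleC)
    finally have "\<epsilon> * norm ?x \<le> norm (C u - r ^ 3 *\<^sub>R y)"
      using shift[of "w k" ?x] r cube_root_average(3)[of r k] by (simp add: w_def)
    then have "(\<epsilon> * norm ?x)\<^sup>2 \<le> (norm (C u - r ^ 3 *\<^sub>R y))\<^sup>2"
      by (rule power_mono) (use \<epsilon> in simp)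
    then show ?thesis by (simp add: power_mult_distrib)
  qed
  have "\<epsilon>\<^sup>2 * (\<Sum>k<3. (norm (u + w k *\<^sub>C v + (w k)\<^sup>2 *\<^sub>C y))\<^sup>2)
      \<le> (\<Sum>k<3::nat. (norm (C u - r ^ 3 *\<^sub>R y))\<^sup>2)"
    unfolding sum_distrib_left by (rule sum_mono) (rule key)
  then have "\<epsilon>\<^sup>2 * ((norm u)\<^sup>2 + r\<^sup>2 * (norm v)\<^sup>2 + r ^ 4 * (norm y)\<^sup>2) \<le> (norm (C u - r ^ 3 *\<^sub>R y))\<^sup>2"
    unfolding w_def cube_root_average(1) by (simp only: mult.left_commute[of _ 3]) simp
  moreover have "\<epsilon>\<^sup>2 * (1 + r\<^sup>2 / \<kappa>\<^sup>2) \<le> \<epsilon>\<^sup>2 * ((norm u)\<^sup>2 + r\<^sup>2 * (norm v)\<^sup>2 + r ^ 4 * (norm y)\<^sup>2)"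
  proof (rule mult_left_mono)
    \<comment> \<open>Here is the gain: v cannot be small, because \<open>C\<close> maps it to the
      unit vector u.\<close>
    have "1 \<le> \<kappa> * norm v" using norm_blinfun[of C v] v u by (simp add: \<kappa>_def)
    then have "1 / \<kappa> \<le> norm v" using \<kappa> by (simp add: field_simps)
    then have "(1 / \<kappa>)\<^sup>2 \<le> (norm v)\<^sup>2" by (rule power_mono) (use \<kappa> in simp)
    then have "r\<^sup>2 * (1 / \<kappa>)\<^sup>2 \<le> r\<^sup>2 * (norm v)\<^sup>2" by (rule mult_left_mono) simp
    then have "r\<^sup>2 / \<kappa>\<^sup>2 \<le> r\<^sup>2 * (norm v)\<^sup>2" by (simp add: power_divide)
    moreover have "0 \<le> r ^ 4 * (norm y)\<^sup>2" using r by simp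
    ultimately show "1 + r\<^sup>2 / \<kappa>\<^sup>2 \<le> (norm u)\<^sup>2 + r\<^sup>2 * (norm v)\<^sup>2 + r ^ 4 * (norm y)\<^sup>2"
      unfolding u(1) power_one by linarith
  qed simp
  moreover have "(norm (C u - r ^ 3 *\<^sub>R y))\<^sup>2 \<le> (\<epsilon> + r ^ 3 * D)\<^sup>2"
  proof (rule power_mono)
    have "\<epsilon> * norm v \<le> 1" using lower[of v] v u by simp
    moreover have "\<epsilon> * norm y \<le> norm v" using lower[of y] y by simp
    ultimately have "\<epsilon> * (\<epsilon> * norm y) \<le> 1" using \<epsilon> by (meson mult_left_mono order_trans less_imp_le)
    then have ny: "norm y \<le> 1 / \<epsilon>\<^sup>2" using \<epsilon> by (simp add: field_simps power2_eq_square)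
    have "norm (C u - r ^ 3 *\<^sub>R y) \<le> norm (C u) + r ^ 3 * norm y"
      using norm_triangle_ineq4[of "C u" "r ^ 3 *\<^sub>R y"] r by simp
    also have "\<dots> \<le> (\<epsilon> + r ^ 3) + r ^ 3 * (1 / \<epsilon>\<^sup>2)"
      using u ny r by (intro add_mono mult_left_mono) auto
    finally show "norm (C u - r ^ 3 *\<^sub>R y) \<le> \<epsilon> + r ^ 3 * D"
      by (simp add: D_def distrib_left)
  qed simp
  ultimately have "\<epsilon>\<^sup>2 * (1 + r\<^sup>2 / \<kappa>\<^sup>2) \<le> (\<epsilon> + r ^ 3 * D)\<^sup>2" by linarith
  then have "\<epsilon>\<^sup>2 * (r\<^sup>2 / \<kappa>\<^sup>2) \<le> 2 * \<epsilon> * (r ^ 3 * D) + (r ^ 3 * D)\<^sup>2"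
    by (simp add: power2_sum distrib_left)
  also have "\<dots> = r ^ 3 * (2 * \<epsilon> * D + r ^ 3 * D\<^sup>2)"
    by (simp add: power_mult_distrib algebra_simps power2_eq_square power3_eq_cube)
  also have "\<dots> \<le> r ^ 3 * (2 * \<epsilon> * D + 1 * D\<^sup>2)"
    using r by (intro mult_left_mono add_left_mono mult_right_mono) (auto simp: power_le_one)
  finally have "r\<^sup>2 * (\<epsilon>\<^sup>2 / \<kappa>\<^sup>2) \<le> r\<^sup>2 * (r * (2 * \<epsilon> * D + D\<^sup>2))"
    by (simp add: power2_eq_square power3_eq_cube mult_ac)
  then have "\<epsilon>\<^sup>2 / \<kappa>\<^sup>2 \<le> r * (2 * \<epsilon> * D + D\<^sup>2)"
    by (rule mult_left_le_imp_le) (use r in simp)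
  then have "r0 \<le> r" unfolding r0_def using den \<kappa> by (simp add: divide_le_eq mult_ac pos_divide_le_eq)
  with r show False by simp
qed

text \<open>The quadratic form of a self-adjoint operator is real, so the imaginary part of z cannot
  be cancelled on any unit vector.\<close>

lemma nu_selfadjoint_Im:
  fixes T :: "'h::complex_inner \<Rightarrow>\<^sub>L 'h"
  assumes T: "adj T T" and unit: "\<exists>x\<in>UNIV::'h set. norm x = 1"
  shows "\<bar>Im z\<bar> \<le> nu UNIV (T - cscale z id_blinfun)"
proof (rule nu_geI[OF unit])
  fix x :: 'h assume x: "norm x = 1"
  have "cinner (T x) x = cnj (cinner (T x) x)"
    using adjD[OF T, of x x] cinner_commute[of "T x" x] by simp
  then have 0: "Im (cinner (T x) x) = 0" by (metis complex_cnj_cancel_iff Reals_cnj_iff complex_is_Real_iff)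
  have "cinner ((T - cscale z id_blinfun) x) x = cinner (T x) x - z"
    using x by (simp add: blinfun.diff_left blinfun_apply_cscale cinner.diff_left cinner_scaleC_left cinner_norm)
  then have "\<bar>Im z\<bar> \<le> cmod (cinner ((T - cscale z id_blinfun) x) x)"
    using abs_Im_le_cmod[of "cinner (T x) x - z"] 0 by simp
  also have "\<dots> \<le> norm ((T - cscale z id_blinfun) x)"
    using cinner_bound[of "(T - cscale z id_blinfun) x" x] x by simp
  finally show "\<bar>Im z\<bar> \<le> norm ((T - cscale z id_blinfun) x)" .
qed

text \<open>\<open>B\<^sup>2 - \<delta>\<^sup>2\<close> is positive and has approximate null vectors for \<open>\<delta> = nu UNIV B\<close>, so one of its two
  factors is not bounded below.\<close>

lemma nu_selfadjoint_attained:
  fixes T :: "'h::complex_inner \<Rightarrow>\<^sub>L 'h" and t :: real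
  assumes T: "adj T T" and unit: "\<exists>x\<in>UNIV::'h set. norm x = 1"
  defines "\<delta> \<equiv> nu UNIV (T - cscale (of_real t) id_blinfun)"
  shows "nu UNIV (T - cscale (of_real (t + \<delta>)) id_blinfun) = 0
       \<or> nu UNIV (T - cscale (of_real (t - \<delta>)) id_blinfun) = 0"
proof (rule ccontr)
  define B where "B = T - cscale (of_real t) id_blinfun"
  have BB: "adj B B"
    using adj_diff[OF T adj_cscale[OF adj_id, of "of_real t"]] by (simp add: B_def)
  have \<delta>0: "0 \<le> \<delta>" unfolding \<delta>_def by (rule nu_nonneg[OF unit])
  define c1 where "c1 = nu UNIV (T - cscale (of_real (t + \<delta>)) id_blinfun)"
  define c2 where "c2 = nu UNIV (T - cscale (of_real (t - \<delta>)) id_blinfun)"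
  assume "\<not> ?thesis"
  then have c: "0 < c1" "0 < c2"
    using nu_nonneg[OF unit, of "T - cscale (of_real (t + \<delta>)) id_blinfun"]
      nu_nonneg[OF unit, of "T - cscale (of_real (t - \<delta>)) id_blinfun"]
    by (auto simp: c1_def c2_def)
  have sh: "(T - cscale (of_real (t + s)) id_blinfun) x = B x - s *\<^sub>R x" for s x
    by (simp add: B_def blinfun.diff_left blinfun_apply_cscale scaleC_add_left scaleR_scaleC)
  have low1: "c1 * norm x \<le> norm (B x - \<delta> *\<^sub>R x)" for x
    using nu_bound[of UNIV x "T - cscale (of_real (t + \<delta>)) id_blinfun"] by (simp add: c1_def sh del: of_real_add)
  have low2: "c2 * norm x \<le> norm (B x + \<delta> *\<^sub>R x)" for x
    using nu_bound[of UNIV x "T - cscale (of_real (t - \<delta>)) id_blinfun"] sh[of "- \<delta>" x] by (simp add: c2_def del: of_real_diff of_real_add)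
  define Q where "Q = (B o\<^sub>L B) - \<delta>\<^sup>2 *\<^sub>R id_blinfun"
  have Qx: "Q x = B (B x) - \<delta>\<^sup>2 *\<^sub>R x" for x
    by (simp add: Q_def blinfun.diff_left blinfun.scaleR_left)
  have fac: "Q x = B (B x + \<delta> *\<^sub>R x) - \<delta> *\<^sub>R (B x + \<delta> *\<^sub>R x)" for x
    by (simp add: Qx blinfun.add_right blinfun.scaleR_right scaleR_add_right power2_eq_square)
  have Qlow: "c1 * c2 * norm x \<le> norm (Q x)" for x
  proof -
    have "c1 * (c2 * norm x) \<le> c1 * norm (B x + \<delta> *\<^sub>R x)"
      using c low2[of x] by (intro mult_left_mono) auto
    also have "\<dots> \<le> norm (Q x)" unfolding fac by (rule low1)
    finally show ?thesis by (simp add: mult.assoc)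
  qed
  have q: "Re (cinner (Q x) x) = (norm (B x))\<^sup>2 - \<delta>\<^sup>2 * (norm x)\<^sup>2" for x
    using adjD[OF BB, of "B x" x]
    by (simp add: Qx cinner.diff_left cinner.scaleR_left Re_cinner_self)
  have q0: "0 \<le> Re (cinner (Q x) x)" for x
  proof -
    have "\<delta> * norm x \<le> norm (B x)" unfolding \<delta>_def B_def by (rule nu_bound) auto
    then have "(\<delta> * norm x)\<^sup>2 \<le> (norm (B x))\<^sup>2" by (rule power_mono) (simp add: \<delta>0)
    then show ?thesis unfolding q by (simp add: power_mult_distrib)
  qed
  have Qs: "cinner (Q x) y = cinner x (Q y)" for x y
    by (simp add: Qx cinner.diff_left cinner.diff_right cinner.scaleR_left cinner.scaleR_right adjD[OF BB])
  define M where "M = norm Q + 1"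
  have M: "0 < M" by (simp add: M_def add_nonneg_pos)
  \<comment> \<open>The Cauchy-Schwarz inequality for the positive form of \<open>Q\<close>,
    obtained by evaluating the form at x - Q x / M.\<close>
  have main: "(norm (Q x))\<^sup>2 \<le> M * Re (cinner (Q x) x)" for x
  proof -
    define y where "y = x - (1 / M) *\<^sub>R Q x"
    have "cinner (Q (Q x)) x = cinner (Q x) (Q x)" using Qs[of "Q x" x] by simp
    then have "Re (cinner (Q y) y) = Re (cinner (Q x) x) - (2 / M) * (norm (Q x))\<^sup>2
        + (1 / M\<^sup>2) * Re (cinner (Q (Q x)) (Q x))"
      by (simp add: y_def blinfun.diff_right blinfun.scaleR_right cinner.diff_left cinner.diff_right
          cinner.scaleR_left cinner.scaleR_right Re_cinner_self power2_eq_square field_simps)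
    moreover have "Re (cinner (Q (Q x)) (Q x)) \<le> M * (norm (Q x))\<^sup>2"
    proof -
      have "Re (cinner (Q (Q x)) (Q x)) \<le> norm (Q (Q x)) * norm (Q x)"
        by (meson complex_Re_le_cmod cinner_bound order_trans)
      also have "\<dots> \<le> (norm Q * norm (Q x)) * norm (Q x)" by (intro mult_right_mono norm_blinfun) simp
      also have "\<dots> \<le> M * (norm (Q x))\<^sup>2" by (simp add: M_def power2_eq_square distrib_right mult.assoc)
      finally show ?thesis .
    qed
    then have "(1 / M\<^sup>2) * Re (cinner (Q (Q x)) (Q x)) \<le> (1 / M\<^sup>2) * (M * (norm (Q x))\<^sup>2)"
      by (rule mult_left_mono) simp
    then have "(1 / M\<^sup>2) * Re (cinner (Q (Q x)) (Q x)) \<le> (1 / M) * (norm (Q x))\<^sup>2"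
      using M by (simp add: power2_eq_square)
    ultimately have "0 \<le> Re (cinner (Q x) x) - (1 / M) * (norm (Q x))\<^sup>2"
      using q0[of y] by (simp add: field_simps)
    then show ?thesis using M by (simp add: field_simps)
  qed
  \<comment> \<open>If both factors are bounded below, unit vectors have form value at least
    \<open>k\<close>; a unit vector with norm (B x) < b has form value at most k / 2.\<close>
  define k where "k = (c1 * c2)\<^sup>2 / M"
  have k: "0 < k" using c M by (simp add: k_def)
  define b where "b = sqrt (\<delta>\<^sup>2 + k / 2)"
  have b2: "b\<^sup>2 = \<delta>\<^sup>2 + k / 2" unfolding b_def using k by (simp add: add_nonneg_nonneg)
  have "\<delta> < b" unfolding b_def by (rule real_less_rsqrt) (use k in simp)
  then obtain x where x: "norm x = 1" "norm (B x) < b"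
    using nu_approx[OF unit, of B b] by (auto simp: \<delta>_def B_def)
  have "(norm (B x))\<^sup>2 \<le> b\<^sup>2" using x by (intro power_mono) auto
  then have "Re (cinner (Q x) x) \<le> k / 2" using q[of x] x b2 by simp
  moreover have "k \<le> Re (cinner (Q x) x)"
  proof -
    have "(c1 * c2)\<^sup>2 \<le> (norm (Q x))\<^sup>2" using Qlow[of x] x c by (intro power_mono) auto
    then show ?thesis using main[of x] M unfolding k_def by (simp add: field_simps)
  qed
  ultimately show False using k by simp
qed

text \<open>The equation T (T' v) = y is solved by Banach's fixed point theorem. The product of
  \<open>T\<close> and \<open>T'\<close> is positive, bounded below by c^2 and of norm at most M^2,
  so a step of size 1 / M^2 contracts by the factor sqrt (1 - c^2 / M^2). The summand
  \<open>c\<close> in \<open>M\<close> keeps the radicand nonnegative.\<close>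

lemma surj_if_adjoint_bounded_below:
  fixes T T' :: "'h::{complex_inner, banach} \<Rightarrow>\<^sub>L 'h"
  assumes TT': "adj T T'" and c: "0 < c" "\<And>x. c * norm x \<le> norm (T' x)"
  shows "\<exists>x. T x = y"
proof -
  define M where "M = norm T + c"
  have M: "0 < M" "c \<le> M" "norm T \<le> M" using c by (simp_all add: M_def add_nonneg_pos)
  define t where "t = 1 / M\<^sup>2"
  have t: "0 < t" using M by (simp add: t_def)
  define f where "f v = v + t *\<^sub>R (y - T (T' v))" for v
  define L where "L = sqrt (1 - c\<^sup>2 / M\<^sup>2)"
  have cM: "c\<^sup>2 / M\<^sup>2 \<le> 1" using M c by (simp add: power_mono)
  have L: "0 \<le> L" "L < 1" unfolding L_def using cM c M by (simp_all add: real_sqrt_lt_1_iff)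
  have con: "norm (d - t *\<^sub>R T (T' d)) \<le> L * norm d" for d
  proof -
    have eq: "Re (cinner d (T (T' d))) = (norm (T' d))\<^sup>2"
      using adjD[OF adj_sym[OF TT'], of d "T' d"] by (simp flip: Re_cinner_self)
    have "(norm (T (T' d)))\<^sup>2 \<le> (M * norm (T' d))\<^sup>2"
      by (intro power_mono order_trans[OF norm_blinfun] mult_right_mono M) auto
    then have "t\<^sup>2 * (norm (T (T' d)))\<^sup>2 \<le> t\<^sup>2 * (M * norm (T' d))\<^sup>2" by (rule mult_left_mono) simp
    also have "\<dots> = t * (norm (T' d))\<^sup>2"
      using M by (simp add: t_def power_mult_distrib power2_eq_square)
    finally have "(norm (d - t *\<^sub>R T (T' d)))\<^sup>2 \<le> (norm d)\<^sup>2 - t * (norm (T' d))\<^sup>2"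
      by (simp add: norm_diff_sq cinner.scaleR_right eq power_mult_distrib)
    also have "\<dots> \<le> (norm d)\<^sup>2 - t * (c * norm d)\<^sup>2"
      using c t by (intro diff_left_mono mult_left_mono power_mono) auto
    also have "\<dots> = (L * norm d)\<^sup>2"
      using cM by (simp add: L_def t_def power_mult_distrib algebra_simps)
    finally show ?thesis by (rule power2_le_imp_le) (simp add: L)
  qed
  have "dist (f v) (f w) \<le> L * dist v w" for v w
  proof -
    have "f v - f w = (v - w) - t *\<^sub>R T (T' (v - w))"
      by (simp add: f_def blinfun.diff_right algebra_simps)
    then show ?thesis using con[of "v - w"] by (simp add: dist_norm)
  qed
  then obtain x where "f x = x" using banach_fix_type[OF L, of f] by blast
  then have "T (T' x) = y" using t by (simp add: f_def)
  then show ?thesis by blast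
qed


section \<open>Schur triangularisation and approximate eigenvectors\<close>

definition csubspace :: "'h::complex_inner set \<Rightarrow> bool" where
  "csubspace H \<longleftrightarrow> 0 \<in> H \<and> (\<forall>x\<in>H. \<forall>y\<in>H. x + y \<in> H) \<and> (\<forall>c. \<forall>x\<in>H. c *\<^sub>C x \<in> H)"

lemma csubspace_sum: "csubspace H \<Longrightarrow> (\<And>i. i \<in> F \<Longrightarrow> f i \<in> H) \<Longrightarrow> sum f F \<in> H"
  by (induction F rule: infinite_finite_induct) (auto simp: csubspace_def)

lemma csubspace_diff:
  assumes "csubspace H" "x \<in> H" "y \<in> H"
  shows "x - y \<in> H"
proof -
  have "x - y = x + (-1) *\<^sub>C y" by (simp add: scaleC.minus_left)
  then show ?thesis using assms by (simp only: csubspace_def)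
qed

text \<open>Plain functions rather than bounded operators, because triangularisation compresses
  \<open>A\<close> again and again to smaller subspaces.\<close>

definition clin :: "('h::complex_inner \<Rightarrow> 'h) \<Rightarrow> bool" where
  "clin A \<longleftrightarrow> (\<forall>x y. A (x + y) = A x + A y) \<and> (\<forall>c x. A (c *\<^sub>C x) = c *\<^sub>C A x)"

lemma clin_zero: "clin A \<Longrightarrow> A 0 = 0"
  by (metis clin_def scaleC_zero_left)

lemma clin_sum: "clin A \<Longrightarrow> A (\<Sum>i\<in>F. c i *\<^sub>C x i) = (\<Sum>i\<in>F. c i *\<^sub>C A (x i))"
  by (induction F rule: infinite_finite_induct) (auto simp: clin_zero clin_def)

definition peval :: "complex poly \<Rightarrow> ('h::complex_inner \<Rightarrow> 'h) \<Rightarrow> 'h \<Rightarrow> 'h" where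
  "peval p A x = (\<Sum>i\<le>degree p. coeff p i *\<^sub>C (A ^^ i) x)"

lemma peval_bound: "degree p \<le> n \<Longrightarrow> peval p A x = (\<Sum>i\<le>n. coeff p i *\<^sub>C (A ^^ i) x)"
  unfolding peval_def by (rule sum.mono_neutral_left) (auto simp: coeff_eq_0 not_le)

lemma peval_linear_factor:
  assumes "clin A"
  shows "peval ([:- z, 1:] * q) A x = A (peval q A x) - z *\<^sub>C peval q A x"
proof -
  let ?n = "degree q"
  have d: "degree ([:- z, 1:] * q) \<le> Suc ?n"
    by (rule order_trans[OF degree_mult_le]) simp
  have c: "coeff ([:- z, 1:] * q) i = (case i of 0 \<Rightarrow> 0 | Suc j \<Rightarrow> coeff q j) - z * coeff q i" for i
    by (simp add: coeff_pCons split: nat.split)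
  have "peval ([:- z, 1:] * q) A x =
      (\<Sum>i\<le>Suc ?n. (case i of 0 \<Rightarrow> 0 | Suc j \<Rightarrow> coeff q j) *\<^sub>C (A ^^ i) x)
      - (\<Sum>i\<le>Suc ?n. (z * coeff q i) *\<^sub>C (A ^^ i) x)"
    unfolding peval_bound[OF d] c by (simp only: scaleC.diff_left sum_subtractf)
  also have "(\<Sum>i\<le>Suc ?n. (case i of 0 \<Rightarrow> 0 | Suc j \<Rightarrow> coeff q j) *\<^sub>C (A ^^ i) x)
      = (\<Sum>j\<le>?n. coeff q j *\<^sub>C A ((A ^^ j) x))"
    by (subst sum.atMost_Suc_shift) simp
  also have "\<dots> = A (peval q A x)" unfolding peval_def clin_sum[OF assms] ..
  also have "(\<Sum>i\<le>Suc ?n. (z * coeff q i) *\<^sub>C (A ^^ i) x) = z *\<^sub>C peval q A x"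
    by (simp add: coeff_eq_0 peval_def scaleC.sum_right scaleC_scaleC)
  finally show ?thesis .
qed

text \<open>The vectors x, A x, A (A x), ... outnumber a spanning set, so a nonzero polynomial in
  \<open>A\<close> annihilates x. From one of least degree a root is split off: the cofactor applied
  to x is nonzero by minimality and is an eigenvector.\<close>

lemma exists_eigenvector:
  fixes H :: "'h::complex_inner set"
  assumes A: "clin A" "\<And>x. x \<in> H \<Longrightarrow> A x \<in> H" and H: "csubspace H"
    and fin: "finite B" "H \<subseteq> span B" and x: "x \<in> H" "x \<noteq> 0"
  shows "\<exists>\<mu>. \<exists>y\<in>H. y \<noteq> 0 \<and> A y = \<mu> *\<^sub>C y"
proof -
  let ?v = "\<lambda>i. (A ^^ i) x"
  let ?m = "card B"
  have vH: "?v i \<in> H" for i by (induction i) (auto simp: A x)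
  \<comment> \<open>A real dependence suffices and is what the real span provides. Coinciding
    iterates are treated apart, because \<open>dependent\<close> speaks about sets of vectors and
    not about families.\<close>
  have "\<exists>c::nat \<Rightarrow> real. (\<exists>i\<le>?m. c i \<noteq> 0) \<and> (\<Sum>i\<le>?m. c i *\<^sub>R ?v i) = 0"
  proof (cases "inj_on ?v {..?m}")
    case False
    then obtain i j where ij: "i \<le> ?m" "j \<le> ?m" "i \<noteq> j" "?v i = ?v j"
      by (auto simp: inj_on_def)
    define c where "c k = (if k = i then 1 else 0) - (if k = j then 1 else 0 :: real)" for k
    have "(\<Sum>k\<le>?m. c k *\<^sub>R ?v k) = (\<Sum>k\<le>?m. if k = i then ?v k else 0) - (\<Sum>k\<le>?m. if k = j then ?v k else 0)"
      unfolding sum_subtractf[symmetric] by (rule sum.cong) (auto simp: c_def)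
    also have "\<dots> = 0" using ij by simp
    finally show ?thesis using ij by (intro exI[of _ c]) (auto simp: c_def intro!: exI[of _ i])
  next
    case True
    have "dependent (?v ` {..?m})"
    proof (rule ccontr)
      assume "\<not> dependent (?v ` {..?m})"
      then have "card (?v ` {..?m}) \<le> card B"
        using independent_span_bound[OF fin(1), of "?v ` {..?m}"] vH fin(2) by blast
      then show False using True by (simp add: card_image)
    qed
    then obtain u where u: "\<exists>v\<in>?v ` {..?m}. u v \<noteq> 0" "(\<Sum>v\<in>?v ` {..?m}. u v *\<^sub>R v) = 0"
      by (auto simp: real_vector.dependent_finite)
    have "(\<Sum>i\<le>?m. u (?v i) *\<^sub>R ?v i) = 0"
      using u(2) unfolding sum.reindex[OF True] by (simp add: o_def)
    then show ?thesis using u(1) by (intro exI[of _ "\<lambda>i. u (?v i)"]) auto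
  qed
  then obtain c :: "nat \<Rightarrow> real" where c: "\<exists>i\<le>?m. c i \<noteq> 0" "(\<Sum>i\<le>?m. c i *\<^sub>R ?v i) = 0" by blast
  define p where "p = (\<Sum>i\<le>?m. monom (complex_of_real (c i)) i)"
  have cp: "coeff p i = (if i \<le> ?m then complex_of_real (c i) else 0)" for i
    by (simp add: p_def coeff_sum coeff_monom)
  have dp: "degree p \<le> ?m" by (rule degree_le) (simp add: cp)
  have "peval p A x = 0"
    unfolding peval_bound[OF dp] using c(2) by (simp add: cp scaleR_scaleC)
  moreover have "p \<noteq> 0" using c(1) cp by (metis coeff_0 of_real_eq_0_iff)
  ultimately have ex: "\<exists>p. p \<noteq> 0 \<and> peval p A x = 0" by blast
  obtain p where p: "p \<noteq> 0" "peval p A x = 0"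
      and min: "\<And>q. q \<noteq> 0 \<Longrightarrow> peval q A x = 0 \<Longrightarrow> degree p \<le> degree q"
    using ex ex_has_least_nat[of "\<lambda>p. p \<noteq> 0 \<and> peval p A x = 0" _ degree] by metis
  have "degree p \<noteq> 0"
  proof
    assume d: "degree p = 0"
    then have "coeff p 0 *\<^sub>C x = 0" using p(2) by (simp add: peval_def)
    then have "coeff p 0 = 0" using x(2) norm_scaleC[of "coeff p 0" x] by simp
    then show False using d p(1) by (metis leading_coeff_0_iff)
  qed
  then have "\<not> constant (poly p)" by (simp add: constant_degree)
  then obtain z where "poly p z = 0" using fundamental_theorem_of_algebra by blast
  then obtain q where q: "p = [:- z, 1:] * q" by (auto simp: poly_eq_0_iff_dvd dvd_def)
  have q0: "q \<noteq> 0" using p(1) q by auto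
  have "degree p = Suc (degree q)" unfolding q using q0 by (subst degree_mult_eq) auto
  then have "peval q A x \<noteq> 0" using min[OF q0] by auto
  moreover have "peval q A x \<in> H"
    unfolding peval_def by (rule csubspace_sum[OF H]) (use H vH in \<open>auto simp: csubspace_def\<close>)
  moreover have "A (peval q A x) = z *\<^sub>C peval q A x"
    using p(2) unfolding q peval_linear_factor[OF A(1)] by simp
  ultimately show ?thesis by blast
qed

section \<open>Orthonormal families and Schur bases\<close>

definition orthonormal :: "('i \<Rightarrow> 'h::complex_inner) \<Rightarrow> 'i set \<Rightarrow> bool" where
  "orthonormal u J \<longleftrightarrow> (\<forall>i\<in>J. \<forall>j\<in>J. cinner (u i) (u j) = (if i = j then 1 else 0))"

lemma orthonormal_norm:
  assumes "orthonormal u J" "i \<in> J"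
  shows "norm (u i) = 1"
proof -
  have "cinner (u i) (u i) = 1" using assms by (simp add: orthonormal_def)
  then have "complex_of_real ((norm (u i))\<^sup>2) = of_real 1" by (simp only: cinner_norm of_real_1)
  then have "(norm (u i))\<^sup>2 = 1" by (simp only: of_real_eq_iff)
  then show ?thesis using norm_ge_zero[of "u i"] by (auto simp: power2_eq_1_iff)
qed

lemma orthonormal_sum_sq:
  assumes u: "orthonormal u J" and J: "finite J"
  shows "(norm (\<Sum>j\<in>J. c j *\<^sub>C u j))\<^sup>2 = (\<Sum>j\<in>J. (cmod (c j))\<^sup>2)"
proof -
  have "cinner (\<Sum>j\<in>J. c j *\<^sub>C u j) (\<Sum>j\<in>J. c j *\<^sub>C u j)
      = (\<Sum>j\<in>J. cinner (c j *\<^sub>C u j) (\<Sum>j\<in>J. c j *\<^sub>C u j))"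
    by (rule cinner.sum_left)
  also have "\<dots> = (\<Sum>j\<in>J. \<Sum>i\<in>J. c j * (cnj (c i) * cinner (u j) (u i)))"
    by (simp add: cinner.sum_right cinner_scaleC_left cinner_scaleC_right sum_distrib_left mult_ac)
  also have "\<dots> = (\<Sum>j\<in>J. \<Sum>i\<in>J. if j = i then c j * cnj (c i) else 0)"
    by (intro sum.cong refl) (use u in \<open>auto simp: orthonormal_def\<close>)
  also have "\<dots> = (\<Sum>j\<in>J. of_real ((cmod (c j))\<^sup>2))"
    using J by (intro sum.cong refl) (simp add: complex_norm_square del: of_real_power)
  finally have "complex_of_real ((norm (\<Sum>j\<in>J. c j *\<^sub>C u j))\<^sup>2) = of_real (\<Sum>j\<in>J. (cmod (c j))\<^sup>2)"
    by (simp add: cinner_norm)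
  then show ?thesis using of_real_eq_iff by blast
qed

lemma bessel:
  assumes u: "orthonormal u J" and J: "finite J"
  shows "(\<Sum>j\<in>J. (cmod (cinner x (u j)))\<^sup>2) \<le> (norm x)\<^sup>2"
proof -
  let ?y = "\<Sum>j\<in>J. cinner x (u j) *\<^sub>C u j"
  have "cinner x ?y = (\<Sum>j\<in>J. cinner x (u j) * cnj (cinner x (u j)))"
    by (simp add: cinner.sum_right cinner_scaleC_right mult.commute)
  also have "\<dots> = (\<Sum>j\<in>J. of_real ((cmod (cinner x (u j)))\<^sup>2))"
    by (simp only: complex_norm_square)
  finally have "Re (cinner x ?y) = (\<Sum>j\<in>J. (cmod (cinner x (u j)))\<^sup>2)"
    by simp
  then have "(norm (x - ?y))\<^sup>2 = (norm x)\<^sup>2 - (\<Sum>j\<in>J. (cmod (cinner x (u j)))\<^sup>2)"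
    by (simp add: norm_diff_sq orthonormal_sum_sq[OF u J])
  then show ?thesis using zero_le_power2[of "norm (x - ?y)"] by linarith
qed

lemma bessel_right:
  assumes u: "orthonormal u J" and J: "finite J"
  shows "(\<Sum>j\<in>J. (cmod (cinner (u j) x))\<^sup>2) \<le> (norm x)\<^sup>2"
proof -
  have "cmod (cinner (u j) x) = cmod (cinner x (u j))" for j
    by (subst cinner_commute) simp
  then show ?thesis using bessel[OF u J, of x] by simp
qed

text \<open>Schur triangularisation: split off an eigenvector and compress to its orthogonal complement.\<close>

lemma schur_basis:
  fixes H :: "'h::complex_inner set"
  assumes "clin A" "\<And>x. x \<in> H \<Longrightarrow> A x \<in> H" "csubspace H"
    and "finite B" "H \<subseteq> span B"
    and "\<And>m u. orthonormal u {..<m::nat} \<Longrightarrow> u ` {..<m} \<subseteq> H \<Longrightarrow> m \<le> d"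
  shows "\<exists>m u. orthonormal u {..<m::nat} \<and> u ` {..<m} \<subseteq> H
      \<and> (\<forall>y\<in>H. y = (\<Sum>j<m. cinner y (u j) *\<^sub>C u j))
      \<and> (\<forall>j i. j < i \<longrightarrow> i < m \<longrightarrow> cinner (A (u j)) (u i) = 0)
      \<and> (\<forall>j<m. \<exists>x\<in>H. x \<noteq> 0 \<and> A x = cinner (A (u j)) (u j) *\<^sub>C x)"
  using assms
\<comment> \<open>The bound \<open>d\<close> on the length of orthonormal families in
  \<open>H\<close> plays the part of the dimension; splitting off the unit eigenvector lowers it by
  one.\<close>
proof (induction d arbitrary: A H)
  case 0
  have "y = 0" if y: "y \<in> H" for y
  proof (rule ccontr)
    assume y0: "y \<noteq> 0"
    have "orthonormal (\<lambda>_. complex_of_real (1 / norm y) *\<^sub>C y) {..<1::nat}"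
      using y0 by (auto simp: orthonormal_def cinner_scaleC_left cinner_scaleC_right cinner_norm norm_scaleC norm_divide power2_eq_square)
    moreover have "(\<lambda>_. complex_of_real (1 / norm y) *\<^sub>C y) ` {..<1::nat} \<subseteq> H"
      using "0.prems"(3) y by (auto simp: csubspace_def)
    ultimately have "(1::nat) \<le> 0" by (rule "0.prems"(6))
    then show False by simp
  qed
  then show ?case by (intro exI[of _ 0] exI[of _ "\<lambda>_. 0"]) (auto simp: orthonormal_def)
next
  case (Suc d)
  note A = Suc.prems(1,2) and H = Suc.prems(3)
  have A_add: "A (x + y) = A x + A y" and A_scale: "A (c *\<^sub>C x) = c *\<^sub>C A x" for x y c
    using A(1) by (auto simp: clin_def)
  show ?case
  proof (cases "H = {0}")
    case True
    then show ?thesis by (intro exI[of _ 0] exI[of _ "\<lambda>_. 0"]) (auto simp: orthonormal_def)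
  next
    case False
    then obtain x where "x \<in> H" "x \<noteq> 0" using H by (auto simp: csubspace_def)
    from exists_eigenvector[OF A H Suc.prems(4,5) this]
    obtain \<mu> y where y: "y \<in> H" "y \<noteq> 0" "A y = \<mu> *\<^sub>C y" by blast
    define v where "v = complex_of_real (1 / norm y) *\<^sub>C y"
    have v: "v \<in> H" "cinner v v = 1" "A v = \<mu> *\<^sub>C v"
      using y H by (auto simp: v_def csubspace_def A_scale scaleC_scaleC mult.commute
          cinner_scaleC_left cinner_scaleC_right cinner_norm norm_scaleC norm_divide power2_eq_square)
    have v0: "v \<noteq> 0" using v(2) by auto
    define H' where "H' = {x \<in> H. cinner x v = 0}"
    define A' where "A' x = A x - cinner (A x) v *\<^sub>C v" for x
    have A'_clin: "clin A'"
      by (auto simp: clin_def A'_def A_add A_scale cinner_add_left cinner_scaleC_left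
          scaleC_add_left scaleC.diff_right scaleC_scaleC)
    have A'_H: "A' x \<in> H'" if "x \<in> H'" for x
      using that A(2) H v
      by (auto simp: H'_def A'_def cinner.diff_left cinner_scaleC_left csubspace_def
          intro!: csubspace_diff[OF H])
    have H'_sub: "csubspace H'"
      using H by (auto simp: csubspace_def H'_def cinner_add_left cinner_scaleC_left)
    have H'_span: "H' \<subseteq> span B" using Suc.prems(5) by (auto simp: H'_def)
    have bound: "m \<le> d" if u: "orthonormal u {..<m::nat}" "u ` {..<m} \<subseteq> H'" for m u
    proof -
      define w where "w i = (case i of 0 \<Rightarrow> v | Suc j \<Rightarrow> u j)" for i
      have uv: "cinner (u j) v = 0" "cinner v (u j) = 0" if "j < m" for j
      proof -
        show "cinner (u j) v = 0" using that u(2) by (auto simp: H'_def)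
        then show "cinner v (u j) = 0" by (subst cinner_commute) simp
      qed
      have "orthonormal w {..<Suc m}"
        using u(1) uv v(2) unfolding orthonormal_def w_def by (auto split: nat.split)
      moreover have "w ` {..<Suc m} \<subseteq> H"
        using u(2) v(1) by (auto simp: w_def H'_def image_subset_iff split: nat.split)
      ultimately have "Suc m \<le> Suc d" by (rule Suc.prems(6))
      then show ?thesis by simp
    qed
    have "\<exists>m u. orthonormal u {..<m::nat} \<and> u ` {..<m} \<subseteq> H'
      \<and> (\<forall>y\<in>H'. y = (\<Sum>j<m. cinner y (u j) *\<^sub>C u j))
      \<and> (\<forall>j i. j < i \<longrightarrow> i < m \<longrightarrow> cinner (A' (u j)) (u i) = 0)
      \<and> (\<forall>j<m. \<exists>x\<in>H'. x \<noteq> 0 \<and> A' x = cinner (A' (u j)) (u j) *\<^sub>C x)"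
      by (rule Suc.IH[OF A'_clin _ H'_sub Suc.prems(4) H'_span]) (fact A'_H, fact bound)
    then obtain m u where u12: "orthonormal u {..<m::nat}" "u ` {..<m} \<subseteq> H'"
        and u3: "\<forall>y\<in>H'. y = (\<Sum>j<m. cinner y (u j) *\<^sub>C u j)"
        and u4: "\<forall>j i. j < i \<longrightarrow> i < m \<longrightarrow> cinner (A' (u j)) (u i) = 0"
        and u5: "\<forall>j<m. \<exists>x\<in>H'. x \<noteq> 0 \<and> A' x = cinner (A' (u j)) (u j) *\<^sub>C x"
      by (elim exE conjE) (rule that; assumption)
    note u = u12 u3[rule_format] u4[rule_format] u5[rule_format]
    define w where "w i = (case i of 0 \<Rightarrow> v | Suc j \<Rightarrow> u j)" for i
    have uv: "cinner (u j) v = 0" "cinner v (u j) = 0" if "j < m" for j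
    proof -
      show "cinner (u j) v = 0" using that u(2) by (auto simp: H'_def)
      then show "cinner v (u j) = 0" by (subst cinner_commute) simp
    qed
    have A'u: "cinner (A' x) (u i) = cinner (A x) (u i)" if "i < m" for x i
      using uv(2)[OF that] by (simp add: A'_def cinner.diff_left cinner_scaleC_left)
    have 1: "orthonormal w {..<Suc m}"
      using u(1) uv v(2) unfolding orthonormal_def w_def by (auto split: nat.split)
    have 2: "w ` {..<Suc m} \<subseteq> H"
      using u(2) v(1) by (auto simp: w_def H'_def image_subset_iff split: nat.split)
    have 3: "y = (\<Sum>j<Suc m. cinner y (w j) *\<^sub>C w j)" if y: "y \<in> H" for y
    proof -
      define y' where "y' = y - cinner y v *\<^sub>C v"
      have "y' \<in> H'"
        using y v H by (auto simp: H'_def y'_def cinner.diff_left cinner_scaleC_left csubspace_def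
            intro!: csubspace_diff[OF H])
      then have "y' = (\<Sum>j<m. cinner y' (u j) *\<^sub>C u j)" by (rule u(3))
      also have "\<dots> = (\<Sum>j<m. cinner y (u j) *\<^sub>C u j)"
        by (intro sum.cong refl) (simp add: y'_def cinner.diff_left cinner_scaleC_left uv)
      finally have "y = cinner y v *\<^sub>C v + (\<Sum>j<m. cinner y (u j) *\<^sub>C u j)"
        unfolding y'_def by (simp add: diff_eq_eq add.commute)
      also have "\<dots> = (\<Sum>j<Suc m. cinner y (w j) *\<^sub>C w j)"
        unfolding sum.lessThan_Suc_shift by (simp add: w_def)
      finally show ?thesis .
    qed
    have 4: "cinner (A (w j)) (w i) = 0" if "j < i" "i < Suc m" for i j
    proof (cases j)
      case 0
      with that show ?thesis
        by (cases i) (auto simp: w_def v(3) cinner_scaleC_left uv)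
    next
      case (Suc j')
      with that show ?thesis
        using u(4)[of j' "i - 1"] A'u[of "i - 1"] by (cases i) (auto simp: w_def)
    qed
    \<comment> \<open>An eigenvector x of the compression satisfies A x = \<zeta> x + s v. Adding s
      / (\<zeta> - \<mu>) times v corrects it to an eigenvector of \<open>A\<close>; if \<zeta> =
      \<mu>, the vector v itself serves.\<close>
    have 5: "\<exists>x\<in>H. x \<noteq> 0 \<and> A x = cinner (A (w j)) (w j) *\<^sub>C x" if j: "j < Suc m" for j
    proof (cases j)
      case 0
      then show ?thesis
        using v v0 by (intro bexI[of _ v]) (auto simp: w_def cinner_scaleC_left)
    next
      case (Suc i)
      then have i: "i < m" using j by simp
      define \<zeta> where "\<zeta> = cinner (A (u i)) (u i)"
      from u(5)[OF i] obtain x where x: "x \<in> H'" "x \<noteq> 0" "A' x = \<zeta> *\<^sub>C x"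
        by (auto simp: A'u[OF i] \<zeta>_def)
      define s where "s = cinner (A x) v"
      have Ax: "A x = \<zeta> *\<^sub>C x + s *\<^sub>C v" using x(3) by (simp add: A'_def s_def diff_eq_eq)
      have wj: "cinner (A (w j)) (w j) = \<zeta>" using Suc by (simp add: w_def \<zeta>_def)
      show ?thesis
      proof (cases "\<mu> = \<zeta>")
        case True
        then show ?thesis using v v0 by (intro bexI[of _ v]) (auto simp: wj)
      next
        case False
        define x' where "x' = x + (s / (\<zeta> - \<mu>)) *\<^sub>C v"
        have "x' \<in> H" using x v H by (auto simp: x'_def H'_def csubspace_def)
        moreover have "x' \<noteq> 0"
        proof
          assume "x' = 0"
          then have "cinner x' x = 0" by simp
          moreover have "cinner v x = 0" using x(1) by (subst cinner_commute) (simp add: H'_def)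
          ultimately have "cinner x x = 0" by (simp add: x'_def cinner_add_left cinner_scaleC_left)
          then show False using x(2) by (simp add: cinner_self_eq_0)
        qed
        moreover have "A x' = \<zeta> *\<^sub>C x'"
        proof -
          have "s + (s / (\<zeta> - \<mu>)) * \<mu> = \<zeta> * (s / (\<zeta> - \<mu>))"
            using False by (simp add: field_simps)
          then have "s *\<^sub>C v + (s / (\<zeta> - \<mu>)) *\<^sub>C \<mu> *\<^sub>C v = \<zeta> *\<^sub>C (s / (\<zeta> - \<mu>)) *\<^sub>C v"
            unfolding scaleC_scaleC scaleC_add_left[symmetric] by simp
          then show ?thesis
            by (simp add: x'_def A_add A_scale Ax v(3) scaleC_add_right add.assoc)
        qed
        ultimately show ?thesis unfolding wj by blast
      qed
    qed
    show ?thesis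
      by (intro exI[of _ "Suc m"] exI[of _ w] conjI ballI allI impI; fact 1 2 3 4 5)
  qed
qed

text \<open>Approximation of the limit set is asked for only one point at a time; a finite cover of
  the compact set \<open>K\<close> makes it uniform.\<close>

lemma hausdorff_tendstoI:
  assumes M: "\<And>n. M n \<noteq> {}" "\<And>n. compact (M n)" and K: "K \<noteq> {}" "compact K"
    and upper: "\<And>e. 0 < e \<Longrightarrow> \<forall>\<^sub>F n in sequentially. \<forall>m\<in>M n. \<exists>k\<in>K. dist m k \<le> e"
    and lower: "\<And>k e. k \<in> K \<Longrightarrow> 0 < e \<Longrightarrow> \<forall>\<^sub>F n in sequentially. \<exists>m\<in>M n. dist m k \<le> e"
  shows "hausdorff_tendsto M K"
proof -
  have lower': "\<forall>\<^sub>F n in sequentially. \<forall>k\<in>K. \<exists>m\<in>M n. dist m k \<le> e" if e: "0 < e" for e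
  proof -
    obtain F where F: "finite F" "F \<subseteq> K" "K \<subseteq> (\<Union>x\<in>F. ball x (e / 2))"
      by (rule compactE_image[OF K(2), of K "\<lambda>x. ball x (e / 2)"]) (use e in auto)
    have "\<forall>\<^sub>F n in sequentially. \<forall>k\<in>F. \<exists>m\<in>M n. dist m k \<le> e / 2"
      unfolding eventually_ball_finite_distrib[OF F(1)]
      by (intro ballI lower) (use F(2) e in auto)
    then show ?thesis
    proof eventually_elim
      case (elim n)
      show ?case
      proof
        fix k assume "k \<in> K"
        then obtain x where x: "x \<in> F" "dist x k < e / 2" using F(3) by auto
        with elim obtain m where m: "m \<in> M n" "dist m x \<le> e / 2" by blast
        have "dist m k \<le> dist m x + dist x k" by (rule dist_triangle)
        then show "\<exists>m\<in>M n. dist m k \<le> e" using m x by (intro bexI[of _ m]) auto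
      qed
    qed
  qed
  have "(\<lambda>n. hausdorff_dist (M n) K) \<longlonglongrightarrow> 0"
  proof (rule tendstoI)
    fix e :: real assume e: "0 < e"
    have "\<forall>\<^sub>F n in sequentially. (\<forall>m\<in>M n. \<exists>k\<in>K. dist m k \<le> e / 2) \<and> (\<forall>k\<in>K. \<exists>m\<in>M n. dist m k \<le> e / 2)"
      using upper[of "e / 2"] lower'[of "e / 2"] e by (simp add: eventually_conj)
    then show "\<forall>\<^sub>F n in sequentially. dist (hausdorff_dist (M n) K) 0 < e"
    proof eventually_elim
      case (elim n)
      have bd: "bdd_below (f ` X)" if "\<And>x. 0 \<le> f x" for f :: "complex \<Rightarrow> real" and X
        using that by (auto intro!: bdd_belowI2[of _ 0])
      have i1: "(INF k\<in>K. dist m k) \<le> e / 2" if "m \<in> M n" for m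
        using elim that by (meson cINF_lower2 bd zero_le_dist)
      have i2: "(INF m\<in>M n. dist m k) \<le> e / 2" if "k \<in> K" for k
        using elim that by (meson cINF_lower2 bd zero_le_dist)
      have u1: "(SUP m\<in>M n. INF k\<in>K. dist m k) \<le> e / 2"
        using i1 M(1) by (intro cSUP_least) auto
      have u2: "(SUP k\<in>K. INF m\<in>M n. dist m k) \<le> e / 2"
        using i2 K(1) by (intro cSUP_least) auto
      obtain m0 where m0: "m0 \<in> M n" using M(1) by blast
      have "0 \<le> (INF k\<in>K. dist m0 k)" by (rule cINF_greatest[OF K(1)]) simp
      also have "\<dots> \<le> (SUP m\<in>M n. INF k\<in>K. dist m k)"
        by (intro cSUP_upper m0 bdd_aboveI2[where M = "e / 2"] i1)
      finally show ?case
        using u1 u2 e by (simp add: hausdorff_dist_def max_def)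
    qed
  qed
  then show ?thesis using M K by (simp add: hausdorff_tendsto_def)
qed

section \<open>Matrix algebras as corners of l2\<close>

lemma coord_P_range: "x \<in> range (P k) \<longleftrightarrow> P k x = x"
proof
  assume "x \<in> range (P k)"
  then obtain y where "x = P k y" by blast
  then show "P k x = x" by (auto intro!: ell2_eqI simp: coord_P)
qed (metis rangeI)

lemma P_idem: "P k o\<^sub>L P k = P k"
  by (rule blinfun_eqI, rule ell2_eqI) (simp add: coord_P)

lemma P_cops: "P k \<in> cops"
  by (rule copsI, rule ell2_eqI) (simp add: coord_P scaleC_complex_def)

lemma norm_P_le: "norm (P k) \<le> 1"
proof (rule norm_blinfun_bound)
  fix x :: l2
  have "norm (P k x) \<le> norm x"
  proof (rule norm_ell2_leI)
    fix n
    have "(\<Sum>i<n. (norm (coord (P k x) i))\<^sup>2) \<le> (\<Sum>i<n. (norm (coord x i))\<^sup>2)"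
      by (rule sum_mono) (simp add: coord_P)
    also have "\<dots> \<le> (norm x)\<^sup>2" by (rule sum_coord_le) simp
    finally show "(\<Sum>i<n. (norm (coord (P k x) i))\<^sup>2) \<le> (norm x)\<^sup>2" .
  qed simp
  then show "norm (P k x) \<le> 1 * norm x" by simp
qed simp

lemma range_P_expand: "x \<in> range (P k) \<Longrightarrow> x = (\<Sum>r<k. coord x r *\<^sub>C ket r)"
  unfolding coord_P_range
  by (rule ell2_eqI) (auto simp: coord_sum scaleC_complex_def if_distrib cong: if_cong dest!: arg_cong[where f = "\<lambda>x. coord x _"] simp: coord_P split: if_splits)

lemma hilbert_corner_P: "0 < k \<Longrightarrow> hilbert_corner (P k)"
proof
  assume "0 < k"
  then have "P k (ket 0) = ket 0" by (intro ell2_eqI) (simp add: coord_P)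
  then show "\<exists>x\<in>range (P k). norm x = 1" using norm_ket by (metis rangeI)
qed (rule P_cops P_idem norm_P_le)+

lemma csubspace_image:
  assumes T: "T \<in> cops" and H: "csubspace H"
  shows "csubspace (blinfun_apply T ` H)"
  unfolding csubspace_def
proof (intro conjI ballI allI)
  show "0 \<in> blinfun_apply T ` H"
    using H by (intro image_eqI[of _ _ 0]) (auto simp: csubspace_def)
  fix x y assume x: "x \<in> blinfun_apply T ` H" and "y \<in> blinfun_apply T ` H"
  then show "x + y \<in> blinfun_apply T ` H"
    using H by (auto simp: csubspace_def simp flip: blinfun.add_right)
next
  fix c x assume "x \<in> blinfun_apply T ` H"
  then show "c *\<^sub>C x \<in> blinfun_apply T ` H"
    using H by (auto simp: csubspace_def simp flip: copsD[OF T])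
qed

lemma csubspace_range: "T \<in> cops \<Longrightarrow> csubspace (range (blinfun_apply T))"
  by (rule csubspace_image) (auto simp: csubspace_def)

text \<open>Double counting of squared coefficients against the vectors \<open>ket r\<close>: each
  \<open>u j\<close> contributes exactly 1, and by Bessel each of the k basis vectors receives at
  most 1.\<close>

lemma orthonormal_range_P_bound:
  assumes u: "orthonormal u {..<m::nat}" "u ` {..<m} \<subseteq> range (P k)"
  shows "m \<le> k"
proof -
  have on: "orthonormal ket {..<k}" by (auto simp: orthonormal_def cinner_ket)
  have "(\<Sum>r<k. (cmod (cinner (u j) (ket r)))\<^sup>2) = 1" if j: "j < m" for j
  proof -
    have "u j \<in> range (P k)" using u(2) j by auto
    then have "u j = (\<Sum>r<k. cinner (u j) (ket r) *\<^sub>C ket r)"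
      unfolding cinner_ket by (rule range_P_expand)
    then have "(norm (u j))\<^sup>2 = (\<Sum>r<k. (cmod (cinner (u j) (ket r)))\<^sup>2)"
      using orthonormal_sum_sq[OF on, of "\<lambda>r. cinner (u j) (ket r)"] by simp
    then show ?thesis using orthonormal_norm[OF u(1), of j] j by simp
  qed
  then have "real m = (\<Sum>j<m. \<Sum>r<k. (cmod (cinner (u j) (ket r)))\<^sup>2)" by simp
  also have "\<dots> = (\<Sum>r<k. \<Sum>j<m. (cmod (cinner (u j) (ket r)))\<^sup>2)" by (rule sum.swap)
  also have "\<dots> \<le> (\<Sum>r<k. (norm (ket r))\<^sup>2)"
    by (rule sum_mono) (rule bessel_right[OF u(1)], simp)
  finally show ?thesis by simp
qed

lemma range_P_subset_span: "range (P k) \<subseteq> span (ket ` {..<k} \<union> (\<lambda>r. \<i> *\<^sub>C ket r) ` {..<k})"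
proof
  fix x assume "x \<in> range (P k)"
  then have "x = (\<Sum>r<k. coord x r *\<^sub>C ket r)" by (rule range_P_expand)
  also have "\<dots> = (\<Sum>r<k. Re (coord x r) *\<^sub>R ket r + Im (coord x r) *\<^sub>R \<i> *\<^sub>C ket r)"
    unfolding scaleR_scaleC scaleC_scaleC scaleC_add_left[symmetric]
    by (intro sum.cong refl) (metis complex_eq mult.commute)
  also have "\<dots> \<in> span (ket ` {..<k} \<union> (\<lambda>r. \<i> *\<^sub>C ket r) ` {..<k})"
    by (intro span_sum span_add span_scale span_base) auto
  finally show "x \<in> span (ket ` {..<k} \<union> (\<lambda>r. \<i> *\<^sub>C ket r) ` {..<k})" .
qed

lemma schur_mat:
  assumes A: "A \<in> carrier (corner (P k))" and k: "0 < k"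
  obtains m u where "orthonormal u {..<m::nat}" "u ` {..<m} \<subseteq> range (P k)"
    and "\<forall>y\<in>range (P k). y = (\<Sum>j<m. cinner y (u j) *\<^sub>C u j)"
    and "\<forall>j i. j < i \<longrightarrow> i < m \<longrightarrow> cinner (A (u j)) (u i) = 0"
    and "\<forall>j<m. \<exists>x\<in>range (P k). x \<noteq> 0 \<and> A x = cinner (A (u j)) (u j) *\<^sub>C x"
proof -
  interpret hilbert_corner "P k" by (rule hilbert_corner_P[OF k])
  have A_cops: "A \<in> cops" using A by simp
  have "\<exists>m u. orthonormal u {..<m::nat} \<and> u ` {..<m} \<subseteq> range (P k)
      \<and> (\<forall>y\<in>range (P k). y = (\<Sum>j<m. cinner y (u j) *\<^sub>C u j))
      \<and> (\<forall>j i. j < i \<longrightarrow> i < m \<longrightarrow> cinner (A (u j)) (u i) = 0)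
      \<and> (\<forall>j<m. \<exists>x\<in>range (P k). x \<noteq> 0 \<and> A x = cinner (A (u j)) (u j) *\<^sub>C x)"
  proof (rule schur_basis[OF _ _ csubspace_range[OF P_cops] _ range_P_subset_span])
    show "clin (blinfun_apply A)" by (simp add: clin_def blinfun.add_right copsD[OF A_cops])
    show "A x \<in> range (P k)" for x by (rule corner_range[OF A])
    show "m \<le> k" if "orthonormal u {..<m}" "u ` {..<m} \<subseteq> range (P k)" for m u
      by (rule orthonormal_range_P_bound[OF that])
  qed simp
  then show ?thesis by (elim exE conjE) (rule that; assumption)
qed

text \<open>In a Schur basis the diagonal entries are eigenvalues, hence nonzero if \<open>A\<close>
  is bounded below; back substitution then puts one basis vector after the other into the
  image.\<close>

lemma mat_surj_if_bounded_below:
  assumes A: "A \<in> carrier (corner (P k))" and k: "0 < k" and pos: "0 < nu (range (P k)) A"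
  shows "range (P k) \<subseteq> A ` range (P k)"
proof
  interpret hilbert_corner "P k" by (rule hilbert_corner_P[OF k])
  have A_cops: "A \<in> cops" using A by simp
  obtain m u where u: "orthonormal u {..<m::nat}" "u ` {..<m} \<subseteq> range (P k)"
      and exp': "\<forall>y\<in>range (P k). y = (\<Sum>j<m. cinner y (u j) *\<^sub>C u j)"
      and tri': "\<forall>j i. j < i \<longrightarrow> i < m \<longrightarrow> cinner (A (u j)) (u i) = 0"
      and eig': "\<forall>j<m. \<exists>x\<in>range (P k). x \<noteq> 0 \<and> A x = cinner (A (u j)) (u j) *\<^sub>C x"
    by (rule schur_mat[OF A k]; rule that; assumption)
  note exp = exp'[rule_format] and tri = tri'[rule_format] and eig = eig'[rule_format]
  have sub: "csubspace (A ` range (P k))"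
    by (rule csubspace_image[OF A_cops csubspace_range[OF P_cops]])
  have "u j \<in> A ` range (P k)" if "j < m" for j
    using that
  proof (induction j rule: less_induct)
    case (less j)
    define b where "b i = cinner (A (u j)) (u i)" for i
    have "A (u j) = (\<Sum>i<m. b i *\<^sub>C u i)"
      unfolding b_def by (rule exp[OF corner_range[OF A]])
    also have "\<dots> = (\<Sum>i\<in>{..<j} \<union> {j}. b i *\<^sub>C u i)"
      by (rule sum.mono_neutral_right) (use less tri in \<open>auto simp: b_def\<close>)
    also have "\<dots> = (\<Sum>i<j. b i *\<^sub>C u i) + b j *\<^sub>C u j" by simp
    finally have eq: "b j *\<^sub>C u j = A (u j) - (\<Sum>i<j. b i *\<^sub>C u i)" by (simp add: algebra_simps)
    have "A (u j) - (\<Sum>i<j. b i *\<^sub>C u i) \<in> A ` range (P k)"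
    proof (rule csubspace_diff[OF sub])
      show "A (u j) \<in> A ` range (P k)" using u(2) less by auto
      show "(\<Sum>i<j. b i *\<^sub>C u i) \<in> A ` range (P k)"
      proof (rule csubspace_sum[OF sub])
        fix i assume "i \<in> {..<j}"
        then have "u i \<in> A ` range (P k)" using less by simp
        then show "b i *\<^sub>C u i \<in> A ` range (P k)" using sub unfolding csubspace_def by blast
      qed
    qed
    moreover have "b j \<noteq> 0"
    proof
      assume "b j = 0"
      then obtain x where x: "x \<in> range (P k)" "x \<noteq> 0" "A x = 0"
        using eig[OF less.prems] by (auto simp: b_def)
      have "nu (range (P k)) A * norm x \<le> norm (A x)"
        by (rule nu_bound[OF subspace_range_Q x(1)])
      then show False using x pos by (simp add: mult_le_0_iff)
    qed
    then have "u j = (1 / b j) *\<^sub>C (b j *\<^sub>C u j)" by (simp add: scaleC_scaleC)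
    ultimately show ?case using sub eq unfolding csubspace_def by metis
  qed
  moreover fix y assume "y \<in> range (P k)"
  ultimately show "y \<in> A ` range (P k)"
    by (subst exp) (auto intro!: csubspace_sum[OF sub] simp: sub[unfolded csubspace_def])
qed

lemma nu_eq_0_if_eigenvector:
  assumes k: "0 < k" and x: "x \<in> range (P k)" "x \<noteq> 0" "blinfun_apply A x = \<mu> *\<^sub>C x"
  shows "nu (range (P k)) (A - cscale \<mu> (P k)) = 0"
proof -
  interpret hilbert_corner "P k" by (rule hilbert_corner_P[OF k])
  have "(A - cscale \<mu> (P k)) x = 0"
    using x(3) by (simp add: blinfun.diff_left blinfun_apply_cscale Q_fix[OF x(1)])
  then have "nu (range (P k)) (A - cscale \<mu> (P k)) * norm x \<le> 0"
    using nu_bound[OF subspace_range_Q x(1), of "A - cscale \<mu> (P k)"] by simp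
  then show ?thesis
    using nu_nonneg[OF Q_nontrivial, of "A - cscale \<mu> (P k)"] x(2) by (simp add: mult_le_0_iff)
qed

lemma mat_spectrum_nonempty:
  assumes A: "A \<in> carrier (corner (P k))" and k: "0 < k"
  shows "\<exists>\<mu>. nu (range (P k)) (A - cscale \<mu> (P k)) = 0"
proof -
  interpret hilbert_corner "P k" by (rule hilbert_corner_P[OF k])
  obtain x where x: "x \<in> range (P k)" "norm x = 1" using Q_nontrivial by blast
  then have x0: "x \<noteq> 0" by auto
  have A_cops: "A \<in> cops" using A by simp
  have "clin (blinfun_apply A)" by (simp add: clin_def blinfun.add_right copsD[OF A_cops])
  from exists_eigenvector[OF this corner_range[OF A] csubspace_range[OF P_cops] _ range_P_subset_span x(1) x0]
  obtain \<mu> y where "y \<in> range (P k)" "y \<noteq> 0" "A y = \<mu> *\<^sub>C y" by auto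
  from nu_eq_0_if_eigenvector[OF k this] show ?thesis by blast
qed

text \<open>The strictly upper triangular part of \<open>A\<close> in a Schur basis has Hilbert--Schmidt norm at most that of
  \<open>A - A\<^sup>*\<close>. Its operator norm is not controlled independently of \<open>k\<close>, which is why many approximate
  eigenvectors are needed to locate a single eigenvalue.\<close>

lemma near_selfadjoint_eigenvalue:
  assumes A: "A \<in> carrier (corner (P k))" and k: "0 < k"
    and A': "adj A A'" "norm (A - A') \<le> e"
    and y: "orthonormal y J" "finite J" "y ` J \<subseteq> range (P k)"
    and approx: "\<And>g. g \<in> J \<Longrightarrow> norm (blinfun_apply A (y g) - \<zeta> *\<^sub>C y g) \<le> \<delta>"
    and far: "\<And>\<mu>. nu (range (P k)) (A - cscale \<mu> (P k)) = 0 \<Longrightarrow> \<delta> + s \<le> cmod (\<mu> - \<zeta>)"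
    and s: "0 \<le> \<delta>" "0 \<le> s"
  shows "real (card J) * s\<^sup>2 \<le> e\<^sup>2 * k"
proof -
  interpret hilbert_corner "P k" by (rule hilbert_corner_P[OF k])
  obtain m u where u: "orthonormal u {..<m::nat}" "u ` {..<m} \<subseteq> range (P k)"
      and exp': "\<forall>y\<in>range (P k). y = (\<Sum>j<m. cinner y (u j) *\<^sub>C u j)"
      and tri': "\<forall>j i. j < i \<longrightarrow> i < m \<longrightarrow> cinner (A (u j)) (u i) = 0"
      and eig': "\<forall>j<m. \<exists>x\<in>range (P k). x \<noteq> 0 \<and> A x = cinner (A (u j)) (u j) *\<^sub>C x"
    by (rule schur_mat[OF A k]; rule that; assumption)
  note exp = exp'[rule_format] and tri = tri'[rule_format] and eig = eig'[rule_format]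
  have mk: "m \<le> k" by (rule orthonormal_range_P_bound[OF u])
  have A_cops: "A \<in> cops" using A by simp
  define b where "b i j = cinner (A (u j)) (u i)" for i j
  have far_j: "\<delta> + s \<le> cmod (b j j - \<zeta>)" if j: "j < m" for j
    using eig[OF j] nu_eq_0_if_eigenvector[OF k, of _ A "b j j"] far by (auto simp: b_def)
  \<comment> \<open>\<open>v i\<close> encodes row i of the strictly upper triangular part: pairing
    a vector with it applies that row.\<close>
  define v where "v i = (\<Sum>j\<in>{i<..<m}. cnj (b i j) *\<^sub>C u j)" for i
  have coord: "cinner (A x - \<zeta> *\<^sub>C x) (u i) = (b i i - \<zeta>) * cinner x (u i) + cinner x (v i)"
    if x: "x \<in> range (P k)" and i: "i < m" for x i
  proof -
    have "A x = A (\<Sum>j<m. cinner x (u j) *\<^sub>C u j)" using exp[OF x] by simp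
    also have "\<dots> = (\<Sum>j<m. cinner x (u j) *\<^sub>C A (u j))"
      by (simp add: blinfun.sum_right copsD[OF A_cops])
    finally have "cinner (A x) (u i) = (\<Sum>j<m. cinner x (u j) * b i j)"
      by (simp add: cinner.sum_left cinner_scaleC_left b_def)
    also have "\<dots> = (\<Sum>j\<in>{i} \<union> {i<..<m}. cinner x (u j) * b i j)"
    proof (rule sum.mono_neutral_right)
      show "\<forall>j\<in>{..<m} - ({i} \<union> {i<..<m}). cinner x (u j) * b i j = 0"
        using i tri by (auto simp: b_def not_less)
    qed (use i in auto)
    also have "\<dots> = b i i * cinner x (u i) + cinner x (v i)"
      by (simp add: v_def cinner.sum_right cinner_scaleC_right mult.commute)
    finally show ?thesis by (simp add: cinner.diff_left cinner_scaleC_left algebra_simps)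
  qed
  define n where "n g = (\<Sum>i<m. (cmod (cinner (y g) (v i)))\<^sup>2)" for g
  \<comment> \<open>In Schur coordinates the diagonal part of A - \<zeta> stretches
    \<open>y g\<close> to length at least \<delta> + s, while A - \<zeta> itself leaves at most
    \<delta>. The strictly upper triangular part has to account for the missing s.\<close>
  have each: "s\<^sup>2 \<le> n g" if g: "g \<in> J" for g
  proof -
    have yg: "y g \<in> range (P k)" using y(3) g by auto
    have "(norm (y g))\<^sup>2 = (\<Sum>i<m. (cmod (cinner (y g) (u i)))\<^sup>2)"
      using orthonormal_sum_sq[OF u(1), of "\<lambda>i. cinner (y g) (u i)"] exp[OF yg] by simp
    then have one: "L2_set (\<lambda>i. cmod (cinner (y g) (u i))) {..<m} = 1"
      using orthonormal_norm[OF y(1) g] by (simp add: L2_set_def)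
    have "\<delta> + s = L2_set (\<lambda>i. (\<delta> + s) * cmod (cinner (y g) (u i))) {..<m}"
      using s one by (simp flip: L2_set_right_distrib)
    also have "\<dots> \<le> L2_set (\<lambda>i. cmod (cinner (A (y g) - \<zeta> *\<^sub>C y g) (u i)) + cmod (cinner (y g) (v i))) {..<m}"
    proof (rule L2_set_mono)
      fix i assume "i \<in> {..<m}"
      then have i: "i < m" by simp
      have "(\<delta> + s) * cmod (cinner (y g) (u i)) \<le> cmod ((b i i - \<zeta>) * cinner (y g) (u i))"
        unfolding norm_mult by (rule mult_right_mono[OF far_j[OF i]]) simp
      also have "(b i i - \<zeta>) * cinner (y g) (u i) = cinner (A (y g) - \<zeta> *\<^sub>C y g) (u i) - cinner (y g) (v i)"
        unfolding coord[OF yg i] by simp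
      also have "cmod \<dots> \<le> cmod (cinner (A (y g) - \<zeta> *\<^sub>C y g) (u i)) + cmod (cinner (y g) (v i))"
        by (rule norm_triangle_ineq4)
      finally show "(\<delta> + s) * cmod (cinner (y g) (u i))
          \<le> cmod (cinner (A (y g) - \<zeta> *\<^sub>C y g) (u i)) + cmod (cinner (y g) (v i))" .
    qed (use s in simp)
    also have "\<dots> \<le> L2_set (\<lambda>i. cmod (cinner (A (y g) - \<zeta> *\<^sub>C y g) (u i))) {..<m}
        + L2_set (\<lambda>i. cmod (cinner (y g) (v i))) {..<m}"
      by (rule L2_set_triangle_ineq)
    also have "L2_set (\<lambda>i. cmod (cinner (A (y g) - \<zeta> *\<^sub>C y g) (u i))) {..<m} \<le> norm (A (y g) - \<zeta> *\<^sub>C y g)"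
      unfolding L2_set_def using bessel[OF u(1), of "A (y g) - \<zeta> *\<^sub>C y g"]
      by (intro real_le_lsqrt) (auto simp: sum_nonneg)
    also have "\<dots> \<le> \<delta>" by (rule approx[OF g])
    finally have "s \<le> sqrt (n g)" by (simp add: L2_set_def n_def)
    then have "s\<^sup>2 \<le> (sqrt (n g))\<^sup>2" by (rule power_mono[OF _ s(2)])
    then show ?thesis by (simp add: n_def sum_nonneg)
  qed
  have "real (card J) * s\<^sup>2 = (\<Sum>g\<in>J. s\<^sup>2)" by simp
  also have "\<dots> \<le> (\<Sum>g\<in>J. n g)" by (rule sum_mono[OF each])
  also have "\<dots> = (\<Sum>i<m. \<Sum>g\<in>J. (cmod (cinner (y g) (v i)))\<^sup>2)"
    unfolding n_def by (rule sum.swap)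
  also have "\<dots> \<le> (\<Sum>i<m. (norm (v i))\<^sup>2)"
    by (intro sum_mono bessel_right y)
  also have "\<dots> = (\<Sum>i<m. \<Sum>j\<in>{i<..<m}. (cmod (b i j))\<^sup>2)"
  proof (rule sum.cong[OF refl])
    fix i
    have "orthonormal u {i<..<m}" using u(1) by (auto simp: orthonormal_def)
    from orthonormal_sum_sq[OF this, of "\<lambda>j. cnj (b i j)"]
    show "(norm (v i))\<^sup>2 = (\<Sum>j\<in>{i<..<m}. (cmod (b i j))\<^sup>2)" by (simp add: v_def)
  qed
  \<comment> \<open>Because \<open>A\<close> is upper triangular, \<open>A'\<close> has the entry 0
    above the diagonal. So \<open>b i j\<close> with i < j is an entry of A - A', and the sum is
    enlarged to all entries of that small operator.\<close>
  also have "\<dots> \<le> (\<Sum>i<m. \<Sum>j<m. (cmod (cinner ((A - A') (u j)) (u i)))\<^sup>2)"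
  proof (rule sum_mono)
    fix i assume "i \<in> {..<m}"
    have "b i j = cinner ((A - A') (u j)) (u i)" if j: "j \<in> {i<..<m}" for j
    proof -
      have "cinner (A' (u j)) (u i) = cinner (u j) (A (u i))"
        by (rule adjD[OF adj_sym[OF A'(1)]])
      also have "\<dots> = cnj (cinner (A (u i)) (u j))" by (rule cinner_commute)
      also have "\<dots> = 0" using tri[of i j] j by simp
      finally show ?thesis by (simp add: b_def blinfun.diff_left cinner.diff_left)
    qed
    then have "(\<Sum>j\<in>{i<..<m}. (cmod (b i j))\<^sup>2) = (\<Sum>j\<in>{i<..<m}. (cmod (cinner ((A - A') (u j)) (u i)))\<^sup>2)"
      by simp
    also have "\<dots> \<le> (\<Sum>j<m. (cmod (cinner ((A - A') (u j)) (u i)))\<^sup>2)"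
      by (rule sum_mono2) auto
    finally show "(\<Sum>j\<in>{i<..<m}. (cmod (b i j))\<^sup>2) \<le> (\<Sum>j<m. (cmod (cinner ((A - A') (u j)) (u i)))\<^sup>2)" .
  qed
  also have "\<dots> = (\<Sum>j<m. \<Sum>i<m. (cmod (cinner ((A - A') (u j)) (u i)))\<^sup>2)" by (rule sum.swap)
  also have "\<dots> \<le> (\<Sum>j<m. (norm ((A - A') (u j)))\<^sup>2)"
    by (intro sum_mono bessel u) simp
  also have "\<dots> \<le> (\<Sum>j<m. e\<^sup>2)"
  proof (intro sum_mono power_mono)
    fix j assume "j \<in> {..<m}"
    then have "norm ((A - A') (u j)) \<le> norm (A - A')"
      using norm_blinfun[of "A - A'" "u j"] orthonormal_norm[OF u(1)] by simp
    then show "norm ((A - A') (u j)) \<le> e" using A'(2) by simp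
  qed simp
  also have "\<dots> = e\<^sup>2 * m" by simp
  also have "\<dots> \<le> e\<^sup>2 * k" using mk by (intro mult_left_mono) auto
  finally show ?thesis .
qed


section \<open>The almost intertwining isometries\<close>

lemma bounded_linear_coord_coord: "bounded_linear (\<lambda>y :: l2 ell2. coord (coord y i) m)"
proof -
  have "bounded_linear (\<lambda>y :: l2 ell2. prj m (prj i y))"
    by (rule bounded_linear_compose[OF blinfun.bounded_linear_right blinfun.bounded_linear_right])
  then show ?thesis by simp
qed

lemma bounded_linear_coord: "bounded_linear (\<lambda>x :: l2. coord x r)"
  using blinfun.bounded_linear_right[of "prj r :: l2 \<Rightarrow>\<^sub>L complex"] by simp

text \<open>The maps \<open>U n\<close> and \<open>Y' q g\<close> and both commutator errors are of
  this shape, so a single norm formula covers them; \<open>wr\<close> is the adjoint shape.\<close>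

definition wc :: "(nat \<times> nat) set \<Rightarrow> (nat \<Rightarrow> nat \<Rightarrow> real) \<Rightarrow> (nat \<Rightarrow> nat \<Rightarrow> nat) \<Rightarrow> l2 \<Rightarrow>\<^sub>L l2 ell2" where
  "wc F k h = Blinfun (\<lambda>x. \<Sum>p\<in>F. (of_real (k (fst p) (snd p)) * coord x (h (fst p) (snd p))) *\<^sub>C E (fst p) (snd p))"

definition wr :: "(nat \<times> nat) set \<Rightarrow> (nat \<Rightarrow> nat \<Rightarrow> real) \<Rightarrow> (nat \<Rightarrow> nat \<Rightarrow> nat) \<Rightarrow> l2 ell2 \<Rightarrow>\<^sub>L l2" where
  "wr F k h = Blinfun (\<lambda>y. \<Sum>p\<in>F. (of_real (k (fst p) (snd p)) * coord (coord y (fst p)) (snd p)) *\<^sub>C ket (h (fst p) (snd p)))"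

lemma wc_apply: "wc F k h x =
    (\<Sum>p\<in>F. (of_real (k (fst p) (snd p)) * coord x (h (fst p) (snd p))) *\<^sub>C E (fst p) (snd p))"
proof -
  have "bounded_linear (\<lambda>x. \<Sum>p\<in>F. (of_real (k (fst p) (snd p)) * coord x (h (fst p) (snd p))) *\<^sub>C E (fst p) (snd p))"
    by (intro bounded_linear_sum bounded_linear_compose[OF scaleC.bounded_linear_left]
        bounded_linear_const_mult bounded_linear_coord)
  then show ?thesis by (simp add: wc_def bounded_linear_Blinfun_apply)
qed

lemma wr_apply: "wr F k h y =
    (\<Sum>p\<in>F. (of_real (k (fst p) (snd p)) * coord (coord y (fst p)) (snd p)) *\<^sub>C ket (h (fst p) (snd p)))"
proof -
  have "bounded_linear (\<lambda>y. \<Sum>p\<in>F. (of_real (k (fst p) (snd p)) * coord (coord y (fst p)) (snd p)) *\<^sub>C ket (h (fst p) (snd p)))"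
    by (intro bounded_linear_sum bounded_linear_compose[OF scaleC.bounded_linear_left]
        bounded_linear_const_mult bounded_linear_coord_coord)
  then show ?thesis by (simp add: wr_def bounded_linear_Blinfun_apply)
qed

lemma coord_wc:
  assumes "finite F"
  shows "coord (coord (wc F k h x) i) m = (if (i, m) \<in> F then of_real (k i m) * coord x (h i m) else 0)"
proof -
  have "coord (coord (wc F k h x) i) m = (\<Sum>p\<in>F. if p = (i, m) then of_real (k i m) * coord x (h i m) else 0)"
    unfolding wc_apply coord_sum
    by (intro sum.cong refl) (auto simp: scaleC_complex_def)
  then show ?thesis using assms by simp
qed

lemma cinner_E_left: "cinner (E i m) y = cnj (coord (coord y i) m)"
  unfolding E_def by (subst cinner_commute) (simp add: cinner_ins_right cinner_ket)

lemma cinner_E: "cinner y (E i m) = coord (coord y i) m"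
  by (simp add: E_def cinner_ins_right cinner_ket)

lemma K_eqI: "(\<And>i m. coord (coord x i) m = coord (coord y i) m) \<Longrightarrow> x = y"
  by (auto intro!: ell2_eqI)

lemma adj_wc_wr: "adj (wc F k h) (wr F k h)"
  unfolding adj_def wc_apply wr_apply
  by (simp add: cinner.sum_left cinner.sum_right cinner_scaleC_left cinner_scaleC_right
      cinner_E_left cinner_ket mult_ac)

lemma norm_wc_sq:
  assumes "finite F"
  shows "(norm (wc F k h x))\<^sup>2 = (\<Sum>p\<in>F. (k (fst p) (snd p))\<^sup>2 * (cmod (coord x (h (fst p) (snd p))))\<^sup>2)"
proof -
  have "orthonormal (\<lambda>p. E (fst p) (snd p)) F"
    by (auto simp: orthonormal_def cinner_E prod_eq_iff)
  from orthonormal_sum_sq[OF this assms] show ?thesis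
    by (simp add: wc_apply norm_mult power_mult_distrib)
qed

text \<open>Each \<open>E i m\<close> receives a single coordinate of x, so different basis vectors
  have orthogonal images and the squared norm becomes diagonal, with the fibre sums of squared
  weights as diagonal entries.\<close>

lemma norm_wc_group:
  assumes F: "finite F"
  shows "(norm (wc F k h x))\<^sup>2 = (\<Sum>r\<in>(\<lambda>p. h (fst p) (snd p)) ` F.
      (\<Sum>p\<in>{p\<in>F. h (fst p) (snd p) = r}. (k (fst p) (snd p))\<^sup>2) * (cmod (coord x r))\<^sup>2)"
proof -
  have "(norm (wc F k h x))\<^sup>2 = (\<Sum>r\<in>(\<lambda>p. h (fst p) (snd p)) ` F.
      \<Sum>p\<in>{p\<in>F. h (fst p) (snd p) = r}. (k (fst p) (snd p))\<^sup>2 * (cmod (coord x (h (fst p) (snd p))))\<^sup>2)"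
    unfolding norm_wc_sq[OF F] by (rule sum.group[symmetric]) (use F in auto)
  also have "\<dots> = (\<Sum>r\<in>(\<lambda>p. h (fst p) (snd p)) ` F.
      (\<Sum>p\<in>{p\<in>F. h (fst p) (snd p) = r}. (k (fst p) (snd p))\<^sup>2) * (cmod (coord x r))\<^sup>2)"
    by (intro sum.cong refl) (simp add: sum_distrib_right)
  finally show ?thesis .
qed

lemma norm_wc_le:
  assumes F: "finite F" and c: "0 \<le> c"
    and b: "\<And>r. (\<Sum>p\<in>{p\<in>F. h (fst p) (snd p) = r}. (k (fst p) (snd p))\<^sup>2) \<le> c\<^sup>2"
  shows "norm (wc F k h) \<le> c"
proof (rule norm_blinfun_bound[OF c])
  fix x
  have "(norm (wc F k h x))\<^sup>2 \<le> (\<Sum>r\<in>(\<lambda>p. h (fst p) (snd p)) ` F. c\<^sup>2 * (cmod (coord x r))\<^sup>2)"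
    unfolding norm_wc_group[OF F] by (intro sum_mono mult_right_mono b) simp
  also have "\<dots> \<le> c\<^sup>2 * (norm x)\<^sup>2"
    unfolding sum_distrib_left[symmetric] using F by (intro mult_left_mono sum_coord_le) auto
  finally have "(norm (wc F k h x))\<^sup>2 \<le> (c * norm x)\<^sup>2" by (simp add: power_mult_distrib)
  then show "norm (wc F k h x) \<le> c * norm x" by (rule power2_le_imp_le) (simp add: c)
qed

text \<open>Within a fibre the level i determines m, so the sum over pairs collapses to a sum over
  levels.\<close>

lemma fiber_sum_le:
  assumes F: "finite F" and I: "finite I"
    and fib: "\<And>i m. (i, m) \<in> F \<Longrightarrow> h i m = r \<Longrightarrow> i \<in> I \<and> m = f i \<and> (k i m)\<^sup>2 \<le> g i"
    and g: "\<And>i. i \<in> I \<Longrightarrow> 0 \<le> g i"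
  shows "(\<Sum>p\<in>{p\<in>F. h (fst p) (snd p) = r}. (k (fst p) (snd p))\<^sup>2) \<le> (\<Sum>i\<in>I. g i :: real)"
proof -
  let ?A = "{p\<in>F. h (fst p) (snd p) = r}"
  have inj: "inj_on fst ?A"
  proof (rule inj_onI)
    have snd: "snd x = f (fst x)" if "x \<in> ?A" for x
      using that fib[of "fst x" "snd x"] by simp
    fix p p' assume p: "p \<in> ?A" "p' \<in> ?A" "fst p = fst p'"
    then show "p = p'" using snd[OF p(1)] snd[OF p(2)] by (simp add: prod_eq_iff)
  qed
  have "(\<Sum>p\<in>?A. (k (fst p) (snd p))\<^sup>2) \<le> (\<Sum>p\<in>?A. g (fst p))"
    by (rule sum_mono) (use fib in auto)
  also have "\<dots> = (\<Sum>i\<in>fst ` ?A. g i)" by (simp add: sum.reindex[OF inj])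
  also have "\<dots> \<le> (\<Sum>i\<in>I. g i)"
    by (rule sum_mono2) (use I fib g in auto)
  finally show ?thesis .
qed

text \<open>An operator-weighted unilateral shift of the levels. It annihilates level 0, just as the
  section of a generator annihilates the indices that already use all n digits.\<close>

definition bsh :: "('a::real_normed_vector \<Rightarrow>\<^sub>L 'a) \<Rightarrow> 'a ell2 \<Rightarrow>\<^sub>L 'a ell2" where
  "bsh T = Blinfun (\<lambda>y. Abs_ell2 (\<lambda>i. T (coord y (Suc i))))"

definition fsh :: "('a::real_normed_vector \<Rightarrow>\<^sub>L 'a) \<Rightarrow> 'a ell2 \<Rightarrow>\<^sub>L 'a ell2" where
  "fsh T = Blinfun (\<lambda>y. Abs_ell2 (\<lambda>i. case i of 0 \<Rightarrow> 0 | Suc j \<Rightarrow> T (coord y j)))"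

lemma coord_bsh: "coord (bsh T y) i = T (coord y (Suc i))"
proof -
  define G where "G y = Abs_ell2 (\<lambda>i. T (coord y (Suc i)))" for y
  have B: "(\<Sum>i<n. (norm (T (coord y (Suc i))))\<^sup>2) \<le> (norm T * norm y)\<^sup>2" for n y
  proof -
    have "(\<Sum>i<n. (norm (T (coord y (Suc i))))\<^sup>2) \<le> (\<Sum>i<n. (norm T)\<^sup>2 * (norm (coord y (Suc i)))\<^sup>2)"
      unfolding power_mult_distrib[symmetric] by (intro sum_mono power_mono norm_blinfun) simp
    also have "\<dots> = (norm T)\<^sup>2 * (\<Sum>i\<in>Suc ` {..<n}. (norm (coord y i))\<^sup>2)"
      by (simp add: sum_distrib_left sum.reindex)
    also have "\<dots> \<le> (norm T)\<^sup>2 * (norm y)\<^sup>2" by (intro mult_left_mono sum_coord_le) auto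
    finally show ?thesis by (simp add: power_mult_distrib)
  qed
  have G: "coord (G y) = (\<lambda>i. T (coord y (Suc i)))" for y
    unfolding G_def using summableI_nonneg_bounded[OF _ B] by (simp add: Abs_ell2_inverse)
  have "bounded_linear G"
  proof (rule bounded_linear_intro)
    show "G (x + y) = G x + G y" for x y by (rule ell2_eqI) (simp add: G blinfun.add_right)
    show "G (r *\<^sub>R x) = r *\<^sub>R G x" for r x by (rule ell2_eqI) (simp add: G blinfun.scaleR_right)
    show "norm (G x) \<le> norm x * norm T" for x
      by (rule norm_ell2_leI) (use B[of x] in \<open>auto simp: G mult.commute\<close>)
  qed
  then show ?thesis using G[of y] by (simp add: bsh_def G_def[abs_def] bounded_linear_Blinfun_apply)
qed

lemma coord_fsh: "coord (fsh T y) i = (case i of 0 \<Rightarrow> 0 | Suc j \<Rightarrow> T (coord y j))"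
proof -
  define G where "G y = Abs_ell2 (\<lambda>i. case i of 0 \<Rightarrow> 0 | Suc j \<Rightarrow> T (coord y j))" for y
  have B: "(\<Sum>i<n. (norm (case i of 0 \<Rightarrow> 0 | Suc j \<Rightarrow> T (coord y j)))\<^sup>2) \<le> (norm T * norm y)\<^sup>2" for n y
  proof -
    have "(\<Sum>i<n. (norm (case i of 0 \<Rightarrow> 0 | Suc j \<Rightarrow> T (coord y j)))\<^sup>2)
        \<le> (\<Sum>i<Suc n. (norm (case i of 0 \<Rightarrow> 0 | Suc j \<Rightarrow> T (coord y j)))\<^sup>2)"
      by (rule sum_mono2) auto
    also have "\<dots> = (\<Sum>i<n. (norm (T (coord y i)))\<^sup>2)"
      unfolding sum.lessThan_Suc_shift by simp
    also have "\<dots> \<le> (\<Sum>i<n. (norm T)\<^sup>2 * (norm (coord y i))\<^sup>2)"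
      unfolding power_mult_distrib[symmetric] by (intro sum_mono power_mono norm_blinfun) simp
    also have "\<dots> \<le> (norm T)\<^sup>2 * (norm y)\<^sup>2"
      unfolding sum_distrib_left[symmetric] by (intro mult_left_mono sum_coord_le) auto
    finally show ?thesis by (simp add: power_mult_distrib)
  qed
  have G: "coord (G y) = (\<lambda>i. case i of 0 \<Rightarrow> 0 | Suc j \<Rightarrow> T (coord y j))" for y
    unfolding G_def using summableI_nonneg_bounded[OF _ B] by (simp add: Abs_ell2_inverse)
  have "bounded_linear G"
  proof (rule bounded_linear_intro)
    show "G (x + y) = G x + G y" for x y
      by (rule ell2_eqI) (simp add: G blinfun.add_right split: nat.split)
    show "G (r *\<^sub>R x) = r *\<^sub>R G x" for r x
      by (rule ell2_eqI) (simp add: G blinfun.scaleR_right split: nat.split)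
    show "norm (G x) \<le> norm x * norm T" for x
      by (rule norm_ell2_leI) (use B[of x] in \<open>auto simp: G mult.commute\<close>)
  qed
  then show ?thesis using G[of y] by (simp add: fsh_def G_def[abs_def] bounded_linear_Blinfun_apply)
qed

lemma adj_bsh_fsh:
  fixes T :: "'a::complex_inner \<Rightarrow>\<^sub>L 'a"
  assumes "adj T T'"
  shows "adj (bsh T) (fsh T')"
  unfolding adj_def
proof (intro allI)
  fix x y :: "'a ell2"
  have s: "summable (\<lambda>k. cinner (coord x k) (coord (fsh T' y) k))"
    by (intro sq_summable_cinner_aux summable_coord)
  have "cinner x (fsh T' y) = (\<Sum>k. cinner (coord x (Suc k)) (coord (fsh T' y) (Suc k)))"
    unfolding cinner_ell2.rep_eq using suminf_split_head[OF s] by (simp add: coord_fsh)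
  then show "cinner (bsh T x) y = cinner x (fsh T' y)"
    by (simp add: cinner_ell2.rep_eq coord_bsh coord_fsh adjD[OF assms])
qed

text \<open>By density of the span of the basis vectors, conjugate transposed matrix entries already
  determine the adjoint.\<close>

lemma adj_l2I:
  fixes T T' :: l2_op
  assumes "T \<in> cops" "\<And>i j. coord (T (ket i)) j = cnj (coord (T' (ket j)) i)" "T' \<in> cops"
  shows "adj T T'"
proof -
  have T: "adj T (cadjoint T)" by (rule cops_adj_cadjoint[OF assms(1)])
  have eq: "cadjoint T (ket j) = T' (ket j)" for j
  proof (rule ell2_eqI)
    fix i
    have "coord (cadjoint T (ket j)) i = cnj (cinner (ket i) (cadjoint T (ket j)))"
      by (simp add: cinner_ket_left)
    also have "\<dots> = cnj (cinner (T (ket i)) (ket j))" by (simp only: adjD[OF T])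
    finally show "coord (cadjoint T (ket j)) i = coord (T' (ket j)) i" by (simp add: cinner_ket assms(2))
  qed
  have c: "cadjoint T \<in> cops" by (rule adj_in_cops[OF adj_sym[OF T]])
  have "cadjoint T = T'"
  proof (rule blinfun_eqI)
    fix x
    have "x \<in> {x. cadjoint T x = T' x}"
    proof (rule l2_dense_induct)
      show "closed {x. cadjoint T x = T' x}"
        by (intro closed_Collect_eq linear_continuous_on blinfun.bounded_linear_right)
    qed (auto simp: blinfun.add_right copsD[OF c] copsD[OF assms(3)] eq)
    then show "cadjoint T x = T' x" by simp
  qed
  then show ?thesis using T by simp
qed

lemma R_cops: "R n \<in> cops"
  by (rule copsI, rule ell2_eqI) (simp add: coord_R scaleC_complex_def)

lemma S_cops: "S N i \<in> cops"
  by (rule copsI, rule ell2_eqI) (simp add: coord_S scaleC_complex_def)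

lemma adj_P: "adj (P n) (P n)"
  by (rule adj_l2I) (auto simp: P_cops coord_P)

lemma adj_R: "adj (R n) (R n)"
  by (rule adj_l2I) (auto simp: R_cops coord_R)

lemma adj_S: "adj (S N i) (cadjoint (S N i))"
  by (rule cops_adj_cadjoint[OF S_cops])

lemma S_ket: "0 < N \<Longrightarrow> i < N \<Longrightarrow> S N i (ket r) = ket (r * N + i)"
  by (rule ell2_eqI) (auto simp: coord_S)

lemma coord_cadjoint_S:
  assumes "i < N"
  shows "coord (cadjoint (S N i) x) r = coord x (r * N + i)"
proof -
  have "coord (cadjoint (S N i) x) r = cinner (cadjoint (S N i) x) (ket r)" by (simp add: cinner_ket)
  also have "\<dots> = cinner x (S N i (ket r))" by (rule adjD[OF adj_sym[OF adj_S]])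
  finally show ?thesis using assms by (simp add: S_ket cinner_ket)
qed

lemma blinfun_compose_assoc: "(A o\<^sub>L B) o\<^sub>L C = A o\<^sub>L (B o\<^sub>L C)"
  by (rule blinfun_eqI) simp

lemma diff_less_cancel: "a < (k::nat) \<Longrightarrow> b < k \<Longrightarrow> k - 1 - a = k - 1 - b \<longleftrightarrow> a = b"
  by arith

text \<open>Subtraction from M * N - 1 complements digits without any borrowing, so the last digit
  and the quotient are reflected separately.\<close>

lemma refl_divmod:
  fixes m M N :: nat
  assumes "m < M * N"
  shows "(M * N - 1 - m) mod N = N - 1 - m mod N" "(M * N - 1 - m) div N = M - 1 - m div N"
proof -
  have N: "0 < N" using assms by (cases N) auto
  have mM: "m div N < M" using assms by (simp add: less_mult_imp_div_less)
  have "m mod N < N" using N by simp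
  then have "M * N - 1 - m = (M - 1 - m div N) * N + (N - 1 - m mod N)"
  proof -
    obtain c where c: "M = m div N + 1 + c" using mM by (metis Suc_eq_plus1 add_Suc_right less_iff_Suc_add add.assoc plus_1_eq_Suc)
    obtain b where b: "N = m mod N + 1 + b" using \<open>m mod N < N\<close>
      by (metis Suc_eq_plus1 add_Suc_right less_iff_Suc_add add.assoc plus_1_eq_Suc)
    have "m = (m div N) * N + m mod N" by simp
    moreover have "M * N = (m div N) * N + N + c * N" by (subst c) (simp add: algebra_simps)
    ultimately have "M * N - 1 - m = c * N + (N - 1 - m mod N)" using \<open>m mod N < N\<close> by linarith
    then show ?thesis by (simp add: c)
  qed
  moreover have "N - 1 - m mod N < N" using N by simp
  ultimately show "(M * N - 1 - m) mod N = N - 1 - m mod N" "(M * N - 1 - m) div N = M - 1 - m div N"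
    by simp_all
qed

text \<open>For \<open>j \<le> m\<close> the distribution \<open>qw m j\<close> is the point mass at \<open>j\<close>; it then moves slowly to the uniform
  distribution on the \<open>m\<close> points below \<open>j\<close>, which is almost invariant under translation.\<close>

definition tw :: "nat \<Rightarrow> nat \<Rightarrow> real" where
  "tw m j = min 1 (max 0 ((real j - real m) / real m))"

definition qw :: "nat \<Rightarrow> nat \<Rightarrow> nat \<Rightarrow> real" where
  "qw m j i = (if i = j then 1 - tw m j else if i < j \<and> j \<le> i + m then tw m j / real m else 0)"

lemma tw_bounds: "0 \<le> tw m j" "tw m j \<le> 1"
  by (auto simp: tw_def)

lemma tw_0: "j \<le> m \<Longrightarrow> tw m j = 0"
  by (simp add: tw_def divide_nonpos_nonneg)

lemma tw_1: "0 < m \<Longrightarrow> 2 * m \<le> j \<Longrightarrow> tw m j = 1"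
  by (simp add: tw_def)

lemma tw_Suc: "0 < m \<Longrightarrow> \<bar>tw m (Suc j) - tw m j\<bar> \<le> 1 / real m"
proof -
  assume m: "0 < m"
  define a where "a = (real j - real m) / real m"
  have 1: "(real (Suc j) - real m) / real m = a + 1 / real m" by (simp add: a_def flip: add_divide_distrib)
  have 2: "\<bar>min 1 (max 0 (a + e)) - min 1 (max 0 a)\<bar> \<le> e" if "0 \<le> e" for e
    using that by (auto simp: min_def max_def)
  have "0 \<le> 1 / real m" by simp
  from 2[OF this] show ?thesis unfolding tw_def 1 a_def[symmetric] .
qed

lemma qw_nonneg: "0 \<le> qw m j i"
  using tw_bounds[of m j] by (simp add: qw_def)

lemma qw_point: "j \<le> m \<Longrightarrow> qw m j i = (if i = j then 1 else 0)"
  by (simp add: qw_def tw_0)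

lemma qw_0: "qw m j 0 = (if j = 0 then 1 else 0)"
  by (auto simp: qw_def tw_0)

lemma qw_above: "j < i \<Longrightarrow> qw m j i = 0"
  by (simp add: qw_def)

lemma qw_sum:
  assumes m: "0 < m"
  shows "(\<Sum>i\<le>j. qw m j i) = 1"
proof -
  have "(\<Sum>i\<le>j. qw m j i) = qw m j j + (\<Sum>i<j. qw m j i)"
    by (simp add: lessThan_Suc_atMost[symmetric])
  also have "(\<Sum>i<j. qw m j i) = tw m j"
  proof (cases "j \<le> m")
    case True
    then show ?thesis by (simp add: qw_def tw_0)
  next
    case False
    have "(\<Sum>i<j. qw m j i) = (\<Sum>i\<in>{j - m..<j}. tw m j / real m)"
      by (rule sum.mono_neutral_cong_right) (use False in \<open>auto simp: qw_def\<close>)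
    then show ?thesis using m False by simp
  qed
  finally show ?thesis by (simp add: qw_def)
qed

text \<open>This is the total variation between the distribution of level j + 1, moved down by one,
  and that of level j. The mass at the top changes by at most 1 / m, and each of at most m block
  entries by at most 1 / m^2.\<close>

lemma qw_shift:
  assumes m: "0 < m"
  shows "(\<Sum>i<n. \<bar>qw m (Suc j) (Suc i) - qw m j i\<bar>) \<le> 2 / real m"
proof -
  have "(\<Sum>i<n. \<bar>qw m (Suc j) (Suc i) - qw m j i\<bar>)
      \<le> (\<Sum>i<n. (if i = j then 1 / real m else 0) + (if i \<in> {j - m..<j} then 1 / (real m)\<^sup>2 else 0))"
  proof (rule sum_mono)
    fix i
    have "\<bar>qw m (Suc j) (Suc i) - qw m j i\<bar> = \<bar>tw m (Suc j) - tw m j\<bar>" if "i = j"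
      using that by (simp add: qw_def)
    moreover have "\<bar>qw m (Suc j) (Suc i) - qw m j i\<bar> = \<bar>tw m (Suc j) - tw m j\<bar> / real m" if "i < j" "j \<le> i + m"
      using that m by (simp add: qw_def flip: diff_divide_distrib)
    moreover have "\<bar>tw m (Suc j) - tw m j\<bar> / real m \<le> 1 / (real m)\<^sup>2"
      using divide_right_mono[OF tw_Suc[OF m, of j], of "real m"] by (simp add: power2_eq_square)
    ultimately show "\<bar>qw m (Suc j) (Suc i) - qw m j i\<bar>
        \<le> (if i = j then 1 / real m else 0) + (if i \<in> {j - m..<j} then 1 / (real m)\<^sup>2 else 0)"
      using tw_Suc[OF m, of j] by (auto simp: qw_def)
  qed
  also have "\<dots> \<le> 1 / real m + real m * (1 / (real m)\<^sup>2)"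
    unfolding sum.distrib
  proof (rule add_mono)
    have "(\<Sum>i<n. if i \<in> {j - m..<j} then 1 / (real m)\<^sup>2 else 0) = (\<Sum>i\<in>{..<n} \<inter> {j - m..<j}. 1 / (real m)\<^sup>2)"
      by (rule sum.inter_restrict[symmetric]) simp
    also have "\<dots> \<le> (\<Sum>i\<in>{j - m..<j}. 1 / (real m)\<^sup>2)" by (rule sum_mono2) auto
    also have "\<dots> = real (j - (j - m)) * (1 / (real m)\<^sup>2)" by simp
    also have "\<dots> \<le> real m * (1 / (real m)\<^sup>2)" by (intro mult_right_mono) auto
    finally show "(\<Sum>i<n. if i \<in> {j - m..<j} then 1 / (real m)\<^sup>2 else 0) \<le> real m * (1 / (real m)\<^sup>2)" .
  qed simp
  also have "\<dots> = 2 / real m" using m by (simp add: power2_eq_square)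
  finally show ?thesis .
qed

text \<open>Meant for the index 0: since \<open>s 0 n\<close> fixes it, its distribution has to be
  compared with its own translate. In the uniform regime only the two ends of the block differ, by 1
  / m each.\<close>

lemma qw_loop:
  assumes m: "0 < m" "2 * m \<le> j"
  shows "(\<Sum>i<n. \<bar>qw m j (Suc i) - qw m j i\<bar>) \<le> 2 / real m"
proof -
  have "(\<Sum>i<n. \<bar>qw m j (Suc i) - qw m j i\<bar>)
      \<le> (\<Sum>i<n. (if i = j - 1 then 1 / real m else 0) + (if i = j - m - 1 then 1 / real m else 0))"
  proof (rule sum_mono)
    fix i
    show "\<bar>qw m j (Suc i) - qw m j i\<bar>
        \<le> (if i = j - 1 then 1 / real m else 0) + (if i = j - m - 1 then 1 / real m else 0)"
      using m by (auto simp: qw_def tw_1)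
  qed
  also have "\<dots> \<le> 1 / real m + 1 / real m"
    unfolding sum.distrib by (intro add_mono) auto
  finally show ?thesis by simp
qed

text \<open>The passage from probabilities to amplitudes: total variation controls the squared l2
  distance of the square roots.\<close>

lemma sqrt_diff_sq_le:
  fixes a b :: real
  assumes "0 \<le> a" "0 \<le> b"
  shows "(sqrt a - sqrt b)\<^sup>2 \<le> \<bar>a - b\<bar>"
proof -
  have "\<bar>sqrt a - sqrt b\<bar> * \<bar>sqrt a - sqrt b\<bar> \<le> \<bar>sqrt a - sqrt b\<bar> * \<bar>sqrt a + sqrt b\<bar>"
  proof (rule mult_left_mono)
    have "0 \<le> sqrt a" "0 \<le> sqrt b" using assms by auto
    then show "\<bar>sqrt a - sqrt b\<bar> \<le> \<bar>sqrt a + sqrt b\<bar>" by linarith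
  qed simp
  also have "\<dots> = \<bar>(sqrt a - sqrt b) * (sqrt a + sqrt b)\<bar>" by (simp add: abs_mult)
  also have "(sqrt a - sqrt b) * (sqrt a + sqrt b) = a - b" using assms by (simp add: algebra_simps)
  finally show ?thesis by (simp add: power2_eq_square flip: abs_mult)
qed

section \<open>Digit counts and level amplitudes\<close>

locale finite_sections =
  fixes N :: nat
  assumes N2: "2 \<le> N"
begin

lemma N_pos: "0 < N" and N_gt1: "1 < N"
  using N2 by auto

lemma N_pow_pos: "0 < N ^ k"
  using N_pos by simp

text \<open>The number of base-N digits, where 0 has none. An index r below N^n thus has n - len r
  leading zeros among n digits, and the index 0 has the highest level n.\<close>

definition len :: "nat \<Rightarrow> nat" where "len r = (LEAST t. r < N ^ t)"

lemma less_N_pow: "k < N ^ k"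
proof -
  have "k < 2 ^ k" by (rule less_exp)
  also have "(2::nat) ^ k \<le> N ^ k" using N2 by (rule power_mono) simp
  finally show ?thesis .
qed

lemma len_le_iff: "len r \<le> t \<longleftrightarrow> r < N ^ t"
proof
  have "r < N ^ len r" unfolding len_def by (rule LeastI[of _ r]) (rule less_N_pow)
  also assume "len r \<le> t"
  then have "N ^ len r \<le> N ^ t" using N_pos by (intro power_increasing) auto
  finally show "r < N ^ t" .
qed (auto simp: len_def intro: Least_le)

lemma len_0: "len 0 = 0"
  using len_le_iff[of 0 0] by simp

lemma len_digit:
  assumes "d < N" "0 < r * N + d"
  shows "len (r * N + d) = Suc (len r)"
proof -
  have "len (r * N + d) \<le> t \<longleftrightarrow> Suc (len r) \<le> t" for t
  proof (cases t)
    case 0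
    then show ?thesis using assms len_le_iff[of "r * N + d" 0] by simp
  next
    case (Suc t')
    have "r * N + d < N ^ t' * N \<longleftrightarrow> r < N ^ t'"
    proof
      assume "r * N + d < N ^ t' * N"
      then have "r * N < N ^ t' * N" by linarith
      then show "r < N ^ t'" by simp
    next
      assume "r < N ^ t'"
      then have "(r + 1) * N \<le> N ^ t' * N" by (intro mult_right_mono) auto
      then show "r * N + d < N ^ t' * N" using assms(1) by simp
    qed
    then show ?thesis by (simp add: Suc len_le_iff mult.commute)
  qed
  then show ?thesis by (metis order_refl antisym)
qed

text \<open>The square root of the probability of level i for the index r. The spread n div 2 tends
  to infinity, leaves each fixed level a point mass for large n, and is at most half of n, which
  puts the index 0 into the uniform regime.\<close>

definition cw :: "nat \<Rightarrow> nat \<Rightarrow> nat \<Rightarrow> real" where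
  "cw n i r = sqrt (qw (n div 2) (n - len r) i)"

lemma cw_shift:
  assumes n: "2 \<le> n" and d: "d < N" and r: "r * N + d < N ^ n"
  shows "(\<Sum>i<n. (cw n (Suc i) r - cw n i (r * N + d))\<^sup>2) \<le> 2 / real (n div 2)"
proof -
  let ?m = "n div 2"
  have m: "0 < ?m" "2 * ?m \<le> n" using n by auto
  have "(\<Sum>i<n. (cw n (Suc i) r - cw n i (r * N + d))\<^sup>2)
      \<le> (\<Sum>i<n. \<bar>qw ?m (n - len r) (Suc i) - qw ?m (n - len (r * N + d)) i\<bar>)"
    unfolding cw_def by (intro sum_mono sqrt_diff_sq_le qw_nonneg)
  also have "\<dots> \<le> 2 / real ?m"
  proof (cases "r * N + d = 0")
    case True
    then have "r = 0" using N_pos by simp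
    then show ?thesis using True qw_loop[OF m] by (simp add: len_0)
  next
    case False
    then have l: "len (r * N + d) = Suc (len r)" by (intro len_digit d) simp
    moreover have "Suc (len r) \<le> n" using r len_le_iff[of "r * N + d" n] l by simp
    then have "n - len r = Suc (n - Suc (len r))" by simp
    ultimately show ?thesis using qw_shift[OF m(1), of "n - Suc (len r)" n] by simp
  qed
  finally show ?thesis .
qed

text \<open>Only the index 0 has level n, and by then its point mass has moved away completely. This
  is what allows \<open>U n\<close> to use only the levels below n.\<close>

lemma cw_top: "2 \<le> n \<Longrightarrow> cw n n r = 0"
proof -
  assume n: "2 \<le> n"
  show ?thesis
  proof (cases "len r = 0")
    case True
    have "tw (n div 2) n = 1" using n by (intro tw_1) auto
    then show ?thesis by (simp add: cw_def True qw_def)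
  next
    case False
    then show ?thesis using n by (simp add: cw_def qw_above)
  qed
qed

text \<open>Spreading never reaches level 0: a level j spreads only if j exceeds n div 2, and then
  at most n div 2 steps down. What remains at level 0 are the indices without leading zeros, at full
  weight.\<close>

lemma cw_0: "cw n 0 r = (if r < N ^ n \<and> N ^ (n - 1) \<le> r \<or> N ^ n \<le> r then 1 else 0)" if "1 \<le> n"
proof -
  have "n - len r = 0 \<longleftrightarrow> \<not> len r \<le> n - 1" using that by auto
  also have "\<dots> \<longleftrightarrow> N ^ (n - 1) \<le> r" by (simp add: len_le_iff not_less)
  finally have *: "n - len r = 0 \<longleftrightarrow> N ^ (n - 1) \<le> r" .
  have "N ^ (n - 1) \<le> N ^ n" using N_pos by (intro power_increasing) auto
  then show ?thesis using * by (auto simp: cw_def qw_0)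
qed

lemma cw_sum:
  assumes n: "2 \<le> n" and r: "r < N ^ n"
  shows "(\<Sum>i<n. (cw n i r)\<^sup>2) = 1"
proof -
  let ?m = "n div 2" and ?j = "n - len r"
  have m: "0 < ?m" using n by auto
  have "(\<Sum>i<n. (cw n i r)\<^sup>2) = (\<Sum>i<Suc n. (cw n i r)\<^sup>2)" by (simp add: cw_top[OF n])
  also have "\<dots> = (\<Sum>i<Suc n. qw ?m ?j i)" by (simp add: cw_def qw_nonneg)
  also have "\<dots> = (\<Sum>i\<le>?j. qw ?m ?j i)"
    by (rule sum.mono_neutral_right) (auto simp: qw_above)
  also have "\<dots> = 1" by (rule qw_sum[OF m])
  finally show ?thesis .
qed

lemma digit_eq: "c < N \<Longrightarrow> k = m * N + c \<longleftrightarrow> k mod N = c \<and> k div N = m"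
  by (auto simp: mult.commute)

lemma compl_digit_iff: "a < N \<Longrightarrow> d < N \<Longrightarrow> N - 1 - a = d \<longleftrightarrow> a = N - 1 - d"
  by arith

section \<open>Finite sections of the generators and the maps U n\<close>

definition s :: "nat \<Rightarrow> nat \<Rightarrow> l2_op" where
  "s d n = P (N ^ n) o\<^sub>L S N d o\<^sub>L P (N ^ n)"

definition s' :: "nat \<Rightarrow> nat \<Rightarrow> l2_op" where
  "s' d n = P (N ^ n) o\<^sub>L cadjoint (S N d) o\<^sub>L P (N ^ n)"

text \<open>A new last digit d costs one leading zero and, after reflection of the index, shows up
  as the digit N - 1 - d. Hence the limit of \<open>s d\<close> lowers the level and applies
  \<open>S N (N - 1 - d)\<close> inside it.\<close>

definition T :: "nat \<Rightarrow> l2 ell2 \<Rightarrow>\<^sub>L l2 ell2" where "T d = bsh (S N (N - 1 - d))"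

definition T' :: "nat \<Rightarrow> l2 ell2 \<Rightarrow>\<^sub>L l2 ell2" where "T' d = fsh (cadjoint (S N (N - 1 - d)))"

lemma adj_T: "adj (T d) (T' d)"
  unfolding T_def T'_def by (rule adj_bsh_fsh[OF adj_S])

lemma adj_s: "adj (s d n) (s' d n)"
  unfolding s_def s'_def using adj_compose[OF adj_compose[OF adj_P adj_S] adj_P]
  by (simp only: blinfun_compose_assoc)

lemma coord_s: "coord (s d n x) k = (if k < N ^ n \<and> k mod N = d then coord x (k div N) else 0)"
proof -
  have "k div N < N ^ n" if "k < N ^ n" using that by (meson div_le_dividend le_less_trans)
  then show ?thesis by (auto simp: s_def coord_P coord_S)
qed

lemma coord_s': "d < N \<Longrightarrow> coord (s' d n x) r = (if r * N + d < N ^ n then coord x (r * N + d) else 0)"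
proof -
  assume d: "d < N"
  have "r < N ^ n" if "r * N + d < N ^ n"
  proof -
    have "r \<le> r * N" using N_pos by simp
    then show ?thesis using that by linarith
  qed
  then show ?thesis using d by (auto simp: s'_def coord_P coord_cadjoint_S)
qed

definition FU :: "nat \<Rightarrow> (nat \<times> nat) set" where
  "FU n = {(i, m). i < n \<and> m < N ^ (n - i)}"

definition hU :: "nat \<Rightarrow> nat \<Rightarrow> nat \<Rightarrow> nat" where
  "hU n i m = N ^ (n - i) - 1 - m"

lemma hU_less: "hU n i m < N ^ n"
proof -
  have "N ^ (n - i) \<le> N ^ n" using N_pos by (intro power_increasing) auto
  then show ?thesis using N_pow_pos[of "n - i"] unfolding hU_def by linarith
qed

text \<open>The level of an index \<open>r\<close> is the number of leading zeros among its \<open>n\<close> base-\<open>N\<close> digits. \<open>U n\<close> sends \<open>ket r\<close>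
  to a combination of the vectors \<open>E i (N ^ (n - i) - 1 - r)\<close> with weights concentrated at \<open>i =\<close> level of \<open>r\<close>
  for small levels, and spread out for large levels.\<close>

definition U :: "nat \<Rightarrow> l2 \<Rightarrow>\<^sub>L l2 ell2" where
  "U n = wc (FU n) (\<lambda>i m. cw n i (hU n i m)) (hU n)"

definition U' :: "nat \<Rightarrow> l2 ell2 \<Rightarrow>\<^sub>L l2" where
  "U' n = wr (FU n) (\<lambda>i m. cw n i (hU n i m)) (hU n)"

lemma adj_U: "adj (U n) (U' n)"
  unfolding U_def U'_def by (rule adj_wc_wr)

lemma finite_triangle: "finite {(i, m). i \<le> n \<and> m < f i}" for f :: "nat \<Rightarrow> nat"
proof -
  have "{(i, m). i \<le> n \<and> m < f i} = Sigma {..n} (\<lambda>i. {..<f i})" by auto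
  then show ?thesis by simp
qed

lemma finite_FU: "finite (FU n)"
  by (rule finite_subset[OF _ finite_triangle[of n "\<lambda>i. N ^ (n - i)"]]) (auto simp: FU_def)

lemma coord_U: "coord (coord (U n x) i) m =
    (if i < n \<and> m < N ^ (n - i) then of_real (cw n i (hU n i m)) * coord x (hU n i m) else 0)"
  unfolding U_def by (subst coord_wc[OF finite_FU]) (auto simp: FU_def)

text \<open>The fibre of r meets every level i with r < N^(n - i) exactly once. The other levels
  carry zero amplitude for r, so the squared weights add up to 1 by \<open>cw_sum\<close>.\<close>

lemma U_isometric:
  assumes n: "2 \<le> n" and x: "x \<in> range (P (N ^ n))"
  shows "norm (U n x) = norm x"
proof -
  let ?h = "\<lambda>p. hU n (fst p) (snd p)"
  have fib: "(\<Sum>p\<in>{p\<in>FU n. ?h p = r}. (cw n (fst p) (?h p))\<^sup>2) = 1" if r: "r < N ^ n" for r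
  proof -
    let ?f = "\<lambda>i. (i, N ^ (n - i) - 1 - r)"
    have eq: "{p\<in>FU n. ?h p = r} = ?f ` {i. i < n \<and> r < N ^ (n - i)}"
    proof (rule Set.set_eqI, rule iffI)
      fix p assume "p \<in> {p\<in>FU n. ?h p = r}"
      then show "p \<in> ?f ` {i. i < n \<and> r < N ^ (n - i)}"
        by (intro image_eqI[of _ _ "fst p"]) (auto simp: FU_def hU_def)
    qed (auto simp: FU_def hU_def)
    have "(\<Sum>p\<in>{p\<in>FU n. ?h p = r}. (cw n (fst p) (?h p))\<^sup>2) = (\<Sum>p\<in>{p\<in>FU n. ?h p = r}. (cw n (fst p) r)\<^sup>2)"
      by (intro sum.cong) auto
    also have "\<dots> = (\<Sum>i\<in>{i. i < n \<and> r < N ^ (n - i)}. (cw n i r)\<^sup>2)"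
      unfolding eq by (subst sum.reindex) (auto simp: inj_on_def)
    also have "\<dots> = (\<Sum>i<n. (cw n i r)\<^sup>2)"
    proof (rule sum.mono_neutral_left)
      show "\<forall>i\<in>{..<n} - {i. i < n \<and> r < N ^ (n - i)}. (cw n i r)\<^sup>2 = 0"
      proof
        fix i assume "i \<in> {..<n} - {i. i < n \<and> r < N ^ (n - i)}"
        then have "\<not> len r \<le> n - i" "i < n" by (auto simp: len_le_iff)
        moreover have "len r \<le> n" using r by (simp add: len_le_iff)
        ultimately have "n - len r < i" by linarith
        then show "(cw n i r)\<^sup>2 = 0" by (simp add: cw_def qw_above)
      qed
    qed auto
    also have "\<dots> = 1" by (rule cw_sum[OF n r])
    finally show ?thesis .
  qed
  have img: "?h ` FU n = {..<N ^ n}"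
  proof
    show "?h ` FU n \<subseteq> {..<N ^ n}" using hU_less by auto
    show "{..<N ^ n} \<subseteq> ?h ` FU n"
    proof
      fix r assume "r \<in> {..<N ^ n}"
      then show "r \<in> ?h ` FU n" using n
        by (intro image_eqI[of _ _ "(0, N ^ n - 1 - r)"]) (auto simp: FU_def hU_def)
    qed
  qed
  have "(norm (U n x))\<^sup>2 = (\<Sum>r<N ^ n. (\<Sum>p\<in>{p\<in>FU n. ?h p = r}. (cw n (fst p) (?h p))\<^sup>2) * (cmod (coord x r))\<^sup>2)"
    unfolding U_def norm_wc_group[OF finite_FU] img by simp
  also have "\<dots> = (\<Sum>r<N ^ n. (cmod (coord x r))\<^sup>2)"
  proof (rule sum.cong[OF refl])
    fix r assume "r \<in> {..<N ^ n}"
    then have "r < N ^ n" by simp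
    then show "(\<Sum>p\<in>{p\<in>FU n. ?h p = r}. (cw n (fst p) (?h p))\<^sup>2) * (cmod (coord x r))\<^sup>2
        = (cmod (coord x r))\<^sup>2" by (simp only: fib mult_1_left)
  qed
  also have "\<dots> = (norm x)\<^sup>2"
  proof (rule norm_ell2_finite[symmetric])
    fix k assume "k \<notin> {..<N ^ n}"
    have "coord x k = coord (P (N ^ n) x) k" using x by (simp add: coord_P_range)
    also have "\<dots> = 0" using \<open>k \<notin> {..<N ^ n}\<close> by (simp add: coord_P)
    finally show "coord x k = 0" .
  qed simp
  finally show ?thesis by (simp add: power2_eq_iff_nonneg)
qed

lemma U_P: "U n o\<^sub>L P (N ^ n) = U n"
proof (rule blinfun_eqI, rule K_eqI)
  fix x i m
  show "coord (coord ((U n o\<^sub>L P (N ^ n)) x) i) m = coord (coord (U n x) i) m"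
    by (simp add: coord_U coord_P hU_less)
qed

lemma norm_U_le:
  assumes n: "2 \<le> n"
  shows "norm (U n) \<le> 1"
proof (rule norm_blinfun_bound)
  fix x
  have "norm (U n x) = norm (U n (P (N ^ n) x))" using U_P by (metis blinfun_apply_blinfun_compose)
  also have "\<dots> = norm (P (N ^ n) x)" by (rule U_isometric[OF n]) simp
  also have "\<dots> \<le> norm (P (N ^ n)) * norm x" by (rule norm_blinfun)
  also have "\<dots> \<le> 1 * norm x" by (rule mult_right_mono[OF norm_P_le]) simp
  finally show "norm (U n x) \<le> 1 * norm x" .
qed simp

text \<open>Both products relabel coordinates in the same way and differ only in amplitude, so their
  difference is again of the form \<open>wc\<close>, with fibre sums bounded by
  \<open>cw_shift\<close>.\<close>

lemma U_s_commutator: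
  assumes n: "2 \<le> n" and d: "d < N"
  shows "norm ((U n o\<^sub>L s d n) - (T d o\<^sub>L U n)) \<le> sqrt (2 / real (n div 2))"
proof -
  \<comment> \<open>The condition on the last digit of m says that the index \<open>hU n i m\<close>
    ends with the digit d.\<close>
  define F where "F = {(i, m). i < n \<and> m < N ^ (n - i) \<and> m mod N = N - 1 - d}"
  define h where "h i m = hU n i m div N" for i m
  define k where "k i m = cw n i (hU n i m) - cw n (Suc i) (h i m)" for i m
  have F: "finite F"
    by (rule finite_subset[OF _ finite_FU]) (auto simp: F_def FU_def)
  have dm: "hU n i m mod N = N - 1 - m mod N" "hU n i m div N = N ^ (n - Suc i) - 1 - m div N"
    if "i < n" "m < N ^ (n - i)" for i m
  proof -
    have e: "N ^ (n - i) = N ^ (n - Suc i) * N"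
      using that(1) by (metis Suc_diff_Suc power_Suc2)
    then have "m < N ^ (n - Suc i) * N" using that(2) by simp
    from refl_divmod[OF this] show "hU n i m mod N = N - 1 - m mod N"
      "hU n i m div N = N ^ (n - Suc i) - 1 - m div N"
      by (simp_all add: hU_def e)
  qed
  have "(U n o\<^sub>L s d n) - (T d o\<^sub>L U n) = wc F k h"
  proof (rule blinfun_eqI, rule K_eqI)
    fix x i m
    have a: "coord (coord (U n (s d n x)) i) m =
        (if (i, m) \<in> F then of_real (cw n i (hU n i m)) * coord x (h i m) else 0)"
    proof (cases "i < n \<and> m < N ^ (n - i)")
      case True
      note hU_less[of n i m]
      moreover have "hU n i m mod N = d \<longleftrightarrow> m mod N = N - 1 - d"
        using dm(1)[of i m] True compl_digit_iff[OF mod_less_divisor[OF N_pos, of m] d] by simp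
      ultimately show ?thesis using True by (simp add: coord_U coord_s F_def h_def)
    qed (auto simp: coord_U F_def)
    have b: "coord (coord (T d (U n x)) i) m =
        (if (i, m) \<in> F then of_real (cw n (Suc i) (h i m)) * coord x (h i m) else 0)"
    proof (cases "m mod N = N - 1 - d")
      case True
      have *: "coord (coord (T d (U n x)) i) m = coord (coord (U n x) (Suc i)) (m div N)"
        using True by (simp add: T_def coord_bsh coord_S)
      show ?thesis
      proof (cases "i < n")
        case i: True
        have e: "N ^ (n - i) = N ^ (n - Suc i) * N" using i by (metis Suc_diff_Suc power_Suc2)
        have mm: "m div N < N ^ (n - Suc i) \<longleftrightarrow> m < N ^ (n - i)"
          unfolding e using N_pos by (simp add: div_less_iff_less_mult)
        show ?thesis
        proof (cases "m < N ^ (n - i)")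
          case m: True
          have hh: "hU n (Suc i) (m div N) = h i m"
            using dm(2)[OF i m] by (simp add: h_def hU_def)
          show ?thesis
          proof (cases "Suc i < n")
            case True
            then show ?thesis using * mm m i \<open>m mod N = N - 1 - d\<close> by (simp add: coord_U F_def hh)
          next
            \<comment> \<open>Here \<open>T d (U n x)\<close> asks for level n, which
              \<open>U n\<close> does not have; by \<open>cw_top\<close> nothing is lost.\<close>
            case False
            then have "n = Suc i" using i by simp
            then show ?thesis using * cw_top[OF n] by (simp add: coord_U)
          qed
        qed (use * mm in \<open>auto simp: coord_U F_def\<close>)
      qed (use * in \<open>auto simp: coord_U F_def\<close>)
    next
      case False
      then show ?thesis by (simp add: T_def coord_bsh coord_S F_def)
    qed
    show "coord (coord (((U n o\<^sub>L s d n) - (T d o\<^sub>L U n)) x) i) m = coord (coord (wc F k h x) i) m"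
      by (simp add: blinfun.diff_left a b coord_wc[OF F] k_def left_diff_distrib)
  qed
  moreover have "norm (wc F k h) \<le> sqrt (2 / real (n div 2))"
  proof (rule norm_wc_le[OF F])
    fix r
    have fib: "r * N + d < N ^ (n - i) \<and> m = N ^ (n - i) - 1 - (r * N + d) \<and> hU n i m = r * N + d"
      if "(i, m) \<in> F" "h i m = r" for i m
    proof -
      have im: "i < n" "m < N ^ (n - i)" "m mod N = N - 1 - d" using that(1) by (auto simp: F_def)
      have "hU n i m mod N = d" using dm(1)[OF im(1,2)] im(3) d by simp
      then have "hU n i m = r * N + d" using that(2) by (metis h_def div_mult_mod_eq)
      then show ?thesis using im(2) by (auto simp: hU_def)
    qed
    show "(\<Sum>p\<in>{p \<in> F. h (fst p) (snd p) = r}. (k (fst p) (snd p))\<^sup>2) \<le> (sqrt (2 / real (n div 2)))\<^sup>2"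
    proof (cases "r * N + d < N ^ n")
      case True
      have "(\<Sum>p\<in>{p \<in> F. h (fst p) (snd p) = r}. (k (fst p) (snd p))\<^sup>2)
          \<le> (\<Sum>i<n. (cw n (Suc i) r - cw n i (r * N + d))\<^sup>2)"
      proof (rule fiber_sum_le[OF F, where f = "\<lambda>i. N ^ (n - i) - 1 - (r * N + d)"])
        fix i m assume p: "(i, m) \<in> F" "h i m = r"
        then show "i \<in> {..<n} \<and> m = N ^ (n - i) - 1 - (r * N + d)
            \<and> (k i m)\<^sup>2 \<le> (cw n (Suc i) r - cw n i (r * N + d))\<^sup>2"
          using fib[OF p] by (auto simp: k_def F_def power2_commute)
      qed auto
      also have "\<dots> \<le> 2 / real (n div 2)" by (rule cw_shift[OF n d True])
      finally show ?thesis by simp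
    next
      case False
      have "N ^ (n - i) \<le> N ^ n" for i using N_pos by (intro power_increasing) auto
      then have e: "{p \<in> F. h (fst p) (snd p) = r} = {}" using fib False by (force intro: less_le_trans)
      show ?thesis unfolding e by simp
    qed
  qed simp
  ultimately show ?thesis by simp
qed

text \<open>A separate computation, because taking adjoints in the previous estimate yields a
  statement about \<open>U' n\<close> and not about \<open>U n\<close>.\<close>

lemma U_s'_commutator:
  assumes n: "2 \<le> n" and d: "d < N"
  shows "norm ((U n o\<^sub>L s' d n) - (T' d o\<^sub>L U n)) \<le> sqrt (2 / real (n div 2))"
proof -
  define F where "F = {(i, m). 1 \<le> i \<and> i \<le> n \<and> m < N ^ (n - i)}"
  define h where "h i m = hU n i m * N + d" for i m
  define k where "k i m = cw n i (hU n i m) - cw n (i - 1) (h i m)" for i m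
  have F: "finite F"
    by (rule finite_subset[OF _ finite_triangle[of n "\<lambda>i. N ^ (n - i)"]]) (auto simp: F_def)
  have h_less: "h i m < N ^ (n - (i - 1))" if "1 \<le> i" "i \<le> n" "m < N ^ (n - i)" for i m
  proof -
    have "(hU n i m + 1) * N \<le> N ^ (n - i) * N" using that(3) by (intro mult_right_mono) (auto simp: hU_def)
    also have "\<dots> = N ^ (n - (i - 1))"
    proof -
      have "n - (i - 1) = Suc (n - i)" using that(1,2) by simp
      then show ?thesis by simp
    qed
    finally show ?thesis using d by (simp add: h_def)
  qed
  have pw: "N ^ (n - i) \<le> N ^ n" for i using N_pos by (intro power_increasing) auto
  have "(U n o\<^sub>L s' d n) - (T' d o\<^sub>L U n) = wc F k h"
  proof (rule blinfun_eqI, rule K_eqI)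
    fix x i m
    show "coord (coord (((U n o\<^sub>L s' d n) - (T' d o\<^sub>L U n)) x) i) m = coord (coord (wc F k h x) i) m"
    proof (cases i)
      \<comment> \<open>Removing a digit leaves at least one leading zero, so \<open>s' d n\<close>
        produces nothing at level 0, in agreement with the forward shift.\<close>
      case 0
      have "coord (coord (U n (s' d n x)) 0) m = 0"
      proof (cases "m < N ^ n \<and> hU n 0 m * N + d < N ^ n")
        case True
        then have "len (hU n 0 m * N + d) \<le> n" by (simp add: len_le_iff)
        then have "hU n 0 m < N ^ (n - 1)"
        proof (cases "hU n 0 m * N + d = 0")
          case True
          then show ?thesis using N_pos N_pow_pos by simp
        next
          case False
          then have "len (hU n 0 m * N + d) = Suc (len (hU n 0 m))" by (intro len_digit d) simp
          with \<open>len (hU n 0 m * N + d) \<le> n\<close> have "len (hU n 0 m) \<le> n - 1" by simp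
          then show ?thesis by (simp add: len_le_iff)
        qed
        moreover have "hU n 0 m < N ^ n" using True by (auto simp: hU_def)
        ultimately show ?thesis using n by (simp add: coord_U cw_0)
      qed (use d in \<open>auto simp: coord_U coord_s'\<close>)
      moreover have "(0, m) \<notin> F" by (simp add: F_def)
      ultimately show ?thesis using 0 by (simp add: blinfun.diff_left T'_def coord_fsh coord_wc[OF F])
    next
      case (Suc i')
      have a: "coord (coord (U n (s' d n x)) i) m =
          (if (i, m) \<in> F then of_real (cw n i (hU n i m)) * coord x (h i m) else 0)"
      proof (cases "i < n \<and> m < N ^ (n - i)")
        case True
        then have "h i m < N ^ n" using h_less[of i m] Suc pw[of "i - 1"] by auto
        then show ?thesis using True Suc d by (simp add: coord_U coord_s' F_def h_def)
      next
        case False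
        then show ?thesis using cw_top[OF n] by (auto simp: coord_U F_def)
      qed
      have b: "coord (coord (T' d (U n x)) i) m =
          (if (i, m) \<in> F then of_real (cw n i' (h i m)) * coord x (h i m) else 0)"
      proof -
        have "N - 1 - d < N" using N_pos by simp
        then have *: "coord (coord (T' d (U n x)) i) m = coord (coord (U n x) i') (m * N + (N - 1 - d))"
          by (simp add: Suc T'_def coord_fsh coord_cadjoint_S)
        show ?thesis
        proof (cases "i' < n")
          case True
          have e: "N ^ (n - i') = N ^ (n - i) * N" using True Suc by (metis Suc_diff_Suc power_Suc2)
          have iff: "m * N + (N - 1 - d) < N ^ (n - i') \<longleftrightarrow> m < N ^ (n - i)"
          proof
            assume "m * N + (N - 1 - d) < N ^ (n - i')"
            then have "m * N < N ^ (n - i) * N" unfolding e by linarith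
            then show "m < N ^ (n - i)" by simp
          next
            assume "m < N ^ (n - i)"
            then have "(m + 1) * N \<le> N ^ (n - i) * N" by (intro mult_right_mono) auto
            then show "m * N + (N - 1 - d) < N ^ (n - i')" unfolding e using N_pos by simp
          qed
          have hh: "hU n i' (m * N + (N - 1 - d)) = h i m" if m: "m < N ^ (n - i)"
          proof -
            obtain c where c: "N ^ (n - i) = m + 1 + c" using m
              by (metis Suc_eq_plus1 add_Suc_right less_iff_Suc_add add.assoc plus_1_eq_Suc)
            show ?thesis unfolding hU_def h_def e c using d by (simp add: algebra_simps)
          qed
          show ?thesis using True * iff hh Suc by (auto simp: coord_U F_def)
        next
          case False
          then show ?thesis using * Suc by (auto simp: coord_U F_def)
        qed
      qed
      have "i - 1 = i'" using Suc by simp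
      then show ?thesis
        by (simp add: blinfun.diff_left a b coord_wc[OF F] k_def left_diff_distrib)
    qed
  qed
  moreover have "norm (wc F k h) \<le> sqrt (2 / real (n div 2))"
  proof (rule norm_wc_le[OF F])
    fix r'
    show "(\<Sum>p\<in>{p \<in> F. h (fst p) (snd p) = r'}. (k (fst p) (snd p))\<^sup>2) \<le> (sqrt (2 / real (n div 2)))\<^sup>2"
    proof (cases "r' < N ^ n \<and> r' mod N = d")
      case True
      define r where "r = r' div N"
      have r: "r' = r * N + d" using True by (metis r_def div_mult_mod_eq)
      have "(\<Sum>p\<in>{p \<in> F. h (fst p) (snd p) = r'}. (k (fst p) (snd p))\<^sup>2)
          \<le> (\<Sum>i\<in>{1..n}. (cw n i r - cw n (i - 1) (r * N + d))\<^sup>2)"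
      proof (rule fiber_sum_le[OF F, where f = "\<lambda>i. N ^ (n - i) - 1 - r"])
        fix i m assume p: "(i, m) \<in> F" "h i m = r'"
        have "hU n i m = r" using p(2) r N_pos by (simp add: h_def)
        then show "i \<in> {1..n} \<and> m = N ^ (n - i) - 1 - r
            \<and> (k i m)\<^sup>2 \<le> (cw n i r - cw n (i - 1) (r * N + d))\<^sup>2"
          using p r by (auto simp: k_def F_def hU_def)
      qed auto
      also have "\<dots> = (\<Sum>i<n. (cw n (Suc i) r - cw n i (r * N + d))\<^sup>2)"
        by (rule sum.reindex_bij_witness[of _ Suc "\<lambda>i. i - 1"]) auto
      also have "\<dots> \<le> 2 / real (n div 2)" using True r by (intro cw_shift[OF n d]) simp
      finally show ?thesis by simp
    next
      case False
      have "h i m < N ^ n \<and> h i m mod N = d" if "(i, m) \<in> F" for i m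
        using h_less[of i m] that pw[of "i - 1"] d by (auto simp: F_def h_def intro: less_le_trans)
      then have e: "{p \<in> F. h (fst p) (snd p) = r'} = {}" using False by force
      show ?thesis unfolding e by simp
    qed
  qed simp
  ultimately show ?thesis by simp
qed

text \<open>Level 0 carries unsmeared weights, so the first component of \<open>U n\<close> is
  exactly a reflection of the block of n-digit indices. This ties \<open>U n\<close> to the
  definition of \<open>W00\<close>.\<close>

lemma prj_U: "1 \<le> n \<Longrightarrow> prj 0 o\<^sub>L U n = R (N ^ n) o\<^sub>L (P (N ^ n) - P (N ^ (n - 1)))"
proof (rule blinfun_eqI, rule ell2_eqI)
  fix x m assume n: "1 \<le> n"
  have "N ^ (n - 1) \<le> N ^ n" using N_pos by (intro power_increasing) auto
  then show "coord ((prj 0 o\<^sub>L U n) x) m = coord ((R (N ^ n) o\<^sub>L (P (N ^ n) - P (N ^ (n - 1)))) x) m"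
    using n by (auto simp: coord_U coord_R coord_P blinfun.diff_left hU_def cw_0)
qed

text \<open>The threshold puts level i below n div 2, where the weights are point masses, and keeps
  m so small that the reflected index has exactly n - i digits.\<close>

lemma U_U'_E:
  assumes n: "2 * (i + m + 1) \<le> n"
  shows "U n (U' n (E i m)) = E i m"
proof -
  define r where "r = N ^ (n - i) - 1 - m"
  have big: "m < N ^ (n - Suc i)"
  proof -
    have "m < n - Suc i" using n by simp
    also have "\<dots> < N ^ (n - Suc i)" by (rule less_N_pow)
    finally show ?thesis .
  qed
  have e: "N ^ (n - i) = N ^ (n - Suc i) * N" 
  proof -
    have "n - i = Suc (n - Suc i)" using n by simp
    then show ?thesis by simp
  qed
  have r: "N ^ (n - Suc i) \<le> r" "r < N ^ (n - i)" "m < N ^ (n - i)"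
  proof -
    have "2 * N ^ (n - Suc i) \<le> N ^ (n - i)" unfolding e using N2 by simp
    then show "N ^ (n - Suc i) \<le> r" "r < N ^ (n - i)" "m < N ^ (n - i)" using big by (auto simp: r_def)
  qed
  have len: "len r = n - i"
    using r len_le_iff[of r "n - i"] len_le_iff[of r "n - Suc i"] by linarith
  have c: "cw n i' r = (if i' = i then 1 else 0)" for i'
    using n by (simp add: cw_def len qw_point)
  have im: "(i, m) \<in> FU n" using r n by (auto simp: FU_def)
  have "U' n (E i m) = (\<Sum>p\<in>FU n. if p = (i, m) then of_real (cw n i r) *\<^sub>C ket r else 0)"
    unfolding U'_def wr_apply
    by (intro sum.cong refl) (auto simp: prod_eq_iff r_def hU_def)
  also have "\<dots> = ket r" using im finite_FU c by simp
  finally have u: "U' n (E i m) = ket r" .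
  show ?thesis
  proof (unfold u, rule K_eqI)
    fix i' m'
    have "hU n i' m' = r \<longleftrightarrow> m' = m" if "i' = i" "m' < N ^ (n - i)"
      unfolding hU_def r_def that(1) by (rule diff_less_cancel[OF that(2) r(3)])
    then show "coord (coord (U n (ket r)) i') m' = coord (coord (E i m) i') m'"
      using c r n by (auto simp: coord_U)
  qed
qed

section \<open>Many orthogonal copies of the low levels\<close>

definition FY :: "nat \<Rightarrow> (nat \<times> nat) set" where
  "FY q = {(i, m). i \<le> q \<and> m < N ^ (q - i)}"

text \<open>The index whose digits are those of g followed by the complement of m written with q - i
  digits. If g has n - q digits, the index has n - i digits and therefore level i.\<close>

definition hY :: "nat \<Rightarrow> nat \<Rightarrow> nat \<Rightarrow> nat \<Rightarrow> nat" where
  "hY q g i m = (g + 1) * N ^ (q - i) - 1 - m"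

text \<open>\<open>Y q g\<close> is a copy of the embedding of low levels in which the leading digits \<open>N - 1\<close> are
  replaced by those of \<open>g\<close>. It supplies the multiplicity needed for part (a).\<close>

definition Y :: "nat \<Rightarrow> nat \<Rightarrow> l2 ell2 \<Rightarrow>\<^sub>L l2" where "Y q g = wr (FY q) (\<lambda>_ _. 1) (hY q g)"

definition Y' :: "nat \<Rightarrow> nat \<Rightarrow> l2 \<Rightarrow>\<^sub>L l2 ell2" where "Y' q g = wc (FY q) (\<lambda>_ _. 1) (hY q g)"

lemma adj_Y: "adj (Y q g) (Y' q g)"
  unfolding Y_def Y'_def by (rule adj_sym[OF adj_wc_wr])

lemma finite_FY: "finite (FY q)"
  unfolding FY_def by (rule finite_triangle)

lemma hY_range: "(i, m) \<in> FY q \<Longrightarrow> g * N ^ (q - i) \<le> hY q g i m \<and> hY q g i m < (g + 1) * N ^ (q - i)"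
  by (auto simp: FY_def hY_def)

text \<open>Since g is nonzero, indices belonging to different levels have different numbers of
  digits; at a fixed level the formula is a reflection.\<close>

lemma hY_inj:
  assumes g: "0 < g" and p: "(i, m) \<in> FY q" "(i', m') \<in> FY q" and eq: "hY q g i m = hY q g i' m'"
  shows "i = i' \<and> m = m'"
proof -
  have no: False if "i < i'" "(i, m) \<in> FY q" "(i', m') \<in> FY q" "hY q g i m = hY q g i' m'" for i m i' m'
  proof -
    have "g + 1 \<le> g * N" using g N2 by (metis Suc_eq_plus1 Suc_leI less_1_mult less_le_trans mult.commute nat_mult_less_cancel_disj nat_mult_1 numeral_2_eq_2 Suc_1 lessI)
    then have "(g + 1) * N ^ (q - i') \<le> g * N * N ^ (q - i')" by (rule mult_right_mono) simp
    also have "\<dots> = g * N ^ Suc (q - i')" by simp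
    also have "\<dots> \<le> g * N ^ (q - i)"
      using that(1,3) N_pos by (intro mult_left_mono power_increasing) (auto simp: FY_def)
    finally show False using hY_range[OF that(2), of g] hY_range[OF that(3), of g] that(4) by linarith
  qed
  have "i = i'" using no[OF _ p eq] no[OF _ p(2,1) eq[symmetric]] by (meson linorder_neqE_nat)
  moreover have "m = m'"
    using eq p \<open>i = i'\<close> by (auto simp: hY_def FY_def)
  ultimately show ?thesis by simp
qed

lemma Y_E: "Y q g (E i m) = (if (i, m) \<in> FY q then ket (hY q g i m) else 0)"
proof -
  have "Y q g (E i m) = (\<Sum>p\<in>FY q. if p = (i, m) then ket (hY q g i m) else 0)"
    unfolding Y_def wr_apply by (intro sum.cong refl) (auto simp: prod_eq_iff)
  then show ?thesis using finite_FY by simp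
qed

lemma norm_Y_le: "0 < g \<Longrightarrow> norm (Y q g) \<le> 1"
proof -
  assume g: "0 < g"
  have "norm (Y' q g) \<le> 1"
    unfolding Y'_def
  proof (rule norm_wc_le[OF finite_FY])
    fix r
    show "(\<Sum>p\<in>{p \<in> FY q. hY q g (fst p) (snd p) = r}. 1\<^sup>2) \<le> (1::real)\<^sup>2"
    proof -
      have "p = p'" if "p \<in> {p \<in> FY q. hY q g (fst p) (snd p) = r}"
        "p' \<in> {p \<in> FY q. hY q g (fst p) (snd p) = r}" for p p'
        using that hY_inj[OF g, of "fst p" "snd p" q "fst p'" "snd p'"] by (simp add: prod_eq_iff)
      then have "card {p \<in> FY q. hY q g (fst p) (snd p) = r} \<le> 1"
        unfolding One_nat_def by (intro card_le_Suc0_iff_eq[THEN iffD2] ballI) (use finite_FY in simp)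
      then show ?thesis by simp
    qed
  qed simp
  then show ?thesis using adj_norm[OF adj_Y] by simp
qed

lemma Y'_Y_E:
  assumes g: "0 < g" and p: "(i, m) \<in> FY q"
  shows "Y' q g (Y q g (E i m)) = E i m"
  using p by (intro K_eqI) (auto simp: Y_E Y'_def coord_wc[OF finite_FY] dest: hY_inj[OF g])

text \<open>The two images are spanned by disjoint sets of basis vectors. As g and g' have equally
  many digits, the length of an index reveals i, and division by N^(q - i) then reveals g.\<close>

lemma Y_orthogonal:
  assumes g: "N ^ t \<le> g" "g < N ^ Suc t" "N ^ t \<le> g'" "g' < N ^ Suc t" "g \<noteq> g'"
  shows "cinner (Y q g x) (Y q g' y) = 0"
proof -
  have ne: "hY q g i m \<noteq> hY q g' i' m'" if p: "(i, m) \<in> FY q" "(i', m') \<in> FY q" for i m i' m'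
  proof
    assume eq: "hY q g i m = hY q g' i' m'"
    have len: "len (hY q g i m) = Suc t + (q - i)"
      if "(i, m) \<in> FY q" "N ^ t \<le> g" "g < N ^ Suc t" for i m g
    proof -
      have r: "g * N ^ (q - i) \<le> hY q g i m" "hY q g i m < (g + 1) * N ^ (q - i)"
        using hY_range[OF that(1)] by auto
      have "N ^ (t + (q - i)) \<le> hY q g i m"
        using order_trans[OF mult_le_mono1[OF that(2)] r(1)] by (simp only: power_add)
      then have "\<not> len (hY q g i m) \<le> t + (q - i)" by (simp add: len_le_iff)
      moreover have "hY q g i m < N ^ (Suc t + (q - i))"
      proof -
        have "g + 1 \<le> N ^ Suc t" using that(3) by simp
        from less_le_trans[OF r(2) mult_le_mono1[OF this]] show ?thesis by (simp only: power_add)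
      qed
      then have "len (hY q g i m) \<le> Suc t + (q - i)" by (simp add: len_le_iff)
      ultimately show ?thesis by simp
    qed
    have "Suc t + (q - i) = Suc t + (q - i')"
      using len[OF p(1) g(1,2)] len[OF p(2) g(3,4)] eq by simp
    then have i: "i = i'" using p by (auto simp: FY_def)
    have "g = hY q g i m div N ^ (q - i)"
      using hY_range[OF p(1), of g] N_pow_pos by (intro div_nat_eqI[symmetric]) (auto simp: mult.commute)
    also have "\<dots> = hY q g' i' m' div N ^ (q - i')" by (simp only: eq) (simp only: i)
    also have "\<dots> = g'"
      using hY_range[OF p(2), of g'] N_pow_pos by (intro div_nat_eqI) (auto simp: mult.commute)
    finally show False using g(5) by simp
  qed
  have "cinner (Y q g x) (Y q g' y) = cinner x (Y' q g (Y q g' y))" by (rule adjD[OF adj_Y])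
  moreover have "Y' q g (Y q g' y) = 0"
  proof (rule K_eqI)
    fix i m
    have "coord (Y q g' y) (hY q g i m) = 0" if "(i, m) \<in> FY q"
      unfolding Y_def wr_apply coord_sum
      by (rule sum.neutral) (use ne[OF that] in \<open>auto simp: scaleC_complex_def\<close>)
    then show "coord (coord (Y' q g (Y q g' y)) i) m = coord (coord 0 i) m"
      by (simp add: Y'_def coord_wc[OF finite_FY])
  qed
  ultimately show ?thesis by simp
qed

lemma FY_mem: "i + m + 1 \<le> q \<Longrightarrow> (i, m) \<in> FY q"
proof -
  assume q: "i + m + 1 \<le> q"
  have "m < q - i" using q by simp
  also have "\<dots> < N ^ (q - i)" by (rule less_N_pow)
  finally show ?thesis using q by (auto simp: FY_def)
qed

lemma s_ket: "d < N \<Longrightarrow> s d n (ket r) = (if r * N + d < N ^ n then ket (r * N + d) else 0)"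
  by (rule ell2_eqI) (auto simp: coord_s digit_eq)

lemma s'_ket: "d < N \<Longrightarrow> s' d n (ket r) = (if r < N ^ n \<and> r mod N = d then ket (r div N) else 0)"
  by (rule ell2_eqI) (auto simp: coord_s' digit_eq eq_commute[of _ r])

lemma T_E:
  assumes d: "d < N"
  shows "T d (E i m) = (case i of 0 \<Rightarrow> 0 | Suc j \<Rightarrow> E j (m * N + (N - 1 - d)))"
proof -
  define c where "c = N - 1 - d"
  have c: "c < N" using N_pos by (simp add: c_def)
  show ?thesis
    unfolding T_def c_def[symmetric]
    by (rule K_eqI) (auto simp: coord_bsh coord_S digit_eq[OF c] split: nat.split)
qed

lemma T'_E:
  assumes d: "d < N"
  shows "T' d (E i m) = (if m mod N = N - 1 - d then E (Suc i) (m div N) else 0)"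
proof -
  define c where "c = N - 1 - d"
  have c: "c < N" using N_pos by (simp add: c_def)
  show ?thesis
    unfolding T'_def c_def[symmetric]
    by (rule K_eqI) (auto simp: coord_fsh coord_cadjoint_S[OF c] digit_eq[OF c] eq_commute[of _ m] split: nat.split)
qed

text \<open>Exact on basis vectors well inside the window q, because g only contributes inert
  leading digits. At level 0 one more digit overflows N^n, which matches the vanishing of the
  backward shift there.\<close>

lemma s_Y_E:
  assumes d: "d < N" and q: "i + m + 1 \<le> q" and n: "q < n" and g: "N ^ (n - q - 1) \<le> g" "g < N ^ (n - q)"
  shows "s d n (Y q g (E i m)) = Y q g (T d (E i m))"
proof (cases i)
  case 0
  have p: "(i, m) \<in> FY q" by (rule FY_mem[OF q])
  have "N ^ n = N ^ (n - q - 1) * N ^ q * N"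
    using n by (simp flip: power_add power_Suc2)
  also have "\<dots> \<le> g * N ^ q * N" using g by (intro mult_right_mono) auto
  also have "\<dots> \<le> hY q g i m * N" using hY_range[OF p, of g] 0 by simp
  finally show ?thesis using 0 d p by (simp add: T_E Y_E s_ket)
next
  case (Suc j)
  have p: "(i, m) \<in> FY q" by (rule FY_mem[OF q])
  have im: "i \<le> q" "m < N ^ (q - i)" using p by (auto simp: FY_def)
  have e: "N ^ (q - j) = N ^ (q - i) * N" using im Suc by (metis Suc_diff_Suc Suc_le_lessD power_Suc2)
  have "(m + 1) * N \<le> N ^ (q - i) * N" using im by (intro mult_right_mono) auto
  then have p': "(j, m * N + (N - 1 - d)) \<in> FY q"
    using im Suc N_pos by (auto simp: FY_def e)
  have hh: "hY q g i m * N + d = hY q g j (m * N + (N - 1 - d))"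
  proof -
    have "m < (g + 1) * N ^ (q - i)" using im by (metis add.commute le_add1 less_le_trans mult_Suc plus_1_eq_Suc)
    then obtain c where c: "(g + 1) * N ^ (q - i) = m + 1 + c"
      by (metis Suc_eq_plus1 add_Suc_right less_iff_Suc_add add.assoc plus_1_eq_Suc)
    have c': "(g + 1) * (N ^ (q - i) * N) = (m + 1 + c) * N" using c by (metis mult.assoc)
    show ?thesis unfolding hY_def e c c' using d by (simp add: algebra_simps)
  qed
  have "hY q g j (m * N + (N - 1 - d)) < N ^ n"
  proof -
    have "hY q g j (m * N + (N - 1 - d)) < (g + 1) * N ^ (q - j)" using hY_range[OF p'] by simp
    also have "\<dots> \<le> N ^ (n - q) * N ^ q"
      using g N_pos by (intro mult_mono power_increasing) auto
    also have "\<dots> = N ^ n" using n by (simp flip: power_add)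
    finally show ?thesis .
  qed
  then show ?thesis using Suc d p p' hh by (simp add: T_E Y_E s_ket)
qed

lemma s'_Y_E:
  assumes d: "d < N" and q: "i + m + 1 \<le> q" and n: "q < n" and g: "N ^ (n - q - 1) \<le> g" "g < N ^ (n - q)"
  shows "s' d n (Y q g (E i m)) = Y q g (T' d (E i m))"
proof -
  have p: "(i, m) \<in> FY q" by (rule FY_mem[OF q])
  have im: "i < q" "m < N ^ (q - i)" using p q by (auto simp: FY_def)
  have e: "N ^ (q - i) = N ^ (q - Suc i) * N" using im by (metis Suc_diff_Suc power_Suc2)
  have h: "hY q g i m = ((g + 1) * N ^ (q - Suc i)) * N - 1 - m" by (simp only: hY_def e mult.assoc)
  have "m < (g + 1) * N ^ (q - i)" using im by (metis add.commute le_add1 less_le_trans mult_Suc plus_1_eq_Suc)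
  then have "m < ((g + 1) * N ^ (q - Suc i)) * N" by (simp only: e mult.assoc)
  from refl_divmod[OF this] have dm: "hY q g i m mod N = N - 1 - m mod N"
    "hY q g i m div N = hY q g (Suc i) (m div N)" unfolding h by (simp_all add: hY_def)
  have iff: "hY q g i m mod N = d \<longleftrightarrow> m mod N = N - 1 - d"
    unfolding dm(1) by (rule compl_digit_iff[OF mod_less_divisor[OF N_pos] d])
  have "m div N < N ^ (q - Suc i)" using im(2) N_pos unfolding e by (simp add: div_less_iff_less_mult)
  then have p': "(Suc i, m div N) \<in> FY q" using im by (auto simp: FY_def)
  have "hY q g i m < N ^ n"
  proof -
    have "hY q g i m < (g + 1) * N ^ (q - i)" using hY_range[OF p] by simp
    also have "\<dots> \<le> N ^ (n - q) * N ^ q"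
      using g N_pos by (intro mult_mono power_increasing) auto
    also have "\<dots> = N ^ n" using n by (simp flip: power_add)
    finally show ?thesis .
  qed
  then show ?thesis using d p p' iff dm(2) by (simp add: T'_E Y_E s'_ket)
qed

end


section \<open>Sequences with a limit operator\<close>

text \<open>Uniform boundedness carries strong convergence to limits of vectors; together with
  density it reduces such convergence to basis vectors.\<close>

lemma closed_strong:
  fixes B :: "'i \<Rightarrow> 'a::real_normed_vector \<Rightarrow>\<^sub>L 'b::real_normed_vector"
  assumes b: "\<forall>\<^sub>F i in F. norm (B i) \<le> c"
  shows "closed {x. ((\<lambda>i. B i x) \<longlongrightarrow> 0) F}"
proof (unfold closed_sequential_limits, intro allI impI)
  fix x l assume "(\<forall>n. x n \<in> {x. ((\<lambda>i. B i x) \<longlongrightarrow> 0) F}) \<and> x \<longlonglongrightarrow> l"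
  then have x: "\<And>n. ((\<lambda>i. B i (x n)) \<longlongrightarrow> 0) F" and l: "x \<longlonglongrightarrow> l" by auto
  define d where "d = \<bar>c\<bar> + 1"
  have d: "0 < d" by (simp add: d_def)
  have "((\<lambda>i. B i l) \<longlongrightarrow> 0) F"
  proof (rule tendstoI)
    fix e :: real assume e: "0 < e"
    then obtain n where n: "norm (x n - l) < e / (2 * d)"
      using LIMSEQ_D[OF l, of "e / (2 * d)"] d by auto
    have "\<forall>\<^sub>F i in F. norm (B i (x n)) < e / 2"
      using tendstoD[OF x[of n], of "e / 2"] e by simp
    with b show "\<forall>\<^sub>F i in F. dist (B i l) 0 < e"
    proof eventually_elim
      case (elim i)
      have "norm (B i l) \<le> norm (B i (x n)) + norm (B i (l - x n))"
        by (metis add_diff_cancel_left' blinfun.diff_right diff_add_cancel norm_triangle_ineq add.commute)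
      also have "norm (B i (l - x n)) \<le> norm (B i) * norm (l - x n)" by (rule norm_blinfun)
      also have "\<dots> \<le> d * (e / (2 * d))"
        using elim(1) n d by (intro mult_mono) (auto simp: d_def norm_minus_commute)
      finally show ?case using elim(2) d by simp
    qed
  qed
  then show "l \<in> {x. ((\<lambda>i. B i x) \<longlongrightarrow> 0) F}" by simp
qed

lemma strong_zero_on_basis:
  fixes B :: "'i \<Rightarrow> l2 ell2 \<Rightarrow>\<^sub>L 'b::complex_inner"
  assumes b: "\<forall>\<^sub>F i in F. norm (B i) \<le> c"
    and lin: "\<And>i c x. B i (c *\<^sub>C x) = c *\<^sub>C B i x"
    and E: "\<And>k m. ((\<lambda>i. B i (E k m)) \<longlongrightarrow> 0) F"
  shows "((\<lambda>i. B i x) \<longlongrightarrow> 0) F"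
proof -
  have "x \<in> {x. ((\<lambda>i. B i x) \<longlongrightarrow> 0) F}"
  proof (rule K_dense_induct)
    show "closed {x. ((\<lambda>i. B i x) \<longlongrightarrow> 0) F}" by (rule closed_strong[OF b])
    show "x + y \<in> {x. ((\<lambda>i. B i x) \<longlongrightarrow> 0) F}"
      if "x \<in> {x. ((\<lambda>i. B i x) \<longlongrightarrow> 0) F}" "y \<in> {x. ((\<lambda>i. B i x) \<longlongrightarrow> 0) F}" for x y
      using that tendsto_add[of "\<lambda>i. B i x" 0 F "\<lambda>i. B i y" 0] by (simp add: blinfun.add_right)
    show "c *\<^sub>C E k m \<in> {x. ((\<lambda>i. B i x) \<longlongrightarrow> 0) F}" for c k m
      using scaleC.tendsto[OF tendsto_const[of c] E[of k m]] by (simp add: lin)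
  qed simp
  then show ?thesis by simp
qed

lemma divide_times_self_cancel: "a \<noteq> 0 \<Longrightarrow> e / (c * a) * a = e / (c::real)"
  by simp

lemma norm_compose_le1:
  assumes "norm A \<le> a" "0 \<le> a" "norm B \<le> b"
  shows "norm (A o\<^sub>L B) \<le> a * b"
  by (rule order_trans[OF norm_blinfun_compose]) (use assms in \<open>auto intro: mult_mono\<close>)

context finite_sections
begin

text \<open>The limit q -> infinity, uniformly in n > q and in all g with exactly n - q digits. The
  uniformity permits fixing q first and letting n grow afterwards.\<close>

definition yf :: "(nat \<times> nat \<times> nat) filter" where
  "yf = inf (filtercomap fst at_top) (principal {(q, n, g). q < n \<and> N ^ (n - q - 1) \<le> g \<and> g < N ^ (n - q)})"

lemma eventually_yf: "eventually Pr yf \<longleftrightarrow>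
    (\<exists>q0. \<forall>q n g. q0 \<le> q \<longrightarrow> q < n \<longrightarrow> N ^ (n - q - 1) \<le> g \<longrightarrow> g < N ^ (n - q) \<longrightarrow> Pr (q, n, g))"
  unfolding yf_def eventually_inf_principal eventually_filtercomap_at_top_linorder by auto

lemma eventually_yf_norm_Y: "\<forall>\<^sub>F (q, n, g) in yf. norm (Y q g) \<le> 1"
  unfolding eventually_yf
proof (intro exI[of _ 0] allI impI)
  fix q n g assume "N ^ (n - q - 1) \<le> g"
  then have "0 < g" using N_pow_pos by (metis less_le_trans)
  then show "case (q, n, g) of (q, n, g) \<Rightarrow> norm (Y q g) \<le> 1" by (simp add: norm_Y_le)
qed

definition ucv :: "(nat \<Rightarrow> l2_op) \<Rightarrow> (l2 ell2 \<Rightarrow>\<^sub>L l2 ell2) \<Rightarrow> bool" where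
  "ucv A L \<longleftrightarrow> (\<lambda>n. norm ((U n o\<^sub>L A n) - (L o\<^sub>L U n))) \<longlonglongrightarrow> 0"

definition ycv :: "(nat \<Rightarrow> l2_op) \<Rightarrow> (l2 ell2 \<Rightarrow>\<^sub>L l2 ell2) \<Rightarrow> bool" where
  "ycv A L \<longleftrightarrow> (\<forall>x. ((\<lambda>(q::nat, n::nat, g::nat). A n (Y q g x) - Y q g (L x)) \<longlongrightarrow> 0) yf)"

text \<open>The adjoint sequence is part of the data: \<open>ucv\<close> for \<open>A'\<close> is no
  formal consequence of \<open>ucv\<close> for \<open>A\<close>, and it is the condition on
  \<open>A'\<close> that makes \<open>U'\<close> almost intertwine \<open>A\<close> with
  \<open>L\<close>. Keeping both makes the class symmetric under adjoints.\<close>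

definition reps :: "(nat \<Rightarrow> l2_op) \<Rightarrow> (nat \<Rightarrow> l2_op) \<Rightarrow> (l2 ell2 \<Rightarrow>\<^sub>L l2 ell2) \<Rightarrow> (l2 ell2 \<Rightarrow>\<^sub>L l2 ell2) \<Rightarrow> bool" where
  "reps A A' L L' \<longleftrightarrow> bounded (range A) \<and> (\<forall>n. adj (A n) (A' n)) \<and> adj L L' \<and>
     ucv A L \<and> ucv A' L' \<and> ycv A L \<and> ycv A' L'"

lemma bounded_range_adj:
  assumes "bounded (range A)" "\<And>n. adj (A n) (A' n)"
  shows "bounded (range A')"
  using assms(1) adj_norm[OF assms(2)] by (simp add: bounded_iff)

lemma reps_sym: "reps A A' L L' \<Longrightarrow> reps A' A L' L"
  by (auto simp: reps_def intro: adj_sym bounded_range_adj)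

lemma reps_bound: "reps A A' L L' \<Longrightarrow> \<exists>c>0. \<forall>n. norm (A n) \<le> c"
  unfolding reps_def bounded_pos by auto

lemma ucv_add: "ucv A L \<Longrightarrow> ucv B M \<Longrightarrow> ucv (\<lambda>n. A n + B n) (L + M)"
proof -
  assume a: "ucv A L" and b: "ucv B M"
  show "ucv (\<lambda>n. A n + B n) (L + M)"
    unfolding ucv_def
  proof (rule tendsto_0_le[OF tendsto_add[OF a[unfolded ucv_def] b[unfolded ucv_def], unfolded add_0], of _ 1])
    have "(U n o\<^sub>L (A n + B n)) - ((L + M) o\<^sub>L U n)
        = ((U n o\<^sub>L A n) - (L o\<^sub>L U n)) + ((U n o\<^sub>L B n) - (M o\<^sub>L U n))" for n
      by (rule blinfun_eqI) (simp add: blinfun.diff_left blinfun.add_left blinfun.add_right)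
    then show "\<forall>\<^sub>F n in sequentially. norm (norm ((U n o\<^sub>L (A n + B n)) - ((L + M) o\<^sub>L U n)))
        \<le> norm (norm ((U n o\<^sub>L A n) - (L o\<^sub>L U n)) + norm ((U n o\<^sub>L B n) - (M o\<^sub>L U n))) * 1"
      by (auto intro!: always_eventually norm_triangle_ineq)
  qed
qed

lemma ycv_add: "ycv A L \<Longrightarrow> ycv B M \<Longrightarrow> ycv (\<lambda>n. A n + B n) (L + M)"
proof -
  assume a: "ycv A L" and b: "ycv B M"
  show ?thesis
    unfolding ycv_def
  proof
    fix x
    show "((\<lambda>(q::nat, n::nat, g::nat). (A n + B n) (Y q g x) - Y q g ((L + M) x)) \<longlongrightarrow> 0) yf"
    proof -
      have "((\<lambda>p. (case p of (q::nat, n::nat, g::nat) \<Rightarrow> A n (Y q g x) - Y q g (L x))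
          + (case p of (q::nat, n::nat, g::nat) \<Rightarrow> B n (Y q g x) - Y q g (M x))) \<longlongrightarrow> 0 + 0) yf"
        using a b unfolding ycv_def by (intro tendsto_add) blast+
      moreover have "(\<lambda>p. (case p of (q::nat, n::nat, g::nat) \<Rightarrow> A n (Y q g x) - Y q g (L x))
          + (case p of (q::nat, n::nat, g::nat) \<Rightarrow> B n (Y q g x) - Y q g (M x)))
        = (\<lambda>(q::nat, n::nat, g::nat). (A n + B n) (Y q g x) - Y q g ((L + M) x))"
        by (auto simp: fun_eq_iff blinfun.add_left blinfun.add_right)
      ultimately show ?thesis by simp
    qed
  qed
qed

lemma ucv_compose:
  assumes a: "ucv A L" and b: "ucv B M" and B: "\<And>n. norm (B n) \<le> c"
  shows "ucv (\<lambda>n. A n o\<^sub>L B n) (L o\<^sub>L M)"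
  unfolding ucv_def
proof (rule tendsto_sandwich[OF _ _ tendsto_const])
  have "(\<lambda>n. norm ((U n o\<^sub>L A n) - (L o\<^sub>L U n)) * c + norm L * norm ((U n o\<^sub>L B n) - (M o\<^sub>L U n))) \<longlonglongrightarrow> 0 * c + norm L * 0"
    using a b unfolding ucv_def by (intro tendsto_intros)
  then show "(\<lambda>n. norm ((U n o\<^sub>L A n) - (L o\<^sub>L U n)) * c + norm L * norm ((U n o\<^sub>L B n) - (M o\<^sub>L U n))) \<longlonglongrightarrow> 0"
    by simp
  have "norm ((U n o\<^sub>L (A n o\<^sub>L B n)) - ((L o\<^sub>L M) o\<^sub>L U n))
      \<le> norm ((U n o\<^sub>L A n) - (L o\<^sub>L U n)) * c + norm L * norm ((U n o\<^sub>L B n) - (M o\<^sub>L U n))" for n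
  proof -
    have "(U n o\<^sub>L (A n o\<^sub>L B n)) - ((L o\<^sub>L M) o\<^sub>L U n)
        = (((U n o\<^sub>L A n) - (L o\<^sub>L U n)) o\<^sub>L B n) + (L o\<^sub>L ((U n o\<^sub>L B n) - (M o\<^sub>L U n)))"
      by (rule blinfun_eqI) (simp add: blinfun.diff_left blinfun.diff_right blinfun.add_left)
    also have "norm \<dots> \<le> norm (((U n o\<^sub>L A n) - (L o\<^sub>L U n)) o\<^sub>L B n) + norm (L o\<^sub>L ((U n o\<^sub>L B n) - (M o\<^sub>L U n)))"
      by (rule norm_triangle_ineq)
    also have "\<dots> \<le> norm ((U n o\<^sub>L A n) - (L o\<^sub>L U n)) * c + norm L * norm ((U n o\<^sub>L B n) - (M o\<^sub>L U n))"
      by (intro add_mono norm_compose_le1 B norm_blinfun_compose) auto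
    finally show ?thesis .
  qed
  then show "\<forall>\<^sub>F n in sequentially. norm ((U n o\<^sub>L (A n o\<^sub>L B n)) - ((L o\<^sub>L M) o\<^sub>L U n))
      \<le> norm ((U n o\<^sub>L A n) - (L o\<^sub>L U n)) * c + norm L * norm ((U n o\<^sub>L B n) - (M o\<^sub>L U n))"
    by simp
qed simp

lemma ycv_compose:
  assumes a: "ycv A L" and b: "ycv B M" and A: "\<And>n. norm (A n) \<le> c"
  shows "ycv (\<lambda>n. A n o\<^sub>L B n) (L o\<^sub>L M)"
  unfolding ycv_def
proof
  fix x
  have c: "0 \<le> c" using A[of 0] norm_ge_zero order_trans by blast
  have 1: "((\<lambda>(q::nat, n::nat, g::nat). A n (B n (Y q g x) - Y q g (M x))) \<longlongrightarrow> 0) yf"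
  proof (rule tendsto_0_le[OF b[unfolded ycv_def, rule_format, of x], of _ c])
    show "\<forall>\<^sub>F p in yf. norm (case p of (q::nat, n::nat, g::nat) \<Rightarrow> A n (B n (Y q g x) - Y q g (M x)))
        \<le> norm (case p of (q::nat, n::nat, g::nat) \<Rightarrow> B n (Y q g x) - Y q g (M x)) * c"
    proof (rule always_eventually, rule allI)
      fix p :: "nat \<times> nat \<times> nat"
      obtain q n g where p: "p = (q, n, g)" by (cases p)
      have "norm (A n (B n (Y q g x) - Y q g (M x))) \<le> norm (A n) * norm (B n (Y q g x) - Y q g (M x))"
        by (rule norm_blinfun)
      also have "\<dots> \<le> c * norm (B n (Y q g x) - Y q g (M x))" by (rule mult_right_mono[OF A]) simp
      finally show "norm (case p of (q::nat, n::nat, g::nat) \<Rightarrow> A n (B n (Y q g x) - Y q g (M x)))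
        \<le> norm (case p of (q::nat, n::nat, g::nat) \<Rightarrow> B n (Y q g x) - Y q g (M x)) * c"
        by (simp add: p mult.commute)
    qed
  qed
  have 2: "((\<lambda>(q::nat, n::nat, g::nat). A n (Y q g (M x)) - Y q g (L (M x))) \<longlongrightarrow> 0) yf"
    using a unfolding ycv_def by blast
  have "((\<lambda>p. (case p of (q::nat, n::nat, g::nat) \<Rightarrow> A n (B n (Y q g x) - Y q g (M x)))
      + (case p of (q::nat, n::nat, g::nat) \<Rightarrow> A n (Y q g (M x)) - Y q g (L (M x)))) \<longlongrightarrow> 0 + 0) yf"
    by (rule tendsto_add[OF 1 2])
  moreover have "(\<lambda>p. (case p of (q::nat, n::nat, g::nat) \<Rightarrow> A n (B n (Y q g x) - Y q g (M x)))
      + (case p of (q::nat, n::nat, g::nat) \<Rightarrow> A n (Y q g (M x)) - Y q g (L (M x))))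
      = (\<lambda>(q::nat, n::nat, g::nat). (A n o\<^sub>L B n) (Y q g x) - Y q g ((L o\<^sub>L M) x))"
    by (auto simp: fun_eq_iff blinfun.diff_right)
  ultimately show "((\<lambda>(q::nat, n::nat, g::nat). (A n o\<^sub>L B n) (Y q g x) - Y q g ((L o\<^sub>L M) x)) \<longlongrightarrow> 0) yf" by simp
qed

lemma U_scaleC: "U n (c *\<^sub>C x) = c *\<^sub>C U n x"
  by (rule adj_scaleC[OF adj_U])

lemma U'_scaleC: "U' n (c *\<^sub>C x) = c *\<^sub>C U' n x"
  by (rule adj_scaleC[OF adj_sym[OF adj_U]])

lemma Y_scaleC: "Y q g (c *\<^sub>C x) = c *\<^sub>C Y q g x"
  by (rule adj_scaleC[OF adj_Y])

lemma Y'_scaleC: "Y' q g (c *\<^sub>C x) = c *\<^sub>C Y' q g x"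
  by (rule adj_scaleC[OF adj_sym[OF adj_Y]])

lemma ucv_cscale: "ucv A L \<Longrightarrow> ucv (\<lambda>n. cscale c (A n)) (cscale c L)"
proof -
  assume a: "ucv A L"
  have le: "norm ((U n o\<^sub>L cscale c (A n)) - (cscale c L o\<^sub>L U n)) \<le> cmod c * norm ((U n o\<^sub>L A n) - (L o\<^sub>L U n))" for n
  proof (rule norm_blinfun_bound)
    fix x
    have "((U n o\<^sub>L cscale c (A n)) - (cscale c L o\<^sub>L U n)) x = c *\<^sub>C ((U n o\<^sub>L A n) - (L o\<^sub>L U n)) x"
      by (simp add: blinfun.diff_left blinfun_apply_cscale U_scaleC scaleC.diff_right)
    then show "norm (((U n o\<^sub>L cscale c (A n)) - (cscale c L o\<^sub>L U n)) x)
        \<le> cmod c * norm ((U n o\<^sub>L A n) - (L o\<^sub>L U n)) * norm x"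
      using mult_left_mono[OF norm_blinfun[of "(U n o\<^sub>L A n) - (L o\<^sub>L U n)" x], of "cmod c"]
      by (simp add: norm_scaleC mult.assoc)
  qed simp
  have "(\<lambda>n. cmod c * norm ((U n o\<^sub>L A n) - (L o\<^sub>L U n))) \<longlonglongrightarrow> cmod c * 0"
    using a unfolding ucv_def by (intro tendsto_intros)
  then show ?thesis
    unfolding ucv_def mult_zero_right by (rule Lim_null_comparison[rotated]) (simp add: le)
qed

lemma ycv_cscale: "ycv A L \<Longrightarrow> ycv (\<lambda>n. cscale c (A n)) (cscale c L)"
  unfolding ycv_def
proof
  fix x assume a: "\<forall>x. ((\<lambda>(q::nat, n::nat, g::nat). A n (Y q g x) - Y q g (L x)) \<longlongrightarrow> 0) yf"
  have "((\<lambda>p. case p of (q::nat, n::nat, g::nat) \<Rightarrow> A n (Y q g x) - Y q g (L x)) \<longlongrightarrow> 0) yf"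
    using a by blast
  from bounded_linear.tendsto[OF scaleC.bounded_linear_right this]
  have "((\<lambda>p. c *\<^sub>C (case p of (q::nat, n::nat, g::nat) \<Rightarrow> A n (Y q g x) - Y q g (L x))) \<longlongrightarrow> c *\<^sub>C 0) yf" .
  moreover have "(\<lambda>p. c *\<^sub>C (case p of (q::nat, n::nat, g::nat) \<Rightarrow> A n (Y q g x) - Y q g (L x)))
      = (\<lambda>(q::nat, n::nat, g::nat). cscale c (A n) (Y q g x) - Y q g (cscale c L x))"
    by (auto simp: fun_eq_iff blinfun_apply_cscale Y_scaleC scaleC.diff_right)
  ultimately show "((\<lambda>(q::nat, n::nat, g::nat). cscale c (A n) (Y q g x) - Y q g (cscale c L x)) \<longlongrightarrow> 0) yf" by simp
qed

lemma reps_add: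
  assumes "reps A A' L L'" "reps B B' M M'"
  shows "reps (\<lambda>n. A n + B n) (\<lambda>n. A' n + B' n) (L + M) (L' + M')"
  using assms unfolding reps_def
  by (auto intro!: adj_add ucv_add ycv_add bounded_plus_comp)

lemma reps_cscale:
  assumes "reps A A' L L'"
  shows "reps (\<lambda>n. cscale c (A n)) (\<lambda>n. cscale (cnj c) (A' n)) (cscale c L) (cscale (cnj c) L')"
proof -
  obtain b where "\<And>n. norm (A n) \<le> b" using reps_bound[OF assms] by blast
  then have "norm (cscale c (A n)) \<le> cmod c * b" for n
    unfolding norm_cscale by (intro mult_left_mono) auto
  then have "bounded (range (\<lambda>n. cscale c (A n)))" unfolding bounded_iff by blast
  then show ?thesis using assms unfolding reps_def by (auto intro!: adj_cscale ucv_cscale ycv_cscale)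
qed

lemma reps_compose:
  assumes a: "reps A A' L L'" and b: "reps B B' M M'"
  shows "reps (\<lambda>n. A n o\<^sub>L B n) (\<lambda>n. B' n o\<^sub>L A' n) (L o\<^sub>L M) (M' o\<^sub>L L')"
proof -
  obtain ca where ca: "0 < ca" "\<And>n. norm (A n) \<le> ca" using reps_bound[OF a] by blast
  obtain cb where cb: "0 < cb" "\<And>n. norm (B n) \<le> cb" using reps_bound[OF b] by blast
  have "norm (A' n) = norm (A n)" "norm (B' n) = norm (B n)" for n
    by (rule adj_norm, use a b in \<open>simp add: reps_def\<close>)+
  then have ca': "norm (A' n) \<le> ca" and cb': "norm (B' n) \<le> cb" for n
    using ca(2) cb(2) by simp_all
  have "norm (A n o\<^sub>L B n) \<le> ca * cb" for n
    using ca cb by (intro norm_compose_le1) auto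
  then have "bounded (range (\<lambda>n. A n o\<^sub>L B n))" unfolding bounded_iff by blast
  moreover have "ucv (\<lambda>n. A n o\<^sub>L B n) (L o\<^sub>L M)"
    by (rule ucv_compose[OF _ _ cb(2)]) (use a b in \<open>auto simp: reps_def\<close>)
  moreover have "ucv (\<lambda>n. B' n o\<^sub>L A' n) (M' o\<^sub>L L')"
    by (rule ucv_compose[OF _ _ ca']) (use a b in \<open>auto simp: reps_def\<close>)
  moreover have "ycv (\<lambda>n. A n o\<^sub>L B n) (L o\<^sub>L M)"
    by (rule ycv_compose[OF _ _ ca(2)]) (use a b in \<open>auto simp: reps_def\<close>)
  moreover have "ycv (\<lambda>n. B' n o\<^sub>L A' n) (M' o\<^sub>L L')"
    by (rule ycv_compose[OF _ _ cb']) (use a b in \<open>auto simp: reps_def\<close>)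
  ultimately show ?thesis using a b by (simp add: reps_def adj_compose)
qed

lemma reps_diff:
  assumes "reps A A' L L'" "reps B B' M M'"
  shows "reps (\<lambda>n. A n - B n) (\<lambda>n. A' n - B' n) (L - M) (L' - M')"
  using reps_add[OF assms(1) reps_cscale[OF assms(2), of "- 1"]] by (simp add: cscale_simps)

text \<open>Exact on every basis vector for large n, and extended by uniform boundedness.
  Convergence is only strong, since each \<open>U n\<close> has finite-dimensional range.\<close>

lemma U_U'_tendsto: "(\<lambda>n. U n (U' n x)) \<longlonglongrightarrow> x"
proof -
  have nU': "norm (U' n) \<le> 1" if "2 \<le> n" for n
    using norm_U_le[OF that] adj_norm[OF adj_U] by simp
  have "(\<lambda>n. ((U n o\<^sub>L U' n) - id_blinfun) x) \<longlonglongrightarrow> 0"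
  proof (rule strong_zero_on_basis)
    show "\<forall>\<^sub>F n in sequentially. norm ((U n o\<^sub>L U' n) - id_blinfun) \<le> 2"
    proof (rule eventually_sequentiallyI[of 2])
      fix n :: nat assume n: "2 \<le> n"
      have "norm ((U n o\<^sub>L U' n) - id_blinfun) \<le> norm (U n o\<^sub>L U' n) + norm (id_blinfun :: l2 ell2 \<Rightarrow>\<^sub>L l2 ell2)"
        by (rule norm_triangle_ineq4)
      also have "\<dots> \<le> 1 * 1 + 1"
        by (intro add_mono norm_compose_le1 norm_U_le nU' n norm_blinfun_id_le) auto
      finally show "norm ((U n o\<^sub>L U' n) - id_blinfun) \<le> 2" by simp
    qed
    show "((U n o\<^sub>L U' n) - id_blinfun) (c *\<^sub>C x) = c *\<^sub>C ((U n o\<^sub>L U' n) - id_blinfun) x" for n c x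
      by (simp add: blinfun.diff_left U_scaleC U'_scaleC scaleC.diff_right)
    show "(\<lambda>n. ((U n o\<^sub>L U' n) - id_blinfun) (E i m)) \<longlonglongrightarrow> 0" for i m
      by (rule tendsto_eventually, rule eventually_sequentiallyI[of "2 * (i + m + 1)"])
        (simp add: blinfun.diff_left U_U'_E)
  qed
  then have "(\<lambda>n. U n (U' n x) - x) \<longlonglongrightarrow> 0" by (simp add: blinfun.diff_left)
  then show ?thesis by (rule LIM_zero_cancel)
qed

lemma norm_U'_tendsto: "(\<lambda>n. norm (U' n x)) \<longlonglongrightarrow> norm x"
proof -
  have "(\<lambda>n. Re (cinner (U n (U' n x)) x)) \<longlonglongrightarrow> Re (cinner x x)"
    by (intro tendsto_Re cinner.tendsto U_U'_tendsto tendsto_const)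
  then have "(\<lambda>n. (norm (U' n x))\<^sup>2) \<longlonglongrightarrow> (norm x)\<^sup>2"
    by (simp add: adjD[OF adj_U] Re_cinner_self)
  then have "(\<lambda>n. sqrt ((norm (U' n x))\<^sup>2)) \<longlonglongrightarrow> sqrt ((norm x)\<^sup>2)" by (rule tendsto_real_sqrt)
  then show ?thesis by simp
qed

text \<open>Adjoints trade \<open>U\<close> for \<open>U'\<close> and \<open>A'\<close> for
  \<open>A\<close>. In this form approximate eigenvectors of the limit operator are pulled back to
  the matrices.\<close>

lemma ucv_adjoint:
  assumes "ucv A' L'" "\<And>n. adj (A n) (A' n)" "adj L L'"
  shows "(\<lambda>n. norm ((A n o\<^sub>L U' n) - (U' n o\<^sub>L L))) \<longlonglongrightarrow> 0"
proof -
  have "adj ((U n o\<^sub>L A' n) - (L' o\<^sub>L U n)) ((A n o\<^sub>L U' n) - (U' n o\<^sub>L L))" for n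
    by (intro adj_diff adj_compose adj_U adj_sym[OF assms(2)] adj_sym[OF assms(3)])
  then have "norm ((A n o\<^sub>L U' n) - (U' n o\<^sub>L L)) = norm ((U n o\<^sub>L A' n) - (L' o\<^sub>L U n))" for n
    by (rule adj_norm)
  then show ?thesis using assms(1) by (simp add: ucv_def)
qed

lemma reps_U': "reps A A' L L' \<Longrightarrow> (\<lambda>n. A n (U' n x) - U' n (L x)) \<longlonglongrightarrow> 0"
proof -
  assume "reps A A' L L'"
  then have "(\<lambda>n. norm ((A n o\<^sub>L U' n) - (U' n o\<^sub>L L))) \<longlonglongrightarrow> 0"
    unfolding reps_def by (intro ucv_adjoint[of A' L']) auto
  then have "(\<lambda>n. norm ((A n o\<^sub>L U' n) - (U' n o\<^sub>L L)) * norm x) \<longlonglongrightarrow> 0 * norm x"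
    by (intro tendsto_intros)
  then have lim: "(\<lambda>n. norm ((A n o\<^sub>L U' n) - (U' n o\<^sub>L L)) * norm x) \<longlonglongrightarrow> 0" by simp
  have "norm (A n (U' n x) - U' n (L x)) \<le> norm ((A n o\<^sub>L U' n) - (U' n o\<^sub>L L)) * norm x" for n
    using norm_blinfun[of "(A n o\<^sub>L U' n) - (U' n o\<^sub>L L)" x] by (simp add: blinfun.diff_left)
  then show ?thesis by (intro Lim_null_comparison[OF _ lim] always_eventually) auto
qed

text \<open>Makes the passage from a sequence to its limit operator contractive, so that uniformly
  convergent sequences have Cauchy limit operators.\<close>

lemma reps_norm_le:
  assumes r: "reps A A' L L'" and c: "\<And>n. norm (A n) \<le> c"
  shows "norm L \<le> c"
proof (rule norm_blinfun_bound)
  show "0 \<le> c" using c[of 0] norm_ge_zero order_trans by blast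
  fix x
  have "(\<lambda>n. norm (A n (U' n x) - U' n (L x)) + c * norm (U' n x)) \<longlonglongrightarrow> 0 + c * norm x"
    by (intro tendsto_intros tendsto_norm_zero reps_U'[OF r] norm_U'_tendsto)
  moreover have "norm (U' n (L x)) \<le> norm (A n (U' n x) - U' n (L x)) + c * norm (U' n x)" for n
  proof -
    have "norm (A n (U' n x)) \<le> norm (A n) * norm (U' n x)" by (rule norm_blinfun)
    also have "\<dots> \<le> c * norm (U' n x)" by (rule mult_right_mono[OF c]) simp
    finally show ?thesis
      using norm_triangle_ineq3[of "A n (U' n x)" "U' n (L x)"] by linarith
  qed
  ultimately show "norm (L x) \<le> c * norm x"
    using LIMSEQ_le[OF norm_U'_tendsto, of _ "0 + c * norm x" "L x"] by (simp add: exI)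
qed

lemma ucv_limit:
  assumes F: "\<And>k. ucv (F k) (M k)" and M: "M \<longlonglongrightarrow> L"
    and A: "\<And>e. 0 < e \<Longrightarrow> \<exists>k0. \<forall>k\<ge>k0. \<forall>n. norm (F k n - A n) \<le> e"
  shows "ucv A L"
  unfolding ucv_def
proof (rule LIMSEQ_I)
  fix e :: real assume e: "0 < e"
  obtain k0 where k0: "\<And>k n. k \<ge> k0 \<Longrightarrow> norm (F k n - A n) \<le> e / 4" using A[of "e / 4"] e by auto
  obtain k1 where k1: "\<And>k. k \<ge> k1 \<Longrightarrow> norm (M k - L) < e / 4" using LIMSEQ_D[OF M, of "e / 4"] e by auto
  define k where "k = max k0 k1"
  obtain n0 where n0: "\<And>n. n \<ge> n0 \<Longrightarrow> norm ((U n o\<^sub>L F k n) - (M k o\<^sub>L U n)) < e / 4"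
    using LIMSEQ_D[OF F[of k, unfolded ucv_def], of "e / 4"] e by auto
  show "\<exists>n0. \<forall>n\<ge>n0. norm (norm ((U n o\<^sub>L A n) - (L o\<^sub>L U n)) - 0) < e"
  proof (intro exI allI impI)
    fix n assume n: "max n0 2 \<le> n"
    have "(U n o\<^sub>L A n) - (L o\<^sub>L U n) = ((U n o\<^sub>L F k n) - (M k o\<^sub>L U n))
        + (((M k - L) o\<^sub>L U n) - (U n o\<^sub>L (F k n - A n)))"
      by (rule blinfun_eqI) (simp add: blinfun.diff_left blinfun.diff_right blinfun.add_left)
    also have "norm \<dots> \<le> norm ((U n o\<^sub>L F k n) - (M k o\<^sub>L U n))
        + (norm ((M k - L) o\<^sub>L U n) + norm (U n o\<^sub>L (F k n - A n)))"
      by (intro norm_triangle_le add_left_mono norm_triangle_ineq4)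
    also have "\<dots> \<le> e / 4 + (e / 4 * 1 + 1 * (e / 4))"
    proof (intro add_mono norm_compose_le1 norm_U_le)
      show "norm ((U n o\<^sub>L F k n) - (M k o\<^sub>L U n)) \<le> e / 4" using n0[of n] n by simp
      show "norm (M k - L) \<le> e / 4" using k1[of k] by (simp add: k_def less_imp_le)
      show "norm (F k n - A n) \<le> e / 4" using k0[of k n] by (simp add: k_def)
    qed (use n e in auto)
    finally show "norm (norm ((U n o\<^sub>L A n) - (L o\<^sub>L U n)) - 0) < e" using e by simp
  qed
qed

lemma ycv_limit:
  assumes F: "\<And>k. ycv (F k) (M k)" and M: "M \<longlonglongrightarrow> L"
    and A: "\<And>e. 0 < e \<Longrightarrow> \<exists>k0. \<forall>k\<ge>k0. \<forall>n. norm (F k n - A n) \<le> e"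
  shows "ycv A L"
  unfolding ycv_def
proof (intro allI tendstoI)
  fix x :: "l2 ell2" and e :: real assume e: "0 < e"
  define d where "d = e / (4 * (norm x + 1))"
  have nx: "0 < norm x + 1" by (simp add: add_nonneg_pos)
  have d: "0 < d" using e nx by (simp add: d_def)
  have dx: "d * norm x \<le> e / 4"
  proof -
    have "d * norm x \<le> d * (norm x + 1)" using d by simp
    also have "\<dots> = e / 4"
      unfolding d_def by (rule divide_times_self_cancel) (use nx in simp)
    finally show ?thesis .
  qed
  obtain k0 where k0: "\<And>k n. k \<ge> k0 \<Longrightarrow> norm (F k n - A n) \<le> d" using A[OF d] by auto
  obtain k1 where k1: "\<And>k. k \<ge> k1 \<Longrightarrow> norm (M k - L) < d" using LIMSEQ_D[OF M d] by auto
  define k where "k = max k0 k1"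
  have Fk: "norm (F k n - A n) \<le> d" for n using k0 by (simp add: k_def)
  have Mk: "norm (M k - L) \<le> d" using k1 by (simp add: k_def less_imp_le)
  have "\<forall>\<^sub>F (q, n, g) in yf. norm (F k n (Y q g x) - Y q g (M k x)) < e / 4"
    using tendstoD[OF F[of k, unfolded ycv_def, rule_format, of x], of "e / 4"] e
    by (simp add: case_prod_unfold)
  with eventually_yf_norm_Y
  show "\<forall>\<^sub>F p in yf. dist (case p of (q::nat, n::nat, g::nat) \<Rightarrow> A n (Y q g x) - Y q g (L x)) 0 < e"
  proof eventually_elim
    case (elim p)
    obtain q n g where p: "p = (q, n, g)" by (cases p)
    have Y1: "norm (Y q g y) \<le> norm y" for y
      using norm_blinfun[of "Y q g" y] mult_right_mono[of "norm (Y q g)" 1 "norm y"] elim(1) by (simp add: p)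
    have "A n (Y q g x) - Y q g (L x) = (F k n (Y q g x) - Y q g (M k x))
        + (Y q g ((M k - L) x) - (F k n - A n) (Y q g x))"
      by (simp add: blinfun.diff_left blinfun.diff_right)
    also have "norm \<dots> \<le> norm (F k n (Y q g x) - Y q g (M k x))
        + (norm (Y q g ((M k - L) x)) + norm ((F k n - A n) (Y q g x)))"
      by (intro norm_triangle_le add_left_mono norm_triangle_ineq4)
    also have "norm (Y q g ((M k - L) x)) \<le> d * norm x"
      using Y1 norm_blinfun[of "M k - L" x] mult_right_mono[OF Mk, of "norm x"] by (meson norm_ge_zero order_trans)
    also have "norm ((F k n - A n) (Y q g x)) \<le> d * norm x"
    proof -
      have "norm ((F k n - A n) (Y q g x)) \<le> norm (F k n - A n) * norm (Y q g x)" by (rule norm_blinfun)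
      also have "\<dots> \<le> d * norm x" using d by (intro mult_mono Fk Y1) auto
      finally show ?thesis .
    qed
    finally have "norm (A n (Y q g x) - Y q g (L x)) \<le> norm (F k n (Y q g x) - Y q g (M k x)) + (d * norm x + d * norm x)"
      by simp
    also have "\<dots> < e" using elim(2) dx e by (simp add: p)
    finally show ?case by (simp add: p)
  qed
qed

text \<open>The operators \<open>M k\<close> are Cauchy by \<open>reps_norm_le\<close> applied to
  differences, and the \<open>M' k\<close> have the same mutual distances. Each convergence
  condition then passes to the limit because its approximation is uniform in n.\<close>

lemma reps_limit:
  assumes r: "\<And>k::nat. reps (F k) (F' k) (M k) (M' k)"
    and AA': "\<And>n. adj (A n) (A' n)" and bd: "bounded (range A)"
    and A: "\<And>e. 0 < e \<Longrightarrow> \<exists>k0. \<forall>k\<ge>k0. \<forall>n. norm (F k n - A n) \<le> e"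
  shows "\<exists>L L'. reps A A' L L'"
proof -
  have A': "\<exists>k0. \<forall>k\<ge>k0. \<forall>n. norm (F' k n - A' n) \<le> e" if "0 < e" for e
  proof -
    have "norm (F' k n - A' n) = norm (F k n - A n)" for k n
      using r[of k] AA' by (intro adj_norm adj_diff) (auto simp: reps_def)
    then show ?thesis using A[OF that] by simp
  qed
  have "Cauchy M"
  proof (rule CauchyI)
    fix e :: real assume e: "0 < e"
    obtain k0 where k0: "\<And>k n. k \<ge> k0 \<Longrightarrow> norm (F k n - A n) \<le> e / 4" using A[of "e / 4"] e by auto
    have "norm (M k - M l) < e" if "k \<ge> k0" "l \<ge> k0" for k l
    proof -
      have "norm (F k n - F l n) \<le> e / 2" for n
      proof -
        have "norm (F k n - F l n) \<le> norm (F k n - A n) + norm (F l n - A n)"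
          by (metis norm_triangle_ineq4 diff_diff_eq2 diff_add_cancel)
        then show ?thesis using k0[OF that(1), of n] k0[OF that(2), of n] by simp
      qed
      then have "norm (M k - M l) \<le> e / 2" by (rule reps_norm_le[OF reps_diff[OF r r]])
      then show ?thesis using e by simp
    qed
    then show "\<exists>K. \<forall>m\<ge>K. \<forall>n\<ge>K. norm (M m - M n) < e" by blast
  qed
  then obtain L where L: "M \<longlonglongrightarrow> L" unfolding Cauchy_convergent_iff convergent_def by blast
  have "norm (M' k - M' l) = norm (M k - M l)" for k l
    using r[of k] r[of l] by (intro adj_norm adj_diff) (auto simp: reps_def)
  then have "Cauchy M'" using \<open>Cauchy M\<close> unfolding Cauchy_def dist_norm by simp
  then obtain L' where L': "M' \<longlonglongrightarrow> L'" unfolding Cauchy_convergent_iff convergent_def by blast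
  have "adj L L'" by (rule adj_limit[OF _ L L']) (use r in \<open>auto simp: reps_def\<close>)
  moreover have "ucv A L" by (rule ucv_limit[OF _ L A]) (use r in \<open>auto simp: reps_def\<close>)
  moreover have "ucv A' L'" by (rule ucv_limit[OF _ L' A']) (use r in \<open>auto simp: reps_def\<close>)
  moreover have "ycv A L" by (rule ycv_limit[OF _ L A]) (use r in \<open>auto simp: reps_def\<close>)
  moreover have "ycv A' L'" by (rule ycv_limit[OF _ L' A']) (use r in \<open>auto simp: reps_def\<close>)
  ultimately show ?thesis using AA' bd unfolding reps_def by blast
qed

lemma ycv_on_basis:
  assumes A: "\<And>n. norm (A n) \<le> c" "\<And>n. A n \<in> cops" and L: "L \<in> cops"
    and E: "\<And>i m q n g. i + m + 1 \<le> q \<Longrightarrow> q < n \<Longrightarrow> N ^ (n - q - 1) \<le> g \<Longrightarrow> g < N ^ (n - q) \<Longrightarrow>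
      A n (Y q g (E i m)) = Y q g (L (E i m))"
  shows "ycv A L"
  unfolding ycv_def
proof
  fix x
  have "((\<lambda>p. (case p of (q::nat, n::nat, g::nat) \<Rightarrow> (A n o\<^sub>L Y q g) - (Y q g o\<^sub>L L)) x) \<longlongrightarrow> 0) yf"
  proof (rule strong_zero_on_basis)
    show "\<forall>\<^sub>F p in yf. norm (case p of (q::nat, n::nat, g::nat) \<Rightarrow> (A n o\<^sub>L Y q g) - (Y q g o\<^sub>L L)) \<le> c * 1 + 1 * norm L"
      using eventually_yf_norm_Y
    proof eventually_elim
      case (elim p)
      obtain q n g where p: "p = (q, n, g)" by (cases p)
      have c: "0 \<le> c" using A(1)[of 0] norm_ge_zero order_trans by blast
      have "norm ((A n o\<^sub>L Y q g) - (Y q g o\<^sub>L L)) \<le> norm (A n o\<^sub>L Y q g) + norm (Y q g o\<^sub>L L)"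
        by (rule norm_triangle_ineq4)
      also have "\<dots> \<le> c * 1 + 1 * norm L"
        using elim by (intro add_mono norm_compose_le1 A c) (auto simp: p)
      finally show ?case by (simp add: p)
    qed
    show "(case p of (q::nat, n::nat, g::nat) \<Rightarrow> (A n o\<^sub>L Y q g) - (Y q g o\<^sub>L L)) (d *\<^sub>C x)
        = d *\<^sub>C (case p of (q::nat, n::nat, g::nat) \<Rightarrow> (A n o\<^sub>L Y q g) - (Y q g o\<^sub>L L)) x" for p d x
      by (cases p) (simp add: blinfun.diff_left copsD[OF A(2)] copsD[OF L] Y_scaleC scaleC.diff_right)
    show "((\<lambda>p. (case p of (q::nat, n::nat, g::nat) \<Rightarrow> (A n o\<^sub>L Y q g) - (Y q g o\<^sub>L L)) (E i m)) \<longlongrightarrow> 0) yf" for i m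
      by (rule tendsto_eventually)
        (auto simp: eventually_yf blinfun.diff_left intro!: exI[of _ "i + m + 1"] E)
  qed
  then show "((\<lambda>(q::nat, n::nat, g::nat). A n (Y q g x) - Y q g (L x)) \<longlongrightarrow> 0) yf"
    by (simp add: case_prod_unfold blinfun.diff_left)
qed

lemma norm_S_le: "norm (S N i) \<le> 1"
proof (rule norm_blinfun_bound)
  fix x
  have "norm (S N i x) \<le> norm x"
  proof (rule norm_ell2_leI)
    fix n
    have "(\<Sum>k<n. (norm (coord (S N i x) k))\<^sup>2) = (\<Sum>k\<in>{k. k < n \<and> k mod N = i}. (norm (coord x (k div N)))\<^sup>2)"
      by (rule sum.mono_neutral_cong_right) (auto simp: coord_S)
    also have "\<dots> = (\<Sum>r\<in>(\<lambda>k. k div N) ` {k. k < n \<and> k mod N = i}. (norm (coord x r))\<^sup>2)"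
    proof -
      have "inj_on (\<lambda>k. k div N) {k. k < n \<and> k mod N = i}"
        by (rule inj_onI) (metis (mono_tags, lifting) div_mult_mod_eq mem_Collect_eq)
      then show ?thesis by (simp add: sum.reindex)
    qed
    also have "\<dots> \<le> (norm x)\<^sup>2" by (rule sum_coord_le) simp
    finally show "(\<Sum>k<n. (norm (coord (S N i x) k))\<^sup>2) \<le> (norm x)\<^sup>2" .
  qed simp
  then show "norm (S N i x) \<le> 1 * norm x" by simp
qed simp

lemma norm_s_le: "norm (s d n) \<le> 1"
proof -
  have "norm (s d n) \<le> (1 * 1) * 1"
    unfolding s_def by (intro norm_compose_le1 norm_P_le norm_S_le) auto
  then show ?thesis by simp
qed

lemma reps_s:
  assumes d: "d < N"
  shows "reps (s d) (s' d) (T d) (T' d)"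
proof -
  have lim: "(\<lambda>n. sqrt (2 / real (n div 2))) \<longlonglongrightarrow> 0"
  proof -
    have "filterlim (\<lambda>n::nat. n div 2) at_top sequentially"
      unfolding filterlim_at_top
    proof
      fix Z :: nat
      show "\<forall>\<^sub>F n in sequentially. Z \<le> n div 2"
        by (rule eventually_sequentiallyI[of "2 * Z"]) auto
    qed
    then have "(\<lambda>n. 2 / real (n div 2)) \<longlonglongrightarrow> 0"
      by (intro tendsto_divide_0[OF tendsto_const] filterlim_at_top_imp_at_infinity
          filterlim_compose[OF filterlim_real_sequentially])
    then have "(\<lambda>n. sqrt (2 / real (n div 2))) \<longlonglongrightarrow> sqrt 0" by (rule tendsto_real_sqrt)
    then show ?thesis by simp
  qed
  have "bounded (range (s d))" unfolding bounded_iff using norm_s_le by blast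
  \<comment> \<open>Against \<open>U\<close> the generators intertwine up to the explicit error
    above; against \<open>Y\<close> they do so exactly on basis vectors.\<close>
  moreover have "ucv (s d) (T d)"
    unfolding ucv_def
    by (rule tendsto_sandwich[OF _ _ tendsto_const lim])
      (auto intro!: eventually_sequentiallyI[of 2] U_s_commutator d)
  moreover have "ucv (s' d) (T' d)"
    unfolding ucv_def
    by (rule tendsto_sandwich[OF _ _ tendsto_const lim])
      (auto intro!: eventually_sequentiallyI[of 2] U_s'_commutator d)
  moreover have "ycv (s d) (T d)"
    by (rule ycv_on_basis[OF norm_s_le adj_in_cops[OF adj_s] adj_in_cops[OF adj_T] s_Y_E[OF d]])
  moreover have "ycv (s' d) (T' d)"
    by (rule ycv_on_basis[where c = 1, OF _ adj_in_cops[OF adj_sym[OF adj_s]] adj_in_cops[OF adj_sym[OF adj_T]] s'_Y_E[OF d]])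
      (simp add: adj_norm[OF adj_s] norm_s_le)
  ultimately show ?thesis using adj_s adj_T by (simp add: reps_def)
qed

lemma reps_P: "reps (\<lambda>n. P (N ^ n)) (\<lambda>n. P (N ^ n)) id_blinfun id_blinfun"
proof -
  have "bounded (range (\<lambda>n. P (N ^ n)))" unfolding bounded_iff using norm_P_le by blast
  moreover have "ucv (\<lambda>n. P (N ^ n)) id_blinfun"
  proof -
    have "id_blinfun o\<^sub>L U n = U n" for n by (rule blinfun_eqI) simp
    then show ?thesis by (simp add: ucv_def U_P)
  qed
  moreover have "ycv (\<lambda>n. P (N ^ n)) id_blinfun"
  proof (rule ycv_on_basis[OF norm_P_le P_cops cops_id])
    fix i m q n g assume q: "i + m + 1 \<le> q" and n: "q < n" and g: "g < N ^ (n - q)"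
    have p: "(i, m) \<in> FY q" by (rule FY_mem[OF q])
    have "hY q g i m < (g + 1) * N ^ (q - i)" using hY_range[OF p] by simp
    also have "\<dots> \<le> N ^ (n - q) * N ^ q"
      using g N_pos by (intro mult_mono power_increasing) auto
    also have "\<dots> = N ^ n" using n by (simp flip: power_add)
    finally have "P (N ^ n) (ket (hY q g i m)) = ket (hY q g i m)"
      by (intro ell2_eqI) (simp add: coord_P)
    then show "P (N ^ n) (Y q g (E i m)) = Y q g (id_blinfun (E i m))" using p by (simp add: Y_E)
  qed
  ultimately show ?thesis using adj_P adj_id by (simp add: reps_def)
qed

lemma reps_0: "reps (\<lambda>n. 0) (\<lambda>n. 0) 0 0"
  using reps_cscale[OF reps_P, of 0] by (simp add: cscale_simps)

end


section \<open>Finite sections of the Cuntz algebra\<close>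

lemma cstar_generated_closed:
  "x \<in> cstar_generated A X \<Longrightarrow> y \<in> cstar_generated A X \<Longrightarrow> x \<otimes>\<^bsub>A\<^esub> y \<in> cstar_generated A X"
  "x \<in> cstar_generated A X \<Longrightarrow> star A x \<in> cstar_generated A X"
  "x \<in> cstar_generated A X \<Longrightarrow> c \<odot>\<^bsub>A\<^esub> x \<in> cstar_generated A X"
  "x \<in> X \<Longrightarrow> x \<in> cstar_generated A X"
  unfolding cstar_generated_def cstar_subalgebra_def by auto

lemma cstar_generated_subset: "cstar_subalgebra A B \<Longrightarrow> X \<subseteq> B \<Longrightarrow> cstar_generated A X \<subseteq> B"
  unfolding cstar_generated_def by blast

lemma bop_simps [simp]:
  "carrier bop = cops" "A \<otimes>\<^bsub>bop\<^esub> B = A o\<^sub>L B" "\<one>\<^bsub>bop\<^esub> = id_blinfun" "\<zero>\<^bsub>bop\<^esub> = 0"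
  "A \<oplus>\<^bsub>bop\<^esub> B = A + B" "c \<odot>\<^bsub>bop\<^esub> A = cscale c A" "star bop = cadjoint" "nrm bop = norm"
  by (simp_all add: bop_def)

lemma id_compose [simp]: "id_blinfun o\<^sub>L A = A" "A o\<^sub>L id_blinfun = A"
  by (rule blinfun_eqI; simp)+

lemma zero_compose [simp]: "0 o\<^sub>L A = 0" "A o\<^sub>L 0 = 0"
  by (rule blinfun_eqI; simp)+

lemma hilbert_corner_id:
  assumes "norm (u::'h::complex_inner) = 1"
  shows "hilbert_corner (id_blinfun :: 'h \<Rightarrow>\<^sub>L 'h)"
  by standard (use assms norm_blinfun_id_le in \<open>auto simp: cops_id intro!: exI[of _ u]\<close>)

lemma bop_minus: "norm (u::'h::complex_inner) = 1 \<Longrightarrow> B \<in> cops \<Longrightarrow> A \<ominus>\<^bsub>bop\<^esub> B = A - (B :: 'h \<Rightarrow>\<^sub>L 'h)"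
  unfolding bop_corner by (rule hilbert_corner.corner_minus[OF hilbert_corner_id]) auto

lemma bop_pow: "A [^]\<^bsub>bop\<^esub> (0::nat) = id_blinfun" "A [^]\<^bsub>bop\<^esub> (Suc i) = (A [^]\<^bsub>bop\<^esub> i) o\<^sub>L A"
  by (simp_all add: nat_pow_def)

lemma cadjoint_cops: "L \<in> cops \<Longrightarrow> cadjoint (L :: l2_op) \<in> cops"
  by (rule adj_in_cops[OF adj_sym[OF cops_adj_cadjoint]])

lemma cadjoint_add: "A \<in> cops \<Longrightarrow> B \<in> cops \<Longrightarrow> cadjoint (A + B :: l2_op) = cadjoint A + cadjoint B"
  by (rule cadjoint_eq) (intro adj_add cops_adj_cadjoint)

lemma cadjoint_diff: "A \<in> cops \<Longrightarrow> B \<in> cops \<Longrightarrow> cadjoint (A - B :: l2_op) = cadjoint A - cadjoint B"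
  by (rule cadjoint_eq) (intro adj_diff cops_adj_cadjoint)

lemma cadjoint_compose: "A \<in> cops \<Longrightarrow> B \<in> cops \<Longrightarrow> cadjoint (A o\<^sub>L B :: l2_op) = cadjoint B o\<^sub>L cadjoint A"
  by (rule cadjoint_eq) (intro adj_compose cops_adj_cadjoint)

lemma cadjoint_cscale: "A \<in> cops \<Longrightarrow> cadjoint (cscale c A :: l2_op) = cscale (cnj c) (cadjoint A)"
  by (rule cadjoint_eq) (intro adj_cscale cops_adj_cadjoint)

lemma cadjoint_cadjoint: "A \<in> cops \<Longrightarrow> cadjoint (cadjoint A :: l2_op) = A"
  by (rule cadjoint_eq[OF adj_sym[OF cops_adj_cadjoint]])

lemma cadjoint_zero: "cadjoint (0 :: l2_op) = 0"
  by (rule cadjoint_eq[OF adj_zero])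

lemma norm_cadjoint: "A \<in> cops \<Longrightarrow> norm (cadjoint A :: l2_op) = norm A"
  by (rule adj_norm[OF cops_adj_cadjoint])

lemma cadjoint_tendsto:
  fixes F :: "nat \<Rightarrow> l2_op"
  assumes "\<And>n. F n \<in> cops" "F \<longlonglongrightarrow> L"
  shows "(\<lambda>n. cadjoint (F n)) \<longlonglongrightarrow> cadjoint L"
proof -
  have L: "L \<in> cops" by (rule cops_limit[OF assms])
  have "(\<lambda>n. norm (F n - L)) \<longlonglongrightarrow> 0" using assms(2) by (simp add: LIM_zero tendsto_norm_zero)
  moreover have "norm (F n - L) = norm (cadjoint (F n) - cadjoint L)" for n
    using norm_cadjoint[OF cops_diff[OF assms(1)[of n] L]] by (simp add: cadjoint_diff assms(1) L)
  ultimately have "(\<lambda>n. norm (cadjoint (F n) - cadjoint L)) \<longlonglongrightarrow> 0" by simp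
  then show ?thesis by (rule LIM_zero_cancel[OF tendsto_norm_zero_cancel])
qed

context finite_sections
begin

definition incorner :: "nat \<Rightarrow> l2_op \<Rightarrow> bool" where
  "incorner n A \<longleftrightarrow> A \<in> cops \<and> P (N ^ n) o\<^sub>L A o\<^sub>L P (N ^ n) = A"

lemma incorner_carrier: "incorner n A \<longleftrightarrow> A \<in> carrier (corner (P (N ^ n)))"
  by (simp add: incorner_def)

lemma hilbert_corner_N_pow: "hilbert_corner (P (N ^ n))"
  by (rule hilbert_corner_P[OF N_pow_pos])

lemma incorner_cops: "incorner n A \<Longrightarrow> A \<in> cops"
  by (simp add: incorner_def)

lemma incorner_P_left: "incorner n A \<Longrightarrow> P (N ^ n) o\<^sub>L A = A"
  unfolding incorner_carrier by (rule blinfun_eqI) (simp add: hilbert_corner.corner_Q_left[OF hilbert_corner_N_pow] del: corner_simps)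

lemma incorner_P_right: "incorner n A \<Longrightarrow> A o\<^sub>L P (N ^ n) = A"
  unfolding incorner_carrier by (rule blinfun_eqI) (simp add: hilbert_corner.corner_Q_right[OF hilbert_corner_N_pow] del: corner_simps)

lemma incornerI: "A \<in> cops \<Longrightarrow> P (N ^ n) o\<^sub>L A = A \<Longrightarrow> A o\<^sub>L P (N ^ n) = A \<Longrightarrow> incorner n A"
  by (simp add: incorner_def)

lemma incorner_compress: "A \<in> cops \<Longrightarrow> incorner n (P (N ^ n) o\<^sub>L A o\<^sub>L P (N ^ n))"
proof (rule incornerI)
  have PP: "P (N ^ n) (P (N ^ n) x) = P (N ^ n) x" for x
    using P_idem[of "N ^ n"] by (metis blinfun_apply_blinfun_compose)
  show "P (N ^ n) o\<^sub>L (P (N ^ n) o\<^sub>L A o\<^sub>L P (N ^ n)) = P (N ^ n) o\<^sub>L A o\<^sub>L P (N ^ n)"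
    "P (N ^ n) o\<^sub>L A o\<^sub>L P (N ^ n) o\<^sub>L P (N ^ n) = P (N ^ n) o\<^sub>L A o\<^sub>L P (N ^ n)"
    by (rule blinfun_eqI, simp add: PP)+
qed (intro cops_compose P_cops)

lemma incorner_ops:
  assumes "incorner n A" "incorner n B"
  shows "incorner n (A + B)" "incorner n (A - B)" "incorner n (A o\<^sub>L B)" "incorner n (cscale c A)" "incorner n (cadjoint A)"
proof -
  note c = incorner_cops[OF assms(1)] incorner_cops[OF assms(2)]
  note l = incorner_P_left[OF assms(1)] incorner_P_left[OF assms(2)]
  note r = incorner_P_right[OF assms(1)] incorner_P_right[OF assms(2)]
  have la: "P (N ^ n) (A x) = A x" "P (N ^ n) (B x) = B x" "A (P (N ^ n) x) = A x" "B (P (N ^ n) x) = B x" for x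
    using l r by (metis blinfun_apply_blinfun_compose)+
  show "incorner n (A + B)"
    by (rule incornerI[OF cops_add[OF c]]; rule blinfun_eqI; simp add: blinfun.add_left blinfun.add_right la)
  show "incorner n (A - B)"
    by (rule incornerI[OF cops_diff[OF c]]; rule blinfun_eqI; simp add: blinfun.diff_left blinfun.diff_right la)
  show "incorner n (A o\<^sub>L B)"
    by (rule incornerI[OF cops_compose[OF c]]; rule blinfun_eqI; simp add: la)
  show "incorner n (cscale c A)"
    by (rule incornerI[OF cops_cscale[OF c(1)]]; rule blinfun_eqI; simp add: blinfun_apply_cscale copsD[OF P_cops] la)
  have a: "adj A (cadjoint A)" by (rule cops_adj_cadjoint[OF c(1)])
  show "incorner n (cadjoint A)"
  proof (rule incornerI[OF cadjoint_cops[OF c(1)]])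
    show "P (N ^ n) o\<^sub>L cadjoint A = cadjoint A"
      using adj_compose[OF a adj_P, of "N ^ n"] a unfolding r by (rule adj_unique)
    show "cadjoint A o\<^sub>L P (N ^ n) = cadjoint A"
      using adj_compose[OF adj_P a, of "N ^ n"] a unfolding l by (rule adj_unique)
  qed
qed

lemma F_carrier: "A \<in> carrier (F_eta N) \<longleftrightarrow> (\<forall>n. incorner n (A n)) \<and> bounded (range A)"
  by (simp add: F_eta_def mat_alg_corner incorner_def)

lemma F_simps:
  "A \<otimes>\<^bsub>F_eta N\<^esub> B = (\<lambda>n. A n o\<^sub>L B n)" "\<one>\<^bsub>F_eta N\<^esub> = (\<lambda>n. P (N ^ n))" "\<zero>\<^bsub>F_eta N\<^esub> = (\<lambda>n. 0)"
  "A \<oplus>\<^bsub>F_eta N\<^esub> B = (\<lambda>n. A n + B n)" "c \<odot>\<^bsub>F_eta N\<^esub> A = (\<lambda>n. cscale c (A n))"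
  "star (F_eta N) A = (\<lambda>n. cadjoint (A n))" "nrm (F_eta N) A = (SUP n. norm (A n))"
  by (simp_all add: F_eta_def)

lemma F_bound:
  assumes "A \<in> carrier (F_eta N)"
  obtains c where "0 < c" "\<And>n. norm (A n) \<le> c"
  using assms unfolding F_carrier bounded_pos by auto

lemma F_boundI: "(\<And>n. incorner n (A n)) \<Longrightarrow> (\<And>n. norm (A n) \<le> c) \<Longrightarrow> A \<in> carrier (F_eta N)"
  unfolding F_carrier bounded_iff by blast

lemma F_add: "A \<in> carrier (F_eta N) \<Longrightarrow> B \<in> carrier (F_eta N) \<Longrightarrow> (\<lambda>n. A n + B n) \<in> carrier (F_eta N)"
  unfolding F_carrier by (auto intro: incorner_ops bounded_plus_comp)

lemma F_diff: "A \<in> carrier (F_eta N) \<Longrightarrow> B \<in> carrier (F_eta N) \<Longrightarrow> (\<lambda>n. A n - B n) \<in> carrier (F_eta N)"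
  unfolding F_carrier by (auto intro: incorner_ops bounded_minus_comp)

lemma F_cscale: "A \<in> carrier (F_eta N) \<Longrightarrow> (\<lambda>n. cscale c (A n)) \<in> carrier (F_eta N)"
proof -
  assume A: "A \<in> carrier (F_eta N)"
  obtain b where "\<And>n. norm (A n) \<le> b" using F_bound[OF A] by blast
  then have "norm (cscale c (A n)) \<le> cmod c * b" for n
    unfolding norm_cscale by (intro mult_left_mono) auto
  moreover have "incorner n (A n)" for n using A by (simp add: F_carrier)
  ultimately show ?thesis by (intro F_boundI incorner_ops(4))
qed

lemma F_mult:
  assumes A: "A \<in> carrier (F_eta N)" and B: "B \<in> carrier (F_eta N)"
  shows "(\<lambda>n. A n o\<^sub>L B n) \<in> carrier (F_eta N)"
proof -
  obtain a where a: "0 < a" "\<And>n. norm (A n) \<le> a" using F_bound[OF A] by blast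
  obtain b where b: "\<And>n. norm (B n) \<le> b" using F_bound[OF B] by blast
  have "norm (A n o\<^sub>L B n) \<le> a * b" for n using a b by (intro norm_compose_le1) auto
  moreover have "incorner n (A n)" "incorner n (B n)" for n using A B by (simp_all add: F_carrier)
  ultimately show ?thesis by (intro F_boundI incorner_ops(3))
qed

lemma F_star: "A \<in> carrier (F_eta N) \<Longrightarrow> (\<lambda>n. cadjoint (A n)) \<in> carrier (F_eta N)"
proof -
  assume A: "A \<in> carrier (F_eta N)"
  obtain b where b: "\<And>n. norm (A n) \<le> b" using F_bound[OF A] by blast
  have i: "incorner n (A n)" for n using A by (simp add: F_carrier)
  show ?thesis
    by (rule F_boundI[of _ b]) (simp_all add: incorner_ops[OF i i] norm_cadjoint[OF incorner_cops[OF i]] b)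
qed

lemma F_zero: "(\<lambda>n. 0) \<in> carrier (F_eta N)"
  by (rule F_boundI[of _ 0]) (auto intro!: incornerI cops_zero)

lemma F_P: "(\<lambda>n. P (N ^ n)) \<in> carrier (F_eta N)"
  by (rule F_boundI[OF _ norm_P_le]) (auto intro!: incornerI P_cops simp: P_idem)

lemma F_minus: "B \<in> carrier (F_eta N) \<Longrightarrow> A \<ominus>\<^bsub>F_eta N\<^esub> B = (\<lambda>n. A n - B n)"
proof -
  assume B: "B \<in> carrier (F_eta N)"
  have "\<ominus>\<^bsub>F_eta N\<^esub> B = (\<lambda>n. - B n)"
    unfolding a_inv_def m_inv_def
  proof (rule the_equality)
    show "(\<lambda>n. - B n) \<in> carrier (add_monoid (F_eta N)) \<and>
        B \<otimes>\<^bsub>add_monoid (F_eta N)\<^esub> (\<lambda>n. - B n) = \<one>\<^bsub>add_monoid (F_eta N)\<^esub> \<and>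
        (\<lambda>n. - B n) \<otimes>\<^bsub>add_monoid (F_eta N)\<^esub> B = \<one>\<^bsub>add_monoid (F_eta N)\<^esub>"
      using F_cscale[OF B, of "- 1"] by (simp add: F_simps cscale_simps)
  qed (auto simp: F_simps fun_eq_iff eq_neg_iff_add_eq_0)
  then show ?thesis by (simp add: a_minus_def F_simps)
qed

text \<open>A closed star-algebra of bounded sequences. The whole of \<open>S_eta N\<close> lies in
  it as soon as the finite sections of all elements of \<open>cuntz N\<close> do.\<close>

definition representable :: "(nat \<Rightarrow> l2_op) set" where
  "representable = {A \<in> carrier (F_eta N). \<exists>A' L L'. reps A A' L L'}"

lemma representable_F: "A \<in> representable \<Longrightarrow> A \<in> carrier (F_eta N)"
  by (simp add: representable_def)

lemma reps_cadjoint: "reps A A' L L' \<Longrightarrow> A' = (\<lambda>n. cadjoint (A n))"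
  by (auto simp: reps_def intro!: ext cadjoint_eq[symmetric])

lemma representable_add: "A \<in> representable \<Longrightarrow> B \<in> representable \<Longrightarrow> (\<lambda>n. A n + B n) \<in> representable"
  unfolding representable_def using F_add reps_add by blast

lemma representable_cscale: "A \<in> representable \<Longrightarrow> (\<lambda>n. cscale c (A n)) \<in> representable"
  unfolding representable_def using F_cscale reps_cscale by blast

lemma representable_mult: "A \<in> representable \<Longrightarrow> B \<in> representable \<Longrightarrow> (\<lambda>n. A n o\<^sub>L B n) \<in> representable"
  unfolding representable_def using F_mult reps_compose by blast

lemma representable_star: "A \<in> representable \<Longrightarrow> (\<lambda>n. cadjoint (A n)) \<in> representable"
  unfolding representable_def using F_star reps_cadjoint reps_sym by blast

lemma representable_zero: "(\<lambda>n. 0) \<in> representable"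
  unfolding representable_def using F_zero reps_0 by blast

lemma representable_limit:
  assumes F: "\<And>k::nat. F k \<in> representable" and A: "A \<in> carrier (F_eta N)"
    and lim: "\<And>e. 0 < e \<Longrightarrow> \<exists>k0. \<forall>k\<ge>k0. \<forall>n. norm (F k n - A n) \<le> e"
  shows "A \<in> representable"
proof -
  have "\<forall>k. \<exists>F' M M'. reps (F k) F' M M'" using F by (simp add: representable_def)
  then obtain F' M M' where r: "\<And>k. reps (F k) (F' k) (M k) (M' k)" by metis
  have "adj (A n) (cadjoint (A n))" for n
    using A by (intro cops_adj_cadjoint) (simp add: F_carrier incorner_def)
  moreover have "bounded (range A)" using A by (simp add: F_carrier)
  ultimately have "\<exists>L L'. reps A (\<lambda>n. cadjoint (A n)) L L'" by (rule reps_limit[OF r _ _ lim])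
  then show ?thesis using A by (auto simp: representable_def)
qed

lemma representable_subalgebra: "cstar_subalgebra (F_eta N) representable"
  unfolding cstar_subalgebra_def
proof (intro conjI ballI allI impI)
  fix f x assume x: "x \<in> carrier (F_eta N)"
    and f: "(\<forall>n. f n \<in> representable) \<and> (\<lambda>n. nrm (F_eta N) (f n \<ominus>\<^bsub>F_eta N\<^esub> x)) \<longlonglongrightarrow> 0"
  show "x \<in> representable"
  proof (rule representable_limit[of f, OF _ x])
    show "f k \<in> representable" for k using f by blast
    fix e :: real assume e: "0 < e"
    from LIMSEQ_D[OF conjunct2[OF f] e] obtain k0
      where k0: "\<And>k. k \<ge> k0 \<Longrightarrow> norm (nrm (F_eta N) (f k \<ominus>\<^bsub>F_eta N\<^esub> x) - 0) < e" by blast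
    have "norm (f k n - x n) \<le> e" if "k \<ge> k0" for k n
    proof -
      have "(\<lambda>n. f k n - x n) \<in> carrier (F_eta N)" using f by (intro F_diff[OF representable_F x]) auto
      then obtain c where "\<And>n. norm (f k n - x n) \<le> c" using F_bound by blast
      then have "norm (f k n - x n) \<le> (SUP n. norm (f k n - x n))"
        by (intro cSUP_upper bdd_aboveI2[where M = c]) auto
      also have "\<dots> < e" using k0[OF that] by (simp add: F_minus[OF x] F_simps)
      finally show ?thesis by simp
    qed
    then show "\<exists>k0. \<forall>k\<ge>k0. \<forall>n. norm (f k n - x n) \<le> e" by blast
  qed
qed (auto simp: F_simps representable_zero representable_F intro: representable_add representable_mult representable_cscale representable_star)

section \<open>Sections of products with generators\<close>

definition sec :: "l2_op \<Rightarrow> nat \<Rightarrow> l2_op" where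
  "sec A n = P (N ^ n) o\<^sub>L A o\<^sub>L P (N ^ n)"

lemma norm_sec_le: "norm (sec A n) \<le> norm A"
proof -
  have "norm (sec A n) \<le> (1 * norm A) * 1"
    unfolding sec_def by (intro norm_compose_le1 norm_P_le) auto
  then show ?thesis by simp
qed

lemma sec_F: "A \<in> cops \<Longrightarrow> sec A \<in> carrier (F_eta N)"
  by (rule F_boundI[OF _ norm_sec_le]) (simp add: sec_def incorner_compress)

lemma sec_add: "sec (A + B) n = sec A n + sec B n"
  by (rule blinfun_eqI) (simp add: sec_def blinfun.add_left blinfun.add_right)

lemma sec_diff: "sec (A - B) n = sec A n - sec B n"
  by (rule blinfun_eqI) (simp add: sec_def blinfun.diff_left blinfun.diff_right)

lemma sec_cscale: "sec (cscale c A) n = cscale c (sec A n)"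
  by (rule blinfun_eqI) (simp add: sec_def blinfun_apply_cscale copsD[OF P_cops])

text \<open>Row k of the isometry has its entry in column k div N <= k, so the matrix is lower
  triangular and a cut on the left already cuts on the right. Compression is therefore
  multiplicative for a generator on the left and for an adjoint generator on the right.\<close>

lemma P_S: "P k o\<^sub>L S N i = P k o\<^sub>L S N i o\<^sub>L P k"
proof (rule blinfun_eqI, rule ell2_eqI)
  fix x r
  have "r div N < k" if "r < k" using that by (meson div_le_dividend le_less_trans)
  then show "coord ((P k o\<^sub>L S N i) x) r = coord ((P k o\<^sub>L S N i o\<^sub>L P k) x) r"
    by (simp add: coord_P coord_S)
qed

lemma cadjoint_S_P: "cadjoint (S N i) o\<^sub>L P k = P k o\<^sub>L (cadjoint (S N i) o\<^sub>L P k)"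
proof (rule adj_unique)
  show "adj (P k o\<^sub>L S N i) (cadjoint (S N i) o\<^sub>L P k)" by (rule adj_compose[OF adj_P adj_S])
  have "adj (P k o\<^sub>L S N i o\<^sub>L P k) (P k o\<^sub>L (cadjoint (S N i) o\<^sub>L P k))"
    by (intro adj_compose adj_P adj_S)
  then show "adj (P k o\<^sub>L S N i) (P k o\<^sub>L (cadjoint (S N i) o\<^sub>L P k))" by (simp only: P_S[symmetric])
qed

lemma sec_S_compose: "sec (S N i o\<^sub>L D) n = s i n o\<^sub>L sec D n"
proof -
  have PP: "P (N ^ n) (P (N ^ n) x) = P (N ^ n) x" for x
    using P_idem[of "N ^ n"] by (metis blinfun_apply_blinfun_compose)
  have "P (N ^ n) (S N i (P (N ^ n) x)) = P (N ^ n) (S N i x)" for x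
    using P_S[of "N ^ n" i] by (metis blinfun_apply_blinfun_compose)
  then show ?thesis by (intro blinfun_eqI) (simp add: sec_def s_def PP)
qed

lemma sec_compose_S: "sec (D o\<^sub>L cadjoint (S N i)) n = sec D n o\<^sub>L s' i n"
proof -
  have PP: "P (N ^ n) (P (N ^ n) x) = P (N ^ n) x" for x
    using P_idem[of "N ^ n"] by (metis blinfun_apply_blinfun_compose)
  have "P (N ^ n) (cadjoint (S N i) (P (N ^ n) x)) = cadjoint (S N i) (P (N ^ n) x)" for x
    by (rule arg_cong[OF cadjoint_S_P[of i "N ^ n"], of "\<lambda>T. blinfun_apply T x",
          unfolded blinfun_apply_blinfun_compose, symmetric])
  then show ?thesis by (intro blinfun_eqI) (simp add: sec_def s'_def PP)
qed

text \<open>The adjoint of the product of generators spelled by w. Its first letter ends up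
  rightmost, where it meets whatever operator \<open>Sst w\<close> is composed with.\<close>

primrec Sst :: "nat list \<Rightarrow> l2_op" where
  "Sst [] = id_blinfun"
| "Sst (i # w) = Sst w o\<^sub>L cadjoint (S N i)"

lemma Sst_cops: "Sst w \<in> cops"
  by (induction w) (auto intro: cops_id cops_compose cadjoint_cops S_cops)

lemma cadjoint_S_S: "i < N \<Longrightarrow> j < N \<Longrightarrow> cadjoint (S N j) o\<^sub>L S N i = (if i = j then id_blinfun else 0)"
  by (rule blinfun_eqI, rule ell2_eqI) (auto simp: coord_cadjoint_S coord_S)

text \<open>Compression to \<open>P (N ^ n)\<close> is not multiplicative. The set of all \<open>D\<close> such that every \<open>S\<^sub>\<alpha>\<^sup>* D\<close> has good
  sections is not an algebra either, but it is a closed left module over the Cuntz algebra.\<close>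

definition good_sections :: "l2_op set" where
  "good_sections = {D \<in> cops. \<forall>w. set w \<subseteq> {..<N} \<longrightarrow> sec (Sst w o\<^sub>L D) \<in> representable}"

lemma sec_zero: "sec 0 \<in> representable"
proof -
  have "sec 0 = (\<lambda>n. 0)" by (simp add: sec_def fun_eq_iff)
  then show ?thesis by (simp add: representable_zero)
qed

lemma good_sections_zero: "0 \<in> good_sections"
  by (simp add: good_sections_def cops_zero sec_zero)

lemma good_sections_add: "A \<in> good_sections \<Longrightarrow> B \<in> good_sections \<Longrightarrow> A + B \<in> good_sections"
proof -
  assume *: "A \<in> good_sections" "B \<in> good_sections"
  have "sec (Sst w o\<^sub>L (A + B)) = (\<lambda>n. sec (Sst w o\<^sub>L A) n + sec (Sst w o\<^sub>L B) n)" for w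
  proof -
    have "Sst w o\<^sub>L (A + B) = (Sst w o\<^sub>L A) + (Sst w o\<^sub>L B)"
      by (rule blinfun_eqI) (simp add: blinfun.add_left blinfun.add_right)
    then show ?thesis by (simp add: fun_eq_iff sec_add)
  qed
  with * show ?thesis by (auto simp: good_sections_def intro: cops_add representable_add)
qed

lemma good_sections_cscale: "A \<in> good_sections \<Longrightarrow> cscale c A \<in> good_sections"
proof -
  assume *: "A \<in> good_sections"
  have "sec (Sst w o\<^sub>L cscale c A) = (\<lambda>n. cscale c (sec (Sst w o\<^sub>L A) n))" for w
    by (simp add: fun_eq_iff compose_cscale[OF Sst_cops] sec_cscale)
  with * show ?thesis by (auto simp: good_sections_def intro: cops_cscale representable_cscale)
qed

lemma good_sections_limit:
  assumes F: "\<And>k::nat. F k \<in> good_sections" and lim: "F \<longlonglongrightarrow> D"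
  shows "D \<in> good_sections"
proof -
  have D: "D \<in> cops" by (rule cops_limit[OF _ lim]) (use F in \<open>auto simp: good_sections_def\<close>)
  have "sec (Sst w o\<^sub>L D) \<in> representable" if w: "set w \<subseteq> {..<N}" for w
  proof (rule representable_limit)
    show "sec (Sst w o\<^sub>L F k) \<in> representable" for k using F[of k] w by (auto simp: good_sections_def)
    show "sec (Sst w o\<^sub>L D) \<in> carrier (F_eta N)" by (intro sec_F cops_compose Sst_cops D)
    fix e :: real assume e: "0 < e"
    define d where "d = norm (Sst w) + 1"
    have d: "0 < d" by (simp add: d_def add_nonneg_pos)
    obtain k0 where k0: "\<And>k. k \<ge> k0 \<Longrightarrow> norm (F k - D) < e / d"
      using LIMSEQ_D[OF lim, of "e / d"] e d by auto
    have "norm (sec (Sst w o\<^sub>L F k) n - sec (Sst w o\<^sub>L D) n) \<le> e" if "k \<ge> k0" for k n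
    proof -
      have eq: "(Sst w o\<^sub>L F k) - (Sst w o\<^sub>L D) = Sst w o\<^sub>L (F k - D)"
        by (rule blinfun_eqI) (simp add: blinfun.diff_left blinfun.diff_right)
      have "norm (sec (Sst w o\<^sub>L F k) n - sec (Sst w o\<^sub>L D) n) \<le> norm (Sst w o\<^sub>L (F k - D))"
        unfolding sec_diff[symmetric] eq by (rule norm_sec_le)
      also have "\<dots> \<le> d * (e / d)"
        using k0[OF that] d by (intro norm_compose_le1) (auto simp: d_def)
      finally show ?thesis using d by simp
    qed
    then show "\<exists>k0. \<forall>k\<ge>k0. \<forall>n. norm (sec (Sst w o\<^sub>L F k) n - sec (Sst w o\<^sub>L D) n) \<le> e" by blast
  qed
  then show ?thesis using D by (simp add: good_sections_def)
qed

lemma s_representable: "i < N \<Longrightarrow> s i \<in> representable"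
proof -
  assume i: "i < N"
  have "s i = sec (S N i)" by (simp add: fun_eq_iff sec_def s_def)
  then have "s i \<in> carrier (F_eta N)" by (simp add: sec_F S_cops)
  then show ?thesis using reps_s[OF i] by (auto simp: representable_def)
qed

lemma s'_representable: "i < N \<Longrightarrow> s' i \<in> representable"
  using representable_star[OF s_representable] by (simp add: cadjoint_eq[OF adj_s])

text \<open>Adjoint generators split off from a section one by one on the right.\<close>

lemma good_sections_id: "id_blinfun \<in> good_sections"
proof -
  have "sec (Sst w) \<in> representable" if "set w \<subseteq> {..<N}" for w
    using that
  proof (induction w)
    case Nil
    have "sec id_blinfun = (\<lambda>n. P (N ^ n))" by (simp add: fun_eq_iff sec_def P_idem)
    then show ?case using F_P reps_P by (auto simp: representable_def)
  next
    case (Cons i w)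
    have "sec (Sst (i # w)) = (\<lambda>n. sec (Sst w) n o\<^sub>L s' i n)"
      by (simp add: fun_eq_iff sec_compose_S)
    then show ?case using Cons by (auto intro: representable_mult s'_representable)
  qed
  then show ?thesis by (simp add: good_sections_def cops_id)
qed

text \<open>A generator in front meets the first letter of the word, and the product is the identity
  or 0; for the empty word it factors out of the section. An adjoint generator in front only
  lengthens the word.\<close>

lemma good_sections_S:
  assumes i: "i < N" and D: "D \<in> good_sections"
  shows "S N i o\<^sub>L D \<in> good_sections" "cadjoint (S N i) o\<^sub>L D \<in> good_sections"
proof -
  have D': "D \<in> cops" "\<And>w. set w \<subseteq> {..<N} \<Longrightarrow> sec (Sst w o\<^sub>L D) \<in> representable" using D by (auto simp: good_sections_def)
  have "sec (Sst w o\<^sub>L (S N i o\<^sub>L D)) \<in> representable" if w: "set w \<subseteq> {..<N}" for w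
  proof (cases w)
    case Nil
    have "sec (S N i o\<^sub>L D) = (\<lambda>n. s i n o\<^sub>L sec D n)" by (simp add: fun_eq_iff sec_S_compose)
    moreover have "sec D \<in> representable" using D'(2)[of "[]"] by simp
    ultimately show ?thesis using Nil by (simp add: representable_mult s_representable i)
  next
    case (Cons j v)
    have "Sst w o\<^sub>L (S N i o\<^sub>L D) = Sst v o\<^sub>L ((cadjoint (S N j) o\<^sub>L S N i) o\<^sub>L D)"
      by (simp add: Cons blinfun_compose_assoc)
    also have "\<dots> = (if i = j then Sst v o\<^sub>L D else 0)"
      using w Cons by (simp add: cadjoint_S_S i)
    finally have "Sst w o\<^sub>L (S N i o\<^sub>L D) = (if i = j then Sst v o\<^sub>L D else 0)" .
    then show ?thesis using D'(2)[of v] w Cons sec_zero by auto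
  qed
  then show "S N i o\<^sub>L D \<in> good_sections" by (simp add: good_sections_def cops_compose S_cops D')
  have "sec (Sst w o\<^sub>L (cadjoint (S N i) o\<^sub>L D)) \<in> representable" if "set w \<subseteq> {..<N}" for w
    using D'(2)[of "i # w"] that i by (simp add: blinfun_compose_assoc)
  then show "cadjoint (S N i) o\<^sub>L D \<in> good_sections" by (simp add: good_sections_def cops_compose cadjoint_cops S_cops D')
qed

text \<open>Passing from the module to its left multipliers restores an algebra. It is closed,
  contains the generators and hence \<open>cuntz N\<close>; applying its elements to the identity
  returns the statement about sections.\<close>

definition multiplier_alg :: "l2_op set" where
  "multiplier_alg = {A \<in> cops. \<forall>D\<in>good_sections. A o\<^sub>L D \<in> good_sections \<and> cadjoint A o\<^sub>L D \<in> good_sections}"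

lemma multiplier_alg_subalgebra: "cstar_subalgebra bop multiplier_alg"
  unfolding cstar_subalgebra_def
proof (intro conjI ballI allI impI)
  show "multiplier_alg \<subseteq> carrier bop" by (auto simp: multiplier_alg_def)
  show "\<zero>\<^bsub>bop\<^esub> \<in> multiplier_alg" by (simp add: multiplier_alg_def cops_zero cadjoint_zero good_sections_zero)
  fix x y assume x: "x \<in> multiplier_alg" and y: "y \<in> multiplier_alg"
  have c: "x \<in> cops" "y \<in> cops" using x y by (auto simp: multiplier_alg_def)
  have add: "(A + B) o\<^sub>L D = (A o\<^sub>L D) + (B o\<^sub>L D)" for A B D :: l2_op
    by (rule blinfun_eqI) (simp add: blinfun.add_left)
  show "x \<oplus>\<^bsub>bop\<^esub> y \<in> multiplier_alg"
    using x y by (auto simp: multiplier_alg_def cops_add cadjoint_add add intro: good_sections_add)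
  show "x \<otimes>\<^bsub>bop\<^esub> y \<in> multiplier_alg"
    using x y by (auto simp: multiplier_alg_def cops_compose cadjoint_compose blinfun_compose_assoc)
next
  fix c x assume x: "x \<in> multiplier_alg"
  then show "c \<odot>\<^bsub>bop\<^esub> x \<in> multiplier_alg"
    by (auto simp: multiplier_alg_def cops_cscale cadjoint_cscale cscale_simps intro: good_sections_cscale)
next
  fix x assume x: "x \<in> multiplier_alg"
  then show "star bop x \<in> multiplier_alg"
    by (auto simp: multiplier_alg_def cadjoint_cops cadjoint_cadjoint)
next
  fix f x assume x: "x \<in> carrier bop"
    and f: "(\<forall>n::nat. f n \<in> multiplier_alg) \<and> (\<lambda>n. nrm bop (f n \<ominus>\<^bsub>bop\<^esub> x)) \<longlonglongrightarrow> 0"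
  have fc: "f n \<in> cops" for n using f by (auto simp: multiplier_alg_def)
  have "(\<lambda>n. norm (f n - x)) \<longlonglongrightarrow> 0" using f x bop_minus[OF norm_ket[of 0]] by simp
  then have lim: "f \<longlonglongrightarrow> x" by (rule LIM_zero_cancel[OF tendsto_norm_zero_cancel])
  have comp: "(\<lambda>n. g n o\<^sub>L D) \<longlonglongrightarrow> (z o\<^sub>L D)" if "g \<longlonglongrightarrow> z" for g and z D :: l2_op
    by (rule bounded_bilinear.tendsto[OF bounded_bilinear_blinfun_compose that tendsto_const])
  have "x o\<^sub>L D \<in> good_sections \<and> cadjoint x o\<^sub>L D \<in> good_sections" if D: "D \<in> good_sections" for D
  proof
    show "x o\<^sub>L D \<in> good_sections"
      by (rule good_sections_limit[OF _ comp[OF lim]]) (use f D in \<open>auto simp: multiplier_alg_def\<close>)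
    show "cadjoint x o\<^sub>L D \<in> good_sections"
      by (rule good_sections_limit[OF _ comp[OF cadjoint_tendsto[OF fc lim]]]) (use f D in \<open>auto simp: multiplier_alg_def\<close>)
  qed
  then show "x \<in> multiplier_alg" using x by (simp add: multiplier_alg_def)
qed

lemma sec_cuntz: "A \<in> cuntz N \<Longrightarrow> sec A \<in> representable"
proof -
  assume "A \<in> cuntz N"
  moreover have "{S N i | i. i < N} \<subseteq> multiplier_alg" using good_sections_S by (auto simp: multiplier_alg_def S_cops)
  ultimately have "A \<in> multiplier_alg"
    unfolding cuntz_def using cstar_generated_subset[OF multiplier_alg_subalgebra] by blast
  then have "A o\<^sub>L id_blinfun \<in> good_sections" using good_sections_id unfolding multiplier_alg_def by blast
  then have "A \<in> good_sections" by simp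
  then have "sec (Sst [] o\<^sub>L A) \<in> representable" unfolding good_sections_def by (auto dest: spec[of _ "[]"])
  then show ?thesis by simp
qed

lemma S_eta_subset_representable: "carrier (S_eta N) \<subseteq> representable"
proof -
  have "(\<lambda>n. P (N ^ n) o\<^sub>L A o\<^sub>L P (N ^ n)) \<in> representable" if "A \<in> cuntz N" for A
    using sec_cuntz[OF that] by (simp add: sec_def[abs_def])
  then have "{\<lambda>n. P (N ^ n) o\<^sub>L A o\<^sub>L P (N ^ n) | A. A \<in> cuntz N} \<subseteq> representable" by blast
  from cstar_generated_subset[OF representable_subalgebra this] show ?thesis by (simp add: S_eta_def)
qed

lemma S_eta_mult: "x \<in> carrier (S_eta N) \<Longrightarrow> y \<in> carrier (S_eta N) \<Longrightarrow> (\<lambda>n. x n o\<^sub>L y n) \<in> carrier (S_eta N)"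
  using cstar_generated_closed(1)[of x "F_eta N" _ y] by (simp add: S_eta_def F_simps)

lemma S_eta_star: "x \<in> carrier (S_eta N) \<Longrightarrow> (\<lambda>n. cadjoint (x n)) \<in> carrier (S_eta N)"
  using cstar_generated_closed(2)[of x "F_eta N"] by (simp add: S_eta_def F_simps)

lemma S_eta_cscale: "x \<in> carrier (S_eta N) \<Longrightarrow> (\<lambda>n. cscale c (x n)) \<in> carrier (S_eta N)"
  using cstar_generated_closed(3)[of x "F_eta N"] by (simp add: S_eta_def F_simps)

lemma s_S_eta: "i < N \<Longrightarrow> s i \<in> carrier (S_eta N)"
proof -
  assume "i < N"
  then have "S N i \<in> cuntz N" unfolding cuntz_def by (intro cstar_generated_closed(4)) auto
  then have "s i \<in> cstar_generated (F_eta N) {\<lambda>n. P (N ^ n) o\<^sub>L A o\<^sub>L P (N ^ n) | A. A \<in> cuntz N}"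
    by (intro cstar_generated_closed(4)) (auto simp: s_def[abs_def])
  then show ?thesis by (simp add: S_eta_def)
qed

lemma S_eta_simps:
  "A \<otimes>\<^bsub>S_eta N\<^esub> B = (\<lambda>n. A n o\<^sub>L B n)" "\<one>\<^bsub>S_eta N\<^esub> = (\<lambda>n. P (N ^ n))"
  "A \<oplus>\<^bsub>S_eta N\<^esub> B = (\<lambda>n. A n + B n)" "star (S_eta N) A = (\<lambda>n. cadjoint (A n))"
  by (simp_all add: S_eta_def F_eta_def)

section \<open>Arithmetic in the quotient by null sequences\<close>

abbreviation gcoset :: "(nat \<Rightarrow> l2_op) \<Rightarrow> (nat \<Rightarrow> l2_op) set" where
  "gcoset x \<equiv> G_eta N +>\<^bsub>S_eta N\<^esub> x"

lemma gcoset_mem: "y \<in> gcoset x \<longleftrightarrow> (\<lambda>n. y n - x n) \<in> G_eta N"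
proof
  assume "y \<in> gcoset x"
  then obtain h where h: "h \<in> G_eta N" "y = (\<lambda>n. h n + x n)"
    by (auto simp: a_r_coset_def r_coset_def S_eta_simps)
  then show "(\<lambda>n. y n - x n) \<in> G_eta N" by simp
next
  assume "(\<lambda>n. y n - x n) \<in> G_eta N"
  then show "y \<in> gcoset x"
    by (auto simp: a_r_coset_def r_coset_def S_eta_simps intro!: bexI[of _ "\<lambda>n. y n - x n"])
qed

lemma G_F: "x \<in> G_eta N \<Longrightarrow> x \<in> carrier (F_eta N)"
  by (simp add: G_eta_def)

lemma G_zero: "(\<lambda>n. 0) \<in> G_eta N"
  by (simp add: G_eta_def F_zero)

lemma G_add: "x \<in> G_eta N \<Longrightarrow> y \<in> G_eta N \<Longrightarrow> (\<lambda>n. x n + y n) \<in> G_eta N"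
proof -
  assume *: "x \<in> G_eta N" "y \<in> G_eta N"
  then have "(\<lambda>n. norm (x n) + norm (y n)) \<longlonglongrightarrow> 0 + 0" by (intro tendsto_add) (auto simp: G_eta_def)
  then have "(\<lambda>n. norm (x n) + norm (y n)) \<longlonglongrightarrow> 0" by simp
  then have "(\<lambda>n. norm (x n + y n)) \<longlonglongrightarrow> 0"
    by (rule Lim_null_comparison[rotated]) (simp add: norm_triangle_ineq)
  then show ?thesis using * by (simp add: G_eta_def F_add)
qed

lemma G_cscale: "x \<in> G_eta N \<Longrightarrow> (\<lambda>n. cscale c (x n)) \<in> G_eta N"
proof -
  assume *: "x \<in> G_eta N"
  then have "(\<lambda>n. cmod c * norm (x n)) \<longlonglongrightarrow> cmod c * 0" by (intro tendsto_mult_left) (auto simp: G_eta_def)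
  then show ?thesis using * by (simp add: G_eta_def F_cscale norm_cscale)
qed

lemma G_uminus: "x \<in> G_eta N \<Longrightarrow> (\<lambda>n. - x n) \<in> G_eta N"
  using G_cscale[of x "- 1"] by (simp add: cscale_simps)

lemma G_diff: "x \<in> G_eta N \<Longrightarrow> y \<in> G_eta N \<Longrightarrow> (\<lambda>n. x n - y n) \<in> G_eta N"
  using G_add[OF _ G_uminus] by simp

lemma G_star: "x \<in> G_eta N \<Longrightarrow> (\<lambda>n. cadjoint (x n)) \<in> G_eta N"
proof -
  assume x: "x \<in> G_eta N"
  then have "norm (cadjoint (x n)) = norm (x n)" for n
    by (intro norm_cadjoint) (simp add: G_eta_def F_carrier incorner_def)
  then show ?thesis using x by (simp add: G_eta_def F_star)
qed

lemma G_mult: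
  assumes x: "x \<in> G_eta N" and y: "y \<in> carrier (F_eta N)"
  shows "(\<lambda>n. x n o\<^sub>L y n) \<in> G_eta N" "(\<lambda>n. y n o\<^sub>L x n) \<in> G_eta N"
proof -
  obtain c where c: "0 < c" "\<And>n. norm (y n) \<le> c" using F_bound[OF y] by blast
  have "(\<lambda>n. norm (x n) * c) \<longlonglongrightarrow> 0 * c" using x by (intro tendsto_mult_right) (auto simp: G_eta_def)
  then have lim: "(\<lambda>n. norm (x n) * c) \<longlonglongrightarrow> 0" by simp
  have 1: "norm (x n o\<^sub>L y n) \<le> norm (x n) * c" for n using c by (intro norm_compose_le1) auto
  have 2: "norm (y n o\<^sub>L x n) \<le> norm (x n) * c" for n
    using norm_compose_le1[of "y n" c "x n" "norm (x n)"] c by (simp add: mult.commute)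
  have "(\<lambda>n. norm (x n o\<^sub>L y n)) \<longlonglongrightarrow> 0" "(\<lambda>n. norm (y n o\<^sub>L x n)) \<longlonglongrightarrow> 0"
    by (rule Lim_null_comparison[OF _ lim]; simp add: 1 2)+
  then show "(\<lambda>n. x n o\<^sub>L y n) \<in> G_eta N" "(\<lambda>n. y n o\<^sub>L x n) \<in> G_eta N"
    using x y by (simp_all add: G_eta_def F_mult)
qed

lemma gcoset_eqI: "(\<lambda>n. x n - y n) \<in> G_eta N \<Longrightarrow> gcoset x = gcoset y"
proof (rule Set.set_eqI)
  fix z assume d: "(\<lambda>n. x n - y n) \<in> G_eta N"
  show "z \<in> gcoset x \<longleftrightarrow> z \<in> gcoset y"
    unfolding gcoset_mem
  proof
    assume "(\<lambda>n. z n - x n) \<in> G_eta N"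
    from G_add[OF this d] show "(\<lambda>n. z n - y n) \<in> G_eta N" by simp
  next
    assume "(\<lambda>n. z n - y n) \<in> G_eta N"
    from G_diff[OF this d] show "(\<lambda>n. z n - x n) \<in> G_eta N" by simp
  qed
qed

lemma gcoset_self: "x \<in> gcoset x"
  by (simp add: gcoset_mem G_zero)

lemma gcoset_F: "x \<in> carrier (F_eta N) \<Longrightarrow> y \<in> gcoset x \<Longrightarrow> y \<in> carrier (F_eta N)"
  using F_add[of "\<lambda>n. y n - x n" x] by (simp add: gcoset_mem G_F)

text \<open>The product of cosets is a union over all pairs of representatives. The members of this
  union coincide, because a bounded sequence times a null sequence is null.\<close>

lemma quot_mult:
  assumes x: "x \<in> carrier (F_eta N)" and y: "y \<in> carrier (F_eta N)"
  shows "gcoset x \<otimes>\<^bsub>S_quot N\<^esub> gcoset y = gcoset (\<lambda>n. x n o\<^sub>L y n)"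
proof -
  have 1: "gcoset (\<lambda>n. a n o\<^sub>L b n) = gcoset (\<lambda>n. x n o\<^sub>L y n)" if a: "a \<in> gcoset x" and b: "b \<in> gcoset y" for a b
  proof (rule gcoset_eqI)
    have "(\<lambda>n. ((a n - x n) o\<^sub>L b n) + (x n o\<^sub>L (b n - y n))) \<in> G_eta N"
      using a b x y by (intro G_add G_mult) (auto simp: gcoset_mem intro: gcoset_F[OF y])
    moreover have "((a n - x n) o\<^sub>L b n) + (x n o\<^sub>L (b n - y n)) = (a n o\<^sub>L b n) - (x n o\<^sub>L y n)" for n
      by (rule blinfun_eqI) (simp add: blinfun.diff_left blinfun.diff_right blinfun.add_left)
    ultimately show "(\<lambda>n. (a n o\<^sub>L b n) - (x n o\<^sub>L y n)) \<in> G_eta N" by simp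
  qed
  have "gcoset x \<otimes>\<^bsub>S_quot N\<^esub> gcoset y = (\<Union>a\<in>gcoset x. \<Union>b\<in>gcoset y. gcoset (\<lambda>n. a n o\<^sub>L b n))"
    by (simp add: S_quot_def cstar_quot_def FactRing_def rcoset_mult_def S_eta_simps)
  also have "\<dots> = (\<Union>a\<in>gcoset x. \<Union>b\<in>gcoset y. gcoset (\<lambda>n. x n o\<^sub>L y n))"
    by (intro SUP_cong refl 1)
  also have "\<dots> = gcoset (\<lambda>n. x n o\<^sub>L y n)" using gcoset_self[of x] gcoset_self[of y] by blast
  finally show ?thesis .
qed

lemma quot_star:
  assumes x: "x \<in> carrier (F_eta N)"
  shows "star (S_quot N) (gcoset x) = gcoset (\<lambda>n. cadjoint (x n))"
proof -
  have xc: "x n \<in> cops" for n using x by (simp add: F_carrier incorner_def)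
  have "star (S_quot N) (gcoset x) = (\<lambda>y n. cadjoint (y n)) ` gcoset x"
    by (simp add: S_quot_def cstar_quot_def S_eta_simps)
  also have "\<dots> = gcoset (\<lambda>n. cadjoint (x n))"
  proof (intro Set.set_eqI iffI)
    fix z assume "z \<in> (\<lambda>y n. cadjoint (y n)) ` gcoset x"
    then obtain y where y: "y \<in> gcoset x" "z = (\<lambda>n. cadjoint (y n))" by blast
    have yc: "y n \<in> cops" for n using gcoset_F[OF x y(1)] by (simp add: F_carrier incorner_def)
    have "(\<lambda>n. cadjoint (y n - x n)) \<in> G_eta N" using y(1) by (intro G_star) (simp add: gcoset_mem)
    then show "z \<in> gcoset (\<lambda>n. cadjoint (x n))" by (simp add: gcoset_mem y(2) cadjoint_diff yc xc)
  next
    fix z assume z: "z \<in> gcoset (\<lambda>n. cadjoint (x n))"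
    have zc: "z n \<in> cops" for n using gcoset_F[OF F_star[OF x] z] by (simp add: F_carrier incorner_def)
    have "(\<lambda>n. cadjoint (z n - cadjoint (x n))) \<in> G_eta N" using z by (intro G_star) (simp add: gcoset_mem)
    then have "(\<lambda>n. cadjoint (z n)) \<in> gcoset x"
      by (simp add: gcoset_mem cadjoint_diff zc cadjoint_cops xc cadjoint_cadjoint)
    moreover have "z = (\<lambda>n. cadjoint (cadjoint (z n)))" by (simp only: cadjoint_cadjoint[OF zc])
    ultimately show "z \<in> (\<lambda>y n. cadjoint (y n)) ` gcoset x" by (intro image_eqI)
  qed
  finally show ?thesis .
qed

lemma quot_add: "gcoset x \<oplus>\<^bsub>S_quot N\<^esub> gcoset y = gcoset (\<lambda>n. x n + y n)"
proof -
  have "gcoset x \<oplus>\<^bsub>S_quot N\<^esub> gcoset y = (\<Union>a\<in>gcoset x. \<Union>b\<in>gcoset y. {\<lambda>n. a n + b n})"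
    by (simp add: S_quot_def cstar_quot_def FactRing_def set_add_def set_mult_def S_eta_simps)
  also have "\<dots> = gcoset (\<lambda>n. x n + y n)"
  proof (intro Set.set_eqI iffI)
    fix z assume "z \<in> (\<Union>a\<in>gcoset x. \<Union>b\<in>gcoset y. {\<lambda>n. a n + b n})"
    then obtain a b where ab: "a \<in> gcoset x" "b \<in> gcoset y" "z = (\<lambda>n. a n + b n)" by blast
    from G_add[OF ab(1,2)[unfolded gcoset_mem]] show "z \<in> gcoset (\<lambda>n. x n + y n)"
      by (simp add: gcoset_mem ab(3) algebra_simps)
  next
    fix z assume z: "z \<in> gcoset (\<lambda>n. x n + y n)"
    have "(\<lambda>n. z n - y n) \<in> gcoset x" using z by (simp add: gcoset_mem algebra_simps)
    moreover have "z = (\<lambda>n. (z n - y n) + y n)" by simp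
    ultimately show "z \<in> (\<Union>a\<in>gcoset x. \<Union>b\<in>gcoset y. {\<lambda>n. a n + b n})" using gcoset_self[of y] by blast
  qed
  finally show ?thesis .
qed

lemma quot_zero: "\<zero>\<^bsub>S_quot N\<^esub> = gcoset (\<lambda>n. 0)"
  by (auto simp: S_quot_def cstar_quot_def FactRing_def gcoset_mem)

lemma quot_one: "\<one>\<^bsub>S_quot N\<^esub> = gcoset (\<lambda>n. P (N ^ n))"
  by (simp add: S_quot_def cstar_quot_def FactRing_def S_eta_simps)

lemma quot_carrier: "carrier (S_quot N) = {gcoset x | x. x \<in> carrier (S_eta N)}"
  by (auto simp: S_quot_def cstar_quot_def FactRing_def A_RCOSETS_def RCOSETS_def a_r_coset_def)

text \<open>The additive inverse is a definite description, so uniqueness among all cosets of the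
  quotient has to accompany existence.\<close>

lemma quot_minus:
  assumes y: "y \<in> carrier (S_eta N)"
  shows "gcoset x \<ominus>\<^bsub>S_quot N\<^esub> gcoset y = gcoset (\<lambda>n. x n - y n)"
proof -
  have "\<ominus>\<^bsub>S_quot N\<^esub> gcoset y = gcoset (\<lambda>n. - y n)"
    unfolding a_inv_def m_inv_def
  proof (rule the_equality)
    have "(\<lambda>n. - y n) \<in> carrier (S_eta N)" using S_eta_cscale[OF y, of "- 1"] by (simp add: cscale_simps)
    then show "gcoset (\<lambda>n. - y n) \<in> carrier (add_monoid (S_quot N)) \<and>
        gcoset y \<otimes>\<^bsub>add_monoid (S_quot N)\<^esub> gcoset (\<lambda>n. - y n) = \<one>\<^bsub>add_monoid (S_quot N)\<^esub> \<and>
        gcoset (\<lambda>n. - y n) \<otimes>\<^bsub>add_monoid (S_quot N)\<^esub> gcoset y = \<one>\<^bsub>add_monoid (S_quot N)\<^esub>"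
      by (auto simp: quot_carrier quot_add quot_zero)
    fix Z assume Z: "Z \<in> carrier (add_monoid (S_quot N)) \<and>
        gcoset y \<otimes>\<^bsub>add_monoid (S_quot N)\<^esub> Z = \<one>\<^bsub>add_monoid (S_quot N)\<^esub> \<and>
        Z \<otimes>\<^bsub>add_monoid (S_quot N)\<^esub> gcoset y = \<one>\<^bsub>add_monoid (S_quot N)\<^esub>"
    then obtain z where z: "Z = gcoset z" by (auto simp: quot_carrier)
    have "gcoset (\<lambda>n. y n + z n) = gcoset (\<lambda>n. 0)" using Z by (simp add: z quot_add quot_zero)
    then have "(\<lambda>n. y n + z n) \<in> gcoset (\<lambda>n. 0)" using gcoset_self by blast
    then have "(\<lambda>n. y n + z n) \<in> G_eta N" by (simp add: gcoset_mem)
    then show "Z = gcoset (\<lambda>n. - y n)" unfolding z by (intro gcoset_eqI) (simp add: add.commute)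
  qed
  then show ?thesis by (simp add: a_minus_def quot_add)
qed

section \<open>Identification of W_tilde with the limit operator\<close>

primrec spow :: "(nat \<Rightarrow> l2_op) \<Rightarrow> nat \<Rightarrow> nat \<Rightarrow> l2_op" where
  "spow x 0 = (\<lambda>n. P (N ^ n))"
| "spow x (Suc i) = (\<lambda>n. spow x i n o\<^sub>L x n)"

lemma spow_F: "x \<in> carrier (F_eta N) \<Longrightarrow> spow x i \<in> carrier (F_eta N)"
  by (induction i) (auto intro: F_P F_mult)

lemma quot_pow: "x \<in> carrier (F_eta N) \<Longrightarrow> gcoset x [^]\<^bsub>S_quot N\<^esub> (i::nat) = gcoset (spow x i)"
proof (induction i)
  case 0
  then show ?case by (simp add: nat_pow_def quot_one)
next
  case (Suc i)
  have "gcoset x [^]\<^bsub>S_quot N\<^esub> Suc i = (gcoset x [^]\<^bsub>S_quot N\<^esub> i) \<otimes>\<^bsub>S_quot N\<^esub> gcoset x"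
    by (simp add: nat_pow_def)
  also have "\<dots> = gcoset (spow x (Suc i))" using Suc by (simp add: quot_mult spow_F)
  finally show ?case .
qed

lemma reps_spow:
  assumes "reps x x' L L'"
  shows "\<exists>x''. reps (spow x i) x'' (L [^]\<^bsub>bop\<^esub> i) (L' [^]\<^bsub>bop\<^esub> i)"
proof (induction i)
  case 0
  then show ?case using reps_P by (auto simp: bop_pow)
next
  case (Suc i)
  then obtain x'' where "reps (spow x i) x'' (L [^]\<^bsub>bop\<^esub> i) (L' [^]\<^bsub>bop\<^esub> i)" by blast
  from reps_compose[OF this assms]
  have "reps (spow x (Suc i)) (\<lambda>n. x' n o\<^sub>L x'' n) (L [^]\<^bsub>bop\<^esub> Suc i) (L' o\<^sub>L (L' [^]\<^bsub>bop\<^esub> i))"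
    by (simp add: bop_pow)
  \<comment> \<open>The adjoint side gains its new factor at the other end, which makes no
    difference for powers of one operator.\<close>
  moreover have "L' o\<^sub>L (L' [^]\<^bsub>bop\<^esub> i) = L' [^]\<^bsub>bop\<^esub> Suc i"
    by (induction i) (simp_all add: bop_pow flip: blinfun_compose_assoc)
  ultimately show ?case by auto
qed

text \<open>A representative of e - p1. For n >= 1 it projects onto the indices with exactly n
  digits, that is, onto level 0.\<close>

definition top_proj :: "nat \<Rightarrow> l2_op" where "top_proj n = P (N ^ n) - (s' 0 n o\<^sub>L s 0 n)"

lemma top_proj_eq: "1 \<le> n \<Longrightarrow> top_proj n = P (N ^ n) - P (N ^ (n - 1))"
proof -
  assume n: "1 \<le> n"
  have "N ^ n = N ^ (n - 1) * N" using n by (metis Suc_diff_le diff_Suc_1 power_Suc2 One_nat_def Suc_le_D)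
  then have "s' 0 n o\<^sub>L s 0 n = P (N ^ (n - 1))"
    using N_pos by (intro blinfun_eqI ell2_eqI) (simp add: coord_s coord_s' coord_P)
  then show ?thesis by (simp add: top_proj_def)
qed

lemma s0_gcoset: "s0 N = gcoset (s 0)"
  by (simp add: s0_def s_def[abs_def])

lemma s_F: "i < N \<Longrightarrow> s i \<in> carrier (F_eta N)" and s'_F: "i < N \<Longrightarrow> s' i \<in> carrier (F_eta N)"
  by (auto intro: representable_F s_representable s'_representable)

lemma star_s0: "star (S_quot N) (s0 N) = gcoset (s' 0)"
  using quot_star[OF s_F[OF N_pos]] by (simp add: s0_gcoset cadjoint_eq[OF adj_s])

lemma e_minus_p1_gcoset: "e_minus_p1 N = gcoset top_proj"
proof -
  have "s' 0 = (\<lambda>n. cadjoint (s 0 n))" by (simp add: fun_eq_iff cadjoint_eq[OF adj_s])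
  then have "s' 0 \<in> carrier (S_eta N)" using S_eta_star[OF s_S_eta[OF N_pos]] by simp
  then have "(\<lambda>n. s' 0 n o\<^sub>L s 0 n) \<in> carrier (S_eta N)" by (intro S_eta_mult s_S_eta N_pos)
  then show ?thesis
    unfolding e_minus_p1_def star_s0 unfolding s0_gcoset quot_mult[OF s'_F[OF N_pos] s_F[OF N_pos]] quot_one
    by (simp add: quot_minus top_proj_def[abs_def])
qed

lemma top_proj_F: "top_proj \<in> carrier (F_eta N)"
  unfolding top_proj_def[abs_def] by (intro F_diff F_P F_mult s_F s'_F N_pos)

definition top_proj_lim :: "l2 ell2 \<Rightarrow>\<^sub>L l2 ell2" where "top_proj_lim = id_blinfun - (T' 0 o\<^sub>L T 0)"

lemma reps_top_proj: "\<exists>f'. reps top_proj f' top_proj_lim top_proj_lim"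
proof -
  have "reps (\<lambda>n. s' 0 n o\<^sub>L s 0 n) (\<lambda>n. s' 0 n o\<^sub>L s 0 n) (T' 0 o\<^sub>L T 0) (T' 0 o\<^sub>L T 0)"
    by (rule reps_compose[OF reps_sym[OF reps_s[OF N_pos]] reps_s[OF N_pos]])
  from reps_diff[OF reps_P this] show ?thesis unfolding top_proj_def[abs_def] top_proj_lim_def by blast
qed

lemma slim_eq:
  fixes A :: "nat \<Rightarrow> ('h::real_normed_vector \<Rightarrow>\<^sub>L 'h)"
  assumes "\<And>x. (\<lambda>n. A n x) \<longlonglongrightarrow> blinfun_apply L x"
  shows "slim A = L"
  unfolding slim_def
proof (rule the_equality)
  fix M assume M: "\<forall>x. (\<lambda>n. A n x) \<longlonglongrightarrow> blinfun_apply M x"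
  show "M = L" by (rule blinfun_eqI) (use M assms LIMSEQ_unique in blast)
qed (use assms in blast)

text \<open>By \<open>prj_U\<close> and its adjoint, the reflected and compressed matrix equals
  \<open>x n\<close> framed by \<open>prj 0 o U n\<close> and \<open>U' n o ins 0\<close>. Then x n
  U' n is close to U' n L, and U n U' n tends strongly to the identity.\<close>

lemma W00_gcoset:
  assumes x: "x \<in> carrier (F_eta N)" and r: "reps x x' L L'"
  shows "W00 N (gcoset x) = prj 0 o\<^sub>L L o\<^sub>L ins 0"
proof -
  define y where "y n = top_proj n o\<^sub>L x n o\<^sub>L top_proj n" for n
  have yF: "y \<in> carrier (F_eta N)" unfolding y_def[abs_def] by (intro F_mult top_proj_F x)
  have set: "e_minus_p1 N \<otimes>\<^bsub>S_quot N\<^esub> gcoset x \<otimes>\<^bsub>S_quot N\<^esub> e_minus_p1 N = gcoset y"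
    unfolding e_minus_p1_gcoset y_def[abs_def] by (simp add: quot_mult F_mult top_proj_F x)
  \<comment> \<open>The representative chosen by \<open>SOME\<close> is arbitrary; it differs from y
    by a null sequence, and \<open>R\<close> is a contraction, so the strong limit is the
    same.\<close>
  define B where "B = (SOME A. A \<in> gcoset y)"
  have "B \<in> gcoset y" unfolding B_def by (rule someI[of _ y]) (rule gcoset_self)
  then have G: "(\<lambda>n. B n - y n) \<in> G_eta N" by (simp add: gcoset_mem)
  have spectral_convergence: "(\<lambda>n. (R (N ^ n) o\<^sub>L y n o\<^sub>L R (N ^ n)) v) \<longlonglongrightarrow> (prj 0 o\<^sub>L L o\<^sub>L ins 0) v" for v
  proof -
    define z where "z = ins 0 v"
    have Rf: "prj 0 o\<^sub>L U n = R (N ^ n) o\<^sub>L top_proj n" and fR: "U' n o\<^sub>L ins 0 = top_proj n o\<^sub>L R (N ^ n)" if n: "1 \<le> n" for n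
    proof -
      show 1: "prj 0 o\<^sub>L U n = R (N ^ n) o\<^sub>L top_proj n" using prj_U[OF n] by (simp add: top_proj_eq[OF n])
      have "adj (top_proj n) (top_proj n)" unfolding top_proj_eq[OF n] by (intro adj_diff adj_P)
      then have "adj (R (N ^ n) o\<^sub>L top_proj n) (top_proj n o\<^sub>L R (N ^ n))" by (intro adj_compose adj_R)
      moreover have "adj (R (N ^ n) o\<^sub>L top_proj n) (U' n o\<^sub>L ins 0)"
        unfolding 1[symmetric] by (intro adj_compose adj_U adj_prj_ins)
      ultimately show "U' n o\<^sub>L ins 0 = top_proj n o\<^sub>L R (N ^ n)" by (rule adj_unique[rotated])
    qed
    have "(\<lambda>n. U n (x n (U' n z) - U' n (L z))) \<longlonglongrightarrow> 0"
    proof (rule Lim_null_comparison)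
      show "\<forall>\<^sub>F n in sequentially. norm (U n (x n (U' n z) - U' n (L z))) \<le> norm (x n (U' n z) - U' n (L z))"
      proof (rule eventually_sequentiallyI[of 2])
        fix n :: nat assume n: "2 \<le> n"
        show "norm (U n (x n (U' n z) - U' n (L z))) \<le> norm (x n (U' n z) - U' n (L z))"
          using norm_blinfun[of "U n" "x n (U' n z) - U' n (L z)"]
            mult_right_mono[OF norm_U_le[OF n], of "norm (x n (U' n z) - U' n (L z))"] by simp
      qed
      show "(\<lambda>n. norm (x n (U' n z) - U' n (L z))) \<longlonglongrightarrow> 0"
        using reps_U'[OF r, of z] by (rule tendsto_norm_zero)
    qed
    from tendsto_add[OF this U_U'_tendsto[of "L z"]]
    have "(\<lambda>n. U n (x n (U' n z))) \<longlonglongrightarrow> L z" by (simp add: blinfun.diff_right)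
    then have "(\<lambda>n. prj 0 (U n (x n (U' n z)))) \<longlonglongrightarrow> prj 0 (L z)"
      by (rule blinfun.tendsto[OF tendsto_const])
    then have "(\<lambda>n. prj 0 (U n (x n (U' n z)))) \<longlonglongrightarrow> (prj 0 o\<^sub>L L o\<^sub>L ins 0) v" by (simp add: z_def)
    then show ?thesis
    proof (rule Lim_transform_eventually)
      show "\<forall>\<^sub>F n in sequentially. prj 0 (U n (x n (U' n z))) = (R (N ^ n) o\<^sub>L y n o\<^sub>L R (N ^ n)) v"
      proof (rule eventually_sequentiallyI[of 1])
        fix n :: nat assume n: "1 \<le> n"
        have "prj 0 (U n (x n (U' n z))) = (prj 0 o\<^sub>L U n) (x n ((U' n o\<^sub>L ins 0) v))" by (simp add: z_def)
        also have "\<dots> = (R (N ^ n) o\<^sub>L y n o\<^sub>L R (N ^ n)) v" unfolding Rf[OF n] fR[OF n] by (simp add: y_def)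
        finally show "prj 0 (U n (x n (U' n z))) = (R (N ^ n) o\<^sub>L y n o\<^sub>L R (N ^ n)) v" .
      qed
    qed
  qed
  have nR: "norm (R k v) \<le> norm v" for k v
  proof -
    have "(norm (R k v))\<^sup>2 = (\<Sum>i<k. (norm (coord v (k - 1 - i)))\<^sup>2)"
      by (subst norm_ell2_finite[of "{..<k}"]) (auto simp: coord_R)
    also have "\<dots> = (\<Sum>i<k. (norm (coord v i))\<^sup>2)"
      by (rule sum.reindex_bij_witness[of _ "\<lambda>i. k - 1 - i" "\<lambda>i. k - 1 - i"]) auto
    also have "\<dots> \<le> (norm v)\<^sup>2" by (rule sum_coord_le) simp
    finally show ?thesis by (rule power2_le_imp_le) simp
  qed
  have "(\<lambda>n. (R (N ^ n) o\<^sub>L B n o\<^sub>L R (N ^ n)) v) \<longlonglongrightarrow> (prj 0 o\<^sub>L L o\<^sub>L ins 0) v" for v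
  proof -
    have "(\<lambda>n. R (N ^ n) ((B n - y n) (R (N ^ n) v))) \<longlonglongrightarrow> 0"
    proof (rule Lim_null_comparison)
      have "norm (R (N ^ n) ((B n - y n) (R (N ^ n) v))) \<le> norm (B n - y n) * norm v" for n
      proof -
        have "norm (R (N ^ n) ((B n - y n) (R (N ^ n) v))) \<le> norm ((B n - y n) (R (N ^ n) v))" by (rule nR)
        also have "\<dots> \<le> norm (B n - y n) * norm (R (N ^ n) v)" by (rule norm_blinfun)
        also have "\<dots> \<le> norm (B n - y n) * norm v" by (intro mult_left_mono nR) simp
        finally show ?thesis .
      qed
      then show "\<forall>\<^sub>F n in sequentially. norm (R (N ^ n) ((B n - y n) (R (N ^ n) v))) \<le> norm (B n - y n) * norm v"
        by simp
      have "(\<lambda>n. norm (B n - y n) * norm v) \<longlonglongrightarrow> 0 * norm v"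
        using G by (intro tendsto_mult_right) (simp add: G_eta_def)
      then show "(\<lambda>n. norm (B n - y n) * norm v) \<longlonglongrightarrow> 0" by simp
    qed
    from tendsto_add[OF this spectral_convergence[of v]] show ?thesis
      by (simp add: blinfun.diff_left blinfun.diff_right)
  qed
  then have "slim (\<lambda>n. R (N ^ n) o\<^sub>L B n o\<^sub>L R (N ^ n)) = prj 0 o\<^sub>L L o\<^sub>L ins 0" by (rule slim_eq)
  then show ?thesis unfolding W00_def set B_def Let_def .
qed

lemma prj_T_pow: "coord ((T 0 [^]\<^bsub>bop\<^esub> i) y) k = (S N (N - 1) [^]\<^bsub>bop\<^esub> i) (coord y (k + i))"
  by (induction i arbitrary: y) (simp_all add: bop_pow T_def coord_bsh)

lemma T'_pow_ins: "(T' 0 [^]\<^bsub>bop\<^esub> j) (ins k v) = ins (k + j) ((cadjoint (S N (N - 1)) [^]\<^bsub>bop\<^esub> j) v)"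
proof (induction j arbitrary: k v)
  case 0
  then show ?case by (simp add: bop_pow)
next
  case (Suc j)
  have "T' 0 (ins k v) = ins (Suc k) (cadjoint (S N (N - 1)) v)"
    by (rule ell2_eqI) (auto simp: T'_def coord_fsh split: nat.split)
  then show ?case by (simp add: bop_pow Suc)
qed

lemma S_pow_cancel: "(cadjoint (S N (N - 1)) [^]\<^bsub>bop\<^esub> (i::nat)) ((S N (N - 1) [^]\<^bsub>bop\<^esub> i) v) = v"
proof (induction i arbitrary: v)
  case 0
  then show ?case by (simp add: bop_pow)
next
  case (Suc i)
  have "N - 1 < N" using N_pos by simp
  then have c: "cadjoint (S N (N - 1)) (S N (N - 1) w) = w" for w
    using cadjoint_S_S[of "N - 1" "N - 1"] by (metis blinfun_apply_blinfun_compose blinfun_apply_id_blinfun id_apply)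
  have comm: "(S N (N - 1) [^]\<^bsub>bop\<^esub> i) (S N (N - 1) w) = S N (N - 1) ((S N (N - 1) [^]\<^bsub>bop\<^esub> i) w)" for w
    by (induction i arbitrary: w) (simp_all add: bop_pow)
  show ?case using Suc by (simp add: bop_pow comm c del: One_nat_def)
qed

text \<open>Powers of \<open>T 0\<close> bring level i down to level 0 at the price of a power of
  \<open>S N (N - 1)\<close>, which the outer adjoint powers in the definition of \<open>W\<close>
  undo. On the right, powers of \<open>T' 0\<close> do the same for level j.\<close>

lemma W_eq:
  assumes A: "A \<in> carrier (F_eta N)" and r: "reps A A' L L'"
  shows "W N (gcoset A) i j = prj i o\<^sub>L L o\<^sub>L ins j"
proof -
  define x where "x n = top_proj n o\<^sub>L spow (s 0) i n o\<^sub>L A n o\<^sub>L spow (s' 0) j n o\<^sub>L top_proj n" for n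
  have spF: "spow (s 0) i \<in> carrier (F_eta N)" "spow (s' 0) j \<in> carrier (F_eta N)"
    by (intro spow_F s_F s'_F N_pos)+
  have xF: "x \<in> carrier (F_eta N)" unfolding x_def[abs_def] by (intro F_mult top_proj_F spF A)
  have "e_minus_p1 N \<otimes>\<^bsub>S_quot N\<^esub> (s0 N [^]\<^bsub>S_quot N\<^esub> i) \<otimes>\<^bsub>S_quot N\<^esub> gcoset A \<otimes>\<^bsub>S_quot N\<^esub>
      (star (S_quot N) (s0 N) [^]\<^bsub>S_quot N\<^esub> j) \<otimes>\<^bsub>S_quot N\<^esub> e_minus_p1 N = gcoset x"
    unfolding e_minus_p1_gcoset star_s0 unfolding s0_gcoset quot_pow[OF s_F[OF N_pos]] quot_pow[OF s'_F[OF N_pos]] x_def[abs_def]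
    by (simp add: quot_mult F_mult top_proj_F spF A)
  moreover obtain f' where f': "reps top_proj f' top_proj_lim top_proj_lim" using reps_top_proj by blast
  obtain a' where a': "reps (spow (s 0) i) a' (T 0 [^]\<^bsub>bop\<^esub> i) (T' 0 [^]\<^bsub>bop\<^esub> i)"
    using reps_spow[OF reps_s[OF N_pos]] by blast
  obtain b' where b': "reps (spow (s' 0) j) b' (T' 0 [^]\<^bsub>bop\<^esub> j) (T 0 [^]\<^bsub>bop\<^esub> j)"
    using reps_spow[OF reps_sym[OF reps_s[OF N_pos]]] by blast
  from reps_compose[OF reps_compose[OF reps_compose[OF reps_compose[OF f' a'] r] b'] f']
  have "W00 N (gcoset x) = prj 0 o\<^sub>L (top_proj_lim o\<^sub>L (T 0 [^]\<^bsub>bop\<^esub> i) o\<^sub>L L o\<^sub>L (T' 0 [^]\<^bsub>bop\<^esub> j) o\<^sub>L top_proj_lim) o\<^sub>L ins 0"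
    unfolding x_def[abs_def, symmetric] by (rule W00_gcoset[OF xF])
  ultimately have W: "W N (gcoset A) i j = (cadjoint (S N (N - 1)) [^]\<^bsub>bop\<^esub> i) o\<^sub>L
      (prj 0 o\<^sub>L (top_proj_lim o\<^sub>L (T 0 [^]\<^bsub>bop\<^esub> i) o\<^sub>L L o\<^sub>L (T' 0 [^]\<^bsub>bop\<^esub> j) o\<^sub>L top_proj_lim) o\<^sub>L ins 0) o\<^sub>L
      (S N (N - 1) [^]\<^bsub>bop\<^esub> j)"
    unfolding W_def by simp
  \<comment> \<open>The image of \<open>T' 0\<close> has no component at level 0, and
    \<open>T 0\<close> annihilates vectors concentrated there. So \<open>top_proj_lim\<close>
    disappears on both sides.\<close>
  have F0: "coord (top_proj_lim y) 0 = coord y 0" for y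
    by (simp add: top_proj_lim_def blinfun.diff_left T'_def coord_fsh)
  have F1: "top_proj_lim (ins 0 v) = ins 0 v" for v
  proof -
    have "T 0 (ins 0 v) = 0" by (rule ell2_eqI) (simp add: T_def coord_bsh)
    then show ?thesis by (simp add: top_proj_lim_def blinfun.diff_left)
  qed
  show ?thesis
    unfolding W by (rule blinfun_eqI) (simp add: F0 F1 prj_T_pow T'_pow_ins S_pow_cancel del: One_nat_def)
qed

lemma W_tilde_eq:
  assumes A: "A \<in> carrier (F_eta N)" and r: "reps A A' L L'"
  shows "W_tilde N (gcoset A) = L"
  unfolding W_tilde_def
proof (rule the_equality)
  have sums: "(\<lambda>j. W N (gcoset A) i j (coord x j)) sums coord (L x) i" for x i
  proof -
    have "(\<lambda>n. prj i (L (\<Sum>j<n. ins j (coord x j)))) \<longlonglongrightarrow> prj i (L x)"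
      by (intro blinfun.tendsto tendsto_const ins_partial_sums)
    then show ?thesis by (simp add: sums_def W_eq[OF A r] blinfun.sum_right coord_sum)
  qed
  then show "\<forall>x i. (\<lambda>j. W N (gcoset A) i j (coord x j)) sums coord (L x) i" by blast
  fix M assume M: "\<forall>x i. (\<lambda>j. W N (gcoset A) i j (coord x j)) sums coord (blinfun_apply M x) i"
  show "M = L"
    by (rule blinfun_eqI, rule ell2_eqI) (rule sums_unique2[OF M[rule_format] sums])
qed

end


section \<open>Convergence of spectra\<close>

context hilbert_corner
begin

lemma nu_shift_diff:
  "nu (range Q) (B - cscale z Q) \<le> nu (range Q) (B - cscale w Q) + cmod (z - w)"
proof -
  have "(B - cscale z Q) - (B - cscale w Q) = cscale (w - z) Q"
    by (rule blinfun_eqI) (simp add: blinfun.diff_left blinfun_apply_cscale scaleC.diff_left)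
  then have "norm ((B - cscale z Q) - (B - cscale w Q)) \<le> cmod (z - w) * 1"
    using mult_left_mono[OF Q_norm, of "cmod (z - w)"] by (simp add: norm_cscale norm_minus_commute)
  then show ?thesis using nu_diff_le[OF Q_nontrivial, of "B - cscale z Q" "B - cscale w Q"] by simp
qed

text \<open>Far from the origin the scalar term dominates; this bounds the sublevel sets, and with
  them spectra and pseudospectra.\<close>

lemma nu_shift_lower: "cmod z - norm B \<le> nu (range Q) (B - cscale z Q)"
proof (rule nu_geI[OF Q_nontrivial])
  fix x assume x: "x \<in> range Q" "norm x = 1"
  have "cmod z = norm (z *\<^sub>C x)" by (simp add: norm_scaleC x)
  also have "\<dots> = norm (B x - (B - cscale z Q) x)"
    by (simp add: blinfun.diff_left blinfun_apply_cscale Q_fix[OF x(1)])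
  also have "\<dots> \<le> norm (B x) + norm ((B - cscale z Q) x)" by (rule norm_triangle_ineq4)
  also have "norm (B x) \<le> norm B" using norm_blinfun[of B x] x by simp
  finally show "cmod z - norm B \<le> norm ((B - cscale z Q) x)" by simp
qed

lemma continuous_nu_shift: "continuous_on X (\<lambda>z. nu (range Q) (B - cscale z Q))"
proof (rule continuous_on_subset[of UNIV])
  have "dist (nu (range Q) (B - cscale z Q)) (nu (range Q) (B - cscale w Q)) \<le> 1 * dist z w" for z w
    using nu_shift_diff[of B z w] nu_shift_diff[of B w z] by (auto simp: dist_norm abs_if norm_minus_commute)
  then have "1-lipschitz_on UNIV (\<lambda>z. nu (range Q) (B - cscale z Q))" by (intro lipschitz_onI) auto
  then show "continuous_on UNIV (\<lambda>z. nu (range Q) (B - cscale z Q))" by (rule lipschitz_on_continuous_on)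
qed simp

lemma compact_nu_sublevel: "compact {z. nu (range Q) (B - cscale z Q) \<le> c}"
proof (rule compact_eq_bounded_closed[THEN iffD2], intro conjI)
  have "cmod z \<le> c + norm B" if "nu (range Q) (B - cscale z Q) \<le> c" for z
    using nu_shift_lower[of z B] that by simp
  then show "bounded {z. nu (range Q) (B - cscale z Q) \<le> c}" unfolding bounded_iff by blast
  show "closed {z. nu (range Q) (B - cscale z Q) \<le> c}"
    by (intro closed_Collect_le continuous_nu_shift continuous_on_const)
qed

text \<open>The quadratic form of the product is nonnegative, so the lower modulus at z is at least
  the modulus of Im z and at least - Re z.\<close>

lemma spectrum_positive:
  assumes T: "adj T T'" and z: "nu (range Q) ((T' o\<^sub>L T) - cscale z Q) = 0"
  shows "z \<in> complex_of_real ` {0..}"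
proof -
  have ge: "cmod (of_real ((norm (T x))\<^sup>2) - z) \<le> norm (((T' o\<^sub>L T) - cscale z Q) x)"
    if x: "x \<in> range Q" "norm x = 1" for x
  proof -
    have "cinner (T' (T x)) x = of_real ((norm (T x))\<^sup>2)"
      using adjD[OF adj_sym[OF T], of "T x" x] by (simp add: cinner_norm)
    then have "cinner (((T' o\<^sub>L T) - cscale z Q) x) x = of_real ((norm (T x))\<^sup>2) - z"
      using x by (simp add: blinfun.diff_left blinfun_apply_cscale Q_fix[OF x(1)] cinner.diff_left
          cinner_scaleC_left cinner_norm)
    then show ?thesis using cinner_bound[of "((T' o\<^sub>L T) - cscale z Q) x" x] x by simp
  qed
  have "\<bar>Im z\<bar> \<le> nu (range Q) ((T' o\<^sub>L T) - cscale z Q)"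
  proof (rule nu_geI[OF Q_nontrivial])
    fix x assume x: "x \<in> range Q" "norm x = 1"
    have "\<bar>Im z\<bar> \<le> cmod (of_real ((norm (T x))\<^sup>2) - z)"
      using abs_Im_le_cmod[of "of_real ((norm (T x))\<^sup>2) - z"] by simp
    with ge[OF x] show "\<bar>Im z\<bar> \<le> norm (((T' o\<^sub>L T) - cscale z Q) x)" by simp
  qed
  moreover have "- Re z \<le> nu (range Q) ((T' o\<^sub>L T) - cscale z Q)"
  proof (rule nu_geI[OF Q_nontrivial])
    fix x assume x: "x \<in> range Q" "norm x = 1"
    have "(norm (T x))\<^sup>2 - Re z \<le> cmod (of_real ((norm (T x))\<^sup>2) - z)"
      using complex_Re_le_cmod[of "of_real ((norm (T x))\<^sup>2) - z"] by simp
    then show "- Re z \<le> norm (((T' o\<^sub>L T) - cscale z Q) x)"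
      using ge[OF x] zero_le_power2[of "norm (T x)"] by linarith
  qed
  ultimately have "z = of_real (Re z)" "0 \<le> Re z" using z by (auto simp: complex_eq_iff)
  then show ?thesis by (metis atLeast_iff imageI)
qed

end

text \<open>The pointwise form of Hausdorff convergence: it is what the estimates deliver, and it
  passes through the square root without a return to suprema and infima.\<close>

definition hconv :: "(nat \<Rightarrow> complex set) \<Rightarrow> complex set \<Rightarrow> bool" where
  "hconv M K \<longleftrightarrow> (\<forall>n. M n \<noteq> {} \<and> compact (M n)) \<and> K \<noteq> {} \<and> compact K \<and>
     (\<forall>e>0. \<forall>\<^sub>F n in sequentially. \<forall>m\<in>M n. \<exists>k\<in>K. dist m k \<le> e) \<and>
     (\<forall>k\<in>K. \<forall>e>0. \<forall>\<^sub>F n in sequentially. \<exists>m\<in>M n. dist m k \<le> e)"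

lemma hconv_imp: "hconv M K \<Longrightarrow> hausdorff_tendsto M K"
  unfolding hconv_def by (intro hausdorff_tendstoI) auto

text \<open>The step from the spectrum of the product of the adjoint with b to \<open>sigma2\<close>
  of b, isolated as an operation on sets.\<close>

definition rsq :: "complex set \<Rightarrow> complex set" where
  "rsq M = {complex_of_real r | r. 0 \<le> r \<and> complex_of_real (r\<^sup>2) \<in> M}"

lemma rsq_image:
  assumes "M \<subseteq> complex_of_real ` {0..}"
  shows "rsq M = (\<lambda>z. complex_of_real (sqrt (Re z))) ` M"
proof (intro Set.set_eqI iffI)
  fix z assume "z \<in> rsq M"
  then obtain r where "z = of_real r" "0 \<le> r" "complex_of_real (r\<^sup>2) \<in> M" by (auto simp: rsq_def)
  then show "z \<in> (\<lambda>z. complex_of_real (sqrt (Re z))) ` M"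
    by (intro image_eqI[of _ _ "complex_of_real (r\<^sup>2)"]) auto
next
  fix z assume "z \<in> (\<lambda>z. complex_of_real (sqrt (Re z))) ` M"
  then obtain m where m: "m \<in> M" "z = complex_of_real (sqrt (Re m))" by blast
  then obtain t where "m = of_real t" "0 \<le> t" using assms by auto
  then have "z = complex_of_real (sqrt t)" "0 \<le> sqrt t" "complex_of_real ((sqrt t)\<^sup>2) \<in> M"
    using m by simp_all
  then show "z \<in> rsq M" unfolding rsq_def by blast
qed

text \<open>The square root is Hoelder continuous of exponent 1/2, whence the tolerance e^2.\<close>

lemma dist_sqrt_le:
  assumes "m \<in> complex_of_real ` {0..}" "k \<in> complex_of_real ` {0..}" "dist m k \<le> e\<^sup>2" "0 \<le> e"
  shows "dist (complex_of_real (sqrt (Re m))) (complex_of_real (sqrt (Re k))) \<le> e"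
proof -
  obtain a b where ab: "m = of_real a" "0 \<le> a" "k = of_real b" "0 \<le> b" using assms by auto
  have "(sqrt a - sqrt b)\<^sup>2 \<le> \<bar>a - b\<bar>" by (rule sqrt_diff_sq_le[OF ab(2,4)])
  also have "\<dots> \<le> e\<^sup>2" using assms(3) by (simp add: ab dist_norm flip: of_real_diff)
  finally have "\<bar>sqrt a - sqrt b\<bar> \<le> e" using assms(4) by (metis abs_le_square_iff abs_of_nonneg power2_abs)
  then show ?thesis by (simp add: ab dist_norm flip: of_real_diff)
qed

lemma hconv_rsq:
  assumes c: "hconv M K" and M: "\<And>n. M n \<subseteq> complex_of_real ` {0..}" and K: "K \<subseteq> complex_of_real ` {0..}"
  shows "hconv (\<lambda>n. rsq (M n)) (rsq K)"
proof -
  let ?f = "\<lambda>z. complex_of_real (sqrt (Re z))"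
  have cont: "continuous_on X ?f" for X by (intro continuous_intros)
  have up: "\<forall>\<^sub>F n in sequentially. \<forall>m\<in>?f ` M n. \<exists>k\<in>?f ` K. dist m k \<le> e" if e: "0 < e" for e
  proof -
    have "\<forall>\<^sub>F n in sequentially. \<forall>m\<in>M n. \<exists>k\<in>K. dist m k \<le> e\<^sup>2"
      using c e unfolding hconv_def by simp
    then show ?thesis
    proof eventually_elim
      case (elim n)
      show ?case
      proof
        fix z assume "z \<in> ?f ` M n"
        then obtain m where m: "m \<in> M n" "z = ?f m" by blast
        with elim obtain k where k: "k \<in> K" "dist m k \<le> e\<^sup>2" by blast
        have "dist (?f m) (?f k) \<le> e" using m k M K e by (intro dist_sqrt_le) auto
        then show "\<exists>k\<in>?f ` K. dist z k \<le> e" using m k by blast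
      qed
    qed
  qed
  have lo: "\<forall>\<^sub>F n in sequentially. \<exists>m\<in>?f ` M n. dist m z \<le> e" if z: "z \<in> ?f ` K" and e: "0 < e" for z e
  proof -
    obtain k where k: "k \<in> K" "z = ?f k" using z by blast
    have "\<forall>\<^sub>F n in sequentially. \<exists>m\<in>M n. dist m k \<le> e\<^sup>2"
      using c e k unfolding hconv_def by simp
    then show ?thesis
    proof eventually_elim
      case (elim n)
      then obtain m where m: "m \<in> M n" "dist m k \<le> e\<^sup>2" by blast
      have "dist (?f m) (?f k) \<le> e" using m k M K e by (intro dist_sqrt_le) auto
      then show ?case using m k by blast
    qed
  qed
  have "compact (?f ` M n)" "compact (?f ` K)" for n
    using c unfolding hconv_def by (auto intro!: compact_continuous_image cont)
  then show ?thesis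
    using c up lo unfolding hconv_def rsq_image[OF M] rsq_image[OF K] by auto
qed

lemma norm_E00: "norm (E 0 0) = 1" by simp

interpretation full: hilbert_corner "id_blinfun :: l2 ell2 \<Rightarrow>\<^sub>L l2 ell2"
  by (rule hilbert_corner_id[OF norm_E00])

lemma K_unit: "\<exists>x\<in>UNIV. norm (x :: l2 ell2) = 1"
  using norm_E00 by blast

context finite_sections
begin

text \<open>\<open>gn\<close> belongs to the matrices and \<open>gl\<close> to the limit operator.
  Their zero sets turn out to be the spectra and their sublevel sets the pseudospectra, so
  everything reduces to comparing these two functions of z.\<close>

definition gn :: "(nat \<Rightarrow> l2_op) \<Rightarrow> nat \<Rightarrow> complex \<Rightarrow> real" where
  "gn A n z = nu (range (P (N ^ n))) (A n - cscale z (P (N ^ n)))"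

definition gl :: "(l2 ell2 \<Rightarrow>\<^sub>L l2 ell2) \<Rightarrow> complex \<Rightarrow> real" where
  "gl L z = nu UNIV (L - cscale z id_blinfun)"

lemma gn_nonneg: "0 \<le> gn A n z"
  unfolding gn_def by (rule nu_nonneg[OF hilbert_corner.Q_nontrivial[OF hilbert_corner_N_pow]])

lemma gl_nonneg: "0 \<le> gl L z"
  unfolding gl_def by (rule nu_nonneg[OF K_unit])

lemma gl_diff: "gl L z \<le> gl L w + cmod (z - w)"
  using full.nu_shift_diff[of L z w] by (simp add: gl_def)

lemma carrier_shift: "incorner n A \<Longrightarrow> A - cscale z (P (N ^ n)) \<in> carrier (corner (P (N ^ n)))"
  unfolding incorner_carrier
  by (intro hilbert_corner.carrier_diff[OF hilbert_corner_N_pow] hilbert_corner.carrier_cscale[OF hilbert_corner_N_pow] hilbert_corner.Q_carrier[OF hilbert_corner_N_pow])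

lemma mat_surj: "incorner n A \<Longrightarrow> 0 < nu (range (P (N ^ n))) (A - cscale z (P (N ^ n))) \<Longrightarrow>
    range (P (N ^ n)) \<subseteq> (A - cscale z (P (N ^ n))) ` range (P (N ^ n))"
  by (rule mat_surj_if_bounded_below[OF carrier_shift N_pow_pos])

lemma cspectrum_mat: "incorner n (A n) \<Longrightarrow> cspectrum (mat_alg (N ^ n)) (A n) = {z. gn A n z = 0}"
  unfolding mat_alg_corner gn_def
  by (rule hilbert_corner.cspectrum_corner[OF hilbert_corner_N_pow _ mat_surj]) (simp_all add: incorner_carrier del: corner_simps)

lemma pseudospectrum_mat: "incorner n (A n) \<Longrightarrow> 0 < \<epsilon> \<Longrightarrow>
    pseudospectrum (mat_alg (N ^ n)) \<epsilon> (A n) = {z. gn A n z \<le> \<epsilon>}"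
  unfolding mat_alg_corner gn_def
  by (rule hilbert_corner.pseudospectrum_corner[OF hilbert_corner_N_pow _ mat_surj]) (simp_all add: incorner_carrier del: corner_simps)

lemma P_U': "P (N ^ n) o\<^sub>L U' n = U' n"
proof (rule adj_unique)
  have "adj (U n o\<^sub>L P (N ^ n)) (P (N ^ n) o\<^sub>L U' n)" by (intro adj_compose adj_U adj_P)
  then show "adj (U n) (P (N ^ n) o\<^sub>L U' n)" by (simp only: U_P)
qed (rule adj_U)

lemma U'_range: "U' n x \<in> range (P (N ^ n))"
  using P_U'[of n] by (metis blinfun_apply_blinfun_compose rangeI)

lemma P_U'_apply: "P (N ^ n) (U' n x) = U' n x"
  using P_U'[of n] by (metis blinfun_apply_blinfun_compose)

definition dn :: "(nat \<Rightarrow> l2_op) \<Rightarrow> (l2 ell2 \<Rightarrow>\<^sub>L l2 ell2) \<Rightarrow> nat \<Rightarrow> real" where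
  "dn A L n = norm ((U n o\<^sub>L A n) - (L o\<^sub>L U n))"

lemma dn_tendsto: "reps A A' L L' \<Longrightarrow> dn A L \<longlonglongrightarrow> 0"
  by (simp add: reps_def ucv_def dn_def[abs_def])

text \<open>\<open>U n\<close> is isometric on the range of the projection, so it carries
  almost-null vectors of A n - z to almost-null vectors of L - z. The error does not involve z,
  which gives uniformity over the whole plane.\<close>

lemma gl_le_gn:
  assumes n: "2 \<le> n"
  shows "gl L z \<le> gn A n z + dn A L n"
proof -
  have "gl L z - dn A L n \<le> gn A n z"
    unfolding gn_def
  proof (rule nu_geI[OF hilbert_corner.Q_nontrivial[OF hilbert_corner_N_pow]])
    fix x assume x: "x \<in> range (P (N ^ n))" "norm x = 1"
    let ?M = "A n - cscale z (P (N ^ n))"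
    have Px: "P (N ^ n) x = x" using x(1) by (simp add: coord_P_range)
    have "gl L z \<le> norm ((L - cscale z id_blinfun) (U n x))"
      unfolding gl_def by (rule nu_le_norm) (simp_all add: U_isometric[OF n x(1)] x)
    also have "(L - cscale z id_blinfun) (U n x) = U n (?M x) - ((U n o\<^sub>L A n) - (L o\<^sub>L U n)) x"
      by (simp add: blinfun.diff_left blinfun.diff_right blinfun_apply_cscale U_scaleC Px)
    also have "norm \<dots> \<le> norm (U n (?M x)) + norm (((U n o\<^sub>L A n) - (L o\<^sub>L U n)) x)"
      by (rule norm_triangle_ineq4)
    also have "\<dots> \<le> norm (?M x) + dn A L n"
    proof (rule add_mono)
      show "norm (U n (?M x)) \<le> norm (?M x)"
        using norm_blinfun[of "U n" "?M x"] mult_right_mono[OF norm_U_le[OF n], of "norm (?M x)"] by simp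
      show "norm (((U n o\<^sub>L A n) - (L o\<^sub>L U n)) x) \<le> dn A L n"
        using norm_blinfun[of "(U n o\<^sub>L A n) - (L o\<^sub>L U n)" x] x by (simp add: dn_def)
    qed
    finally show "gl L z - dn A L n \<le> norm (?M x)" by simp
  qed
  then show ?thesis by simp
qed

text \<open>A near-minimiser x for the limit is pulled back to \<open>U' n x\<close>. As x depends
  on z, this direction works for one z at a time.\<close>

lemma gn_less_gl:
  assumes r: "reps A A' L L'" and b: "gl L z < b"
  shows "\<forall>\<^sub>F n in sequentially. gn A n z < b"
proof -
  obtain x where x: "norm x = 1" "norm ((L - cscale z id_blinfun) x) < b"
    using nu_approx[OF K_unit b[unfolded gl_def]] by blast
  define a where "a n = norm (A n (U' n x) - U' n (L x)) + norm (U' n ((L - cscale z id_blinfun) x))" for n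
  have "a \<longlonglongrightarrow> 0 + norm ((L - cscale z id_blinfun) x)"
    unfolding a_def by (intro tendsto_add tendsto_norm_zero reps_U'[OF r] norm_U'_tendsto)
  moreover have "(\<lambda>n. norm (U' n x)) \<longlonglongrightarrow> 1" using norm_U'_tendsto[of x] x by simp
  ultimately have "(\<lambda>n. a n / norm (U' n x)) \<longlonglongrightarrow> (0 + norm ((L - cscale z id_blinfun) x)) / 1"
    by (rule tendsto_divide) simp
  then have "\<forall>\<^sub>F n in sequentially. a n / norm (U' n x) < b" by (rule order_tendstoD) (use x in simp)
  moreover have "\<forall>\<^sub>F n in sequentially. 0 < norm (U' n x)"
    using norm_U'_tendsto[of x] by (rule order_tendstoD) (use x in simp)
  ultimately show ?thesis
  proof eventually_elim
    case (elim n)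
    have "gn A n z * norm (U' n x) \<le> norm ((A n - cscale z (P (N ^ n))) (U' n x))"
      unfolding gn_def by (rule nu_bound[OF hilbert_corner.subspace_range_Q[OF hilbert_corner_N_pow] U'_range])
    also have "(A n - cscale z (P (N ^ n))) (U' n x)
        = (A n (U' n x) - U' n (L x)) + U' n ((L - cscale z id_blinfun) x)"
      by (simp add: blinfun.diff_left blinfun.diff_right blinfun_apply_cscale P_U'_apply U'_scaleC)
    also have "norm \<dots> \<le> a n" unfolding a_def by (rule norm_triangle_ineq)
    finally have "gn A n z \<le> a n / norm (U' n x)" using elim(2) by (simp add: le_divide_eq)
    then show ?case using elim(1) by simp
  qed
qed

text \<open>A matrix that is bounded below is onto, so y = M x for some x; expanding (norm y)^2
  through \<open>M'\<close> transfers the bound.\<close>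

lemma adjoint_bounded_below:
  assumes M: "M \<in> carrier (corner (P k))" and k: "0 < k" and MM': "adj M M'"
    and c: "0 < c" "c \<le> nu (range (P k)) M" and y: "y \<in> range (P k)"
  shows "c * norm y \<le> norm (M' y)"
proof -
  interpret hilbert_corner "P k" by (rule hilbert_corner_P[OF k])
  have pos: "0 < nu (range (P k)) M" using c by simp
  obtain x where x: "x \<in> range (P k)" "M x = y"
    using subsetD[OF mat_surj_if_bounded_below[OF M k pos] y] by (rule imageE) auto
  have cx: "c * norm x \<le> norm y"
    using nu_bound[OF subspace_range_Q x(1), of M] mult_right_mono[OF c(2), of "norm x"] x(2) by simp
  have "(norm y)\<^sup>2 = Re (cinner (M x) y)" by (simp add: x(2) Re_cinner_self)
  also have "\<dots> = Re (cinner x (M' y))" by (simp add: adjD[OF MM'])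
  also have "\<dots> \<le> norm x * norm (M' y)" by (meson complex_Re_le_cmod cinner_bound order_trans)
  finally have "c * (norm y)\<^sup>2 \<le> (c * norm x) * norm (M' y)" using c(1) by (simp add: mult.assoc)
  also have "\<dots> \<le> norm y * norm (M' y)" by (rule mult_right_mono[OF cx]) simp
  finally have "norm y * (c * norm y) \<le> norm y * norm (M' y)" by (simp add: power2_eq_square mult_ac)
  then show ?thesis by (cases "norm y = 0") (auto simp: mult_le_cancel_left)
qed

text \<open>In infinite dimension being bounded below does not make an operator onto. Here the
  adjoints of A n - z share its lower bound for large n, the bound survives for the adjoint of L -
  z, and that makes L - z onto.\<close>

lemma L_surj:
  assumes A: "A \<in> carrier (F_eta N)" and r: "reps A A' L L'" and pos: "0 < gl L z"
  shows "\<exists>x. (L - cscale z id_blinfun) x = y"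
proof (rule surj_if_adjoint_bounded_below)
  have LL': "adj L L'" and AA': "adj (A n) (A' n)" for n using r by (auto simp: reps_def)
  show "adj (L - cscale z id_blinfun) (L' - cscale (cnj z) id_blinfun)"
    by (intro adj_diff adj_cscale adj_id LL')
  \<comment> \<open>Half of the lower modulus leaves room for the error
    \<open>dn A L n\<close>.\<close>
  define c where "c = gl L z / 2"
  show c: "0 < c" using pos by (simp add: c_def)
  fix x
  have "\<forall>\<^sub>F n in sequentially. dn A L n < c" using dn_tendsto[OF r] c by (rule order_tendstoD)
  moreover have "\<forall>\<^sub>F n in sequentially. 2 \<le> n" by (rule eventually_ge_at_top)
  ultimately have ev: "\<forall>\<^sub>F n in sequentially.
      c * norm (U' n x) \<le> norm (A' n (U' n x) - U' n (L' x)) + norm (U' n ((L' - cscale (cnj z) id_blinfun) x))"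
  proof eventually_elim
    case (elim n)
    have i: "incorner n (A n)" using A by (simp add: F_carrier)
    have "c \<le> gn A n z" using gl_le_gn[OF elim(2), of L z A] elim(1) by (simp add: c_def)
    moreover have "adj (A n - cscale z (P (N ^ n))) (A' n - cscale (cnj z) (P (N ^ n)))"
      by (intro adj_diff adj_cscale adj_P AA')
    ultimately have "c * norm (U' n x) \<le> norm ((A' n - cscale (cnj z) (P (N ^ n))) (U' n x))"
      by (intro adjoint_bounded_below[OF carrier_shift[OF i] N_pow_pos _ c _ U'_range]) (auto simp: gn_def)
    also have "(A' n - cscale (cnj z) (P (N ^ n))) (U' n x)
        = (A' n (U' n x) - U' n (L' x)) + U' n ((L' - cscale (cnj z) id_blinfun) x)"
      by (simp add: blinfun.diff_left blinfun.diff_right blinfun_apply_cscale P_U'_apply U'_scaleC)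
    also have "norm \<dots> \<le> norm (A' n (U' n x) - U' n (L' x)) + norm (U' n ((L' - cscale (cnj z) id_blinfun) x))"
      by (rule norm_triangle_ineq)
    finally show ?case .
  qed
  have l1: "(\<lambda>n. c * norm (U' n x)) \<longlonglongrightarrow> c * norm x" by (intro tendsto_intros norm_U'_tendsto)
  have l2: "(\<lambda>n. norm (A' n (U' n x) - U' n (L' x)) + norm (U' n ((L' - cscale (cnj z) id_blinfun) x)))
      \<longlonglongrightarrow> 0 + norm ((L' - cscale (cnj z) id_blinfun) x)"
    by (intro tendsto_add tendsto_norm_zero reps_U'[OF reps_sym[OF r]] norm_U'_tendsto)
  show "c * norm x \<le> norm ((L' - cscale (cnj z) id_blinfun) x)"
    using tendsto_le[OF _ l2 l1 ev] by simp
qed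

lemma spectra_limit:
  assumes A: "A \<in> carrier (F_eta N)" and r: "reps A A' L L'"
  shows "cspectrum bop L = {z. gl L z = 0}"
    and "0 < \<epsilon> \<Longrightarrow> pseudospectrum bop \<epsilon> L = {z. gl L z \<le> \<epsilon>}"
proof -
  have LL': "adj L L'" using r by (simp add: reps_def)
  have L: "L \<in> carrier (corner id_blinfun)" by (simp add: adj_in_cops[OF LL'])
  have surj: "range id_blinfun \<subseteq> (L - cscale z id_blinfun) ` range id_blinfun"
    if "0 < nu (range id_blinfun) (L - cscale z id_blinfun)" for z
  proof
    fix y :: "l2 ell2"
    have "0 < gl L z" using that by (simp add: gl_def)
    from L_surj[OF A r this] obtain x where "(L - cscale z id_blinfun) x = y" by blast
    moreover have "x \<in> range id_blinfun" by (metis id_blinfun.rep_eq rangeI)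
    ultimately show "y \<in> (L - cscale z id_blinfun) ` range id_blinfun" by (metis imageI)
  qed
  show "cspectrum bop L = {z. gl L z = 0}"
    using full.cspectrum_corner[OF L surj] by (simp add: bop_corner gl_def)
  show "pseudospectrum bop \<epsilon> L = {z. gl L z \<le> \<epsilon>}" if "0 < \<epsilon>"
    using full.pseudospectrum_corner[OF L surj that] by (simp add: bop_corner gl_def)
qed

lemma compact_gn: "compact {z. gn A n z \<le> c}"
  unfolding gn_def by (rule hilbert_corner.compact_nu_sublevel[OF hilbert_corner_N_pow])

lemma compact_gl: "compact {z. gl L z \<le> c}"
  using full.compact_nu_sublevel[of L c] by (simp add: gl_def)

lemma gn_eq_0: "{z. gn A n z = 0} = {z. gn A n z \<le> 0}"
  using gn_nonneg by (auto intro: antisym)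

lemma gl_eq_0: "{z. gl L z = 0} = {z. gl L z \<le> 0}"
  using gl_nonneg by (auto intro: antisym)

lemma gn_zero_ex:
  assumes "A \<in> carrier (F_eta N)"
  shows "\<exists>z. gn A n z = 0"
  unfolding gn_def
  by (rule mat_spectrum_nonempty[OF _ N_pow_pos])
    (use assms in \<open>simp add: F_carrier incorner_carrier del: corner_simps\<close>)

lemma hconv_pseudospectrum:
  assumes A: "A \<in> carrier (F_eta N)" and r: "reps A A' L L'" and \<epsilon>: "0 < \<epsilon>"
  shows "hconv (\<lambda>n. {z. gn A n z \<le> \<epsilon>}) {z. gl L z \<le> \<epsilon>}"
proof -
  let ?K = "{z. gl L z \<le> \<epsilon>}"
  have ne: "{z. gn A n z \<le> \<epsilon>} \<noteq> {}" for n
    using gn_zero_ex[OF A, of n] \<epsilon> by (metis (mono_tags, lifting) empty_iff less_imp_le mem_Collect_eq)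
  have dn0: "\<forall>\<^sub>F n in sequentially. dn A L n < e \<and> 2 \<le> n" if "0 < e" for e
    using order_tendstoD(2)[OF dn_tendsto[OF r] that] eventually_ge_at_top by (rule eventually_conj)
  have neK: "?K \<noteq> {}"
  proof -
    from dn0[OF \<epsilon>] obtain n where n: "dn A L n < \<epsilon>" "2 \<le> n" by (auto simp: eventually_sequentially)
    obtain z where "gn A n z = 0" using gn_zero_ex[OF A] by blast
    then have "gl L z \<le> \<epsilon>" using gl_le_gn[OF n(2), of L z A] n(1) by simp
    then show ?thesis by blast
  qed
  have up: "\<forall>\<^sub>F n in sequentially. \<forall>m\<in>{z. gn A n z \<le> \<epsilon>}. \<exists>k\<in>?K. dist m k \<le> e" if e: "0 < e" for e
  proof -
    \<comment> \<open>The part of an enlarged sublevel set at distance at least e from the limit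
      set. The cap \<epsilon> + 1 makes it compact, so on it the lower modulus exceeds \<epsilon> by
      a fixed amount.\<close>
    define C where "C = {z. gl L z \<le> \<epsilon> + 1} \<inter> - (\<Union>k\<in>?K. ball k e)"
    have C: "compact C"
      unfolding C_def by (intro compact_Int_closed compact_gl closed_Compl open_UN) auto
    have "\<exists>\<delta>>0. \<forall>z\<in>C. \<epsilon> + \<delta> \<le> gl L z"
    proof (cases "C = {}")
      case False
      have "continuous_on C (gl L)"
        using full.continuous_nu_shift[of C L] by (simp add: gl_def[abs_def])
      then obtain z0 where z0: "z0 \<in> C" "\<And>z. z \<in> C \<Longrightarrow> gl L z0 \<le> gl L z"
        using continuous_attains_inf[OF C False] by blast
      have "\<epsilon> < gl L z0"
      proof (rule ccontr)
        assume "\<not> \<epsilon> < gl L z0"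
        then have "z0 \<in> ?K" by simp
        moreover have "z0 \<in> ball z0 e" using e by simp
        ultimately have "z0 \<in> (\<Union>k\<in>?K. ball k e)" by (rule UN_I)
        then show False using z0(1) unfolding C_def by blast
      qed
      then show ?thesis using z0(2) by (intro exI[of _ "gl L z0 - \<epsilon>"]) auto
    qed (auto intro: exI[of _ 1])
    then obtain \<delta> where \<delta>: "0 < \<delta>" "\<And>z. z \<in> C \<Longrightarrow> \<epsilon> + \<delta> \<le> gl L z" by blast
    have "0 < min \<delta> 1" using \<delta> by simp
    from dn0[OF this] show ?thesis
    proof eventually_elim
      case (elim n)
      show ?case
      proof
        fix m assume m: "m \<in> {z. gn A n z \<le> \<epsilon>}"
        have "gl L m < \<epsilon> + min \<delta> 1" 
          using gl_le_gn[of n L m A] elim m by (simp del: min_less_iff_conj)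
        then have "m \<notin> C" "gl L m \<le> \<epsilon> + 1" using \<delta>(2)[of m] by auto
        then have "m \<in> (\<Union>k\<in>?K. ball k e)" by (simp add: C_def)
        then obtain k where "k \<in> ?K" "dist k m < e" by auto
        then show "\<exists>k\<in>?K. dist m k \<le> e" by (intro bexI[of _ k]) (auto simp: dist_commute)
      qed
    qed
  qed
  have lo: "\<forall>\<^sub>F n in sequentially. \<exists>m\<in>{z. gn A n z \<le> \<epsilon>}. dist m k \<le> e" if k: "k \<in> ?K" and e: "0 < e" for k e
  proof -
    \<comment> \<open>A point where the lower modulus equals \<epsilon> can be moved slightly to a
      point strictly below, where \<open>gn_less_gl\<close> applies.\<close>
    have "\<exists>z'. cmod (z' - k) < e \<and> gl L z' < \<epsilon>"
    proof (cases "gl L k < \<epsilon>")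
      case True
      then show ?thesis using e by (intro exI[of _ k]) auto
    next
      case False
      then have eq: "gl L k = \<epsilon>" using k by simp
      have L: "L \<in> cops" using r by (auto simp: reps_def intro: adj_in_cops)
      have "0 < gl L k" using eq \<epsilon> by simp
      from nu_no_local_min[OF L K_unit this[unfolded gl_def] L_surj[OF A r this] e]
      show ?thesis by (simp add: gl_def[symmetric] eq)
    qed
    then obtain z' where z': "cmod (z' - k) < e" "gl L z' < \<epsilon>" by blast
    from gn_less_gl[OF r z'(2)] show ?thesis
    proof eventually_elim
      case (elim n)
      then show ?case using z'(1) by (intro bexI[of _ z']) (auto simp: dist_norm)
    qed
  qed
  show ?thesis
    unfolding hconv_def using ne neK compact_gn compact_gl up lo by blast
qed

section \<open>Multiplicity and the spectra of part (a)\<close>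

lemma P_Y:
  assumes "q < n" "g < N ^ (n - q)"
  shows "Y q g x \<in> range (P (N ^ n))"
proof -
  have "hY q g i m < N ^ n" if p: "(i, m) \<in> FY q" for i m
  proof -
    have "hY q g i m < (g + 1) * N ^ (q - i)" using hY_range[OF p] by simp
    also have "\<dots> \<le> N ^ (n - q) * N ^ q"
      using assms N_pos by (intro mult_mono power_increasing) auto
    also have "\<dots> = N ^ n" using assms by (simp flip: power_add)
    finally show ?thesis .
  qed
  then have "coord (Y q g x) r = 0" if "\<not> r < N ^ n" for r
    unfolding Y_def wr_apply coord_sum
    by (intro sum.neutral) (use that in \<open>auto simp: scaleC_complex_def\<close>)
  then show ?thesis unfolding coord_P_range by (intro ell2_eqI) (simp add: coord_P)
qed

text \<open>\<open>Y q g\<close> annihilates the basis vectors outside its window and is no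
  isometry. On a fixed x it is nearly isometric once q is large, and half of the norm is enough for
  normalising.\<close>

lemma eventually_norm_Y:
  assumes x: "norm x = 1"
  shows "\<forall>\<^sub>F (q, n, g) in yf. 1 / 2 \<le> norm (Y q g x)"
proof -
  have pos: "0 < g" if "N ^ (n - q - 1) \<le> g" for n q g
    using that N_pow_pos by (metis less_le_trans)
  have "((\<lambda>p. (case p of (q::nat, n::nat, g::nat) \<Rightarrow> (Y' q g o\<^sub>L Y q g) - id_blinfun) x) \<longlongrightarrow> 0) yf"
  proof (rule strong_zero_on_basis)
    show "\<forall>\<^sub>F p in yf. norm (case p of (q::nat, n::nat, g::nat) \<Rightarrow> (Y' q g o\<^sub>L Y q g) - id_blinfun) \<le> 2"
      using eventually_yf_norm_Y
    proof eventually_elim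
      case (elim p)
      obtain q n g where p: "p = (q, n, g)" by (cases p)
      have "norm ((Y' q g o\<^sub>L Y q g) - id_blinfun) \<le> norm (Y' q g o\<^sub>L Y q g) + norm (id_blinfun :: l2 ell2 \<Rightarrow>\<^sub>L l2 ell2)"
        by (rule norm_triangle_ineq4)
      also have "\<dots> \<le> 1 * 1 + 1"
        using elim adj_norm[OF adj_Y, of q g]
        by (intro add_mono norm_compose_le1 norm_blinfun_id_le) (auto simp: p)
      finally show ?case by (simp add: p)
    qed
    show "(case p of (q::nat, n::nat, g::nat) \<Rightarrow> (Y' q g o\<^sub>L Y q g) - id_blinfun) (c *\<^sub>C x)
        = c *\<^sub>C (case p of (q::nat, n::nat, g::nat) \<Rightarrow> (Y' q g o\<^sub>L Y q g) - id_blinfun) x" for p c x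
      by (cases p) (simp add: blinfun.diff_left Y_scaleC Y'_scaleC scaleC.diff_right)
    show "((\<lambda>p. (case p of (q::nat, n::nat, g::nat) \<Rightarrow> (Y' q g o\<^sub>L Y q g) - id_blinfun) (E i m)) \<longlongrightarrow> 0) yf" for i m
    proof (rule tendsto_eventually, unfold eventually_yf, intro exI[of _ "i + m + 1"] allI impI)
      fix q n g assume q: "i + m + 1 \<le> q" and g: "N ^ (n - q - 1) \<le> g"
      show "(case (q, n, g) of (q, n, g) \<Rightarrow> (Y' q g o\<^sub>L Y q g) - id_blinfun) (E i m) = 0"
        by (simp add: blinfun.diff_left Y'_Y_E[OF pos[OF g] FY_mem[OF q]])
    qed
  qed
  then have "\<forall>\<^sub>F p in yf. norm ((case p of (q::nat, n::nat, g::nat) \<Rightarrow> (Y' q g o\<^sub>L Y q g) - id_blinfun) x) < 1 / 2"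
    using tendstoD[of _ "0 :: l2 ell2" yf "1 / 2"] by simp
  then show ?thesis
  proof eventually_elim
    case (elim p)
    obtain q n g where p: "p = (q, n, g)" by (cases p)
    have "(norm (Y q g x))\<^sup>2 = Re (cinner x (Y' q g (Y q g x)))"
      using adjD[OF adj_Y, of q g x "Y q g x"] by (simp flip: Re_cinner_self)
    also have "\<dots> = 1 + Re (cinner x (Y' q g (Y q g x) - x))"
      by (simp add: cinner.diff_right Re_cinner_self x)
    finally have eq: "(norm (Y q g x))\<^sup>2 = 1 + Re (cinner x (Y' q g (Y q g x) - x))" .
    have "cmod (cinner x (Y' q g (Y q g x) - x)) \<le> norm x * norm (Y' q g (Y q g x) - x)" by (rule cinner_bound)
    also have "\<dots> < 1 / 2" using elim x by (simp add: p blinfun.diff_left)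
    finally have "- (1 / 2) < Re (cinner x (Y' q g (Y q g x) - x))"
      using abs_Re_le_cmod[of "cinner x (Y' q g (Y q g x) - x)"] by linarith
    then have "(1 / 2)\<^sup>2 \<le> (norm (Y q g x))\<^sup>2" unfolding eq by (simp add: power2_eq_square)
    then have "1 / 2 \<le> norm (Y q g x)" by (rule power2_le_imp_le) simp
    then show ?case by (simp add: p)
  qed
qed

text \<open>The family obtained from one approximate eigenvector has at least N^(n - q - 1) members
  in dimension N^n. This proportion, 1 / N^(q + 1), is fixed before n grows, so an eigenvalue-free
  disc of radius e would contradict the Hilbert-Schmidt estimate once A n - A' n is small.\<close>

lemma spectrum_lower_limit:
  assumes A: "A \<in> carrier (F_eta N)" and r: "reps A A' L L'"
    and sa: "(\<lambda>n. norm (A n - A' n)) \<longlonglongrightarrow> 0"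
    and k: "gl L k = 0" and e: "0 < e"
  shows "\<forall>\<^sub>F n in sequentially. \<exists>m\<in>{z. gn A n z = 0}. dist m k \<le> e"
proof -
  \<comment> \<open>Two errors of e / 8, divided by a norm of at least 1 / 2, make the e / 2 used as
    \<delta>; the other half of e is the gap s.\<close>
  obtain x where x: "norm x = 1" "norm ((L - cscale k id_blinfun) x) < e / 8"
    using nu_approx[OF K_unit, of "L - cscale k id_blinfun" "e / 8"] k e by (auto simp: gl_def)
  have "\<forall>\<^sub>F p in yf. dist (case p of (q, n, g) \<Rightarrow> A n (Y q g x) - Y q g (L x)) 0 < e / 8"
    using r e by (intro tendstoD) (auto simp: reps_def ycv_def)
  with eventually_yf_norm_Y eventually_norm_Y[OF x(1)]
  have "\<forall>\<^sub>F p in yf. (case p of (q, n, g) \<Rightarrow> norm (Y q g) \<le> 1 \<and> 1 / 2 \<le> norm (Y q g x)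
      \<and> norm (A n (Y q g x) - Y q g (L x)) < e / 8)"
    by eventually_elim (auto simp: case_prod_unfold)
  then obtain q where q: "\<And>n g. q < n \<Longrightarrow> N ^ (n - q - 1) \<le> g \<Longrightarrow> g < N ^ (n - q) \<Longrightarrow>
      norm (Y q g) \<le> 1 \<and> 1 / 2 \<le> norm (Y q g x) \<and> norm (A n (Y q g x) - Y q g (L x)) < e / 8"
    unfolding eventually_yf by (auto simp: eq_commute)
  have "(\<lambda>n. (norm (A n - A' n))\<^sup>2 * real (N ^ (q + 1))) \<longlonglongrightarrow> 0\<^sup>2 * real (N ^ (q + 1))"
    by (intro tendsto_intros sa)
  then have "\<forall>\<^sub>F n in sequentially. (norm (A n - A' n))\<^sup>2 * real (N ^ (q + 1)) < (e / 2)\<^sup>2"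
    by (rule order_tendstoD) (use e in simp)
  moreover have "\<forall>\<^sub>F n in sequentially. q < n" by (rule eventually_gt_at_top)
  ultimately show ?thesis
  proof eventually_elim
    case (elim n)
    have i: "incorner n (A n)" using A by (simp add: F_carrier)
    let ?J = "{N ^ (n - q - 1)..<N ^ (n - q)}"
    define y where "y g = complex_of_real (1 / norm (Y q g x)) *\<^sub>C Y q g x" for g
    have Yg: "norm (Y q g) \<le> 1" "1 / 2 \<le> norm (Y q g x)" "norm (A n (Y q g x) - Y q g (L x)) < e / 8"
      if "g \<in> ?J" for g using q[of n g] elim(2) that by auto
    have Suc: "Suc (n - q - 1) = n - q" using elim(2) by simp
    have on: "orthonormal y ?J"
      unfolding orthonormal_def
    proof (intro ballI)
      fix g g' assume g: "g \<in> ?J" "g' \<in> ?J"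
      show "cinner (y g) (y g') = (if g = g' then 1 else 0)"
      proof (cases "g = g'")
        case True
        have "norm (Y q g x) \<noteq> 0" using Yg(2)[OF g(1)] by auto
        then have "norm (y g) = 1" by (simp add: y_def norm_scaleC norm_divide)
        then show ?thesis using True by (simp add: cinner_norm)
      next
        case False
        have "cinner (Y q g x) (Y q g' x) = 0"
          by (rule Y_orthogonal[of "n - q - 1"]) (use g False Suc in auto)
        then show ?thesis using False by (simp add: y_def cinner_scaleC_left cinner_scaleC_right)
      qed
    qed
    have range: "y ` ?J \<subseteq> range (P (N ^ n))"
    proof (rule image_subsetI)
      fix g assume g: "g \<in> ?J"
      have "P (N ^ n) (Y q g x) = Y q g x"
        using P_Y[OF elim(2), of g x] g by (simp add: coord_P_range)
      then have "P (N ^ n) (y g) = y g" by (simp add: y_def copsD[OF P_cops])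
      then show "y g \<in> range (P (N ^ n))" by (metis rangeI)
    qed
    have approx: "norm (A n (y g) - k *\<^sub>C y g) \<le> e / 2" if g: "g \<in> ?J" for g
    proof -
      note Y = Yg[OF g]
      have "A n (y g) - k *\<^sub>C y g = complex_of_real (1 / norm (Y q g x)) *\<^sub>C (A n (Y q g x) - k *\<^sub>C Y q g x)"
        using incorner_cops[OF i] by (simp add: y_def copsD scaleC.diff_right scaleC_scaleC mult.commute)
      then have eq: "norm (A n (y g) - k *\<^sub>C y g) = 1 / norm (Y q g x) * norm (A n (Y q g x) - k *\<^sub>C Y q g x)"
        by (simp add: norm_scaleC norm_divide)
      have "A n (Y q g x) - k *\<^sub>C Y q g x
          = (A n (Y q g x) - Y q g (L x)) + Y q g ((L - cscale k id_blinfun) x)"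
        by (simp add: blinfun.diff_left blinfun.diff_right blinfun_apply_cscale Y_scaleC)
      also have "norm \<dots> \<le> norm (A n (Y q g x) - Y q g (L x)) + norm (Y q g ((L - cscale k id_blinfun) x))"
        by (rule norm_triangle_ineq)
      also have "\<dots> \<le> e / 8 + e / 8"
      proof (rule add_mono)
        have "norm (Y q g ((L - cscale k id_blinfun) x)) \<le> norm (Y q g) * norm ((L - cscale k id_blinfun) x)"
          by (rule norm_blinfun)
        also have "\<dots> \<le> 1 * (e / 8)" using Y(1) x(2) by (intro mult_mono) auto
        finally show "norm (Y q g ((L - cscale k id_blinfun) x)) \<le> e / 8" by simp
      qed (use Y(3) in simp)
      finally have 1: "norm (A n (Y q g x) - k *\<^sub>C Y q g x) \<le> e / 4" by simp
      have "1 / norm (Y q g x) \<le> 1 / (1 / 2)" using Y(2) by (intro divide_left_mono) auto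
      then have "1 / norm (Y q g x) * norm (A n (Y q g x) - k *\<^sub>C Y q g x) \<le> 2 * (e / 4)"
        using 1 by (intro mult_mono) auto
      then show ?thesis unfolding eq by simp
    qed
    show ?case
    proof (rule ccontr)
      assume "\<not> ?case"
      then have far: "e / 2 + e / 2 \<le> cmod (\<mu> - k)"
        if "nu (range (P (N ^ n))) (A n - cscale \<mu> (P (N ^ n))) = 0" for \<mu>
        using that by (force simp: gn_def dist_norm)
      have AA': "adj (A n) (A' n)" using r by (simp add: reps_def)
      have "real (card ?J) * (e / 2)\<^sup>2 \<le> (norm (A n - A' n))\<^sup>2 * real (N ^ n)"
      proof (rule near_selfadjoint_eigenvalue[OF i[unfolded incorner_carrier] N_pow_pos AA' order_refl on _ range])
        show "norm (A n (y g) - k *\<^sub>C y g) \<le> e / 2" if "g \<in> ?J" for g by (rule approx[OF that])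
        show "e / 2 + e / 2 \<le> cmod (\<mu> - k)"
          if "nu (range (P (N ^ n))) (A n - cscale \<mu> (P (N ^ n))) = 0" for \<mu>
          by (rule far[OF that])
        show "0 \<le> e / 2" "0 \<le> e / 2" using e by simp_all
      qed (rule finite_atLeastLessThan)
      moreover have "real (N ^ (n - q - 1)) \<le> real (card ?J)"
      proof -
        have "N ^ (n - q - 1) * 2 \<le> N ^ (n - q - 1) * N" using N2 by (rule mult_left_mono) simp
        also have "\<dots> = N ^ (n - q)" by (rule power_Suc2[of N "n - q - 1", unfolded Suc, symmetric])
        finally have "N ^ (n - q - 1) \<le> card ?J" by simp
        then show ?thesis by (rule of_nat_mono)
      qed
      then have "real (N ^ (n - q - 1)) * (e / 2)\<^sup>2 \<le> real (card ?J) * (e / 2)\<^sup>2"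
        by (rule mult_right_mono) simp
      moreover have "n = (n - q - 1) + (q + 1)" using elim(2) by simp
      then have "N ^ n = N ^ (n - q - 1) * N ^ (q + 1)" by (metis power_add)
      then have "(norm (A n - A' n))\<^sup>2 * real (N ^ n)
          = real (N ^ (n - q - 1)) * ((norm (A n - A' n))\<^sup>2 * real (N ^ (q + 1)))" by simp
      moreover have "real (N ^ (n - q - 1)) * ((norm (A n - A' n))\<^sup>2 * real (N ^ (q + 1)))
          < real (N ^ (n - q - 1)) * (e / 2)\<^sup>2"
        using elim(1) N_pos by (intro mult_strict_left_mono) auto
      ultimately show False by linarith
    qed
  qed
qed

lemma hconv_spectrum:
  assumes A: "A \<in> carrier (F_eta N)" and r: "reps A A' L L"
    and sa: "(\<lambda>n. norm (A n - A' n)) \<longlonglongrightarrow> 0"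
  shows "hconv (\<lambda>n. {z. gn A n z = 0}) {z. gl L z = 0}"
proof -
  have LL: "adj L L" using r by (simp add: reps_def)
  \<comment> \<open>Moving m to its real part costs at most \<open>gl L m\<close>, and the lower
    modulus there is at most twice \<open>gl L m\<close>. A spectral point lies at exactly that
    lower modulus to the left or to the right, which gives the factor 3.\<close>
  have near: "\<exists>k. gl L k = 0 \<and> dist m k \<le> 3 * gl L m" for m
  proof -
    define \<delta> where "\<delta> = gl L (of_real (Re m))"
    have im: "\<bar>Im m\<bar> \<le> gl L m" unfolding gl_def by (rule nu_selfadjoint_Im[OF LL K_unit])
    have mr: "cmod (of_real (Re m) - m) = \<bar>Im m\<bar>" "cmod (m - of_real (Re m)) = \<bar>Im m\<bar>"
      by (simp_all add: cmod_def)
    have d: "\<delta> \<le> 2 * gl L m" "0 \<le> \<delta>"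
      using gl_diff[of L "of_real (Re m)" m] im gl_nonneg by (simp_all add: \<delta>_def mr)
    have near: "dist m (of_real (Re m + t)) \<le> 3 * gl L m" if "\<bar>t\<bar> = \<delta>" for t
    proof -
      have "m - of_real (Re m + t) = (m - of_real (Re m)) - of_real t" by simp
      then have "dist m (of_real (Re m + t)) \<le> \<bar>Im m\<bar> + \<bar>t\<bar>"
        unfolding dist_norm using norm_triangle_ineq4[of "m - of_real (Re m)" "of_real t"]
        by (simp only: mr norm_of_real real_norm_def)
      then show ?thesis using im d that by simp
    qed
    have "gl L (of_real (Re m + \<delta>)) = 0 \<or> gl L (of_real (Re m - \<delta>)) = 0"
      using nu_selfadjoint_attained[OF LL K_unit, of "Re m"] by (simp add: gl_def \<delta>_def)
    then show ?thesis using near[of \<delta>] near[of "- \<delta>"] d by auto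
  qed
  have up: "\<forall>\<^sub>F n in sequentially. \<forall>m\<in>{z. gn A n z = 0}. \<exists>k\<in>{z. gl L z = 0}. dist m k \<le> e" if e: "0 < e" for e
  proof -
    have "0 < e / 3" using e by simp
    from order_tendstoD(2)[OF dn_tendsto[OF r] this] eventually_ge_at_top[of 2] show ?thesis
    proof eventually_elim
      case (elim n)
      show ?case
      proof
        fix m assume m: "m \<in> {z. gn A n z = 0}"
        have "gl L m < e / 3" using gl_le_gn[OF elim(2), of L m A] elim(1) m by simp
        moreover obtain k where "gl L k = 0" "dist m k \<le> 3 * gl L m" using near by blast
        ultimately show "\<exists>k\<in>{z. gl L z = 0}. dist m k \<le> e" by (intro bexI[of _ k]) auto
      qed
    qed
  qed
  have "compact {z. gn A n z = 0}" "compact {z. gl L z = 0}" for n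
    unfolding gn_eq_0 gl_eq_0 by (rule compact_gn compact_gl)+
  moreover have "{z. gn A n z = 0} \<noteq> {}" for n using gn_zero_ex[OF A] by blast
  moreover have "{z. gl L z = 0} \<noteq> {}" using near by blast
  moreover have "\<forall>\<^sub>F n in sequentially. \<exists>m\<in>{z. gn A n z = 0}. dist m k \<le> e"
    if "k \<in> {z. gl L z = 0}" "0 < e" for k e
    using that by (intro spectrum_lower_limit[OF A r sa]) auto
  ultimately show ?thesis unfolding hconv_def using up by blast
qed

lemma spectral_convergence:
  assumes AS: "A \<in> carrier (S_eta N)" and a: "a = gcoset A"
  shows "star (S_quot N) a = a \<Longrightarrow>
      hausdorff_tendsto (\<lambda>n. cspectrum (mat_alg (N ^ n)) (A n)) (cspectrum bop (W_tilde N a))"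
    and "hausdorff_tendsto (\<lambda>n. sigma2 (mat_alg (N ^ n)) (A n)) (sigma2 bop (W_tilde N a))"
    and "0 < \<epsilon> \<Longrightarrow> hausdorff_tendsto (\<lambda>n. pseudospectrum (mat_alg (N ^ n)) \<epsilon> (A n))
      (pseudospectrum bop \<epsilon> (W_tilde N a))"
proof -
  have "A \<in> representable" using AS S_eta_subset_representable by blast
  then obtain A' L L' where A: "A \<in> carrier (F_eta N)" and r: "reps A A' L L'" by (auto simp: representable_def)
  have i: "incorner n (A n)" for n using A by (simp add: F_carrier)
  have A': "A' = (\<lambda>n. cadjoint (A n))" by (rule reps_cadjoint[OF r])
  have W: "W_tilde N a = L" unfolding a by (rule W_tilde_eq[OF A r])
  show "hausdorff_tendsto (\<lambda>n. cspectrum (mat_alg (N ^ n)) (A n)) (cspectrum bop (W_tilde N a))"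
    if star: "star (S_quot N) a = a"
  proof -
    have A'F: "A' \<in> carrier (F_eta N)" unfolding A' by (rule F_star[OF A])
    \<comment> \<open>Self-adjointness in the quotient says two things: the limit operator is
      self-adjoint, because \<open>W_tilde\<close> depends on the coset alone, and A n - A' n is a
      null sequence.\<close>
    have eq: "gcoset A' = gcoset A" using star unfolding a quot_star[OF A] A' .
    have "W_tilde N (gcoset A') = L'" by (rule W_tilde_eq[OF A'F reps_sym[OF r]])
    then have "W_tilde N a = L'" by (simp only: a eq)
    then have LL: "reps A A' L L" using r W by simp
    have "A \<in> gcoset A'" using eq gcoset_self by blast
    then have "(\<lambda>n. norm (A n - A' n)) \<longlonglongrightarrow> 0" unfolding gcoset_mem by (simp add: G_eta_def)
    from hconv_imp[OF hconv_spectrum[OF A LL this]] show ?thesis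
      by (simp add: W cspectrum_mat[where A = A, OF i] spectra_limit(1)[OF A r])
  qed
  show "hausdorff_tendsto (\<lambda>n. pseudospectrum (mat_alg (N ^ n)) \<epsilon> (A n)) (pseudospectrum bop \<epsilon> (W_tilde N a))"
    if \<epsilon>: "0 < \<epsilon>"
    using hconv_imp[OF hconv_pseudospectrum[OF A r \<epsilon>]]
    by (simp add: W pseudospectrum_mat[where A = A, OF i \<epsilon>] spectra_limit(2)[OF A r \<epsilon>])
  show "hausdorff_tendsto (\<lambda>n. sigma2 (mat_alg (N ^ n)) (A n)) (sigma2 bop (W_tilde N a))"
  proof -
    \<comment> \<open>Each \<open>B n\<close> is exactly self-adjoint, so the defect in the spectral
      argument vanishes identically; the limit operator of the sequence is the product of
      \<open>L'\<close> and \<open>L\<close>.\<close>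
    define B where "B n = A' n o\<^sub>L A n" for n
    have AA': "adj (A n) (A' n)" and LL': "adj L L'" for n using r by (auto simp: reps_def)
    have rB: "reps B B (L' o\<^sub>L L) (L' o\<^sub>L L)"
      unfolding B_def[abs_def] by (rule reps_compose[OF reps_sym[OF r] r])
    have B: "B \<in> carrier (F_eta N)"
      unfolding B_def[abs_def] by (rule F_mult[OF _ A]) (simp add: A' F_star[OF A])
    have iB: "incorner n (B n)" for n using B by (simp add: F_carrier)
    have "hconv (\<lambda>n. {z. gn B n z = 0}) {z. gl (L' o\<^sub>L L) z = 0}"
      by (rule hconv_spectrum[OF B rB]) simp
    then have "hconv (\<lambda>n. rsq {z. gn B n z = 0}) (rsq {z. gl (L' o\<^sub>L L) z = 0})"
    proof (rule hconv_rsq)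
      show "{z. gn B n z = 0} \<subseteq> complex_of_real ` {0..}" for n
        using hilbert_corner.spectrum_positive[OF hilbert_corner_N_pow AA'] by (auto simp: gn_def B_def)
      show "{z. gl (L' o\<^sub>L L) z = 0} \<subseteq> complex_of_real ` {0..}"
        using full.spectrum_positive[OF LL'] by (auto simp: gl_def)
    qed
    moreover have "sigma2 (mat_alg (N ^ n)) (A n) = rsq {z. gn B n z = 0}" for n
      using cspectrum_mat[where A = B, OF iB, of n]
      by (simp add: sigma2_def rsq_def mat_alg_corner B_def A' )
    moreover have "sigma2 bop L = rsq {z. gl (L' o\<^sub>L L) z = 0}"
      using spectra_limit(1)[OF B rB] by (simp add: sigma2_def rsq_def cadjoint_eq[OF LL'])
    ultimately show ?thesis using hconv_imp by (simp add: W)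
  qed
qed

end

theorem theorem6p21:
  fixes N :: nat and A :: "nat \<Rightarrow> l2_op" and a :: "(nat \<Rightarrow> l2_op) set"
  assumes "2 \<le> N"
    and "A \<in> carrier (S_eta N)"
    and "a = G_eta N +>\<^bsub>S_eta N\<^esub> A"
  shows "(star (S_quot N) a = a \<longrightarrow>
           hausdorff_tendsto (\<lambda>n. cspectrum (mat_alg (N ^ n)) (A n)) (cspectrum bop (W_tilde N a)))
       \<and> hausdorff_tendsto (\<lambda>n. sigma2 (mat_alg (N ^ n)) (A n)) (sigma2 bop (W_tilde N a))
       \<and> (\<forall>\<epsilon>>0. hausdorff_tendsto (\<lambda>n. pseudospectrum (mat_alg (N ^ n)) \<epsilon> (A n))
             (pseudospectrum bop \<epsilon> (W_tilde N a)))"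
proof -
  interpret finite_sections N by standard (rule assms(1))
  show ?thesis using spectral_convergence[OF assms(2,3)] by blast
qed


end
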